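(* Let $H$ be the Hopf algebra associated to a group datum $(G,\chi,g,1)$ of non-nilpotent type, as in the context. The Green ring $r(H)$ has no non-trivial idempotents (i.e. its only idempotents are $0$ and $1$).
   Context: $\Bbbk$ is an algebraically closed field of characteristic zero; modules are finite-dimensional left modules. Fix a finite group $G$, a $\Bbbk$-linear character $\chi$ of $G$ and a central element $g\in G$; let $n\ge 2$ be the order of $q=\chi(g)$, and assume $\chi^n=1$ and $g^n\neq 1$. $H$ is the Hopf algebra generated as an algebra by $y$ and $G$, with $\Bbbk G$ as a subalgebra and relations $y^n=g^n-1$, $yh=\chi(h)hy$ for $h\in G$; $\Delta(y)=y\otimes g+1\otimes y$, $\varepsilon(y)=0$, $S(y)=-yg^{-1}$, and the elements of $G$ are group-like. It has $\Bbbk$-basis $\{y^ih\mid h\in G,\ 0\le i\le n-1\}$. The Green ring $r(H)$ is the abelian group generated by isomorphism classes $[M]$ of finite-dimensional $H$-modules modulo $[M\oplus N]=[M]+[N]$, with product $[M][N]=[M\otimes N]$ and identity $1=[\Bbbk]$; it is commutative. *)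

theory Defs
  imports
    "HOL-Algebra.QuotRing"
    "HOL-Algebra.Generated_Groups"
    "HOL-Library.Poly_Mapping"
    "HOL-Computational_Algebra.Polynomial"
    "Jordan_Normal_Form.Matrix"
begin

hide_const (open) Multiset.mult

section \<open>Free modules with a given basis\<close>

text \<open>The free module over \<open>'c\<close> with basis \<open>B\<close> consists of the finitely supported
  functions with support in \<open>B\<close>; the basis vector \<open>b\<close> is \<open>Poly_Mapping.single b 1\<close>.\<close>

abbreviation bas :: "'b \<Rightarrow> ('b \<Rightarrow>\<^sub>0 'c::comm_ring_1)"
  where "bas b \<equiv> Poly_Mapping.single b 1"

definition scale :: "'c::comm_ring_1 \<Rightarrow> ('b \<Rightarrow>\<^sub>0 'c) \<Rightarrow> ('b \<Rightarrow>\<^sub>0 'c)"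
  where "scale c x = Poly_Mapping.map ((*) c) x"

definition lin_ext :: "('a \<Rightarrow> ('b \<Rightarrow>\<^sub>0 'c)) \<Rightarrow> ('a \<Rightarrow>\<^sub>0 'c::comm_ring_1) \<Rightarrow> ('b \<Rightarrow>\<^sub>0 'c)"
  where "lin_ext f x = (\<Sum>a\<in>Poly_Mapping.keys x. scale (Poly_Mapping.lookup x a) (f a))"

definition bilin_ext ::
    "('a \<Rightarrow> 'b \<Rightarrow> ('d \<Rightarrow>\<^sub>0 'c)) \<Rightarrow> ('a \<Rightarrow>\<^sub>0 'c::comm_ring_1) \<Rightarrow> ('b \<Rightarrow>\<^sub>0 'c) \<Rightarrow> ('d \<Rightarrow>\<^sub>0 'c)"
  where "bilin_ext f x y = lin_ext (\<lambda>a. lin_ext (f a) y) x"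

definition basis_algebra ::
    "'b set \<Rightarrow> ('b \<Rightarrow> 'b \<Rightarrow> ('b \<Rightarrow>\<^sub>0 'c)) \<Rightarrow> ('b \<Rightarrow>\<^sub>0 'c) \<Rightarrow> ('b \<Rightarrow>\<^sub>0 'c::comm_ring_1) ring"
  where "basis_algebra B m u =
    \<lparr>carrier = {x. Poly_Mapping.keys x \<subseteq> B}, mult = bilin_ext m, one = u, zero = 0, add = (+)\<rparr>"

definition tens ::
    "('a \<Rightarrow>\<^sub>0 'c) \<Rightarrow> ('b \<Rightarrow>\<^sub>0 'c::comm_ring_1) \<Rightarrow> ('a \<times> 'b \<Rightarrow>\<^sub>0 'c)"
  where "tens = bilin_ext (\<lambda>a b. bas (a, b))"

lemma lookup_scale: "Poly_Mapping.lookup (scale c x) b = c * Poly_Mapping.lookup x b"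
  unfolding scale_def by (simp add: Poly_Mapping.map.rep_eq when_def)

lemma scale_simps [simp]:
  "scale c (x + y) = scale c x + scale c y" "scale c (x - y) = scale c x - scale c y"
  "scale c 0 = 0" "scale 0 x = 0" "scale 1 x = x" "scale c (scale d x) = scale (c * d) x"
  "scale (c + d) x = scale c x + scale d x"
  by (rule poly_mapping_eqI; simp add: lookup_scale lookup_add lookup_minus algebra_simps)+

lemma scale_sum: "scale c (sum f A) = (\<Sum>a\<in>A. scale c (f a))"
  by (induction A rule: infinite_finite_induct) auto

lemma keys_scale: "Poly_Mapping.keys (scale c x) \<subseteq> Poly_Mapping.keys x"
  by (auto simp: in_keys_iff lookup_scale)

lemma lin_ext_superset:
  assumes "finite S" "Poly_Mapping.keys x \<subseteq> S"
  shows "lin_ext f x = (\<Sum>a\<in>S. scale (Poly_Mapping.lookup x a) (f a))"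
  unfolding lin_ext_def using assms by (intro sum.mono_neutral_left) (auto simp: in_keys_iff)

lemma lin_ext_bas [simp]: "lin_ext f (bas a) = f a"
  by (subst lin_ext_superset[of "{a}"]) (auto simp: lookup_single)

lemma lin_ext_zero [simp]: "lin_ext f 0 = 0"
  by (simp add: lin_ext_def)

lemma lin_ext_add [simp]: "lin_ext f (x + y) = lin_ext f x + lin_ext f y"
proof -
  let ?S = "Poly_Mapping.keys x \<union> Poly_Mapping.keys y"
  have "Poly_Mapping.keys (x + y) \<subseteq> ?S" by (rule Poly_Mapping.keys_add)
  then show ?thesis
    by (subst (1 2 3) lin_ext_superset[of ?S]) (auto simp: lookup_add sum.distrib)
qed

lemma lin_ext_scale [simp]: "lin_ext f (scale c x) = scale c (lin_ext f x)"
  using lin_ext_superset[OF finite_keys keys_scale, of f c x]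
  by (simp add: lookup_scale lin_ext_def[of f x] scale_sum)

lemma lin_ext_diff [simp]: "lin_ext f (x - y) = lin_ext f x - lin_ext f y"
  using lin_ext_add[of f "x - y" y] by simp

lemma lin_ext_sum: "lin_ext f (sum h A) = (\<Sum>a\<in>A. lin_ext f (h a))"
  by (induction A rule: infinite_finite_induct) auto

lemma lin_ext_cong:
  "(\<And>a. a \<in> Poly_Mapping.keys x \<Longrightarrow> f a = f' a) \<Longrightarrow> lin_ext f x = lin_ext f' x"
  by (simp add: lin_ext_def)

lemma lin_ext_fun_add: "lin_ext (\<lambda>a. f a + f' a) x = lin_ext f x + lin_ext f' x"
  by (simp add: lin_ext_def sum.distrib)

lemma lin_ext_id: "lin_ext bas x = x"
proof (rule poly_mapping_eqI)
  fix b
  have "Poly_Mapping.lookup (lin_ext bas x) b =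
      (\<Sum>a\<in>Poly_Mapping.keys x. Poly_Mapping.lookup x a when a = b)"
    by (simp add: lin_ext_def lookup_sum lookup_scale lookup_single when_def
        if_distrib[of "(*) _"] cong: if_cong)
  then show "Poly_Mapping.lookup (lin_ext bas x) b = Poly_Mapping.lookup x b"
    by (simp add: when_def in_keys_iff)
qed

lemma lin_ext_lin_ext: "lin_ext f (lin_ext h x) = lin_ext (\<lambda>a. lin_ext f (h a)) x"
  by (simp add: lin_ext_def[of h] lin_ext_def[of "\<lambda>a. lin_ext f (h a)"] lin_ext_sum)

lemma lin_ext_swap: "lin_ext (\<lambda>a. lin_ext (f a) y) x = lin_ext (\<lambda>b. lin_ext (\<lambda>a. f a b) x) y"
  unfolding lin_ext_def scale_sum by (subst sum.swap) (simp add: mult.commute)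

lemma keys_lin_ext:
  assumes "\<And>a. a \<in> Poly_Mapping.keys x \<Longrightarrow> Poly_Mapping.keys (f a) \<subseteq> B"
  shows "Poly_Mapping.keys (lin_ext f x) \<subseteq> B"
proof -
  have "Poly_Mapping.keys (lin_ext f x)
      \<subseteq> (\<Union>a\<in>Poly_Mapping.keys x. Poly_Mapping.keys (scale (Poly_Mapping.lookup x a) (f a)))"
    unfolding lin_ext_def by (rule keys_sum)
  also have "\<dots> \<subseteq> B" using assms keys_scale by fastforce
  finally show ?thesis .
qed

lemma basis_algebra_ring:
  fixes u :: "'b \<Rightarrow>\<^sub>0 'c::comm_ring_1"
  assumes u: "Poly_Mapping.keys u \<subseteq> B"
    and closed: "\<And>a b. a \<in> B \<Longrightarrow> b \<in> B \<Longrightarrow> Poly_Mapping.keys (m a b) \<subseteq> B"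
    and assoc: "\<And>a b c. a \<in> B \<Longrightarrow> b \<in> B \<Longrightarrow> c \<in> B \<Longrightarrow>
      lin_ext (\<lambda>t. m t c) (m a b) = lin_ext (m a) (m b c)"
    and unit: "\<And>a. a \<in> B \<Longrightarrow> lin_ext (\<lambda>t. m t a) u = bas a"
      "\<And>a. a \<in> B \<Longrightarrow> lin_ext (m a) u = bas a"
  shows "ring (basis_algebra B m u)"
proof -
  have neg: "Poly_Mapping.keys (- x) \<subseteq> B" if "Poly_Mapping.keys x \<subseteq> B" for x :: "'b \<Rightarrow>\<^sub>0 'c"
    using that by simp
  have add: "Poly_Mapping.keys (x + y) \<subseteq> B"
    if "Poly_Mapping.keys x \<subseteq> B" "Poly_Mapping.keys y \<subseteq> B" for x y :: "'b \<Rightarrow>\<^sub>0 'c"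
    using that Poly_Mapping.keys_add[of x y] by blast
  have 1: "abelian_group (basis_algebra B m u)"
  proof (rule abelian_groupI, goal_cases)
    case (6 x)
    then show ?case
      by (intro bexI[of _ "- x"]) (simp_all add: basis_algebra_def)
  qed (simp_all add: basis_algebra_def add ac_simps)
  have 2: "monoid (basis_algebra B m u)"
  proof (rule monoidI, goal_cases)
    case (1 x y)
    then show ?case
      unfolding basis_algebra_def bilin_ext_def partial_object.simps monoid.simps mem_Collect_eq
      by (intro keys_lin_ext closed) auto
  next
    case 2
    show ?case using u by (simp add: basis_algebra_def)
  next
    case (3 x y z)
    then have K: "Poly_Mapping.keys x \<subseteq> B" "Poly_Mapping.keys y \<subseteq> B" "Poly_Mapping.keys z \<subseteq> B"
      by (auto simp: basis_algebra_def)
    have "bilin_ext m (bilin_ext m x y) z =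
        lin_ext (\<lambda>a. lin_ext (\<lambda>b. lin_ext (\<lambda>c. lin_ext (\<lambda>t. m t c) (m a b)) z) y) x"
      unfolding bilin_ext_def lin_ext_lin_ext
      by (intro lin_ext_cong) (rule lin_ext_swap)
    also have "\<dots> = lin_ext (\<lambda>a. lin_ext (\<lambda>b. lin_ext (\<lambda>c. lin_ext (m a) (m b c)) z) y) x"
      using K by (intro lin_ext_cong assoc) auto
    also have "\<dots> = bilin_ext m x (bilin_ext m y z)"
      unfolding bilin_ext_def lin_ext_lin_ext ..
    finally show ?case by (simp add: basis_algebra_def)
  next
    case (4 x)
    then have "bilin_ext m u x = lin_ext bas x"
      unfolding bilin_ext_def
      by (subst lin_ext_swap) (auto simp: basis_algebra_def unit intro!: lin_ext_cong)
    then show ?case by (simp add: basis_algebra_def lin_ext_id)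
  next
    case (5 x)
    then have "bilin_ext m x u = lin_ext bas x"
      unfolding bilin_ext_def by (auto simp: basis_algebra_def unit intro!: lin_ext_cong)
    then show ?case by (simp add: basis_algebra_def lin_ext_id)
  qed
  show ?thesis
    by (rule ringI[OF 1 2]) (auto simp: basis_algebra_def bilin_ext_def lin_ext_fun_add)
qed


section \<open>The Hopf algebra of a group datum of non-nilpotent type\<close>

locale non_nilpotent_datum = group G for G (structure) +
  fixes \<chi> :: "'a \<Rightarrow> 'k::field" and g :: 'a and n :: nat
  assumes finite_G: "finite (carrier G)"
    and \<chi>_one: "\<chi> \<one> = 1"
    and \<chi>_mult: "\<lbrakk>h \<in> carrier G; k \<in> carrier G\<rbrakk> \<Longrightarrow> \<chi> (h \<otimes> k) = \<chi> h * \<chi> k"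
    and g_closed: "g \<in> carrier G"
    and g_central: "h \<in> carrier G \<Longrightarrow> g \<otimes> h = h \<otimes> g"
    and n_ge_2: "n \<ge> 2"
    and order_q: "\<chi> g ^ m = 1 \<longleftrightarrow> n dvd m"
    and \<chi>_pow: "h \<in> carrier G \<Longrightarrow> \<chi> h ^ n = 1"
    and g_pow: "g [^] n \<noteq> \<one>"

text \<open>The pair \<open>(i, h)\<close> stands for the basis element \<open>y\<^sup>i h\<close>. The relation
  \<open>y h = \<chi>(h) h y\<close> gives \<open>(y\<^sup>i h) (y\<^sup>j k) = \<chi>(h)\<^sup>-\<^sup>j y\<^sup>i\<^sup>+\<^sup>j h k\<close>, and for \<open>i + j \<ge> n\<close> one reduces
  with \<open>y\<^sup>n = g\<^sup>n - 1\<close>. The lemmas below show that this is an associative unital algebra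
  which contains the group algebra and satisfies the defining relations of \<open>H\<close>; being generated
  by \<open>y\<close> and \<open>G\<close>, with the expected basis, it is the algebra so presented.\<close>

definition H_basis :: "('a, 'm) monoid_scheme \<Rightarrow> nat \<Rightarrow> (nat \<times> 'a) set"
  where "H_basis G n = {..<n} \<times> carrier G"

definition H_mult :: "('a, 'm) monoid_scheme \<Rightarrow> ('a \<Rightarrow> 'k::field) \<Rightarrow> 'a \<Rightarrow> nat \<Rightarrow>
    nat \<times> 'a \<Rightarrow> nat \<times> 'a \<Rightarrow> (nat \<times> 'a \<Rightarrow>\<^sub>0 'k)"
  where "H_mult G \<chi> g n = (\<lambda>(i, h) (j, k).
    scale (inverse (\<chi> h) ^ j)
      (if i + j < n then bas (i + j, h \<otimes>\<^bsub>G\<^esub> k)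
       else bas (i + j - n, g [^]\<^bsub>G\<^esub> n \<otimes>\<^bsub>G\<^esub> (h \<otimes>\<^bsub>G\<^esub> k)) - bas (i + j - n, h \<otimes>\<^bsub>G\<^esub> k)))"

definition H_grp :: "'a \<Rightarrow> (nat \<times> 'a \<Rightarrow>\<^sub>0 'k::field)"
  where "H_grp h = bas (0, h)"

definition H_y :: "('a, 'm) monoid_scheme \<Rightarrow> (nat \<times> 'a \<Rightarrow>\<^sub>0 'k::field)"
  where "H_y G = bas (1, \<one>\<^bsub>G\<^esub>)"

definition hopf :: "('a, 'm) monoid_scheme \<Rightarrow> ('a \<Rightarrow> 'k::field) \<Rightarrow> 'a \<Rightarrow> nat \<Rightarrow> (nat \<times> 'a \<Rightarrow>\<^sub>0 'k) ring"
  where "hopf G \<chi> g n = basis_algebra (H_basis G n) (H_mult G \<chi> g n) (H_grp \<one>\<^bsub>G\<^esub>)"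

context non_nilpotent_datum
begin

lemma \<chi>_nz: "h \<in> carrier G \<Longrightarrow> \<chi> h \<noteq> 0"
  using \<chi>_pow[of h] n_ge_2 by (auto simp: power_0_left)

lemma g_pow_central: "h \<in> carrier G \<Longrightarrow> g [^] (m::nat) \<otimes> h = h \<otimes> g [^] m"
proof (induction m)
  case (Suc m)
  have "g [^] Suc m \<otimes> h = g [^] m \<otimes> (h \<otimes> g)"
    using Suc g_closed g_central[of h] by (simp add: m_assoc)
  also have "\<dots> = h \<otimes> g [^] Suc m"
    using Suc g_closed by (simp add: m_assoc[symmetric])
  finally show ?case .
qed (simp add: g_closed)

lemma \<chi>_g_pow: "\<chi> (g [^] (m::nat)) = \<chi> g ^ m"
  by (induction m) (simp_all add: \<chi>_one \<chi>_mult g_closed)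

lemma inverse_\<chi>_pow:
  assumes "h \<in> carrier G" "n \<le> j"
  shows "inverse (\<chi> h) ^ (j - n) = inverse (\<chi> h) ^ j"
proof -
  have "inverse (\<chi> h) ^ j = inverse (\<chi> h) ^ (j - n) * inverse (\<chi> h) ^ n"
    using assms(2) by (simp flip: power_add)
  then show ?thesis using \<chi>_pow[OF assms(1)] by (simp add: power_inverse)
qed

lemma H_mult_assoc:
  assumes "a \<in> H_basis G n" "b \<in> H_basis G n" "c \<in> H_basis G n"
  shows "lin_ext (\<lambda>t. H_mult G \<chi> g n t c) (H_mult G \<chi> g n a b) =
    lin_ext (H_mult G \<chi> g n a) (H_mult G \<chi> g n b c)"
proof -
  obtain i h j k l m where abc: "a = (i, h)" "b = (j, k)" "c = (l, m)"
    by (metis surj_pair)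
  define N where "N = g [^] n"
  have cl: "h \<in> carrier G" "k \<in> carrier G" "m \<in> carrier G" "N \<in> carrier G"
    and lt: "i < n" "j < n" "l < n"
    using assms g_closed by (auto simp: H_basis_def abc N_def)
  have chN: "\<chi> N = 1" using order_q[of n] by (simp add: N_def \<chi>_g_pow)
  have N: "x \<otimes> N = N \<otimes> x" if "x \<in> {h, k}" for x
    using that cl g_pow_central[of x n] by (auto simp: N_def)
  have N': "x \<otimes> (N \<otimes> y) = N \<otimes> (x \<otimes> y)" if "x \<in> {h, k}" "y \<in> carrier G" for x y
    using that cl m_assoc[of x N y] m_assoc[of N x y] N[of x] by auto
  define C where "C = inverse (\<chi> h) ^ (j + l) * inverse (\<chi> k) ^ l"
  have c1: "inverse (\<chi> h) ^ j * inverse (\<chi> (h \<otimes> k)) ^ l = C"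
    "inverse (\<chi> h) ^ j * inverse (\<chi> (N \<otimes> (h \<otimes> k))) ^ l = C"
    "inverse (\<chi> k) ^ l * inverse (\<chi> h) ^ (j + l) = C"
    using cl by (simp_all add: C_def \<chi>_mult chN power_mult_distrib power_add)
  have c2: "inverse (\<chi> k) ^ l * inverse (\<chi> h) ^ (j + l - n) = C" if "n \<le> j + l"
    using inverse_\<chi>_pow[OF cl(1) that] c1(3) by simp
  note E = H_mult_def abc N_def[symmetric] c1 c2 cl N[of h, simplified] N[of k, simplified]
    N'[of h, simplified] N'[of k, simplified] m_assoc
  consider "i + j < n" "j + l < n" | "i + j < n" "\<not> j + l < n"
    | "\<not> i + j < n" "j + l < n" | "\<not> i + j < n" "\<not> j + l < n" by blast
  then show ?thesis
  proof cases
    case 1 then show ?thesis by (simp add: E ac_simps)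
  next
    case 2
    then have "\<not> i + j + l < n" "i + (j + l - n) < n" "i + (j + l - n) = i + j + l - n"
      using lt by auto
    with 2 show ?thesis by (simp add: E)
  next
    case 3
    then have "\<not> i + (j + l) < n" "i + j - n + l < n" "i + (j + l) - n = i + j - n + l"
      using lt by auto
    with 3 show ?thesis by (simp add: E)
  next
    case 4
    have eq: "i + (j + l - n) = i + j - n + l" using 4 by auto
    show ?thesis
      using 4 by (cases "i + j - n + l < n") (simp_all add: E eq)
  qed
qed

lemma hopf_ring: "ring (hopf G \<chi> g n)"
  unfolding hopf_def
proof (rule basis_algebra_ring)
  show "Poly_Mapping.keys (H_mult G \<chi> g n a b) \<subseteq> H_basis G n"
    if ab: "a \<in> H_basis G n" "b \<in> H_basis G n" for a b
  proof -
    obtain i h j k where *: "a = (i, h)" "b = (j, k)" by (metis surj_pair)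
    have "Poly_Mapping.keys (if i + j < n then bas (i + j, h \<otimes> k)
        else bas (i + j - n, g [^] n \<otimes> (h \<otimes> k)) - bas (i + j - n, h \<otimes> k) :: _ \<Rightarrow>\<^sub>0 'k)
      \<subseteq> H_basis G n"
      using ab * g_closed
      by (auto simp: H_basis_def in_keys_iff lookup_minus lookup_single when_def split: if_splits)
    then show ?thesis unfolding * H_mult_def prod.case
      by (rule order_trans[OF keys_scale])
  qed
next
  show "Poly_Mapping.keys (H_grp \<one> :: _ \<Rightarrow>\<^sub>0 'k) \<subseteq> H_basis G n"
    using n_ge_2 by (simp add: H_grp_def H_basis_def)
next
  fix a assume "a \<in> H_basis G n"
  then obtain i h where a: "a = (i, h)" "i < n" "h \<in> carrier G"
    by (auto simp: H_basis_def)
  show "lin_ext (\<lambda>t. H_mult G \<chi> g n t a) (H_grp \<one>) = bas a"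
    and "lin_ext (H_mult G \<chi> g n a) (H_grp \<one>) = bas a"
    using a by (simp_all add: H_grp_def H_mult_def \<chi>_one)
qed (rule H_mult_assoc)

lemma H_y_pow: "i < n \<Longrightarrow> H_y G [^]\<^bsub>hopf G \<chi> g n\<^esub> i = bas (i, \<one>)"
proof (induction i)
  case 0
  then show ?case by (simp add: hopf_def basis_algebra_def nat_pow_def H_grp_def)
next
  case (Suc i)
  then have "bas (i, \<one>) \<otimes>\<^bsub>hopf G \<chi> g n\<^esub> H_y G = bas (Suc i, \<one>)"
    by (simp add: hopf_def basis_algebra_def bilin_ext_def H_y_def H_mult_def \<chi>_one)
  with Suc show ?case by simp
qed

lemma hopf_basis: "\<lbrakk>i < n; h \<in> carrier G\<rbrakk> \<Longrightarrow>
    H_y G [^]\<^bsub>hopf G \<chi> g n\<^esub> i \<otimes>\<^bsub>hopf G \<chi> g n\<^esub> H_grp h = bas (i, h)"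
  by (simp add: H_y_pow) (simp add: hopf_def basis_algebra_def bilin_ext_def H_mult_def H_grp_def)

lemma hopf_group_algebra: "\<lbrakk>h \<in> carrier G; k \<in> carrier G\<rbrakk> \<Longrightarrow>
    H_grp h \<otimes>\<^bsub>hopf G \<chi> g n\<^esub> H_grp k = H_grp (h \<otimes> k)"
  using n_ge_2 by (simp add: hopf_def basis_algebra_def bilin_ext_def H_mult_def H_grp_def)

lemma hopf_relation_y_pow:
  "H_y G [^]\<^bsub>hopf G \<chi> g n\<^esub> n = H_grp (g [^] n) - H_grp \<one>"
proof -
  interpret H: ring "hopf G \<chi> g n" by (rule hopf_ring)
  obtain m where m: "n = Suc m" using n_ge_2 by (cases n) auto
  have "H_y G [^]\<^bsub>hopf G \<chi> g n\<^esub> n = bas (m, \<one>) \<otimes>\<^bsub>hopf G \<chi> g n\<^esub> H_y G"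
    using H_y_pow[of m] m by simp
  also have "\<dots> = H_grp (g [^] n) - H_grp \<one>"
    using g_closed
    by (simp add: hopf_def basis_algebra_def bilin_ext_def H_mult_def H_grp_def H_y_def \<chi>_one m
        del: nat_pow_Suc)
  finally show ?thesis .
qed

lemma hopf_relation_commute: "h \<in> carrier G \<Longrightarrow>
    H_y G \<otimes>\<^bsub>hopf G \<chi> g n\<^esub> H_grp h = scale (\<chi> h) (H_grp h \<otimes>\<^bsub>hopf G \<chi> g n\<^esub> H_y G)"
  using n_ge_2 \<chi>_nz
  by (simp add: hopf_def basis_algebra_def bilin_ext_def H_mult_def H_grp_def H_y_def)

end

definition hopf2 :: "('a, 'm) monoid_scheme \<Rightarrow> ('a \<Rightarrow> 'k::field) \<Rightarrow> 'a \<Rightarrow> nat \<Rightarrow>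
    ((nat \<times> 'a) \<times> (nat \<times> 'a) \<Rightarrow>\<^sub>0 'k) ring"  \<comment> \<open>\<open>H \<otimes> H\<close>\<close>
  where "hopf2 G \<chi> g n = basis_algebra (H_basis G n \<times> H_basis G n)
    (\<lambda>(a, b) (c, d). tens (H_mult G \<chi> g n a c) (H_mult G \<chi> g n b d))
    (tens (H_grp \<one>\<^bsub>G\<^esub>) (H_grp \<one>\<^bsub>G\<^esub>))"

text \<open>The comultiplication is the algebra map with \<open>\<Delta>(y) = y \<otimes> g + 1 \<otimes> y\<close> and
  \<open>\<Delta>(h) = h \<otimes> h\<close>, so that \<open>\<Delta>(y\<^sup>i h) = \<Delta>(y)\<^sup>i (h \<otimes> h)\<close>; likewise
  \<open>\<epsilon>(y\<^sup>i h) = 0\<^sup>i\<close> for the counit. The antipode plays no role in the Green ring.\<close>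

definition H_comult :: "('a, 'm) monoid_scheme \<Rightarrow> ('a \<Rightarrow> 'k::field) \<Rightarrow> 'a \<Rightarrow> nat \<Rightarrow>
    (nat \<times> 'a \<Rightarrow>\<^sub>0 'k) \<Rightarrow> ((nat \<times> 'a) \<times> (nat \<times> 'a) \<Rightarrow>\<^sub>0 'k)"
  where "H_comult G \<chi> g n = lin_ext (\<lambda>(i, h).
    (tens (H_y G) (H_grp g) + tens (H_grp \<one>\<^bsub>G\<^esub>) (H_y G)) [^]\<^bsub>hopf2 G \<chi> g n\<^esub> i
      \<otimes>\<^bsub>hopf2 G \<chi> g n\<^esub> tens (H_grp h) (H_grp h))"

context non_nilpotent_datum
begin

lemma H_comult_grp: "h \<in> carrier G \<Longrightarrow> H_comult G \<chi> g n (H_grp h) = tens (H_grp h) (H_grp h)"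
  using n_ge_2
  by (simp add: H_comult_def H_grp_def hopf2_def basis_algebra_def nat_pow_def bilin_ext_def
      tens_def H_mult_def \<chi>_one)

lemma H_comult_y: "H_comult G \<chi> g n (H_y G) = tens (H_y G) (H_grp g) + tens (H_grp \<one>) (H_y G)"
  using n_ge_2 g_closed
  by (simp add: H_comult_def H_grp_def H_y_def hopf2_def basis_algebra_def nat_pow_def
      bilin_ext_def tens_def H_mult_def \<chi>_one)

end

definition H_counit :: "(nat \<times> 'a \<Rightarrow>\<^sub>0 'k::field) \<Rightarrow> 'k"
  where "H_counit x = (\<Sum>(i, h)\<in>Poly_Mapping.keys x. Poly_Mapping.lookup x (i, h) * 0 ^ i)"


section \<open>Finite-dimensional modules\<close>

text \<open>A finite-dimensional left module is given, up to isomorphism, by a module structure on some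
  \<open>k\<^sup>d\<close>, i.e. by a unital \<open>k\<close>-algebra homomorphism \<open>\<rho>\<close> from \<open>H\<close> to the \<open>d \<times> d\<close> matrices
  (the zero module, \<open>d = 0\<close>, is included). The values of \<open>\<rho>\<close> outside the carrier of \<open>H\<close> are
  irrelevant, and isomorphism of modules ignores them.\<close>

type_synonym ('b, 'k) rep = "nat \<times> (('b \<Rightarrow>\<^sub>0 'k) \<Rightarrow> 'k mat)"

definition fd_modules :: "('b \<Rightarrow>\<^sub>0 'k::field) ring \<Rightarrow> ('b, 'k) rep set"
  where "fd_modules H = {(d, \<rho>). \<rho> \<in> Ring.ring_hom H (ring_mat TYPE('k) d ()) \<and>
    (\<forall>c. \<forall>x\<in>carrier H. \<rho> (scale c x) = c \<cdot>\<^sub>m \<rho> x)}"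

definition module_iso :: "('b \<Rightarrow>\<^sub>0 'k::field) ring \<Rightarrow> (('b, 'k) rep \<times> ('b, 'k) rep) set"
  where "module_iso H = {((d, \<rho>), (e, \<sigma>)). (d, \<rho>) \<in> fd_modules H \<and> (e, \<sigma>) \<in> fd_modules H \<and>
    (\<exists>P \<in> carrier_mat e d. invertible_mat P \<and> (\<forall>x\<in>carrier H. P * \<rho> x = \<sigma> x * P))}"

fun module_sum :: "('b, 'k::field) rep \<Rightarrow> ('b, 'k) rep \<Rightarrow> ('b, 'k) rep"
  where "module_sum (d, \<rho>) (e, \<sigma>) =
    (d + e, \<lambda>x. four_block_mat (\<rho> x) (0\<^sub>m d e) (0\<^sub>m e d) (\<sigma> x))"

definition kronecker :: "'k::field mat \<Rightarrow> 'k mat \<Rightarrow> 'k mat"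
  where "kronecker A B = mat (dim_row A * dim_row B) (dim_col A * dim_col B)
    (\<lambda>(i, j). A $$ (i div dim_row B, j div dim_col B) * B $$ (i mod dim_row B, j mod dim_col B))"

text \<open>\<open>H\<close> acts on \<open>M \<otimes> N\<close> through \<open>\<Delta>\<close>: if \<open>\<Delta>(x) = \<Sum> c\<^sub>a\<^sub>b a \<otimes> b\<close> over basis elements
  \<open>a, b\<close>, then \<open>x\<close> acts as \<open>\<Sum> c\<^sub>a\<^sub>b \<rho>(a) \<otimes> \<sigma>(b)\<close>.\<close>

fun module_tensor :: "(('b \<Rightarrow>\<^sub>0 'k) \<Rightarrow> ('b \<times> 'b \<Rightarrow>\<^sub>0 'k)) \<Rightarrow>
    ('b, 'k::field) rep \<Rightarrow> ('b, 'k) rep \<Rightarrow> ('b, 'k) rep"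
  where "module_tensor \<Delta> (d, \<rho>) (e, \<sigma>) = (d * e, \<lambda>x. mat (d * e) (d * e) (\<lambda>(i, j).
    \<Sum>(a, b)\<in>Poly_Mapping.keys (\<Delta> x).
      Poly_Mapping.lookup (\<Delta> x) (a, b) * kronecker (\<rho> (bas a)) (\<sigma> (bas b)) $$ (i, j)))"

definition trivial_module :: "(('b \<Rightarrow>\<^sub>0 'k) \<Rightarrow> 'k) \<Rightarrow> ('b, 'k::field) rep"
  where "trivial_module \<epsilon> = (1, \<lambda>x. mat 1 1 (\<lambda>_. \<epsilon> x))"


section \<open>The Green ring\<close>

definition iso_class :: "('b \<Rightarrow>\<^sub>0 'k::field) ring \<Rightarrow> ('b, 'k) rep \<Rightarrow> ('b, 'k) rep set"
  where "iso_class H M = module_iso H `` {M}"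

text \<open>The class of \<open>M \<otimes> N\<close> does not depend on the representatives, so the union below
  is a single isomorphism class.\<close>

definition class_tensor :: "('b \<Rightarrow>\<^sub>0 'k::field) ring \<Rightarrow> (('b \<Rightarrow>\<^sub>0 'k) \<Rightarrow> ('b \<times> 'b \<Rightarrow>\<^sub>0 'k)) \<Rightarrow>
    ('b, 'k) rep set \<Rightarrow> ('b, 'k) rep set \<Rightarrow> ('b, 'k) rep set"
  where "class_tensor H \<Delta> A B = (\<Union>M\<in>A. \<Union>N\<in>B. iso_class H (module_tensor \<Delta> M N))"

text \<open>The free abelian group on the isomorphism classes, with the product induced by \<open>\<otimes>\<close>.\<close>

definition free_class_ring :: "('b \<Rightarrow>\<^sub>0 'k::field) ring \<Rightarrow> (('b \<Rightarrow>\<^sub>0 'k) \<Rightarrow> ('b \<times> 'b \<Rightarrow>\<^sub>0 'k)) \<Rightarrow>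
    (('b \<Rightarrow>\<^sub>0 'k) \<Rightarrow> 'k) \<Rightarrow> (('b, 'k) rep set \<Rightarrow>\<^sub>0 int) ring"
  where "free_class_ring H \<Delta> \<epsilon> = basis_algebra (fd_modules H // module_iso H)
    (\<lambda>A B. frag_of (class_tensor H \<Delta> A B)) (frag_of (iso_class H (trivial_module \<epsilon>)))"

text \<open>The subgroup generated by the elements \<open>[M \<oplus> N] - [M] - [N]\<close>; it is an ideal, since
  \<open>\<otimes>\<close> distributes over \<open>\<oplus>\<close>.\<close>

definition sum_relations :: "('b \<Rightarrow>\<^sub>0 'k::field) ring \<Rightarrow> (('b \<Rightarrow>\<^sub>0 'k) \<Rightarrow> ('b \<times> 'b \<Rightarrow>\<^sub>0 'k)) \<Rightarrow>
    (('b \<Rightarrow>\<^sub>0 'k) \<Rightarrow> 'k) \<Rightarrow> (('b, 'k) rep set \<Rightarrow>\<^sub>0 int) set"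
  where "sum_relations H \<Delta> \<epsilon> = generate (add_monoid (free_class_ring H \<Delta> \<epsilon>))
    {frag_of (iso_class H (module_sum M N)) - frag_of (iso_class H M) - frag_of (iso_class H N)
      | M N. M \<in> fd_modules H \<and> N \<in> fd_modules H}"

definition green_ring :: "('b \<Rightarrow>\<^sub>0 'k::field) ring \<Rightarrow> (('b \<Rightarrow>\<^sub>0 'k) \<Rightarrow> ('b \<times> 'b \<Rightarrow>\<^sub>0 'k)) \<Rightarrow>
    (('b \<Rightarrow>\<^sub>0 'k) \<Rightarrow> 'k) \<Rightarrow> (('b, 'k) rep set \<Rightarrow>\<^sub>0 int) set ring"
  where "green_ring H \<Delta> \<epsilon> = free_class_ring H \<Delta> \<epsilon> Quot sum_relations H \<Delta> \<epsilon>"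

definition green_ring_H :: "('a, 'm) monoid_scheme \<Rightarrow> ('a \<Rightarrow> 'k::field) \<Rightarrow> 'a \<Rightarrow> nat \<Rightarrow>
    ((nat \<times> 'a, 'k) rep set \<Rightarrow>\<^sub>0 int) set ring"
  where "green_ring_H G \<chi> g n = green_ring (hopf G \<chi> g n) (H_comult G \<chi> g n) H_counit"

end

theory Submission
  imports Defs "Jordan_Normal_Form.Char_Poly" "HOL-Algebra.Multiplicative_Group"
begin

text \<open>Write an idempotent as \<open>e = [M] - [N]\<close>; replacing it by \<open>1 - e\<close> we may assume that \<open>M\<close> and \<open>N\<close> have the
  same dimension. Every ring homomorphism from the Green ring to \<open>\<Bbbk>\<close> sends \<open>e\<close> to 0 or 1. We use the
  traces of group elements and the homomorphisms \<open>phi x a b\<close> for \<open>x \<in> G\<close>, \<open>a b = \<chi>(x)\<^sup>-\<^sup>1\<close>, \<open>a\<^sup>n = b\<^sup>n\<close>,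
  \<open>a \<noteq> b\<close>, which kill the modules induced from \<open>\<Bbbk>G\<close> and send the uniserial module of length \<open>l\<close> with
  first layer \<open>V\<close> to \<open>tr\<^sub>V(x) (a\<^sup>l - b\<^sup>l) / (a - b)\<close>. Their values are sums of roots of unity,
  so for a prime \<open>p\<close> the \<open>p\<close>-th power of a value is congruent modulo \<open>p\<close> to the value at \<open>(x\<^sup>p, a\<^sup>p, b\<^sup>p)\<close>;
  as \<open>1/p\<close> is not an algebraic integer, this forces all of them to vanish on \<open>e\<close>. Varying \<open>a\<close> and
  \<open>b\<close> one finds that \<open>M\<close> and \<open>N\<close> have the same non-induced summands and are isomorphic over \<open>G\<close>.
  Then \<open>e\<close> is a difference of induced modules, and such a difference annihilates
  \<open>[M] - [N]\<close>, since \<open>Ind W \<otimes> M = Ind (W \<otimes> M)\<close> depends only on \<open>M\<close> over \<open>G\<close>. Hence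
  \<open>e = e\<^sup>2 = 0\<close>.\<close>


section \<open>Matrices\<close>

text \<open>Modulo induced modules the Clebsch-Gordan rule says that the module of length 2 times
  the one of length \<open>l\<close> is the sum of those of lengths \<open>l + 1\<close> and
  \<open>l - 1\<close>, the latter twisted by the inverse of \<open>\<chi>\<close>, and that length
  \<open>n\<close> counts as zero. A character of such a ring sends length \<open>l\<close> to a
  solution of a linear recursion with roots \<open>a\<close> and \<open>b\<close>, where
  \<open>a * b\<close> is the value of the twist; truncation at \<open>n\<close> becomes the
  condition that the \<open>n\<close>-th powers agree. This is where \<open>phi\<close> comes from.
  The obstacle is that the Frobenius argument wants to move \<open>(x, a, b)\<close> to
  \<open>(1, 1, 1)\<close>, where only dimensions remain, but there \<open>a = b\<close> and the
  chain of length \<open>n\<close> has value \<open>n\<close> instead of 0. What survives is a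
  congruence modulo \<open>n\<close>; it suffices because a prime dividing the order of
  \<open>a / b\<close> also divides \<open>n\<close>. These homomorphisms need not separate
  elements: of a difference of induced modules they see only the restriction to \<open>G\<close>. So
  their vanishing on \<open>e\<close> does not give \<open>e = 0\<close> directly, and the last step
  works with the annihilator of \<open>e\<close>.\<close>

declare index_mult_mat(1) [simp del] assoc_mult_mat [simp del]

lemma index_mult_sum [simp]:
  "i < dim_row A \<Longrightarrow> j < dim_col B \<Longrightarrow> dim_col A = dim_row B \<Longrightarrow>
    (A * B) $$ (i, j) = (\<Sum>k<dim_row B. A $$ (i, k) * (B :: 'k::field mat) $$ (k, j))"
  by (simp add: index_mult_mat(1) scalar_prod_def lessThan_atLeast0)

text \<open>Side conditions stated as equations of dimensions can be discharged by simplification,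
  whereas carrier memberships would leave the inner sizes to be guessed.\<close>

lemma mat_assoc:
  fixes A B C :: "'k::field mat"
  shows "dim_col A = dim_row B \<Longrightarrow> dim_col B = dim_row C \<Longrightarrow> A * B * C = A * (B * C)"
  by (rule assoc_mult_mat[of _ "dim_row A" "dim_col A" _ "dim_col B" _ "dim_col C"]) auto

text \<open>After reassociation to the right a product \<open>A * B\<close> only occurs as
  \<open>A * (B * X)\<close>; this turns an equation for \<open>A * B\<close> into a rewrite rule
  for that shape.\<close>

lemma mat_pull:
  fixes A B C X :: "'k::field mat"
  shows "A * B = C \<Longrightarrow> dim_col A = dim_row B \<Longrightarrow> dim_col B = dim_row X \<Longrightarrow> A * (B * X) = C * X"
  by (simp flip: mat_assoc)

lemma mat_diff_self [simp]: "A - A = (0\<^sub>m (dim_row A) (dim_col A) :: 'k::field mat)"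
  by (intro eq_matI) auto

lemma mat_left_distrib:
  fixes A B C :: "'k::field mat"
  shows "dim_row A = dim_row B \<Longrightarrow> dim_col A = dim_col B \<Longrightarrow> dim_col A = dim_row C \<Longrightarrow>
    (A + B) * C = A * C + B * C"
  by (rule add_mult_distrib_mat[of _ "dim_row A" "dim_col A" _ _ "dim_col C"]) auto

lemma mat_right_distrib:
  fixes A B C :: "'k::field mat"
  shows "dim_row A = dim_row B \<Longrightarrow> dim_col A = dim_col B \<Longrightarrow> dim_col C = dim_row A \<Longrightarrow>
    C * (A + B) = C * A + C * B"
  by (rule mult_add_distrib_mat[of _ "dim_row C" "dim_col C" _ "dim_col A" _]) auto

lemma mat_left_diff_distrib:
  fixes A B C :: "'k::field mat"
  shows "dim_row A = dim_row B \<Longrightarrow> dim_col A = dim_col B \<Longrightarrow> dim_col A = dim_row C \<Longrightarrow>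
    (A - B) * C = A * C - B * C"
  by (rule minus_mult_distrib_mat[of _ "dim_row A" "dim_col A" _ _ "dim_col C"]) auto

lemma mat_right_diff_distrib:
  fixes A B C :: "'k::field mat"
  shows "dim_row A = dim_row B \<Longrightarrow> dim_col A = dim_col B \<Longrightarrow> dim_col C = dim_row A \<Longrightarrow>
    C * (A - B) = C * A - C * B"
  by (rule mult_minus_distrib_mat[of _ "dim_row C" "dim_col C" _ "dim_col A" _]) auto

lemma smult_mat_mult [simp]:
  fixes A B :: "'k::field mat"
  shows "dim_col A = dim_row B \<Longrightarrow> (c \<cdot>\<^sub>m A) * B = c \<cdot>\<^sub>m (A * B)"
    "dim_col A = dim_row B \<Longrightarrow> A * (c \<cdot>\<^sub>m B) = c \<cdot>\<^sub>m (A * B)"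
  by (intro eq_matI; simp add: sum_distrib_left mult_ac)+

lemma smult_smult_mat [simp]: "c \<cdot>\<^sub>m (d \<cdot>\<^sub>m A) = (c * d :: 'k::field) \<cdot>\<^sub>m A"
  by (intro eq_matI) auto

lemma one_smult_mat [simp]: "(1::'k::field) \<cdot>\<^sub>m A = A"
  by (intro eq_matI) auto

lemma zero_smult_mat [simp]: "(0::'k::field) \<cdot>\<^sub>m A = 0\<^sub>m (dim_row A) (dim_col A)"
  by (intro eq_matI) auto

lemma mat_one_mult [simp]:
  fixes A :: "'k::field mat"
  shows "dim_row A = m \<Longrightarrow> 1\<^sub>m m * A = A" "dim_col A = m \<Longrightarrow> A * 1\<^sub>m m = A"
  using left_mult_one_mat'[of A m] right_mult_one_mat'[of A m] by auto

lemma mat_zero_mult [simp]: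
  fixes A :: "'k::field mat"
  shows "dim_row A = m \<Longrightarrow> 0\<^sub>m l m * A = 0\<^sub>m l (dim_col A)"
    "dim_col A = m \<Longrightarrow> A * 0\<^sub>m m l = 0\<^sub>m (dim_row A) l"
  by (auto intro!: eq_matI)

lemma mat_zero_add [simp]:
  fixes A :: "'k::field mat"
  shows "dim_row A = m \<Longrightarrow> dim_col A = l \<Longrightarrow> 0\<^sub>m m l + A = A"
    "dim_row A = m \<Longrightarrow> dim_col A = l \<Longrightarrow> A + 0\<^sub>m m l = A"
    "dim_row A = m \<Longrightarrow> dim_col A = l \<Longrightarrow> A - 0\<^sub>m m l = A"
  by (auto intro!: eq_matI)

definition mtr :: "'k::field mat \<Rightarrow> 'k"
  where "mtr A = (\<Sum>i<dim_row A. A $$ (i, i))"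

lemma mtr_comm:
  assumes "dim_row A = dim_col B" "dim_col A = dim_row B"
  shows "mtr (A * B) = mtr (B * A)"
proof -
  have "mtr (A * B) = (\<Sum>i<dim_row A. \<Sum>k<dim_row B. A $$ (i, k) * B $$ (k, i))"
    using assms by (simp add: mtr_def index_mult_sum)
  also have "\<dots> = (\<Sum>k<dim_row B. \<Sum>i<dim_row A. B $$ (k, i) * A $$ (i, k))"
    by (subst sum.swap) (simp add: mult.commute)
  also have "\<dots> = mtr (B * A)"
    using assms by (simp add: mtr_def index_mult_sum)
  finally show ?thesis .
qed

lemma mtr_simps [simp]:
  "mtr (1\<^sub>m m) = of_nat m" "mtr (0\<^sub>m m m) = 0" "dim_row A = dim_col A \<Longrightarrow> mtr (c \<cdot>\<^sub>m A) = c * mtr A"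
  by (simp_all add: mtr_def sum_distrib_left)

lemma mtr_add [simp]:
  "A \<in> carrier_mat m m \<Longrightarrow> B \<in> carrier_mat m m \<Longrightarrow> mtr (A + B) = mtr A + mtr B"
  by (simp add: mtr_def sum.distrib)

lemma pow_mat_Suc2:
  "dim_row A = dim_col A \<Longrightarrow> (A :: 'k::field mat) ^\<^sub>m Suc i = A * A ^\<^sub>m i"
proof (induction i)
  case (Suc i)
  have "A ^\<^sub>m Suc (Suc i) = (A * A ^\<^sub>m i) * A" using Suc by simp
  then show ?case using Suc.prems by (simp add: mat_assoc)
qed simp

lemma pow_mat_dims [simp]:
  "dim_row A = dim_col A \<Longrightarrow> dim_row (A ^\<^sub>m i) = dim_row A"
  "dim_row A = dim_col A \<Longrightarrow> dim_col (A ^\<^sub>m i) = dim_row A"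
  by (induction i) auto

lemma pow_mat_add:
  "dim_row A = dim_col A \<Longrightarrow> (A :: 'k::field mat) ^\<^sub>m (i + j) = A ^\<^sub>m i * A ^\<^sub>m j"
  by (induction j) (simp_all add: mat_assoc)

lemma pow_mat_zero: "0 < i \<Longrightarrow> (0\<^sub>m m m :: 'k::field mat) ^\<^sub>m i = 0\<^sub>m m m"
  by (cases i) auto

lemma pow_mat_one [simp]: "(1\<^sub>m m :: 'k::field mat) ^\<^sub>m i = 1\<^sub>m m"
  by (induction i) auto

lemma pow_mat_smult: "dim_row A = dim_col A \<Longrightarrow> (c \<cdot>\<^sub>m A :: 'k::field mat) ^\<^sub>m i = c ^ i \<cdot>\<^sub>m (A ^\<^sub>m i)"
  by (induction i) (simp_all add: mult.commute)

text \<open>The scalar \<open>c\<close> lets one statement serve for module homomorphisms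
  (\<open>c = 1\<close>), for moving a group element past powers of \<open>y\<close>, and for the
  two q-commuting matrices of the binomial theorem.\<close>

lemma pow_mat_intertwine:
  fixes A B P :: "'k::field mat"
  assumes "A \<in> carrier_mat m m" "B \<in> carrier_mat l l" "P \<in> carrier_mat l m" "P * A = c \<cdot>\<^sub>m (B * P)"
  shows "P * A ^\<^sub>m i = c ^ i \<cdot>\<^sub>m (B ^\<^sub>m i * P)"
proof (induction i)
  case (Suc i)
  have "P * A ^\<^sub>m Suc i = (P * A ^\<^sub>m i) * A" using assms(1-3) by (simp add: mat_assoc)
  also have "\<dots> = c ^ i \<cdot>\<^sub>m (B ^\<^sub>m i * (P * A))" using assms(1-3) Suc by (simp add: mat_assoc)
  also have "\<dots> = c ^ Suc i \<cdot>\<^sub>m (B ^\<^sub>m Suc i * P)"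
    using assms(1-3) by (simp add: assms(4) mat_assoc mult.commute)
  finally show ?case .
qed (use assms in simp)

subsection \<open>Sums of matrices\<close>

text \<open>Matrices of all sizes share one type without a common zero, so a sum has to carry its
  dimensions.\<close>

definition gsum :: "nat \<Rightarrow> nat \<Rightarrow> ('i \<Rightarrow> 'k::field mat) \<Rightarrow> 'i set \<Rightarrow> 'k mat"
  where "gsum r c f S = mat r c (\<lambda>ij. \<Sum>s\<in>S. f s $$ ij)"

lemma gsum_carrier [simp]: "gsum r c f S \<in> carrier_mat r c"
  and gsum_dims [simp]: "dim_row (gsum r c f S) = r" "dim_col (gsum r c f S) = c"
  by (simp_all add: gsum_def)

lemma index_gsum [simp]:
  "i < r \<Longrightarrow> j < c \<Longrightarrow> gsum r c f S $$ (i, j) = (\<Sum>s\<in>S. f s $$ (i, j))"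
  by (simp add: gsum_def)

lemma gsum_cong: "(\<And>s. s \<in> S \<Longrightarrow> f s = f' s) \<Longrightarrow> gsum r c f S = gsum r c f' S"
  by (intro eq_matI) auto

lemma gsum_insert:
  "finite S \<Longrightarrow> s \<notin> S \<Longrightarrow> f s \<in> carrier_mat r c \<Longrightarrow> gsum r c f (insert s S) = f s + gsum r c f S"
  by (intro eq_matI) auto

lemma gsum_empty [simp]: "gsum r c f {} = 0\<^sub>m r c"
  by (intro eq_matI) auto

lemma gsum_lessThan_Suc:
  "f m \<in> carrier_mat r c \<Longrightarrow> gsum r c f {..<Suc m} = gsum r c f {..<m} + f m"
  by (intro eq_matI) auto

lemma gsum_lessThan_Suc_shift:
  "f 0 \<in> carrier_mat r c \<Longrightarrow> gsum r c f {..<Suc m} = f 0 + gsum r c (\<lambda>i. f (Suc i)) {..<m}"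
  by (intro eq_matI) (auto simp del: sum.lessThan_Suc simp: sum.lessThan_Suc_shift)

lemma gsum_reindex: "inj_on h S \<Longrightarrow> gsum r c f (h ` S) = gsum r c (\<lambda>s. f (h s)) S"
  by (intro eq_matI) (auto simp: sum.reindex)

lemma gsum_mult_right:
  assumes "\<And>s. s \<in> S \<Longrightarrow> f s \<in> carrier_mat r c" "dim_row B = c"
  shows "gsum r c f S * B = gsum r (dim_col B) (\<lambda>s. f s * B) S"
proof (rule eq_matI, goal_cases)
  case (1 i j)
  then have ij: "i < r" "j < dim_col B" by auto
  have "(gsum r c f S * B) $$ (i, j) = (\<Sum>k<c. \<Sum>s\<in>S. f s $$ (i, k) * B $$ (k, j))"
    using assms(2) ij by (simp add: index_mult_sum sum_distrib_right)
  also have "\<dots> = (\<Sum>s\<in>S. (f s * B) $$ (i, j))"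
    using assms ij by (subst sum.swap) (auto intro!: sum.cong simp: index_mult_sum dest!: assms(1))
  finally show ?case using ij by simp
qed auto

lemma gsum_mult_left:
  assumes "\<And>s. s \<in> S \<Longrightarrow> f s \<in> carrier_mat r c" "dim_col B = r"
  shows "B * gsum r c f S = gsum (dim_row B) c (\<lambda>s. B * f s) S"
proof (rule eq_matI, goal_cases)
  case (1 i j)
  then have ij: "i < dim_row B" "j < c" by auto
  have "(B * gsum r c f S) $$ (i, j) = (\<Sum>k<r. \<Sum>s\<in>S. B $$ (i, k) * f s $$ (k, j))"
    using assms(2) ij by (simp add: index_mult_sum sum_distrib_left)
  also have "\<dots> = (\<Sum>s\<in>S. (B * f s) $$ (i, j))"
    using assms ij by (subst sum.swap) (auto intro!: sum.cong simp: index_mult_sum dest!: assms(1))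
  finally show ?case using ij by simp
qed auto

lemma gsum_smult:
  assumes "\<And>s. s \<in> S \<Longrightarrow> f s \<in> carrier_mat r c"
  shows "a \<cdot>\<^sub>m gsum r c f S = gsum r c (\<lambda>s. a \<cdot>\<^sub>m f s) S"
proof -
  have "dim_row (f s) = r" "dim_col (f s) = c" if "s \<in> S" for s using assms[OF that] by auto
  then show ?thesis by (intro eq_matI) (auto simp: sum_distrib_left intro!: sum.cong)
qed

lemma gsum_const:
  "finite S \<Longrightarrow> A \<in> carrier_mat r c \<Longrightarrow> gsum r c (\<lambda>_. A) S = of_nat (card S) \<cdot>\<^sub>m A"
  by (intro eq_matI) auto

lemma mtr_gsum:
  assumes "\<And>s. s \<in> S \<Longrightarrow> f s \<in> carrier_mat r r"
  shows "mtr (gsum r r f S) = (\<Sum>s\<in>S. mtr (f s))"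
proof -
  have "mtr (gsum r r f S) = (\<Sum>s\<in>S. \<Sum>i<r. f s $$ (i, i))"
    unfolding mtr_def by (subst sum.swap) simp
  also have "\<dots> = (\<Sum>s\<in>S. mtr (f s))"
    unfolding mtr_def using assms by (intro sum.cong) auto
  finally show ?thesis .
qed

subsection \<open>Kronecker products\<close>

lemma div_mod_bounds:
  assumes "i < a * b"
  shows "i div b < a" "i mod b < (b::nat)"
proof -
  have "b > 0" using assms by (intro Nat.gr0I) auto
  then show "i div b < a" "i mod b < b" using assms by (simp_all add: less_mult_imp_div_less)
qed

lemma sum_div_mod:
  fixes f :: "nat \<Rightarrow> nat \<Rightarrow> 'c::comm_monoid_add"
  shows "(\<Sum>j<m * n. f (j div n) (j mod n)) = (\<Sum>a<m. \<Sum>b<n. f a b)"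
proof -
  have "(\<Sum>(a, b)\<in>{..<m} \<times> {..<n}. f a b) = (\<Sum>j<m * n. f (j div n) (j mod n))"
  proof (rule sum.reindex_bij_witness[where i = "\<lambda>j. (j div n, j mod n)" and j = "\<lambda>(a, b). a * n + b"])
    fix p assume "p \<in> {..<m} \<times> {..<n}"
    then obtain a b where p: "p = (a, b)" "a < m" "b < n" by auto
    have "a * n + b < Suc a * n" using p by simp
    also have "\<dots> \<le> m * n" using p by (intro mult_le_mono1) auto
    finally show "(case p of (a, b) \<Rightarrow> a * n + b) \<in> {..<m * n}" using p by simp
  qed (auto simp: div_mod_bounds)
  then show ?thesis by (simp add: sum.cartesian_product)
qed

lemma kron_dims [simp]:
  "dim_row (kronecker A B) = dim_row A * dim_row B" "dim_col (kronecker A B) = dim_col A * dim_col B"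
  by (simp_all add: kronecker_def)

lemma kron_carrier [simp]:
  "A \<in> carrier_mat a b \<Longrightarrow> B \<in> carrier_mat c d \<Longrightarrow> kronecker A B \<in> carrier_mat (a * c) (b * d)"
  by (auto simp: kronecker_def)

lemma index_kron:
  "i < dim_row A * dim_row B \<Longrightarrow> j < dim_col A * dim_col B \<Longrightarrow> kronecker A B $$ (i, j) =
    A $$ (i div dim_row B, j div dim_col B) * B $$ (i mod dim_row B, j mod dim_col B)"
  by (simp add: kronecker_def)

lemma kron_mult:
  assumes "dim_col A = dim_row C" "dim_col B = dim_row D"
  shows "kronecker A B * kronecker C D = kronecker (A * C) (B * D)"
proof (rule eq_matI, goal_cases)
  case (1 i j)
  then have ij: "i < dim_row A * dim_row B" "j < dim_col C * dim_col D" by auto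
  have "(kronecker A B * kronecker C D) $$ (i, j) = (\<Sum>k<dim_row C * dim_row D.
      (A $$ (i div dim_row B, k div dim_row D) * C $$ (k div dim_row D, j div dim_col D)) *
      (B $$ (i mod dim_row B, k mod dim_row D) * D $$ (k mod dim_row D, j mod dim_col D)))"
    using ij assms by (simp add: index_mult_sum index_kron mult_ac)
  also have "\<dots> = (A * C) $$ (i div dim_row B, j div dim_col D) * (B * D) $$ (i mod dim_row B, j mod dim_col D)"
    using ij assms by (subst sum_div_mod) (simp add: index_mult_sum div_mod_bounds sum_product)
  finally show ?case using ij by (simp add: index_kron)
qed auto

lemma kron_add_left:
  assumes "dim_row A = dim_row B" "dim_col A = dim_col B"
  shows "kronecker (A + B) C = kronecker A C + kronecker B C"
  using assms by (intro eq_matI) (auto simp: index_kron div_mod_bounds algebra_simps)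

lemma kron_add_right:
  assumes "dim_row A = dim_row B" "dim_col A = dim_col B"
  shows "kronecker C (A + B) = kronecker C A + kronecker C B"
proof (intro eq_matI, goal_cases)
  case (1 i j)
  then have "i mod dim_row B < dim_row B" "j mod dim_col B < dim_col B"
    by (auto intro!: div_mod_bounds)
  with 1 assms show ?case by (simp add: index_kron algebra_simps)
qed (use assms in auto)

lemma kron_smult [simp]:
  "kronecker (c \<cdot>\<^sub>m A) B = c \<cdot>\<^sub>m kronecker A B" "kronecker A (c \<cdot>\<^sub>m B) = c \<cdot>\<^sub>m kronecker A B"
  by (intro eq_matI; auto simp: index_kron div_mod_bounds)+

lemma kron_zero [simp]:
  "kronecker (0\<^sub>m a b) B = 0\<^sub>m (a * dim_row B) (b * dim_col B)"
  "kronecker A (0\<^sub>m a b) = 0\<^sub>m (dim_row A * a) (dim_col A * b)"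
  by (intro eq_matI; auto simp: index_kron div_mod_bounds)+

lemma kron_one [simp]: "kronecker (1\<^sub>m a) (1\<^sub>m b) = 1\<^sub>m (a * b)"
proof (rule eq_matI, goal_cases)
  case (1 i j)
  have "i = j" if "i div b = j div b" "i mod b = j mod b"
    using that by (metis div_mult_mod_eq)
  with 1 show ?case by (auto simp: index_kron div_mod_bounds)
qed auto

text \<open>Both sides read an index as the same three-digit number in mixed radix. Equality on the
  nose makes \<open>htens\<close> strictly associative.\<close>

lemma kron_assoc: "kronecker (kronecker A B) C = kronecker A (kronecker B C)"
proof (rule eq_matI, goal_cases)
  case (1 i j)
  have *: "i div b div a = i div (a * b)" "i div b mod a = i mod (a * b) div b"
    "i mod (a * b) mod b = i mod b" if "i < c * (a * b)" for i a b c :: nat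
  proof -
    have b: "b > 0" using that by (intro Nat.gr0I) auto
    show "i div b div a = i div (a * b)" by (metis div_mult2_eq mult.commute)
    have eq: "i mod (a * b) = b * (i div b mod a) + i mod b"
      by (subst mult.commute) (rule mod_mult2_eq)
    show "i div b mod a = i mod (a * b) div b" "i mod (a * b) mod b = i mod b"
      using b by (simp_all add: eq)
  qed
  from 1 have i: "i < dim_row A * (dim_row B * dim_row C)" and j: "j < dim_col A * (dim_col B * dim_col C)"
    by auto
  then show ?case
    using *[OF i] *[OF j] div_mod_bounds[OF i] div_mod_bounds[OF j]
    by (simp add: index_kron mult.assoc[symmetric] div_mod_bounds)
qed auto

lemma mtr_kron:
  "dim_row A = dim_col A \<Longrightarrow> dim_row B = dim_col B \<Longrightarrow> mtr (kronecker A B) = mtr A * mtr B"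
  unfolding mtr_def by (simp add: index_kron sum_div_mod[of "\<lambda>a b. A $$ (a, a) * B $$ (b, b)"] sum_product)

lemma kron_pow:
  "dim_row A = dim_col A \<Longrightarrow> dim_row B = dim_col B \<Longrightarrow>
    kronecker A B ^\<^sub>m i = kronecker (A ^\<^sub>m i) (B ^\<^sub>m i)"
  by (induction i) (simp_all add: kron_mult)

subsection \<open>Biproducts\<close>

definition in1 :: "nat \<Rightarrow> nat \<Rightarrow> 'k::field mat" where "in1 a b = mat (a + b) a (\<lambda>(i, j). if i = j then 1 else 0)"
definition in2 :: "nat \<Rightarrow> nat \<Rightarrow> 'k::field mat" where "in2 a b = mat (a + b) b (\<lambda>(i, j). if i = a + j then 1 else 0)"
definition pr1 :: "nat \<Rightarrow> nat \<Rightarrow> 'k::field mat" where "pr1 a b = mat a (a + b) (\<lambda>(i, j). if i = j then 1 else 0)"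
definition pr2 :: "nat \<Rightarrow> nat \<Rightarrow> 'k::field mat" where "pr2 a b = mat b (a + b) (\<lambda>(i, j). if a + i = j then 1 else 0)"

lemma biprod_dims [simp]:
  "dim_row (in1 a b) = a + b" "dim_col (in1 a b) = a" "dim_row (in2 a b) = a + b" "dim_col (in2 a b) = b"
  "dim_row (pr1 a b) = a" "dim_col (pr1 a b) = a + b" "dim_row (pr2 a b) = b" "dim_col (pr2 a b) = a + b"
  by (simp_all add: in1_def in2_def pr1_def pr2_def)

lemma biprod_simps [simp]:
  "pr1 a b * in1 a b = 1\<^sub>m a" "pr2 a b * in2 a b = 1\<^sub>m b"
  "pr1 a b * in2 a b = 0\<^sub>m a b" "pr2 a b * in1 a b = 0\<^sub>m b a"
  by (intro eq_matI; auto simp: index_mult_sum in1_def in2_def pr1_def pr2_def if_distrib[of "\<lambda>x. x * _"] cong: if_cong)+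

lemma biprod_mult [simp]:
  fixes A B :: "'k::field mat"
  shows "dim_row A = a \<Longrightarrow> pr1 a b * (in1 a b * A) = A"
    "dim_row B = b \<Longrightarrow> pr2 a b * (in2 a b * B) = B"
    "dim_row B = b \<Longrightarrow> pr1 a b * (in2 a b * B) = 0\<^sub>m a (dim_col B)"
    "dim_row A = a \<Longrightarrow> pr2 a b * (in1 a b * A) = 0\<^sub>m b (dim_col A)"
  by (simp_all flip: mat_assoc)

lemma biprod_sum: "in1 a b * pr1 a b + in2 a b * pr2 a b = 1\<^sub>m (a + b)"
proof (intro eq_matI, goal_cases)
  case (1 i j)
  then have ij: "i < a + b" "j < a + b" by auto
  have 1: "(\<Sum>k<a. if i = k then if k = j then 1 else 0 else 0) = (if i = j \<and> i < a then 1 else (0::'a))"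
    by (auto simp: sum.delta' cong: if_cong)
  have 2: "(\<Sum>k<b. if i = a + k then if a + k = j then 1 else 0 else 0) = (if i = j \<and> a \<le> i then 1 else (0::'a))"
  proof (cases "a \<le> i")
    case True
    have "(\<Sum>k<b. if i = a + k then if a + k = j then 1 else 0 else 0) = (\<Sum>k<b. if k = i - a then if i = j then 1 else 0 else (0::'a))"
      using True by (intro sum.cong) auto
    then show ?thesis using True ij by auto
  qed auto
  from 1 2 show ?case using ij
    by (simp add: index_mult_sum in1_def in2_def pr1_def pr2_def if_distrib[of "\<lambda>x. x * _"] cong: if_cong)
qed auto

text \<open>This links the block matrices, in terms of which \<open>module_sum\<close> is defined,
  with the biproduct maps, whose relations reduce direct sums to matrix algebra.\<close>

lemma four_block_biprod:
  assumes "A \<in> carrier_mat a c" "B \<in> carrier_mat b d"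
  shows "four_block_mat A (0\<^sub>m a d) (0\<^sub>m b c) B = in1 a b * (A * pr1 c d) + in2 a b * (B * pr2 c d)"
proof (intro eq_matI, goal_cases)
  case (1 i j)
  then have ij: "i < a + b" "j < c + d" using assms by auto
  note [simp del] = index_mult_sum
  have 1: "(A * pr1 c d) $$ (k, j) = (if j < c then A $$ (k, j) else 0)" if "k < a" for k
    using that ij assms
    by (auto simp: index_mult_sum pr1_def if_distrib[of "\<lambda>x. _ * x"] cong: if_cong)
  have 2: "(B * pr2 c d) $$ (k, j) = (if j < c then 0 else B $$ (k, j - c))" if "k < b" for k
  proof -
    have "(B * pr2 c d) $$ (k, j) = (\<Sum>l<d. if l = j - c \<and> \<not> j < c then B $$ (k, l) else 0)"
      using that ij assms
      by (auto simp: index_mult_sum pr2_def if_distrib[of "\<lambda>x. _ * x"] cong: if_cong intro!: sum.cong)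
    then show ?thesis using ij by (auto cong: if_cong)
  qed
  have 3: "(in1 a b * (A * pr1 c d)) $$ (i, j) = (if i < a then (A * pr1 c d) $$ (i, j) else 0)"
    using ij assms
    by (simp add: index_mult_sum[of i "in1 a b"])
      (simp add: in1_def if_distrib[of "\<lambda>x. x * _"] cong: if_cong)
  have 4: "(in2 a b * (B * pr2 c d)) $$ (i, j) = (if i < a then 0 else (B * pr2 c d) $$ (i - a, j))"
  proof -
    have "(in2 a b * (B * pr2 c d)) $$ (i, j) = (\<Sum>l<b. if l = i - a \<and> \<not> i < a then (B * pr2 c d) $$ (l, j) else 0)"
      using ij assms
      by (simp add: index_mult_sum[of i "in2 a b"]) (auto simp: in2_def if_distrib[of "\<lambda>x. x * _"] cong: if_cong intro!: sum.cong)
    then show ?thesis using ij by (auto cong: if_cong)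
  qed
  from ij assms show ?case by (auto simp: 1 2 3 4)
qed (use assms in auto)


subsection \<open>Rank factorisation, generalised inverses and splittings\<close>

text \<open>A factor with a one-sided inverse can be cancelled; in the rank induction this carries
  the vanishing of \<open>u * T'\<close> and \<open>T' * v\<close> over to the factors of
  \<open>T'\<close>.\<close>

lemma mat_factor_zero:
  fixes A B :: "'k::field mat"
  assumes "A \<in> carrier_mat a b" "B \<in> carrier_mat b c" "S \<in> carrier_mat c b" "B * S = 1\<^sub>m b"
    "v \<in> carrier_mat l a" "v * (A * B) = 0\<^sub>m l c"
  shows "v * A = 0\<^sub>m l b"
proof -
  have "v * A = v * (A * (B * S))" unfolding assms(4) using assms(1) by simp
  also have "\<dots> = v * (A * B) * S" using assms(1-3,5) by (simp add: mat_assoc)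
  finally show ?thesis unfolding assms(6) using assms(3) by simp
qed

lemma mat_factor_zero':
  fixes A B :: "'k::field mat"
  assumes "A \<in> carrier_mat a b" "B \<in> carrier_mat b c" "L \<in> carrier_mat b a" "L * A = 1\<^sub>m b"
    "v \<in> carrier_mat c l" "(A * B) * v = 0\<^sub>m a l"
  shows "B * v = 0\<^sub>m b l"
proof -
  have "B * v = (L * A) * (B * v)" unfolding assms(4) using assms(2) by simp
  also have "\<dots> = L * (A * B * v)" using assms(1-3,5) by (simp add: mat_assoc)
  finally show ?thesis unfolding assms(6) using assms(3) by simp
qed

lemma mat_add_diff_cancel [simp]:
  fixes A B :: "'k::field mat"
  shows "dim_row A = dim_row B \<Longrightarrow> dim_col A = dim_col B \<Longrightarrow> A + B - B = A"
  by (intro eq_matI) auto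

lemma mat_one_index:
  fixes A :: "'k::field mat"
  assumes "A \<in> carrier_mat 1 1"
  shows "A = A $$ (0, 0) \<cdot>\<^sub>m 1\<^sub>m 1"
  using assms by (intro eq_matI) auto

text \<open>By induction on the number of non-zero rows, subtracting from \<open>T\<close> the rank one matrix that
  agrees with it in the row and the column of a non-zero entry.\<close>

lemma rank_factorisation:
  fixes T :: "'k::field mat"
  assumes "T \<in> carrier_mat a c"
  obtains r A B L S where "A \<in> carrier_mat a r" "B \<in> carrier_mat r c" "L \<in> carrier_mat r a"
    "S \<in> carrier_mat c r" "T = A * B" "L * A = 1\<^sub>m r" "B * S = 1\<^sub>m r"
proof -
  have "\<exists>r A B L S. A \<in> carrier_mat a r \<and> B \<in> carrier_mat r c \<and> L \<in> carrier_mat r a \<and>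
    S \<in> carrier_mat c r \<and> T = A * B \<and> L * A = 1\<^sub>m r \<and> B * S = 1\<^sub>m r"
    using assms
  proof (induction "card {i. i < a \<and> (\<exists>j<c. T $$ (i, j) \<noteq> 0)}" arbitrary: T rule: less_induct)
    case less
    note T = less.prems
    show ?case
    proof (cases "\<forall>i<a. \<forall>j<c. T $$ (i, j) = 0")
      case True
      then have "T = 0\<^sub>m a 0 * 0\<^sub>m 0 c" using T by (intro eq_matI) auto
      then show ?thesis
        by (intro exI[of _ 0] exI[of _ "0\<^sub>m a 0"] exI[of _ "0\<^sub>m 0 c"] exI[of _ "0\<^sub>m 0 a"] exI[of _ "0\<^sub>m c 0"]) auto
    next
      case False
      then obtain i j where ij: "i < a" "j < c" "T $$ (i, j) \<noteq> 0" by auto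
      define t where "t = T $$ (i, j)"
      define u :: "'k mat" where "u = mat 1 a (\<lambda>(_, k). if k = i then 1 else 0)"
      define v :: "'k mat" where "v = mat c 1 (\<lambda>(k, _). if k = j then 1 else 0)"
      have uv [simp]: "u \<in> carrier_mat 1 a" "v \<in> carrier_mat c 1" by (auto simp: u_def v_def)
      have d [simp]: "dim_row u = 1" "dim_col u = a" "dim_row v = c" "dim_col v = 1" "dim_row T = a" "dim_col T = c"
        using T by (auto simp: u_def v_def)
      have t0: "t \<noteq> 0" using ij by (simp add: t_def)
      have u_index: "(u * M) $$ (0, k) = M $$ (i, k)" if "dim_row M = a" "k < dim_col M" for M :: "'k mat" and k
        using that ij by (simp add: u_def if_distrib[of "\<lambda>x. x * _"] cong: if_cong)
      have v_index: "(M * v) $$ (k, 0) = M $$ (k, j)" if "dim_col M = c" "k < dim_row M" for M :: "'k mat" and k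
        using that ij by (simp add: v_def if_distrib[of "\<lambda>x. _ * x"] cong: if_cong)
      have uTv0: "(u * (T * v)) $$ (0, 0) = t"
        using u_index[of "T * v" 0] v_index[of T i] ij by (simp del: index_mult_sum add: t_def)
      have "u * (T * v) \<in> carrier_mat 1 1" using uv T by (intro mult_carrier_mat)
      note uTv = mat_one_index[OF this, unfolded uTv0]
      define T' where "T' = T - inverse t \<cdot>\<^sub>m (T * v * (u * T))"
      have T': "T' \<in> carrier_mat a c" unfolding T'_def by (intro carrier_matI) simp_all
      then have d' [simp]: "dim_row T' = a" "dim_col T' = c" by auto
      have T'_index: "T' $$ (k, l) = T $$ (k, l) - inverse t * (T $$ (k, j) * T $$ (i, l))"
        if "k < a" "l < c" for k l
      proof -
        have "(T * v * (u * T)) $$ (k, l) = (T * v) $$ (k, 0) * (u * T) $$ (0, l)"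
          using that by (subst index_mult_sum) (simp_all del: index_mult_sum)
        then show ?thesis using that by (simp add: T'_def v_index u_index del: index_mult_sum)
      qed
      have "{k. k < a \<and> (\<exists>l<c. T' $$ (k, l) \<noteq> 0)} \<subset> {k. k < a \<and> (\<exists>l<c. T $$ (k, l) \<noteq> 0)}"
      proof (intro psubsetI)
        show "{k. k < a \<and> (\<exists>l<c. T' $$ (k, l) \<noteq> 0)} \<subseteq> {k. k < a \<and> (\<exists>l<c. T $$ (k, l) \<noteq> 0)}"
          using ij(2) by (auto simp: T'_index) (metis mult_zero_left mult_zero_right)
        have "T' $$ (i, l) = 0" if "l < c" for l
          using that ij t0 by (simp add: T'_index) (simp add: t_def)
        then show "{k. k < a \<and> (\<exists>l<c. T' $$ (k, l) \<noteq> 0)} \<noteq> {k. k < a \<and> (\<exists>l<c. T $$ (k, l) \<noteq> 0)}"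
          using ij by auto
      qed
      then have "card {k. k < a \<and> (\<exists>l<c. T' $$ (k, l) \<noteq> 0)} < card {k. k < a \<and> (\<exists>l<c. T $$ (k, l) \<noteq> 0)}"
        by (intro psubset_card_mono) auto
      from less.hyps[OF this T'] obtain r A B L S where IH: "A \<in> carrier_mat a r" "B \<in> carrier_mat r c"
        "L \<in> carrier_mat r a" "S \<in> carrier_mat c r" "T' = A * B" "L * A = 1\<^sub>m r" "B * S = 1\<^sub>m r" by auto
      have dd [simp]: "dim_row A = a" "dim_col A = r" "dim_row B = r" "dim_col B = c" "dim_row L = r" "dim_col L = a"
         "dim_row S = c" "dim_col S = r" using IH by auto
      define w where "w = T * v"
      define z where "z = inverse t \<cdot>\<^sub>m (u * T)"
      have dw [simp]: "dim_row w = a" "dim_col w = 1" "dim_row z = 1" "dim_col z = c" by (auto simp: w_def z_def)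
      have uw: "u * w = t \<cdot>\<^sub>m 1\<^sub>m 1" and zv: "z * v = 1\<^sub>m 1"
        using uTv t0 by (auto simp: w_def z_def mat_assoc)
      have "u * T' = 0\<^sub>m 1 c"
      proof -
        have "u * T' = u * T - inverse t \<cdot>\<^sub>m (u * (T * v) * (u * T))"
          unfolding T'_def by (simp add: mat_right_diff_distrib mat_assoc)
        also have "\<dots> = u * T - u * T" unfolding uTv using t0 by simp
        also have "\<dots> = 0\<^sub>m 1 c" by (intro eq_matI) auto
        finally show ?thesis .
      qed
      then have uA: "u * A = 0\<^sub>m 1 r"
        unfolding IH(5) by (rule mat_factor_zero[OF IH(1,2,4,7) uv(1)])
      have "T' * v = 0\<^sub>m a 1"
      proof -
        have "T' * v = T * v - inverse t \<cdot>\<^sub>m (T * v * (u * (T * v)))"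
          unfolding T'_def by (simp add: mat_left_diff_distrib mat_assoc)
        also have "\<dots> = T * v - T * v" unfolding uTv using t0 by simp
        also have "\<dots> = 0\<^sub>m a 1" by (intro eq_matI) auto
        finally show ?thesis .
      qed
      then have Bv: "B * v = 0\<^sub>m r 1"
        unfolding IH(5) by (rule mat_factor_zero'[OF IH(1,2,3,6) uv(2)])
      have T_eq: "T = A * B + w * z"
        unfolding IH(5)[symmetric] T'_def w_def z_def using T
        by (intro eq_matI) (auto simp del: index_mult_sum)
      let ?A = "A * pr1 r 1 + w * pr2 r 1" and ?B = "in1 r 1 * B + in2 r 1 * z"
      \<comment> \<open>As \<open>u * A = 0\<close> and \<open>B * v = 0\<close>, only the mixed
        products \<open>L * w\<close> and \<open>z * S\<close> stand in the way of one-sided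
        inverses; the subtracted terms remove them.\<close>
      let ?L = "in1 r 1 * (L - inverse t \<cdot>\<^sub>m (L * w * u)) + in2 r 1 * (inverse t \<cdot>\<^sub>m u)"
        and ?S = "(S - v * (z * S)) * pr1 r 1 + v * pr2 r 1"
      note distr = mat_left_distrib mat_right_distrib mat_left_diff_distrib mat_right_diff_distrib mat_assoc
      note pulls = IH(6,7) uA Bv uw zv mat_pull[OF IH(6)] mat_pull[OF IH(7)] mat_pull[OF uA]
        mat_pull[OF Bv] mat_pull[OF uw] mat_pull[OF zv]
      have 1: "?A * ?B = T" unfolding T_eq by (simp add: distr)
      have 2: "?L * ?A = 1\<^sub>m (r + 1)"
        using t0 biprod_sum[of r 1, where ?'a = 'k] by (simp add: distr pulls)
      have 3: "?B * ?S = 1\<^sub>m (r + 1)"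
        using t0 biprod_sum[of r 1, where ?'a = 'k] by (simp add: distr pulls)
      show ?thesis
        by (rule exI[of _ "r + 1"], rule exI[of _ ?A], rule exI[of _ ?B], rule exI[of _ ?L], rule exI[of _ ?S])
          (use 1 2 3 in \<open>auto intro!: carrier_matI\<close>)
    qed
  qed
  then show ?thesis using that by blast
qed

lemma gen_inverse_exists:
  fixes T :: "'k::field mat"
  assumes "T \<in> carrier_mat a c"
  obtains Q where "Q \<in> carrier_mat c a" "T * Q * T = T"
proof -
  obtain r A B L S where *: "A \<in> carrier_mat a r" "B \<in> carrier_mat r c" "L \<in> carrier_mat r a"
    "S \<in> carrier_mat c r" "T = A * B" "L * A = 1\<^sub>m r" "B * S = 1\<^sub>m r"
    using rank_factorisation[OF assms] .
  then have "T * (S * L) * T = T"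
    by (simp add: mat_assoc mat_pull[OF *(6)] mat_pull[OF *(7)])
  then show ?thesis using that[of "S * L"] * by auto
qed

text \<open>Cancelling the one-sided inverses \<open>L\<close> and \<open>S\<close> around
  \<open>E * E = E\<close> shows that a rank factorisation of an idempotent is already a
  splitting.\<close>

lemma idempotent_factorisation:
  fixes E :: "'k::field mat"
  assumes "E \<in> carrier_mat d d" "E * E = E"
  obtains r A B where "A \<in> carrier_mat d r" "B \<in> carrier_mat r d" "E = A * B" "B * A = 1\<^sub>m r"
proof -
  obtain r A B L S where *: "A \<in> carrier_mat d r" "B \<in> carrier_mat r d" "L \<in> carrier_mat r d"
    "S \<in> carrier_mat d r" "E = A * B" "L * A = 1\<^sub>m r" "B * S = 1\<^sub>m r"
    using rank_factorisation[OF assms(1)] .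
  have "B * A = (L * A) * (B * A) * (B * S)" unfolding *(6,7) using * by simp
  also have "\<dots> = L * (E * E) * S" unfolding *(5) using *(1-4) by (simp add: mat_assoc)
  also have "\<dots> = L * E * S" unfolding assms(2) ..
  also have "\<dots> = (L * A) * (B * S)" unfolding *(5) using *(1-4) by (simp add: mat_assoc)
  also have "\<dots> = 1\<^sub>m r" unfolding *(6,7) by simp
  finally show ?thesis using that * by blast
qed

text \<open>In characteristic 0 the trace of a split idempotent determines its rank, so trace zero
  leaves no image.\<close>

lemma idempotent_trace:
  fixes E :: "'k::field_char_0 mat"
  assumes "E \<in> carrier_mat d d" "E * E = E" "mtr E = 0"
  shows "E = 0\<^sub>m d d"
proof -
  obtain r A B where *: "A \<in> carrier_mat d r" "B \<in> carrier_mat r d" "E = A * B" "B * A = 1\<^sub>m r"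
    using idempotent_factorisation[OF assms(1,2)] .
  then have "of_nat r = (0::'k)" using assms(3) mtr_comm[of A B] by simp
  then have "r = 0" by simp
  then show ?thesis using * by (intro eq_matI) auto
qed

text \<open>Given inclusions \<open>J1\<close>, \<open>J2\<close> whose images together span, dimensions force a direct sum.\<close>

lemma direct_sum_iso:
  fixes J1 J2 :: "'k::field mat"
  assumes c: "J1 \<in> carrier_mat d d1" "J2 \<in> carrier_mat d d2" "K1 \<in> carrier_mat d1 d" "K2 \<in> carrier_mat d2 d"
    and s: "J1 * K1 + J2 * K2 = 1\<^sub>m d" and d: "d = d1 + d2"
  obtains P P' where "P \<in> carrier_mat d d" "P' \<in> carrier_mat d d" "P * P' = 1\<^sub>m d" "P' * P = 1\<^sub>m d"
    "\<And>T T1 T2. T \<in> carrier_mat d d \<Longrightarrow> T1 \<in> carrier_mat d1 d1 \<Longrightarrow> T2 \<in> carrier_mat d2 d2 \<Longrightarrow>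
      T * J1 = J1 * T1 \<Longrightarrow> T * J2 = J2 * T2 \<Longrightarrow>
      P * T = four_block_mat T1 (0\<^sub>m d1 d2) (0\<^sub>m d2 d1) T2 * P"
proof -
  let ?P = "in1 d1 d2 * K1 + in2 d1 d2 * K2" and ?P' = "J1 * pr1 d1 d2 + J2 * pr2 d1 d2"
  note distr = mat_left_distrib mat_right_distrib mat_assoc
  have dims [simp]: "dim_row J1 = d" "dim_col J1 = d1" "dim_row J2 = d" "dim_col J2 = d2"
    "dim_row K1 = d1" "dim_col K1 = d" "dim_row K2 = d2" "dim_col K2 = d" using c by auto
  have P: "?P \<in> carrier_mat d d" "?P' \<in> carrier_mat d d" by (auto intro!: carrier_matI simp: d)
  have 1: "?P' * ?P = 1\<^sub>m d" using s by (simp add: distr)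
  have 2: "?P * ?P' = 1\<^sub>m d" using mat_mult_left_right_inverse[OF P(2,1) 1] .
  have "?P * T = four_block_mat T1 (0\<^sub>m d1 d2) (0\<^sub>m d2 d1) T2 * ?P"
    if T: "T \<in> carrier_mat d d" "T1 \<in> carrier_mat d1 d1" "T2 \<in> carrier_mat d2 d2"
      and eq: "T * J1 = J1 * T1" "T * J2 = J2 * T2" for T T1 T2
  proof -
    let ?D = "four_block_mat T1 (0\<^sub>m d1 d2) (0\<^sub>m d2 d1) T2"
    have [simp]: "dim_row T = d" "dim_col T = d" "dim_row T1 = d1" "dim_col T1 = d1" "dim_row T2 = d2" "dim_col T2 = d2"
      using T by auto
    have D: "?D = in1 d1 d2 * (T1 * pr1 d1 d2) + in2 d1 d2 * (T2 * pr2 d1 d2)"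
      using T(2,3) by (rule four_block_biprod)
    have D': "?D \<in> carrier_mat d d" using T d by auto
    have *: "T * ?P' = ?P' * ?D"
      unfolding D by (simp add: distr eq mat_pull[OF eq(1)] mat_pull[OF eq(2)])
    have "?P * T = ?P * (T * (?P' * ?P))" unfolding 1 by simp
    also have "\<dots> = ?P * (T * ?P' * ?P)" using P T by (simp add: mat_assoc)
    also have "\<dots> = (?P * ?P') * (?D * ?P)" unfolding * using P D' by (simp add: mat_assoc)
    also have "\<dots> = ?D * ?P" unfolding 2 by (rule left_mult_one_mat[OF mult_carrier_mat[OF D' P(1)]])
    finally show ?thesis .
  qed
  then show ?thesis using that[OF P 2 1] by blast
qed

text \<open>The image of an idempotent that commutes with \<open>T\<close> is invariant, and
  \<open>B * T * A\<close> is the action of \<open>T\<close> on it; this is how actions pass to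
  direct summands.\<close>

lemma idempotent_restrict:
  fixes A B T :: "'k::field mat"
  assumes "A \<in> carrier_mat d r" "B \<in> carrier_mat r d" "T \<in> carrier_mat d d" "B * A = 1\<^sub>m r"
    and "T * (A * B) = (A * B) * T"
  shows "T * A = A * (B * T * A)" "B * T = (B * T * A) * B"
proof -
  have "T * A = T * (A * (B * A))" unfolding assms(4) using assms(1) by simp
  also have "\<dots> = T * (A * B) * A" using assms(1-3) by (simp add: mat_assoc)
  also have "\<dots> = A * (B * T * A)" unfolding assms(5) using assms(1-3) by (simp add: mat_assoc)
  finally show "T * A = A * (B * T * A)" .
  have "B * T = (B * A) * B * T" unfolding assms(4) using assms(2,3) by simp
  also have "\<dots> = B * ((A * B) * T)" using assms(1-3) by (simp add: mat_assoc)
  also have "\<dots> = (B * T * A) * B" unfolding assms(5)[symmetric] using assms(1-3) by (simp add: mat_assoc)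
  finally show "B * T = (B * T * A) * B" .
qed


subsection \<open>The binomial theorem at a root of unity\<close>

text \<open>The Gaussian binomial coefficient. The recursion makes sense at a root of unity, where
  the quotient of q-factorials may become 0/0.\<close>

fun qbin :: "'k::field \<Rightarrow> nat \<Rightarrow> nat \<Rightarrow> 'k" where
  "qbin q m 0 = 1"
| "qbin q 0 (Suc k) = 0"
| "qbin q (Suc m) (Suc k) = qbin q m (Suc k) + q ^ (m - k) * qbin q m k"

lemma qbin_zero: "m < k \<Longrightarrow> qbin q m k = 0"
  by (induction q m k rule: qbin.induct) auto

lemma qbin_self: "qbin q m m = 1"
  by (induction m) (auto simp: qbin_zero)

text \<open>The ratio of neighbouring Gaussian coefficients, in a form without division that holds
  for every \<open>q\<close>.\<close>

lemma qbin_ratio: "k \<le> m \<Longrightarrow> (1 - q ^ Suc k) * qbin q m (Suc k) = (1 - q ^ (m - k)) * qbin q m k"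
proof (induction q m k rule: qbin.induct)
  case (1 q m)
  then show ?case
  proof (induction m)
    case (Suc m)
    have "(1 - q ^ Suc 0) * qbin q (Suc m) (Suc 0) = (1 - q ^ Suc 0) * qbin q m (Suc 0) + (1 - q) * q ^ m"
      by (simp add: algebra_simps)
    with Suc show ?case by (simp add: algebra_simps)
  qed simp
next
  case (3 q m k)
  show ?case
  proof (cases "Suc k \<le> m")
    case True
    define e where "e = m - Suc k"
    have m: "m = Suc k + e" using True by (simp add: e_def)
    have IH: "(1 - q ^ Suc (Suc k)) * qbin q m (Suc (Suc k)) = (1 - q ^ e) * qbin q m (Suc k)"
      "(1 - q ^ Suc k) * qbin q m (Suc k) = (1 - q ^ Suc e) * qbin q m k"
      using 3 True by (simp_all add: m)
    have "(1 - q ^ Suc (Suc k)) * qbin q (Suc m) (Suc (Suc k)) =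
        (1 - q ^ Suc (Suc k)) * qbin q m (Suc (Suc k)) + q ^ e * ((1 - q ^ Suc (Suc k)) * qbin q m (Suc k))"
      by (simp add: e_def algebra_simps)
    also have "\<dots> = (1 - q ^ Suc m) * qbin q m (Suc k)"
      unfolding IH by (simp add: m algebra_simps power_add)
    also have "\<dots> = (1 - q ^ Suc e) * qbin q m (Suc k) + q ^ Suc e * ((1 - q ^ Suc k) * qbin q m (Suc k))"
      by (simp add: m algebra_simps power_add)
    also have "\<dots> = (1 - q ^ (Suc m - Suc k)) * qbin q (Suc m) (Suc k)"
      unfolding IH by (simp add: m algebra_simps)
    finally show ?thesis .
  next
    case False
    then have "m = k \<or> m < k" by auto
    then show ?thesis using 3(3) by (auto simp: qbin_zero qbin_self)
  qed
qed auto

text \<open>In \<open>qbin_ratio\<close> the factor \<open>1 - q ^ n\<close> vanishes at the start,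
  and the zero is passed on because \<open>1 - q ^ Suc k\<close> is invertible as long as
  \<open>Suc k < n\<close>.\<close>

lemma qbin_root_of_unity:
  assumes "\<And>m. q ^ m = 1 \<longleftrightarrow> n dvd m" "0 < k" "k < n"
  shows "qbin q n k = (0::'k::field)"
  using assms(2,3)
proof (induction k)
  case (Suc k)
  have "(1 - q ^ Suc k) * qbin q n (Suc k) = (1 - q ^ (n - k)) * qbin q n k"
    using Suc by (intro qbin_ratio) auto
  also have "\<dots> = 0" using Suc assms(1)[of n] by (cases k) auto
  finally show ?case using assms(1)[of "Suc k"] Suc by (auto dest: dvd_imp_le)
qed simp

lemma q_binomial:
  fixes B C :: "'k::field mat"
  assumes B: "B \<in> carrier_mat d d" and C: "C \<in> carrier_mat d d" and CB: "C * B = q \<cdot>\<^sub>m (B * C)"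
  shows "(B + C) ^\<^sub>m m = gsum d d (\<lambda>k. qbin q m k \<cdot>\<^sub>m (B ^\<^sub>m (m - k) * C ^\<^sub>m k)) {..<Suc m}"
proof (induction m)
  case 0
  show ?case using B C by (subst gsum_lessThan_Suc) auto
next
  case (Suc m)
  have [simp]: "dim_row B = d" "dim_col B = d" "dim_row C = d" "dim_col C = d" using B C by auto
  have CBk: "C * B ^\<^sub>m j = q ^ j \<cdot>\<^sub>m (B ^\<^sub>m j * C)" for j
    using pow_mat_intertwine[OF B B C CB] .
  let ?t = "\<lambda>m k. B ^\<^sub>m (m - k) * C ^\<^sub>m k"
  have t: "?t m k \<in> carrier_mat d d" for m k by (intro carrier_matI) auto
  have "(B + C) ^\<^sub>m Suc m = (B + C) * gsum d d (\<lambda>k. qbin q m k \<cdot>\<^sub>m ?t m k) {..<Suc m}"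
    unfolding Suc[symmetric] by (rule pow_mat_Suc2) simp
  also have "\<dots> = gsum d d (\<lambda>k. B * (qbin q m k \<cdot>\<^sub>m ?t m k)) {..<Suc m} + gsum d d (\<lambda>k. C * (qbin q m k \<cdot>\<^sub>m ?t m k)) {..<Suc m}"
    using t by (subst mat_left_distrib) (simp_all add: gsum_mult_left[where r = d and c = d] del: smult_mat_mult)
  also have "gsum d d (\<lambda>k. B * (qbin q m k \<cdot>\<^sub>m ?t m k)) {..<Suc m} =
      gsum d d (\<lambda>k. qbin q m k \<cdot>\<^sub>m ?t (Suc m) k) {..<Suc m}"
    by (intro gsum_cong) (simp add: Suc_diff_le pow_mat_Suc2 mat_assoc del: pow_mat.simps)
  \<comment> \<open>The added term \<open>k = Suc m\<close> has coefficient 0; with it the first sum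
    can be shifted so that the recursion of \<open>qbin\<close> applies term by term.\<close>
  also have "\<dots> = gsum d d (\<lambda>k. qbin q m k \<cdot>\<^sub>m ?t (Suc m) k) {..<Suc (Suc m)}"
    using t by (subst (2) gsum_lessThan_Suc) (auto simp: qbin_zero)
  also have "\<dots> = ?t (Suc m) 0 + gsum d d (\<lambda>k. qbin q m (Suc k) \<cdot>\<^sub>m ?t (Suc m) (Suc k)) {..<Suc m}"
    by (subst gsum_lessThan_Suc_shift) (auto intro!: carrier_matI)
  also have "gsum d d (\<lambda>k. C * (qbin q m k \<cdot>\<^sub>m ?t m k)) {..<Suc m} =
      gsum d d (\<lambda>k. (q ^ (m - k) * qbin q m k) \<cdot>\<^sub>m ?t (Suc m) (Suc k)) {..<Suc m}"
  proof (intro gsum_cong)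
    fix k
    have "C * ?t m k = (C * B ^\<^sub>m (m - k)) * C ^\<^sub>m k" by (simp add: mat_assoc)
    also have "\<dots> = q ^ (m - k) \<cdot>\<^sub>m ?t (Suc m) (Suc k)"
      unfolding CBk by (simp add: mat_assoc flip: pow_mat_Suc2)
    finally show "C * (qbin q m k \<cdot>\<^sub>m ?t m k) = (q ^ (m - k) * qbin q m k) \<cdot>\<^sub>m ?t (Suc m) (Suc k)"
      by (simp add: mult.commute)
  qed
  also have "?t (Suc m) 0 + gsum d d (\<lambda>k. qbin q m (Suc k) \<cdot>\<^sub>m ?t (Suc m) (Suc k)) {..<Suc m} +
      gsum d d (\<lambda>k. (q ^ (m - k) * qbin q m k) \<cdot>\<^sub>m ?t (Suc m) (Suc k)) {..<Suc m} =
      ?t (Suc m) 0 + gsum d d (\<lambda>k. qbin q (Suc m) (Suc k) \<cdot>\<^sub>m ?t (Suc m) (Suc k)) {..<Suc m}"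
    by (intro eq_matI) (simp_all add: algebra_simps sum.distrib del: index_mult_sum pow_mat.simps)
  also have "\<dots> = gsum d d (\<lambda>k. qbin q (Suc m) k \<cdot>\<^sub>m ?t (Suc m) k) {..<Suc (Suc m)}"
    by (subst gsum_lessThan_Suc_shift) (auto intro!: carrier_matI)
  finally show ?case .
qed

text \<open>This is what makes the comultiplication compatible with the relation for
  \<open>y^n\<close>: the two summands of \<open>\<Delta>(y)\<close> commute up to the factor
  \<open>\<chi> g\<close>.\<close>

lemma q_binomial_root_of_unity:
  fixes B C :: "'k::field mat"
  assumes "B \<in> carrier_mat d d" "C \<in> carrier_mat d d" "C * B = q \<cdot>\<^sub>m (B * C)"
    and "\<And>m. q ^ m = 1 \<longleftrightarrow> n dvd m" "0 < n"
  shows "(B + C) ^\<^sub>m n = B ^\<^sub>m n + C ^\<^sub>m n"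
proof -
  have dims: "dim_row B = d" "dim_col B = d" "dim_row C = d" "dim_col C = d" using assms by auto
  let ?t = "\<lambda>k. qbin q n k \<cdot>\<^sub>m (B ^\<^sub>m (n - k) * C ^\<^sub>m k)"
  have t: "?t k \<in> carrier_mat d d" for k using dims by (intro carrier_matI) auto
  have "gsum d d ?t {..<Suc n} = gsum d d ?t {..<n} + ?t n" using t by (rule gsum_lessThan_Suc)
  also have "gsum d d ?t {..<n} = gsum d d (\<lambda>k. if k = 0 then B ^\<^sub>m n else 0\<^sub>m d d) {..<n}"
    using qbin_root_of_unity[OF assms(4)] dims by (intro gsum_cong) auto
  also have "\<dots> = B ^\<^sub>m n"
    using assms(5) dims by (intro eq_matI) (auto simp: if_distrib[of "\<lambda>x. x $$ _"] cong: if_cong)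
  finally show ?thesis using q_binomial[OF assms(1-3), of n] dims by (simp add: qbin_self)
qed

lemma smult_diff_mat:
  "dim_row A = dim_row B \<Longrightarrow> dim_col A = dim_col B \<Longrightarrow>
    c \<cdot>\<^sub>m (A - B) = c \<cdot>\<^sub>m A - (c :: 'k::field) \<cdot>\<^sub>m B"
  by (intro eq_matI) (auto simp: algebra_simps)

subsection \<open>Evaluating formal linear combinations in a matrix algebra\<close>

definition evm :: "nat \<Rightarrow> ('b \<Rightarrow> 'k::field mat) \<Rightarrow> ('b \<Rightarrow>\<^sub>0 'k) \<Rightarrow> 'k mat"
  where "evm d m x = mat d d (\<lambda>ij. \<Sum>b\<in>Poly_Mapping.keys x. Poly_Mapping.lookup x b * m b $$ ij)"

lemma evm_dims [simp]: "dim_row (evm d m x) = d" "dim_col (evm d m x) = d"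
  by (simp_all add: evm_def)

lemma evm_carrier [simp]: "evm d m x \<in> carrier_mat d d"
  by (simp add: evm_def)

lemma index_evm:
  "i < d \<Longrightarrow> j < d \<Longrightarrow>
    evm d m x $$ (i, j) = (\<Sum>b\<in>Poly_Mapping.keys x. Poly_Mapping.lookup x b * m b $$ (i, j))"
  by (simp add: evm_def)

lemma index_evm_superset:
  assumes "i < d" "j < d" "finite S" "Poly_Mapping.keys x \<subseteq> S"
  shows "evm d m x $$ (i, j) = (\<Sum>b\<in>S. Poly_Mapping.lookup x b * m b $$ (i, j))"
  unfolding index_evm[OF assms(1,2)] using assms
  by (intro sum.mono_neutral_left) (auto simp: in_keys_iff)

lemma evm_bas [simp]: "m b \<in> carrier_mat d d \<Longrightarrow> evm d m (bas b) = m b"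
  by (intro eq_matI) (auto simp: index_evm)

lemma evm_zero [simp]: "evm d m 0 = 0\<^sub>m d d"
  by (intro eq_matI) (auto simp: index_evm)

lemma evm_add: "evm d m (x + y) = evm d m x + evm d m y"
proof (intro eq_matI, goal_cases)
  case (1 i j)
  let ?S = "Poly_Mapping.keys x \<union> Poly_Mapping.keys y"
  have "Poly_Mapping.keys (x + y) \<subseteq> ?S" by (rule Poly_Mapping.keys_add)
  with 1 show ?case
    by (simp add: index_evm_superset[of _ _ _ ?S] lookup_add algebra_simps sum.distrib)
qed auto

lemma evm_scale: "evm d m (scale c x) = c \<cdot>\<^sub>m evm d m x"
proof (intro eq_matI, goal_cases)
  case (1 i j)
  then show ?case
    using index_evm_superset[OF _ _ finite_keys keys_scale, of i d j m c x]
    by (simp add: index_evm lookup_scale sum_distrib_left mult.assoc)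
qed auto

lemma evm_diff: "evm d m (x - y) = evm d m x - evm d m y"
proof -
  have "evm d m x = evm d m (x - y) + evm d m y" by (simp flip: evm_add)
  then show ?thesis by simp
qed

lemma evm_sum: "evm d m (sum f S) = gsum d d (\<lambda>s. evm d m (f s)) S"
proof (induction S rule: infinite_finite_induct)
  case (infinite A)
  then show ?case by (intro eq_matI) auto
qed (auto simp: gsum_insert evm_add)

lemma evm_lin_ext: "evm d m (lin_ext f x) = evm d (\<lambda>a. evm d m (f a)) x"
  unfolding lin_ext_def evm_sum evm_scale by (intro eq_matI) (auto simp: index_evm)

lemma evm_cong: "(\<And>b. b \<in> Poly_Mapping.keys x \<Longrightarrow> m b = m' b) \<Longrightarrow> evm d m x = evm d m' x"
  by (simp add: evm_def)

lemma evm_eq_gsum: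
  assumes "\<And>b. b \<in> Poly_Mapping.keys x \<Longrightarrow> m b \<in> carrier_mat d d"
  shows "evm d m x = gsum d d (\<lambda>b. Poly_Mapping.lookup x b \<cdot>\<^sub>m m b) (Poly_Mapping.keys x)"
proof (intro eq_matI, goal_cases)
  case (1 i j)
  have "dim_row (m b) = d" "dim_col (m b) = d" if "b \<in> Poly_Mapping.keys x" for b
    using assms[OF that] by auto
  with 1 show ?case by (simp add: index_evm)
qed auto

lemma gsum_cong_simp:
  "r = r' \<Longrightarrow> c = c' \<Longrightarrow> S = S' \<Longrightarrow> (\<And>s. s \<in> S' \<Longrightarrow> f s = f' s) \<Longrightarrow> gsum r c f S = gsum r' c' f' S'"
  by (auto intro: gsum_cong)

lemma evm_mult_right:
  assumes m: "\<And>b. b \<in> Poly_Mapping.keys x \<Longrightarrow> m b \<in> carrier_mat d d" and B: "B \<in> carrier_mat d d"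
  shows "evm d m x * B = evm d (\<lambda>b. m b * B) x"
  using carrier_matD[OF B] mult_carrier_mat[OF m B] mult_smult_assoc_mat[OF m B]
  by (simp add: evm_eq_gsum m gsum_mult_right[where r = d and c = d] cong: gsum_cong_simp)

lemma evm_mult_left:
  assumes m: "\<And>b. b \<in> Poly_Mapping.keys x \<Longrightarrow> m b \<in> carrier_mat d d" and B: "B \<in> carrier_mat d d"
  shows "B * evm d m x = evm d (\<lambda>b. B * m b) x"
  using carrier_matD[OF B] mult_carrier_mat[OF B m] mult_smult_distrib[OF B m]
  by (simp add: evm_eq_gsum m gsum_mult_left[where r = d and c = d] cong: gsum_cong_simp)

lemma evm_mult:
  assumes "\<And>b. b \<in> Poly_Mapping.keys x \<Longrightarrow> m b \<in> carrier_mat d d"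
    "\<And>b. b \<in> Poly_Mapping.keys y \<Longrightarrow> m' b \<in> carrier_mat d d"
  shows "evm d m x * evm d m' y = evm d (\<lambda>a. evm d (\<lambda>b. m a * m' b) y) x"
  using assms by (subst evm_mult_right) (auto intro!: evm_cong evm_mult_left)

lemma evm_kron:
  assumes "\<And>b. b \<in> Poly_Mapping.keys x \<Longrightarrow> m b \<in> carrier_mat d d"
    "\<And>b. b \<in> Poly_Mapping.keys y \<Longrightarrow> m' b \<in> carrier_mat e e"
  shows "kronecker (evm d m x) (evm e m' y) =
    evm (d * e) (\<lambda>a. evm (d * e) (\<lambda>b. kronecker (m a) (m' b)) y) x"
proof (intro eq_matI, goal_cases)
  case (1 i j)
  have [simp]: "dim_row (m b) = d" "dim_col (m b) = d" if "b \<in> Poly_Mapping.keys x" for b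
    using assms(1)[OF that] by auto
  have [simp]: "dim_row (m' b) = e" "dim_col (m' b) = e" if "b \<in> Poly_Mapping.keys y" for b
    using assms(2)[OF that] by auto
  from 1 have "i mod e < e" "j mod e < e" by (auto intro: div_mod_bounds)
  with 1 show ?case
    by (simp add: index_kron index_evm div_mod_bounds sum_product sum_distrib_left mult_ac)
      (rule sum.swap)
qed auto

subsection \<open>Modules over the Hopf algebra\<close>

definition gmod :: "('a, 'm) monoid_scheme \<Rightarrow> nat \<Rightarrow> ('a \<Rightarrow> 'k::field mat) \<Rightarrow> bool"
  where "gmod G d X \<longleftrightarrow> (\<forall>h\<in>carrier G. X h \<in> carrier_mat d d) \<and> X \<one>\<^bsub>G\<^esub> = 1\<^sub>m d \<and>
    (\<forall>h\<in>carrier G. \<forall>k\<in>carrier G. X (h \<otimes>\<^bsub>G\<^esub> k) = X h * X k)"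

text \<open>A triple \<open>(d, X, Y)\<close> stands for the module of dimension \<open>d\<close> on which \<open>h \<in> G\<close> acts by \<open>X h\<close> and
  \<open>y\<close> by \<open>Y\<close>.\<close>

type_synonym ('a, 'k) hmod = "nat \<times> ('a \<Rightarrow> 'k mat) \<times> 'k mat"

locale green_datum = non_nilpotent_datum G \<chi> g n
  for G (structure) and \<chi> :: "'a \<Rightarrow> 'k::{alg_closed_field, field_char_0}" and g :: 'a and n :: nat
begin

abbreviation "H \<equiv> hopf G \<chi> g n"

definition hmods :: "('a, 'k) hmod set"
  where "hmods = {(d, X, Y). gmod G d X \<and> Y \<in> carrier_mat d d \<and>
    (\<forall>h\<in>carrier G. Y * X h = \<chi> h \<cdot>\<^sub>m (X h * Y)) \<and> Y ^\<^sub>m n = X (g [^] n) - 1\<^sub>m d}"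

fun rep_of :: "('a, 'k) hmod \<Rightarrow> (nat \<times> 'a, 'k) rep"
  where "rep_of (d, X, Y) = (d, evm d (\<lambda>(i, h). Y ^\<^sub>m i * X h))"

fun hiso :: "('a, 'k) hmod \<Rightarrow> ('a, 'k) hmod \<Rightarrow> bool"
  where "hiso (d, X, Y) (e, X', Y') \<longleftrightarrow> d = e \<and> (\<exists>P\<in>carrier_mat d d. \<exists>Q\<in>carrier_mat d d.
    P * Q = 1\<^sub>m d \<and> Q * P = 1\<^sub>m d \<and> (\<forall>h\<in>carrier G. P * X h = X' h * P) \<and> P * Y = Y' * P)"

fun hsum :: "('a, 'k) hmod \<Rightarrow> ('a, 'k) hmod \<Rightarrow> ('a, 'k) hmod"
  where "hsum (d, X, Y) (e, X', Y') = (d + e,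
    (\<lambda>h. four_block_mat (X h) (0\<^sub>m d e) (0\<^sub>m e d) (X' h)), four_block_mat Y (0\<^sub>m d e) (0\<^sub>m e d) Y')"

fun htens :: "('a, 'k) hmod \<Rightarrow> ('a, 'k) hmod \<Rightarrow> ('a, 'k) hmod"
  where "htens (d, X, Y) (e, X', Y') = (d * e, (\<lambda>h. kronecker (X h) (X' h)),
    kronecker Y (X' g) + kronecker (1\<^sub>m d) Y')"

definition htriv :: "('a, 'k) hmod"
  where "htriv = (1, (\<lambda>_. 1\<^sub>m 1), 0\<^sub>m 1 1)"

lemma gmodD:
  assumes "gmod G d X"
  shows "h \<in> carrier G \<Longrightarrow> X h \<in> carrier_mat d d" "X \<one> = 1\<^sub>m d"
    "h \<in> carrier G \<Longrightarrow> k \<in> carrier G \<Longrightarrow> X (h \<otimes> k) = X h * X k"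
    "h \<in> carrier G \<Longrightarrow> dim_row (X h) = d" "h \<in> carrier G \<Longrightarrow> dim_col (X h) = d"
    "h \<in> carrier G \<Longrightarrow> X (inv h) * X h = 1\<^sub>m d" "h \<in> carrier G \<Longrightarrow> X h * X (inv h) = 1\<^sub>m d"
    "X (g [^] (i::nat)) = X g ^\<^sub>m i"
proof -
  note * = assms[unfolded gmod_def]
  show 1: "h \<in> carrier G \<Longrightarrow> X h \<in> carrier_mat d d" and 2: "X \<one> = 1\<^sub>m d"
    and 3: "h \<in> carrier G \<Longrightarrow> k \<in> carrier G \<Longrightarrow> X (h \<otimes> k) = X h * X k" for h k
    using * by auto
  show "h \<in> carrier G \<Longrightarrow> dim_row (X h) = d" "h \<in> carrier G \<Longrightarrow> dim_col (X h) = d" using 1[of h] by auto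
  show "h \<in> carrier G \<Longrightarrow> X (inv h) * X h = 1\<^sub>m d" "h \<in> carrier G \<Longrightarrow> X h * X (inv h) = 1\<^sub>m d"
    using 2 3[of h "inv h"] 3[of "inv h" h] by simp_all
  show "X (g [^] i) = X g ^\<^sub>m i"
    using 1[OF g_closed] by (induction i) (auto simp: 2 3 g_closed)
qed

lemma hmodsD:
  assumes "(d, X, Y) \<in> hmods"
  shows "gmod G d X" "Y \<in> carrier_mat d d" "dim_row Y = d" "dim_col Y = d"
    "h \<in> carrier G \<Longrightarrow> Y * X h = \<chi> h \<cdot>\<^sub>m (X h * Y)" "Y ^\<^sub>m n = X (g [^] n) - 1\<^sub>m d"
  using assms by (auto simp: hmods_def)

lemma hmods_commute:
  assumes "(d, X, Y) \<in> hmods" "h \<in> carrier G"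
  shows "X h * Y ^\<^sub>m j = inverse (\<chi> h) ^ j \<cdot>\<^sub>m (Y ^\<^sub>m j * X h)"
proof (rule pow_mat_intertwine)
  note M = hmodsD[OF assms(1)]
  show "X h * Y = inverse (\<chi> h) \<cdot>\<^sub>m (Y * X h)"
    using M(5)[OF assms(2)] \<chi>_nz[OF assms(2)] by simp
qed (use hmodsD[OF assms(1)] gmodD[OF hmodsD(1)[OF assms(1)]] assms(2) in auto)

lemma hopf_carrier: "carrier H = {x. Poly_Mapping.keys x \<subseteq> H_basis G n}"
  by (simp add: hopf_def basis_algebra_def)

text \<open>The structure constants of \<open>H\<close> come from the relations, so matrices
  satisfying the relations multiply like the basis elements; bilinearity does the rest.\<close>

lemma rep_of_mult:
  assumes M: "(d, X, Y) \<in> hmods" and xy: "x \<in> carrier H" "y \<in> carrier H"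
  defines "m \<equiv> \<lambda>(i, h). Y ^\<^sub>m i * X h"
  shows "evm d m (x \<otimes>\<^bsub>H\<^esub> y) = evm d m x * evm d m y"
proof -
  note D = hmodsD[OF M] and GD = gmodD[OF hmodsD(1)[OF M]]
  have m: "m b \<in> carrier_mat d d" if "b \<in> H_basis G n" for b
    using that D GD by (auto simp: m_def H_basis_def intro!: carrier_matI)
  have mm: "m a * m b = evm d m (H_mult G \<chi> g n a b)" if ab: "a \<in> H_basis G n" "b \<in> H_basis G n" for a b
  proof -
    obtain i h j k where eq: "a = (i, h)" "b = (j, k)" by (metis surj_pair)
    have hk: "h \<in> carrier G" "k \<in> carrier G" "i < n" "j < n" using ab by (auto simp: eq H_basis_def)
    have dims: "dim_row Y = d" "dim_col Y = d" "dim_row (X h) = d" "dim_col (X h) = d"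
      "dim_row (X k) = d" "dim_col (X k) = d" using D GD hk by auto
    have "m a * m b = Y ^\<^sub>m i * (X h * Y ^\<^sub>m j) * X k"
      using dims by (simp add: eq m_def mat_assoc)
    also have "\<dots> = inverse (\<chi> h) ^ j \<cdot>\<^sub>m (Y ^\<^sub>m (i + j) * X (h \<otimes> k))"
      unfolding hmods_commute[OF M hk(1)] using dims hk by (simp add: mat_assoc GD(3) pow_mat_add)
    also have "\<dots> = evm d m (H_mult G \<chi> g n a b)"
    proof (cases "i + j < n")
      case True
      then have "m (i + j, h \<otimes> k) \<in> carrier_mat d d" using hk by (intro m) (auto simp: H_basis_def)
      with True show ?thesis by (simp add: eq H_mult_def evm_scale) (simp add: m_def)
    next
      case False
      define l where "l = i + j - n"
      have l: "i + j = l + n" "l < n" using False hk by (auto simp: l_def)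
      have c: "m (l, h \<otimes> k) \<in> carrier_mat d d" "m (l, g [^] n \<otimes> (h \<otimes> k)) \<in> carrier_mat d d"
        using hk l g_closed by (auto intro!: m simp: H_basis_def)
      have "Y ^\<^sub>m (i + j) * X (h \<otimes> k) = Y ^\<^sub>m l * ((X (g [^] n) - 1\<^sub>m d) * X (h \<otimes> k))"
        unfolding l(1) using dims hk D(6) GD(4,5) by (simp add: pow_mat_add mat_assoc)
      also have "\<dots> = m (l, g [^] n \<otimes> (h \<otimes> k)) - m (l, h \<otimes> k)"
        using dims hk g_closed GD(4,5) GD(3)[of "g [^] n" "h \<otimes> k"]
        by (simp add: mat_left_diff_distrib mat_right_diff_distrib m_def)
      finally show ?thesis using False c
        by (simp add: eq H_mult_def evm_scale evm_diff smult_diff_mat flip: l_def)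
    qed
    finally show ?thesis .
  qed
  have keys: "Poly_Mapping.keys x \<subseteq> H_basis G n" "Poly_Mapping.keys y \<subseteq> H_basis G n"
    using xy by (auto simp: hopf_carrier)
  have "evm d m (x \<otimes>\<^bsub>H\<^esub> y) = evm d (\<lambda>a. evm d (\<lambda>b. evm d m (H_mult G \<chi> g n a b)) y) x"
    by (simp add: hopf_def basis_algebra_def bilin_ext_def evm_lin_ext)
  also have "\<dots> = evm d (\<lambda>a. evm d (\<lambda>b. m a * m b) y) x"
    using keys by (intro evm_cong mm[symmetric]) auto
  also have "\<dots> = evm d m x * evm d m y"
    using keys m by (subst evm_mult) auto
  finally show ?thesis .
qed

lemma rep_of_fd_modules: "M \<in> hmods \<Longrightarrow> rep_of M \<in> fd_modules H"
proof (induction M rule: rep_of.induct)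
  case (1 d X Y)
  note GD = gmodD[OF hmodsD(1)[OF 1]] and D = hmodsD[OF 1]
  show ?case unfolding rep_of.simps fd_modules_def mem_Collect_eq prod.case
  proof (intro conjI ballI allI ring_hom_memI, goal_cases)
    case (2 x y)
    then show ?case using rep_of_mult[OF 1] by (simp add: ring_mat_def)
  next
    case (3 x y)
    show ?case by (simp add: hopf_def basis_algebra_def evm_add ring_mat_def)
  next
    case 4
    show ?case using D GD
      by (simp add: hopf_def basis_algebra_def ring_mat_def H_grp_def)
  qed (simp_all add: ring_mat_def evm_scale)
qed

lemma H_grp_carrier: "h \<in> carrier G \<Longrightarrow> H_grp h \<in> carrier H"
  using n_ge_2 by (simp add: hopf_carrier H_grp_def H_basis_def)

lemma H_y_carrier: "H_y G \<in> carrier H"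
  using n_ge_2 by (simp add: hopf_carrier H_y_def H_basis_def)

lemma scale_carrier: "x \<in> carrier H \<Longrightarrow> scale c x \<in> carrier H"
  using keys_scale[of c x] by (auto simp: hopf_carrier)

text \<open>Together with \<open>rep_of_fd_modules\<close> this is the universal property of the
  presentation: a module amounts to an action of \<open>y\<close> and \<open>G\<close> subject to
  the relations.\<close>

lemma rep_of_surj:
  assumes "(d, \<rho>) \<in> fd_modules H"
  defines "X \<equiv> \<lambda>h. \<rho> (H_grp h)" and "Y \<equiv> \<rho> (H_y G)"
  shows "(d, X, Y) \<in> hmods" "\<And>x. x \<in> carrier H \<Longrightarrow> \<rho> x = evm d (\<lambda>(i, h). Y ^\<^sub>m i * X h) x"
proof -
  interpret H: ring H by (rule hopf_ring)
  have hom: "\<rho> \<in> Ring.ring_hom H (ring_mat TYPE('k) d ())"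
    and sc: "\<And>c x. x \<in> carrier H \<Longrightarrow> \<rho> (scale c x) = c \<cdot>\<^sub>m \<rho> x"
    using assms(1) by (auto simp: fd_modules_def)
  have c: "\<rho> x \<in> carrier_mat d d" if "x \<in> carrier H" for x
    using ring_hom_closed[OF hom that] by (simp add: ring_mat_def)
  have m: "\<rho> (x \<otimes>\<^bsub>H\<^esub> y) = \<rho> x * \<rho> y" if "x \<in> carrier H" "y \<in> carrier H" for x y
    using ring_hom_mult[OF hom that] by (simp add: ring_mat_def)
  have a: "\<rho> (x + y) = \<rho> x + \<rho> y" if "x \<in> carrier H" "y \<in> carrier H" for x y
    using ring_hom_add[OF hom that] by (simp add: ring_mat_def hopf_def basis_algebra_def)
  have o: "\<rho> (H_grp \<one>) = 1\<^sub>m d"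
    using ring_hom_one[OF hom] by (simp add: ring_mat_def hopf_def basis_algebra_def)
  have p: "\<rho> (x [^]\<^bsub>H\<^esub> i) = \<rho> x ^\<^sub>m i" if "x \<in> carrier H" for x and i :: nat
  proof (induction i)
    case 0
    show ?case using o c[OF that] by (simp add: hopf_def basis_algebra_def)
  qed (use that m in auto)
  have minus: "\<rho> (x - y) = \<rho> x - \<rho> y" if "x \<in> carrier H" "y \<in> carrier H" "x - y \<in> carrier H" for x y
    using a[of "x - y" y] that c[of "x - y"] c[of y] by auto
  show "(d, X, Y) \<in> hmods"
    unfolding hmods_def mem_Collect_eq prod.case gmod_def
  proof (intro conjI ballI)
    show "Y * X h = \<chi> h \<cdot>\<^sub>m (X h * Y)" if "h \<in> carrier G" for h
      using that H_grp_carrier[OF that] H_y_carrier m sc hopf_relation_commute[OF that]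
      by (metis H.m_closed X_def Y_def)
    show "Y ^\<^sub>m n = X (g [^] n) - 1\<^sub>m d"
    proof -
      have "Y ^\<^sub>m n = \<rho> (H_grp (g [^] n) - H_grp \<one>)"
        unfolding Y_def p[OF H_y_carrier, symmetric] hopf_relation_y_pow ..
      also have "\<dots> = X (g [^] n) - 1\<^sub>m d"
        using minus[of "H_grp (g [^] n)" "H_grp \<one>"] H_grp_carrier g_closed
          hopf_relation_y_pow H.nat_pow_closed[OF H_y_carrier, of n]
        by (simp add: o X_def)
      finally show ?thesis .
    qed
  qed (auto simp: X_def Y_def H_grp_carrier H_y_carrier c o m[symmetric] hopf_group_algebra)
  fix x assume x: "x \<in> carrier H"
  have b: "\<rho> (bas (i, h)) = Y ^\<^sub>m i * X h" if "(i, h) \<in> H_basis G n" for i h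
    using that hopf_basis[of i h] m[of "H_y G [^]\<^bsub>H\<^esub> i" "H_grp h"] p[OF H_y_carrier, of i] H_grp_carrier[of h] H_y_carrier
    by (auto simp: H_basis_def X_def Y_def)
  have carr: "bas b \<in> carrier H" if "b \<in> H_basis G n" for b using that by (simp add: hopf_carrier)
  have z: "\<rho> 0 = 0\<^sub>m d d" using sc[of "H_grp \<one>" 0] H_grp_carrier[of \<one>] o by simp
  have "\<rho> (\<Sum>b\<in>S. scale (f b) (bas b)) = gsum d d (\<lambda>b. f b \<cdot>\<^sub>m \<rho> (bas b)) S \<and> (\<Sum>b\<in>S. scale (f b) (bas b)) \<in> carrier H"
    if "finite S" "S \<subseteq> H_basis G n" for S f
    using that
  proof (induction S)
    case empty
    show ?case by (simp add: z) (simp add: hopf_carrier)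
  next
    case (insert b S)
    then have "scale (f b) (bas b) \<in> carrier H" "bas b \<in> carrier H" by (auto intro!: scale_carrier carr)
    moreover have "u + v \<in> carrier H" if "u \<in> carrier H" "v \<in> carrier H" for u v
      using H.a_closed[OF that] by (simp add: hopf_def basis_algebra_def)
    ultimately show ?case using insert by (auto simp: a sc gsum_insert c)
  qed
  from this[OF finite_keys, of x "Poly_Mapping.lookup x"] x
  have "\<rho> x = gsum d d (\<lambda>b. Poly_Mapping.lookup x b \<cdot>\<^sub>m \<rho> (bas b)) (Poly_Mapping.keys x)"
    using lin_ext_id[of x] by (simp add: lin_ext_def hopf_carrier)
  also have "\<dots> = evm d (\<lambda>b. \<rho> (bas b)) x"
    using x c carr by (subst evm_eq_gsum) (auto simp: hopf_carrier)
  also have "\<dots> = evm d (\<lambda>(i, h). Y ^\<^sub>m i * X h) x"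
    using x b by (intro evm_cong) (auto simp: hopf_carrier)
  finally show "\<rho> x = evm d (\<lambda>(i, h). Y ^\<^sub>m i * X h) x" .
qed

text \<open>Basis elements are products \<open>y^i h\<close>, so a matrix that intertwines the
  actions of \<open>y\<close> and of \<open>G\<close> intertwines the action of all of
  \<open>H\<close>.\<close>

lemma module_iso_iff:
  assumes "M \<in> hmods" "N \<in> hmods"
  shows "(rep_of M, rep_of N) \<in> module_iso H \<longleftrightarrow> hiso M N"
proof -
  obtain d X Y e X' Y' where eq: "M = (d, X, Y)" "N = (e, X', Y')" by (metis surj_pair)
  note M = assms(1)[unfolded eq] and N = assms(2)[unfolded eq]
  note D = hmodsD[OF M] gmodD[OF hmodsD(1)[OF M]] and D' = hmodsD[OF N] gmodD[OF hmodsD(1)[OF N]]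
  let ?\<rho> = "evm d (\<lambda>(i, h). Y ^\<^sub>m i * X h)" and ?\<sigma> = "evm e (\<lambda>(i, h). Y' ^\<^sub>m i * X' h)"
  have ev: "?\<rho> (H_grp h) = X h" "?\<sigma> (H_grp h) = X' h" if "h \<in> carrier G" for h
    using that D D' by (simp_all add: H_grp_def)
  have evy: "?\<rho> (H_y G) = Y" "?\<sigma> (H_y G) = Y'"
    using D D' by (simp_all add: H_y_def)
  show ?thesis
  proof
    assume "(rep_of M, rep_of N) \<in> module_iso H"
    then obtain P where P: "P \<in> carrier_mat e d" "invertible_mat P"
      "\<And>x. x \<in> carrier H \<Longrightarrow> P * ?\<rho> x = ?\<sigma> x * P"
      by (auto simp: module_iso_def eq)
    from P(2) obtain Q where de: "d = e" and Q: "P * Q = 1\<^sub>m (dim_row P)" "Q * P = 1\<^sub>m (dim_row Q)"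
      using P(1) by (auto simp: invertible_mat_def inverts_mat_def)
    \<comment> \<open>The inverse comes without its size, which is read off by comparing dimensions
      in the two identities.\<close>
    have "dim_row Q = d" "dim_col Q = d"
      using arg_cong[OF Q(2), of dim_col] arg_cong[OF Q(1), of dim_col] P(1) de by auto
    then have c: "P \<in> carrier_mat d d" "Q \<in> carrier_mat d d" "P * Q = 1\<^sub>m d" "Q * P = 1\<^sub>m d"
      using P(1) Q de by auto
    show "hiso M N" unfolding eq hiso.simps
    proof (rule conjI[OF de], rule bexI[OF _ c(1)], rule bexI[OF _ c(2)], intro conjI c(3,4) ballI)
      show "P * X h = X' h * P" if "h \<in> carrier G" for h
        using P(3)[OF H_grp_carrier[OF that]] that by (simp add: ev)
      show "P * Y = Y' * P" using P(3)[OF H_y_carrier] by (simp add: evy)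
    qed
  next
    assume "hiso M N"
    then obtain P Q where de: "d = e" and P: "P \<in> carrier_mat d d" "Q \<in> carrier_mat d d"
      "P * Q = 1\<^sub>m d" "Q * P = 1\<^sub>m d" "\<And>h. h \<in> carrier G \<Longrightarrow> P * X h = X' h * P" "P * Y = Y' * P"
      by (auto simp: eq)
    have "P * ?\<rho> x = ?\<sigma> x * P" if "x \<in> carrier H" for x
    proof -
      have *: "P * (Y ^\<^sub>m i * X h) = (Y' ^\<^sub>m i * X' h) * P" if "h \<in> carrier G" for i h
      proof -
        have "P * Y ^\<^sub>m i = Y' ^\<^sub>m i * P"
          using pow_mat_intertwine[of Y d Y' d P 1 i] D D' de P by simp
        then have eq: "P * (Y ^\<^sub>m i * X h) = Y' ^\<^sub>m i * P * X h"
          using D(3,4) gmodD(4)[OF D(1) that] P(1) by (simp flip: mat_assoc)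
        have "Y' ^\<^sub>m i * P * X h = Y' ^\<^sub>m i * (P * X h)"
          using D'(3,4) gmodD(4)[OF D(1) that] P(1) de by (intro mat_assoc) auto
        then show ?thesis
          using D'(3,4) gmodD(4,5)[OF D'(1) that] P(1,5) de that eq by (simp add: mat_assoc)
      qed
      have k: "b \<in> Poly_Mapping.keys x \<Longrightarrow> snd b \<in> carrier G" for b
        using that by (auto simp: hopf_carrier H_basis_def)
      have c: "Y ^\<^sub>m i * X h \<in> carrier_mat d d" "Y' ^\<^sub>m i * X' h \<in> carrier_mat d d" if "h \<in> carrier G" for i h
        using D D' de that by (auto intro!: carrier_matI)
      have "P * ?\<rho> x = evm d (\<lambda>b. P * (case b of (i, h) \<Rightarrow> Y ^\<^sub>m i * X h)) x"
        using k c P by (intro evm_mult_left) auto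
      also have "\<dots> = evm d (\<lambda>b. (case b of (i, h) \<Rightarrow> Y' ^\<^sub>m i * X' h) * P) x"
        using k * by (intro evm_cong) auto
      also have "\<dots> = ?\<sigma> x * P"
        unfolding de[symmetric] using k c P by (intro evm_mult_right[symmetric]) auto
      finally show ?thesis .
    qed
    moreover have "invertible_mat P"
      using P(1-4) by (auto simp: invertible_mat_def inverts_mat_def intro!: exI[of _ Q])
    ultimately show "(rep_of M, rep_of N) \<in> module_iso H"
      using rep_of_fd_modules[OF assms(1)] rep_of_fd_modules[OF assms(2)] P(1) de
      by (auto simp: module_iso_def eq intro!: bexI[of _ P])
  qed
qed

end


section \<open>Tensor products and direct sums of modules\<close>

lemma kron_diff_left:
  assumes "dim_row A = dim_row B" "dim_col A = dim_col B"
  shows "kronecker (A - B) C = kronecker A C - kronecker B C"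
  using assms by (intro eq_matI) (auto simp: index_kron div_mod_bounds algebra_simps)

lemma kron_diff_right:
  assumes "dim_row A = dim_row B" "dim_col A = dim_col B"
  shows "kronecker C (A - B) = kronecker C A - kronecker C B"
proof (intro eq_matI, goal_cases)
  case (1 i j)
  then have "i mod dim_row B < dim_row B" "j mod dim_col B < dim_col B"
    by (auto intro!: div_mod_bounds)
  with 1 assms show ?case by (simp add: index_kron algebra_simps)
qed (use assms in auto)

lemma kron_one_left [simp]: "kronecker (1\<^sub>m (Suc 0)) A = A" "kronecker A (1\<^sub>m (Suc 0)) = A"
  by (intro eq_matI; auto simp: index_kron)+

lemma smult_add_mat:
  "dim_row A = dim_row B \<Longrightarrow> dim_col A = dim_col B \<Longrightarrow>
    c \<cdot>\<^sub>m (A + B) = c \<cdot>\<^sub>m A + (c :: 'k::field) \<cdot>\<^sub>m B"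
  by (intro eq_matI) (auto simp: algebra_simps)

context green_datum
begin

text \<open>The relation for \<open>y^n\<close> is the delicate one: \<open>y \<otimes> g\<close>
  and \<open>1 \<otimes> y\<close> commute up to the root of unity \<open>\<chi> g\<close>, so the
  \<open>n\<close>-th power of their sum has no mixed terms.\<close>

lemma htens_hmods:
  assumes "M \<in> hmods" "N \<in> hmods"
  shows "htens M N \<in> hmods"
proof -
  obtain d X Y e X' Y' where eq: "M = (d, X, Y)" "N = (e, X', Y')" by (metis surj_pair)
  note M = assms(1)[unfolded eq] and N = assms(2)[unfolded eq]
  note D = hmodsD[OF M] and GD = gmodD[OF hmodsD(1)[OF M]]
  note D' = hmodsD[OF N] and GD' = gmodD[OF hmodsD(1)[OF N]]
  note [simp] = D(3,4) GD(4,5) D'(3,4) GD'(4,5) g_closed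
  let ?B = "kronecker Y (X' g)" and ?C = "kronecker (1\<^sub>m d) Y'"
  have 1: "gmod G (d * e) (\<lambda>h. kronecker (X h) (X' h))"
    unfolding gmod_def using GD(1-3) GD'(1-3) by (auto simp: kron_mult)
  have 2: "(?B + ?C) * kronecker (X h) (X' h) = \<chi> h \<cdot>\<^sub>m (kronecker (X h) (X' h) * (?B + ?C))"
    if h: "h \<in> carrier G" for h
  proof -
    have gh: "X' g * X' h = X' h * X' g"
      using GD'(3)[of g h] GD'(3)[of h g] g_central[OF h] h by simp
    show ?thesis
      using h by (simp add: mat_left_distrib mat_right_distrib kron_mult gh D(5) D'(5) smult_add_mat)
  qed
  have 3: "(?B + ?C) ^\<^sub>m n = kronecker (X (g [^] n)) (X' (g [^] n)) - 1\<^sub>m (d * e)"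
  proof -
    have "(?B + ?C) ^\<^sub>m n = ?B ^\<^sub>m n + ?C ^\<^sub>m n"
    proof (rule q_binomial_root_of_unity[OF _ _ _ order_q])
      show "?C * ?B = \<chi> g \<cdot>\<^sub>m (?B * ?C)" by (simp add: kron_mult D'(5))
    qed (use n_ge_2 in \<open>auto intro!: carrier_matI\<close>)
    also have "\<dots> = kronecker (X (g [^] n) - 1\<^sub>m d) (X' (g [^] n)) + kronecker (1\<^sub>m d) (X' (g [^] n) - 1\<^sub>m e)"
      using D(6) D'(6) GD'(8)[of n] by (simp add: kron_pow)
    \<comment> \<open>The sum telescopes, as in
      \<open>(u - 1) v + (v - 1) = u v - 1\<close>.\<close>
    also have "\<dots> = kronecker (X (g [^] n)) (X' (g [^] n)) - 1\<^sub>m (d * e)"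
    proof -
      have *: "A - B + (B - C) = A - C"
        if "A \<in> carrier_mat (d * e) (d * e)" "B \<in> carrier_mat (d * e) (d * e)" "C \<in> carrier_mat (d * e) (d * e)" for A B C :: "'k mat"
        using that by (intro eq_matI) auto
      show ?thesis
        by (simp add: kron_diff_left kron_diff_right) (intro * carrier_matI; simp)
    qed
    finally show ?thesis .
  qed
  show ?thesis unfolding eq htens.simps hmods_def mem_Collect_eq prod.case
    using 1 2 3 by (auto intro!: carrier_matI)
qed

lemma htriv_hmods: "htriv \<in> hmods"
  using n_ge_2 \<chi>_nz by (auto simp: htriv_def hmods_def gmod_def pow_mat_zero)

lemma hsum_hmods:
  assumes "M \<in> hmods" "N \<in> hmods"
  shows "hsum M N \<in> hmods"
proof -
  obtain d X Y e X' Y' where eq: "M = (d, X, Y)" "N = (e, X', Y')" by (metis surj_pair)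
  note M = assms(1)[unfolded eq] and N = assms(2)[unfolded eq]
  note D = hmodsD[OF M] and GD = gmodD[OF hmodsD(1)[OF M]]
  note D' = hmodsD[OF N] and GD' = gmodD[OF hmodsD(1)[OF N]]
  have m: "four_block_mat A (0\<^sub>m d e) (0\<^sub>m e d) B * four_block_mat A' (0\<^sub>m d e) (0\<^sub>m e d) B' =
      four_block_mat (A * A') (0\<^sub>m d e) (0\<^sub>m e d) (B * B')"
    if "A \<in> carrier_mat d d" "A' \<in> carrier_mat d d" "B \<in> carrier_mat e e" "B' \<in> carrier_mat e e" for A A' B B' :: "'k mat"
    using that by (subst mult_four_block_mat[of _ d d _ e _ e _ _ d _ e]) auto
  have s: "c \<cdot>\<^sub>m four_block_mat A (0\<^sub>m d e) (0\<^sub>m e d) B = four_block_mat (c \<cdot>\<^sub>m A) (0\<^sub>m d e) (0\<^sub>m e d) (c \<cdot>\<^sub>m B)"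
    if "A \<in> carrier_mat d d" "B \<in> carrier_mat e e" for A B :: "'k mat" and c
    using that by (subst smult_four_block_mat[of _ d d _ e _ e]) auto
  have p: "four_block_mat A (0\<^sub>m d e) (0\<^sub>m e d) B ^\<^sub>m i = four_block_mat (A ^\<^sub>m i) (0\<^sub>m d e) (0\<^sub>m e d) (B ^\<^sub>m i)"
    if "A \<in> carrier_mat d d" "B \<in> carrier_mat e e" for A B :: "'k mat" and i
    using that by (subst pow_four_block_mat[of _ d _ e]) auto
  have g: "X h \<in> carrier_mat d d" "X' h \<in> carrier_mat e e" if "h \<in> carrier G" for h using GD(1) GD'(1) that by auto
  show ?thesis unfolding eq hsum.simps hmods_def mem_Collect_eq prod.case gmod_def
  proof (intro conjI ballI)
    show "four_block_mat Y (0\<^sub>m d e) (0\<^sub>m e d) Y' ^\<^sub>m n =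
      four_block_mat (X (g [^] n)) (0\<^sub>m d e) (0\<^sub>m e d) (X' (g [^] n)) - 1\<^sub>m (d + e)"
      unfolding p[OF D(2) D'(2)] D(6) D'(6) using g[of "g [^] n"] g_closed
      by (intro eq_matI) auto
    fix h assume h: "h \<in> carrier G"
    show "four_block_mat Y (0\<^sub>m d e) (0\<^sub>m e d) Y' * four_block_mat (X h) (0\<^sub>m d e) (0\<^sub>m e d) (X' h) =
      \<chi> h \<cdot>\<^sub>m (four_block_mat (X h) (0\<^sub>m d e) (0\<^sub>m e d) (X' h) * four_block_mat Y (0\<^sub>m d e) (0\<^sub>m e d) Y')"
      using g[OF h] D(2) D'(2) D(5)[OF h] D'(5)[OF h] mult_carrier_mat[OF g(1)[OF h] D(2)]
        mult_carrier_mat[OF g(2)[OF h] D'(2)] by (simp add: m s)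
  qed (use g D D' GD GD' in \<open>auto simp: m\<close>)
qed

section \<open>The action on a tensor product through the comultiplication\<close>

definition ev2 :: "('a, 'k) hmod \<Rightarrow> ('a, 'k) hmod \<Rightarrow> (nat \<times> 'a) \<times> (nat \<times> 'a) \<Rightarrow> 'k mat"
  where "ev2 M N = (\<lambda>(a, b). kronecker (snd (rep_of M) (bas a)) (snd (rep_of N) (bas b)))"

lemma H_mult_closed:
  assumes "a \<in> H_basis G n" "b \<in> H_basis G n"
  shows "Poly_Mapping.keys (H_mult G \<chi> g n a b :: _ \<Rightarrow>\<^sub>0 'k) \<subseteq> H_basis G n"
proof -
  interpret H: ring H by (rule hopf_ring)
  have "bas a \<otimes>\<^bsub>H\<^esub> bas b \<in> carrier H"
    using assms by (intro H.m_closed) (auto simp: hopf_carrier)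
  then show ?thesis unfolding hopf_carrier by (simp add: hopf_def basis_algebra_def bilin_ext_def)
qed

lemma keys_tens:
  assumes "Poly_Mapping.keys x \<subseteq> A" "Poly_Mapping.keys y \<subseteq> B"
  shows "Poly_Mapping.keys (tens x y) \<subseteq> A \<times> B"
  using assms unfolding tens_def bilin_ext_def by (intro keys_lin_ext) auto

abbreviation "BB \<equiv> H_basis G n \<times> H_basis G n"
abbreviation "H2 \<equiv> hopf2 G \<chi> g n"

lemma hopf2_closed:
  assumes "Poly_Mapping.keys x \<subseteq> BB" "Poly_Mapping.keys y \<subseteq> BB"
  shows "Poly_Mapping.keys (x \<otimes>\<^bsub>H2\<^esub> y) \<subseteq> BB"
  unfolding hopf2_def basis_algebra_def bilin_ext_def monoid.simps
proof (intro keys_lin_ext)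
  fix a b assume "a \<in> Poly_Mapping.keys x" "b \<in> Poly_Mapping.keys y"
  then have "fst a \<in> H_basis G n" "fst b \<in> H_basis G n" "snd a \<in> H_basis G n" "snd b \<in> H_basis G n"
    using assms by auto
  then show "Poly_Mapping.keys ((case a of (a, b) \<Rightarrow> \<lambda>(c, d). tens (H_mult G \<chi> g n a c) (H_mult G \<chi> g n b d)) b) \<subseteq> BB"
    unfolding split_def by (intro keys_tens H_mult_closed)
qed

context
  fixes M N d X Y e X' Y'
  assumes M: "M \<in> hmods" and N: "N \<in> hmods" and M_eq: "M = (d, X, Y)" and N_eq: "N = (e, X', Y')"
begin

lemma ev2_carrier: "ev2 M N ab \<in> carrier_mat (d * e) (d * e)"
  by (auto simp: ev2_def M_eq N_eq split_def)

lemma ev2_tens: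
  assumes "x \<in> carrier H" "y \<in> carrier H"
  shows "evm (d * e) (ev2 M N) (tens x y) = kronecker (snd (rep_of M) x) (snd (rep_of N) y)"
proof -
  note D = hmodsD[OF M[unfolded M_eq]] and GD = gmodD[OF hmodsD(1)[OF M[unfolded M_eq]]]
  note D' = hmodsD[OF N[unfolded N_eq]] and GD' = gmodD[OF hmodsD(1)[OF N[unfolded N_eq]]]
  define p where "p = snd (rep_of M)"
  define s where "s = snd (rep_of N)"
  have k: "b \<in> Poly_Mapping.keys x \<Longrightarrow> snd b \<in> carrier G" "b \<in> Poly_Mapping.keys y \<Longrightarrow> snd b \<in> carrier G" for b
    using assms by (auto simp: hopf_carrier H_basis_def)
  have c: "p (bas b) \<in> carrier_mat d d" "s (bas b) \<in> carrier_mat e e" for b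
    by (simp_all add: p_def s_def M_eq N_eq)
  have p: "evm d (\<lambda>b. p (bas b)) x = p x"
  proof -
    have "evm d (\<lambda>b. p (bas b)) x = evm d (\<lambda>(i, h). Y ^\<^sub>m i * X h) x"
    proof (intro evm_cong)
      fix b assume "b \<in> Poly_Mapping.keys x"
      then obtain i h where b: "b = (i, h)" "h \<in> carrier G" using k(1) by (cases b) auto
      then have "Y ^\<^sub>m i * X h \<in> carrier_mat d d" using D(3,4) GD(4,5) by (intro carrier_matI) auto
      then show "p (bas b) = (case b of (i, h) \<Rightarrow> Y ^\<^sub>m i * X h)" by (simp add: p_def M_eq b)
    qed
    then show ?thesis by (simp add: p_def M_eq)
  qed
  have s: "evm e (\<lambda>b. s (bas b)) y = s y"
  proof -
    have "evm e (\<lambda>b. s (bas b)) y = evm e (\<lambda>(i, h). Y' ^\<^sub>m i * X' h) y"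
    proof (intro evm_cong)
      fix b assume "b \<in> Poly_Mapping.keys y"
      then obtain i h where b: "b = (i, h)" "h \<in> carrier G" using k(2) by (cases b) auto
      then have "Y' ^\<^sub>m i * X' h \<in> carrier_mat e e" using D'(3,4) GD'(4,5) by (intro carrier_matI) auto
      then show "s (bas b) = (case b of (i, h) \<Rightarrow> Y' ^\<^sub>m i * X' h)" by (simp add: s_def N_eq b)
    qed
    then show ?thesis by (simp add: s_def N_eq)
  qed
  have "evm (d * e) (ev2 M N) (tens x y) =
      evm (d * e) (\<lambda>a. evm (d * e) (\<lambda>b. kronecker (p (bas a)) (s (bas b))) y) x"
    unfolding tens_def bilin_ext_def evm_lin_ext evm_bas[of "ev2 M N", OF ev2_carrier]
    by (simp add: ev2_def p_def s_def)
  also have "\<dots> = kronecker (p x) (s y)"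
    using c by (subst evm_kron[symmetric]) (auto simp: p s)
  finally show ?thesis by (simp add: p_def s_def)
qed

lemma ev2_mult:
  assumes "Poly_Mapping.keys x \<subseteq> BB" "Poly_Mapping.keys y \<subseteq> BB"
  shows "evm (d * e) (ev2 M N) (x \<otimes>\<^bsub>H2\<^esub> y) = evm (d * e) (ev2 M N) x * evm (d * e) (ev2 M N) y"
proof -
  have mm: "ev2 M N p * ev2 M N r =
      evm (d * e) (ev2 M N) (case p of (a, b) \<Rightarrow> case r of (u, v) \<Rightarrow> tens (H_mult G \<chi> g n a u) (H_mult G \<chi> g n b v))"
    if pr: "p \<in> BB" "r \<in> BB" for p r
  proof -
    obtain a b u v where eq: "p = (a, b)" "r = (u, v)" by (metis surj_pair)
    have bs: "a \<in> H_basis G n" "b \<in> H_basis G n" "u \<in> H_basis G n" "v \<in> H_basis G n" using pr eq by auto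
    then have c: "bas a \<in> carrier H" "bas b \<in> carrier H" "bas u \<in> carrier H" "bas v \<in> carrier H"
      by (auto simp: hopf_carrier)
    have bb: "bas a \<otimes>\<^bsub>H\<^esub> bas u = H_mult G \<chi> g n a u" "bas b \<otimes>\<^bsub>H\<^esub> bas v = H_mult G \<chi> g n b v"
      by (simp_all add: hopf_def basis_algebra_def bilin_ext_def)
    have "ev2 M N p * ev2 M N r = kronecker
        (snd (rep_of M) (bas a) * snd (rep_of M) (bas u)) (snd (rep_of N) (bas b) * snd (rep_of N) (bas v))"
      by (simp add: eq ev2_def M_eq N_eq kron_mult)
    also have "\<dots> = kronecker (snd (rep_of M) (H_mult G \<chi> g n a u)) (snd (rep_of N) (H_mult G \<chi> g n b v))"
      using rep_of_mult[OF M[unfolded M_eq] c(1,3)] rep_of_mult[OF N[unfolded N_eq] c(2,4)]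
      by (simp add: M_eq N_eq bb)
    also have "\<dots> = evm (d * e) (ev2 M N) (tens (H_mult G \<chi> g n a u) (H_mult G \<chi> g n b v))"
      using bs by (intro ev2_tens[symmetric]) (auto simp: hopf_carrier dest!: subsetD[OF H_mult_closed, rotated -1])
    finally show ?thesis by (simp add: eq)
  qed
  have "evm (d * e) (ev2 M N) (x \<otimes>\<^bsub>H2\<^esub> y) =
      evm (d * e) (\<lambda>p. evm (d * e) (\<lambda>r. evm (d * e) (ev2 M N)
        (case p of (a, b) \<Rightarrow> case r of (u, v) \<Rightarrow> tens (H_mult G \<chi> g n a u) (H_mult G \<chi> g n b v))) y) x"
    unfolding hopf2_def basis_algebra_def bilin_ext_def monoid.simps evm_lin_ext by (simp add: split_def)
  also have "\<dots> = evm (d * e) (\<lambda>p. evm (d * e) (\<lambda>r. ev2 M N p * ev2 M N r) y) x"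
    using assms by (intro evm_cong mm[symmetric]) auto
  also have "\<dots> = evm (d * e) (ev2 M N) x * evm (d * e) (ev2 M N) y"
    using ev2_carrier by (intro evm_mult[symmetric]) auto
  finally show ?thesis .
qed

text \<open>Evaluation by \<open>ev2\<close> is multiplicative, and the comultiplication sends
  \<open>y^i h\<close> to \<open>\<Delta>(y)^i (h \<otimes> h)\<close>. Comparing the actions of
  \<open>y\<close> and of group elements is therefore enough, and the power of
  \<open>\<Delta>(y)\<close> is never expanded.\<close>

lemma module_tensor_rep:
  assumes x: "x \<in> carrier H"
  shows "snd (rep_of (htens M N)) x = evm (d * e) (ev2 M N) (H_comult G \<chi> g n x)"
    "Poly_Mapping.keys (H_comult G \<chi> g n x) \<subseteq> BB"
proof -
  note D = hmodsD[OF M[unfolded M_eq]] and GD = gmodD[OF hmodsD(1)[OF M[unfolded M_eq]]]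
  note D' = hmodsD[OF N[unfolded N_eq]] and GD' = gmodD[OF hmodsD(1)[OF N[unfolded N_eq]]]
  let ?T = "tens (H_y G) (H_grp g) + tens (H_grp \<one>) (H_y G) :: _ \<Rightarrow>\<^sub>0 'k"
  let ?YT = "kronecker Y (X' g) + kronecker (1\<^sub>m d) Y'"
  let ?E = "evm (d * e) (ev2 M N)"
  have rep: "snd (rep_of M) (H_grp h) = X h" "snd (rep_of N) (H_grp h) = X' h" if "h \<in> carrier G" for h
    using that D GD D' GD' by (simp_all add: M_eq N_eq H_grp_def)
  have repy: "snd (rep_of M) (H_y G) = Y" "snd (rep_of N) (H_y G) = Y'"
    using D GD D' GD' by (simp_all add: M_eq N_eq H_y_def)
  have carr: "H_y G \<in> carrier H" "H_grp h \<in> carrier H" if "h \<in> carrier G" for h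
    using H_y_carrier H_grp_carrier[OF that] by auto
  have kt: "Poly_Mapping.keys (tens u v :: _ \<Rightarrow>\<^sub>0 'k) \<subseteq> BB" if "u \<in> carrier H" "v \<in> carrier H" for u v
    using that by (intro keys_tens) (auto simp: hopf_carrier)
  have kT: "Poly_Mapping.keys ?T \<subseteq> BB"
    by (rule order.trans[OF Poly_Mapping.keys_add Un_least[OF kt kt]]) (use carr g_closed in auto)
  have ET: "?E ?T = ?YT"
    using carr g_closed by (simp add: evm_add ev2_tens rep repy GD(2))
  have one: "Poly_Mapping.keys (\<one>\<^bsub>H2\<^esub>) \<subseteq> BB" "?E \<one>\<^bsub>H2\<^esub> = 1\<^sub>m (d * e)"
    using kt[OF carr(2) carr(2)] carr(2)[of \<one>] rep[of \<one>]
    by (simp_all add: hopf2_def basis_algebra_def ev2_tens GD(2) GD'(2))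
  have pow: "Poly_Mapping.keys (?T [^]\<^bsub>H2\<^esub> i) \<subseteq> BB \<and> ?E (?T [^]\<^bsub>H2\<^esub> i) = ?YT ^\<^sub>m i" for i :: nat
  proof (induction i)
    case 0
    show ?case using one D'(3) by (simp add: nat_pow_def)
  next
    case (Suc i)
    then show ?case using hopf2_closed[OF _ kT] by (simp add: ev2_mult[OF _ kT] ET)
  qed
  have trm: "Poly_Mapping.keys (?T [^]\<^bsub>H2\<^esub> i \<otimes>\<^bsub>H2\<^esub> tens (H_grp h) (H_grp h)) \<subseteq> BB"
    "?E (?T [^]\<^bsub>H2\<^esub> i \<otimes>\<^bsub>H2\<^esub> tens (H_grp h) (H_grp h)) = ?YT ^\<^sub>m i * kronecker (X h) (X' h)"
    if "h \<in> carrier G" for i h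
  proof -
    note hh = kt[OF carr(2)[OF that] carr(2)[OF that]]
    show "Poly_Mapping.keys (?T [^]\<^bsub>H2\<^esub> i \<otimes>\<^bsub>H2\<^esub> tens (H_grp h) (H_grp h)) \<subseteq> BB"
      using pow[of i] hh by (intro hopf2_closed) auto
    show "?E (?T [^]\<^bsub>H2\<^esub> i \<otimes>\<^bsub>H2\<^esub> tens (H_grp h) (H_grp h)) = ?YT ^\<^sub>m i * kronecker (X h) (X' h)"
      using pow[of i] carr(2)[OF that] by (simp add: ev2_mult[OF _ hh] ev2_tens rep[OF that])
  qed
  have k: "b \<in> Poly_Mapping.keys x \<Longrightarrow> snd b \<in> carrier G" for b
    using x by (auto simp: hopf_carrier H_basis_def)
  show "Poly_Mapping.keys (H_comult G \<chi> g n x) \<subseteq> BB"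
    unfolding H_comult_def
  proof (intro keys_lin_ext)
    fix a assume "a \<in> Poly_Mapping.keys x"
    from trm(1)[OF k[OF this], of "fst a"]
    show "Poly_Mapping.keys (case a of (i, h) \<Rightarrow> ?T [^]\<^bsub>H2\<^esub> i \<otimes>\<^bsub>H2\<^esub> tens (H_grp h) (H_grp h)) \<subseteq> BB"
      by (simp only: split_def)
  qed
  have "snd (rep_of (htens M N)) x = evm (d * e) (\<lambda>(i, h). ?YT ^\<^sub>m i * kronecker (X h) (X' h)) x"
    by (simp add: M_eq N_eq)
  also have "\<dots> = evm (d * e) (\<lambda>a. ?E (case a of (i, h) \<Rightarrow> ?T [^]\<^bsub>H2\<^esub> i \<otimes>\<^bsub>H2\<^esub> tens (H_grp h) (H_grp h))) x"
  proof (intro evm_cong)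
    fix a assume "a \<in> Poly_Mapping.keys x"
    from trm(2)[OF k[OF this], of "fst a"]
    show "(case a of (i, h) \<Rightarrow> ?YT ^\<^sub>m i * kronecker (X h) (X' h)) =
        ?E (case a of (i, h) \<Rightarrow> ?T [^]\<^bsub>H2\<^esub> i \<otimes>\<^bsub>H2\<^esub> tens (H_grp h) (H_grp h))"
      by (simp only: split_def)
  qed
  also have "\<dots> = ?E (H_comult G \<chi> g n x)"
    by (simp only: H_comult_def evm_lin_ext)
  finally show "snd (rep_of (htens M N)) x = ?E (H_comult G \<chi> g n x)" .
qed

end

end


subsection \<open>The Green ring\<close>

context green_datum
begin

lemma fd_modules_cong:
  assumes "(d, \<rho>) \<in> fd_modules H" "\<And>x. x \<in> carrier H \<Longrightarrow> \<rho>' x = \<rho> x"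
  shows "(d, \<rho>') \<in> fd_modules H"
proof -
  interpret H: ring H by (rule hopf_ring)
  have hom: "\<rho> \<in> Ring.ring_hom H (ring_mat TYPE('k) d ())" using assms(1) by (simp add: fd_modules_def)
  have "\<rho>' \<in> Ring.ring_hom H (ring_mat TYPE('k) d ())"
    using ring_hom_closed[OF hom] ring_hom_mult[OF hom] ring_hom_add[OF hom] ring_hom_one[OF hom]
    by (intro ring_hom_memI) (simp_all add: assms(2))
  then show ?thesis using assms scale_carrier by (simp add: fd_modules_def)
qed

lemma module_iso_equiv: "equiv (fd_modules H) (module_iso H)"
proof (rule equivI)
  show "module_iso H \<subseteq> fd_modules H \<times> fd_modules H" by (auto simp: module_iso_def)
  have c: "\<rho> x \<in> carrier_mat d d" if "(d, \<rho>) \<in> fd_modules H" "x \<in> carrier H" for d \<rho> x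
    using ring_hom_closed[of \<rho> H "ring_mat TYPE('k) d ()" x] that by (simp add: fd_modules_def ring_mat_def)
  have inv: "\<exists>Q. d = e \<and> Q \<in> carrier_mat d d \<and> P * Q = 1\<^sub>m d \<and> Q * P = 1\<^sub>m d"
    if "P \<in> carrier_mat e d" "invertible_mat P" for P :: "'k mat" and d e
  proof -
    note asm = that
    have "d = e" using asm by (auto simp: invertible_mat_def)
    moreover obtain Q where "P * Q = 1\<^sub>m (dim_row P)" "Q * P = 1\<^sub>m (dim_row Q)"
      using asm(2) by (auto simp: invertible_mat_def inverts_mat_def)
    ultimately have Q: "d = e" "P * Q = 1\<^sub>m (dim_row P)" "Q * P = 1\<^sub>m (dim_row Q)" by auto
    have "dim_row Q = d" "dim_col Q = d"
      using arg_cong[OF Q(3), of dim_col] arg_cong[OF Q(2), of dim_col] asm Q(1) by auto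
    with Q asm show ?thesis by auto
  qed
  have I: "((d, \<rho>), (d, \<sigma>)) \<in> module_iso H"
    if "(d, \<rho>) \<in> fd_modules H" "(d, \<sigma>) \<in> fd_modules H" "P \<in> carrier_mat d d" "Q \<in> carrier_mat d d"
      "P * Q = 1\<^sub>m d" "Q * P = 1\<^sub>m d" "\<And>x. x \<in> carrier H \<Longrightarrow> P * \<rho> x = \<sigma> x * P" for d \<rho> \<sigma> P Q
    using that by (auto simp: module_iso_def invertible_mat_def inverts_mat_def intro!: bexI[of _ P] exI[of _ Q])
  show "refl_on (fd_modules H) (module_iso H)"
  proof (intro refl_onI, clarify)
    fix d \<rho> assume M: "(d, \<rho>) \<in> fd_modules H"
    show "((d, \<rho>), (d, \<rho>)) \<in> module_iso H"
    proof (rule I[OF M M, of "1\<^sub>m d" "1\<^sub>m d"])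
      fix x assume "x \<in> carrier H"
      then have "\<rho> x \<in> carrier_mat d d" by (rule c[OF M])
      then show "1\<^sub>m d * \<rho> x = \<rho> x * 1\<^sub>m d" by simp
    qed auto
  qed
  show "sym (module_iso H)"
  proof (intro symI, clarify)
    fix d \<rho> e \<sigma> assume "((d, \<rho>), (e, \<sigma>)) \<in> module_iso H"
    then obtain P where P: "(d, \<rho>) \<in> fd_modules H" "(e, \<sigma>) \<in> fd_modules H" "P \<in> carrier_mat e d" "invertible_mat P"
      "\<And>x. x \<in> carrier H \<Longrightarrow> P * \<rho> x = \<sigma> x * P" by (auto simp: module_iso_def)
    obtain Q where Q: "d = e" "Q \<in> carrier_mat d d" "P * Q = 1\<^sub>m d" "Q * P = 1\<^sub>m d" using inv[OF P(3,4)] by auto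
    have "Q * \<sigma> x = \<rho> x * Q" if x: "x \<in> carrier H" for x
    proof -
      note cc = c[OF P(1) x] c[OF P(2) x]
      have "Q * \<sigma> x = Q * (\<sigma> x * P) * Q" using cc P(3) Q(1,2) by (simp add: mat_assoc Q(3))
      also have "\<dots> = (Q * P) * (\<rho> x * Q)" unfolding P(5)[OF x, symmetric] using cc P(3) Q(1,2) by (simp add: mat_assoc)
      also have "\<dots> = \<rho> x * Q" unfolding Q(4) using cc Q(2) by simp
      finally show ?thesis .
    qed
    then show "((e, \<sigma>), (d, \<rho>)) \<in> module_iso H"
      using I[of e \<sigma> \<rho> Q P] P Q by auto
  qed
  show "trans (module_iso H)"
  proof (intro transI, clarify)
    fix d \<rho> e \<sigma> f \<tau> assume "((d, \<rho>), (e, \<sigma>)) \<in> module_iso H" "((e, \<sigma>), (f, \<tau>)) \<in> module_iso H"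
    then obtain P P' where P: "(d, \<rho>) \<in> fd_modules H" "(e, \<sigma>) \<in> fd_modules H" "P \<in> carrier_mat e d" "invertible_mat P"
      "\<And>x. x \<in> carrier H \<Longrightarrow> P * \<rho> x = \<sigma> x * P"
      and P': "(f, \<tau>) \<in> fd_modules H" "P' \<in> carrier_mat f e" "invertible_mat P'"
      "\<And>x. x \<in> carrier H \<Longrightarrow> P' * \<sigma> x = \<tau> x * P'"
      by (auto simp: module_iso_def)
    obtain Q where Q: "d = e" "Q \<in> carrier_mat d d" "P * Q = 1\<^sub>m d" "Q * P = 1\<^sub>m d" using inv[OF P(3,4)] by auto
    obtain Q' where Q': "e = f" "Q' \<in> carrier_mat e e" "P' * Q' = 1\<^sub>m e" "Q' * P' = 1\<^sub>m e" using inv[OF P'(2,3)] by auto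
    have "(P' * P) * \<rho> x = \<tau> x * (P' * P)" if x: "x \<in> carrier H" for x
    proof -
      note cc = c[OF P(1) x] c[OF P(2) x] c[OF P'(1) x]
      have "(P' * P) * \<rho> x = P' * (\<sigma> x * P)" using cc P(3,5) P'(2) Q(1) Q'(1) x by (simp add: mat_assoc)
      also have "\<dots> = (P' * \<sigma> x) * P" using cc P(3) P'(2) Q(1) Q'(1) by (simp add: mat_assoc)
      also have "\<dots> = \<tau> x * (P' * P)" unfolding P'(4)[OF x] using cc P(3) P'(2) Q(1) Q'(1) by (simp add: mat_assoc)
      finally show ?thesis .
    qed
    moreover have "(P' * P) * (Q * Q') = 1\<^sub>m d"
      using P(3) P'(2) Q Q' by (simp add: mat_assoc mat_pull[OF Q(3)])
    moreover have "(Q * Q') * (P' * P) = 1\<^sub>m d"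
      using P(3) P'(2) Q Q' by (simp add: mat_assoc mat_pull[OF Q'(4)])
    ultimately show "((d, \<rho>), (f, \<tau>)) \<in> module_iso H"
      using I[of d \<rho> \<tau> "P' * P" "Q * Q'"] P P' Q Q' by auto
  qed
qed

lemma iso_class_eq_iff:
  assumes "M \<in> fd_modules H" "N \<in> fd_modules H"
  shows "iso_class H M = iso_class H N \<longleftrightarrow> (M, N) \<in> module_iso H"
  unfolding iso_class_def using eq_equiv_class_iff[OF module_iso_equiv assms] .

text \<open>Values of a representation outside the carrier are arbitrary, and the constructions on
  modules agree with those on triples only on the carrier; the identity matrix is the isomorphism
  between such variants.\<close>

lemma iso_class_cong:
  assumes "(d, \<rho>) \<in> fd_modules H" "\<And>x. x \<in> carrier H \<Longrightarrow> \<rho>' x = \<rho> x"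
  shows "iso_class H (d, \<rho>') = iso_class H (d, \<rho>)"
proof -
  have M': "(d, \<rho>') \<in> fd_modules H" using fd_modules_cong[OF assms] .
  have c: "\<rho> x \<in> carrier_mat d d" if "x \<in> carrier H" for x
    using ring_hom_closed[of \<rho> H "ring_mat TYPE('k) d ()" x] that assms(1) by (simp add: fd_modules_def ring_mat_def)
  have "invertible_mat (1\<^sub>m d :: 'k mat)"
    by (auto simp: invertible_mat_def inverts_mat_def intro!: exI[of _ "1\<^sub>m d"])
  moreover have "1\<^sub>m d * \<rho>' x = \<rho> x * 1\<^sub>m d" if "x \<in> carrier H" for x
    using c[OF that] by (simp add: assms(2)[OF that])
  ultimately have "((d, \<rho>'), (d, \<rho>)) \<in> module_iso H"
    using M' assms(1) by (auto simp: module_iso_def intro!: bexI[of _ "1\<^sub>m d"])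
  then show ?thesis using iso_class_eq_iff[OF M' assms(1)] by simp
qed

definition cls :: "('a, 'k) hmod \<Rightarrow> (nat \<times> 'a, 'k) rep set"
  where "cls M = iso_class H (rep_of M)"

lemma cls_eq_iff: "M \<in> hmods \<Longrightarrow> N \<in> hmods \<Longrightarrow> cls M = cls N \<longleftrightarrow> hiso M N"
  unfolding cls_def using iso_class_eq_iff[OF rep_of_fd_modules rep_of_fd_modules] module_iso_iff by simp

lemma fd_modules_rep:
  assumes "(d, \<rho>) \<in> fd_modules H"
  obtains X Y where "(d, X, Y) \<in> hmods" "\<And>x. x \<in> carrier H \<Longrightarrow> \<rho> x = snd (rep_of (d, X, Y)) x"
  using rep_of_surj[OF assms] by simp

lemma iso_class_cls:
  assumes "M \<in> fd_modules H"
  obtains N where "N \<in> hmods" "iso_class H M = cls N"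
proof -
  obtain d \<rho> where M: "M = (d, \<rho>)" by (metis surj_pair)
  obtain X Y where N: "(d, X, Y) \<in> hmods" "\<And>x. x \<in> carrier H \<Longrightarrow> \<rho> x = snd (rep_of (d, X, Y)) x"
    using fd_modules_rep assms M by metis
  have "iso_class H (d, \<rho>) = cls (d, X, Y)"
    unfolding cls_def using iso_class_cong[of d "snd (rep_of (d, X, Y))" \<rho>] rep_of_fd_modules[OF N(1)] N(2) by simp
  with N(1) M show ?thesis using that by blast
qed

lemma classes: "fd_modules H // module_iso H = cls ` hmods"
proof -
  have "C \<in> cls ` hmods" if C: "C \<in> fd_modules H // module_iso H" for C
  proof -
    obtain M where M: "M \<in> fd_modules H" "C = iso_class H M" using C unfolding quotient_def iso_class_def by blast
    obtain N where "N \<in> hmods" "iso_class H M = cls N" using iso_class_cls[OF M(1)] .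
    then show ?thesis using M(2) by auto
  qed
  then show ?thesis
    using rep_of_fd_modules by (auto simp: cls_def iso_class_def intro!: quotientI)
qed

lemma htens_hiso:
  assumes M: "M \<in> hmods" "M' \<in> hmods" "hiso M M'" and N: "N \<in> hmods" "N' \<in> hmods" "hiso N N'"
  shows "hiso (htens M N) (htens M' N')"
proof -
  obtain d X Y where eq: "M = (d, X, Y)" by (metis surj_pair)
  obtain X' Y' where eq': "M' = (d, X', Y')" using M(3) eq by (cases M') auto
  obtain e U V where eqN: "N = (e, U, V)" by (metis surj_pair)
  obtain U' V' where eqN': "N' = (e, U', V')" using N(3) eqN by (cases N') auto
  obtain P Q where P: "P \<in> carrier_mat d d" "Q \<in> carrier_mat d d" "P * Q = 1\<^sub>m d" "Q * P = 1\<^sub>m d"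
    "\<And>h. h \<in> carrier G \<Longrightarrow> P * X h = X' h * P" "P * Y = Y' * P" using M(3) by (auto simp: eq eq')
  obtain R S where R: "R \<in> carrier_mat e e" "S \<in> carrier_mat e e" "R * S = 1\<^sub>m e" "S * R = 1\<^sub>m e"
    "\<And>h. h \<in> carrier G \<Longrightarrow> R * U h = U' h * R" "R * V = V' * R" using N(3) by (auto simp: eqN eqN')
  note D = hmodsD[OF M(1)[unfolded eq]] hmodsD[OF M(2)[unfolded eq']] hmodsD[OF N(1)[unfolded eqN]] hmodsD[OF N(2)[unfolded eqN']]
  note [simp] = D(3,4) gmodD(4,5)[OF D(1)] D(9,10) gmodD(4,5)[OF D(7)] D(15,16) gmodD(4,5)[OF D(13)]
    D(21,22) gmodD(4,5)[OF D(19)] g_closed carrier_matD[OF P(1)] carrier_matD[OF P(2)] carrier_matD[OF R(1)] carrier_matD[OF R(2)]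
  have c: "kronecker P R \<in> carrier_mat (d * e) (d * e)" "kronecker Q S \<in> carrier_mat (d * e) (d * e)"
    by (auto intro!: carrier_matI)
  show ?thesis unfolding eq eq' eqN eqN' htens.simps hiso.simps
    by (rule conjI[OF refl], rule bexI[OF _ c(1)], rule bexI[OF _ c(2)])
      (auto simp: kron_mult P(3-6) R(3-6) mat_left_distrib mat_right_distrib)
qed

text \<open>The union in \<open>class_tensor\<close> runs over all representatives, and by
  \<open>htens_hiso\<close> all its members are one and the same class.\<close>

lemma class_tensor_cls:
  assumes M: "M \<in> hmods" and N: "N \<in> hmods"
  shows "class_tensor H (H_comult G \<chi> g n) (cls M) (cls N) = cls (htens M N)"
proof -
  have *: "iso_class H (module_tensor (H_comult G \<chi> g n) A B) = cls (htens M N)"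
    if "A \<in> cls M" "B \<in> cls N" for A B
  proof -
    obtain d \<rho> e \<sigma> where eq: "A = (d, \<rho>)" "B = (e, \<sigma>)" by (metis surj_pair)
    have A: "(rep_of M, A) \<in> module_iso H" and B: "(rep_of N, B) \<in> module_iso H"
      using that by (auto simp: cls_def iso_class_def)
    have AB: "A \<in> fd_modules H" "B \<in> fd_modules H" using A B by (auto simp: module_iso_def)
    obtain X Y where M': "(d, X, Y) \<in> hmods" "\<And>x. x \<in> carrier H \<Longrightarrow> \<rho> x = snd (rep_of (d, X, Y)) x"
      using fd_modules_rep AB(1) unfolding eq by metis
    obtain X' Y' where N': "(e, X', Y') \<in> hmods" "\<And>x. x \<in> carrier H \<Longrightarrow> \<sigma> x = snd (rep_of (e, X', Y')) x"
      using fd_modules_rep AB(2) unfolding eq by metis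
    have iM: "hiso M (d, X, Y)"
      using A iso_class_cong[of d "snd (rep_of (d, X, Y))" \<rho>] rep_of_fd_modules[OF M'(1)] M'(2)
        iso_class_eq_iff[OF rep_of_fd_modules[OF M] AB(1)] cls_eq_iff[OF M M'(1)]
      by (simp add: eq cls_def)
    have iN: "hiso N (e, X', Y')"
      using B iso_class_cong[of e "snd (rep_of (e, X', Y'))" \<sigma>] rep_of_fd_modules[OF N'(1)] N'(2)
        iso_class_eq_iff[OF rep_of_fd_modules[OF N] AB(2)] cls_eq_iff[OF N N'(1)]
      by (simp add: eq cls_def)
    let ?MN = "htens (d, X, Y) (e, X', Y')"
    have MN: "?MN \<in> hmods" using htens_hmods[OF M'(1) N'(1)] .
    have "snd (module_tensor (H_comult G \<chi> g n) (d, \<rho>) (e, \<sigma>)) x = snd (rep_of ?MN) x"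
      if x: "x \<in> carrier H" for x
    proof -
      note R = module_tensor_rep[OF M'(1) N'(1) refl refl x]
      have b: "bas a \<in> carrier H" if "a \<in> H_basis G n" for a using that by (simp add: hopf_carrier)
      have "snd (module_tensor (H_comult G \<chi> g n) (d, \<rho>) (e, \<sigma>)) x =
          evm (d * e) (\<lambda>(a, b). kronecker (\<rho> (bas a)) (\<sigma> (bas b))) (H_comult G \<chi> g n x)"
        by (simp add: evm_def split_def)
      also have "\<dots> = evm (d * e) (ev2 (d, X, Y) (e, X', Y')) (H_comult G \<chi> g n x)"
        using R(2) b by (intro evm_cong) (auto simp: ev2_def M'(2) N'(2))
      finally show ?thesis using R(1) by simp
    qed
    then have "iso_class H (module_tensor (H_comult G \<chi> g n) A B) = cls ?MN"
      using iso_class_cong[of "d * e" "snd (rep_of ?MN)" "snd (module_tensor (H_comult G \<chi> g n) (d, \<rho>) (e, \<sigma>))"]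
        rep_of_fd_modules[OF MN] by (simp add: eq cls_def)
    also have "\<dots> = cls (htens M N)"
      using htens_hiso[OF M M'(1) iM N N'(1) iN] cls_eq_iff[OF htens_hmods[OF M N] MN] by simp
    finally show ?thesis .
  qed
  moreover have "rep_of M \<in> cls M" "rep_of N \<in> cls N"
    using equiv_class_self[OF module_iso_equiv] rep_of_fd_modules M N by (auto simp: cls_def iso_class_def)
  ultimately show ?thesis unfolding class_tensor_def by blast
qed

lemma trivial_module_cls: "iso_class H (trivial_module H_counit) = cls htriv"
proof -
  have "mat 1 1 (\<lambda>_. H_counit x) = snd (rep_of htriv) x" for x :: "nat \<times> 'a \<Rightarrow>\<^sub>0 'k"
  proof -
    \<comment> \<open>The case \<open>i = 0\<close> rests on \<open>0 ^ 0 = 1\<close>, for matrices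
      and for scalars alike, so that group elements act by 1.\<close>
    have "(0\<^sub>m 1 1 ^\<^sub>m i * 1\<^sub>m 1 :: 'k mat) $$ (0, 0) = 0 ^ i" for i
      by (cases i) auto
    then show ?thesis
      by (intro eq_matI) (auto simp: H_counit_def htriv_def index_evm split_def)
  qed
  then have "trivial_module H_counit = rep_of htriv"
    by (simp add: trivial_module_def prod_eq_iff fun_eq_iff) (simp add: htriv_def)
  then show ?thesis by (simp add: cls_def)
qed

lemma evm_four_block:
  assumes "\<And>b. b \<in> Poly_Mapping.keys x \<Longrightarrow> m b \<in> carrier_mat d d"
    "\<And>b. b \<in> Poly_Mapping.keys x \<Longrightarrow> m' b \<in> carrier_mat e e"
  shows "evm (d + e) (\<lambda>b. four_block_mat (m b) (0\<^sub>m d e) (0\<^sub>m e d) (m' b)) x =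
    four_block_mat (evm d m x) (0\<^sub>m d e) (0\<^sub>m e d) (evm e m' x)"
proof (intro eq_matI, goal_cases)
  case (1 i j)
  have [simp]: "dim_row (m b) = d" "dim_col (m b) = d" "dim_row (m' b) = e" "dim_col (m' b) = e"
    if "b \<in> Poly_Mapping.keys x" for b using assms[OF that] by auto
  from 1 show ?case by (auto simp: index_evm)
qed auto

lemma module_sum_cls:
  assumes "A \<in> fd_modules H" "B \<in> fd_modules H"
  obtains M N where "M \<in> hmods" "N \<in> hmods" "iso_class H A = cls M" "iso_class H B = cls N"
    "iso_class H (module_sum A B) = cls (hsum M N)"
proof -
  obtain d \<rho> e \<sigma> where eq: "A = (d, \<rho>)" "B = (e, \<sigma>)" by (metis surj_pair)
  obtain X Y where M: "(d, X, Y) \<in> hmods" "\<And>x. x \<in> carrier H \<Longrightarrow> \<rho> x = snd (rep_of (d, X, Y)) x"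
    using fd_modules_rep assms(1) unfolding eq by metis
  obtain X' Y' where N: "(e, X', Y') \<in> hmods" "\<And>x. x \<in> carrier H \<Longrightarrow> \<sigma> x = snd (rep_of (e, X', Y')) x"
    using fd_modules_rep assms(2) unfolding eq by metis
  note D = hmodsD[OF M(1)] and GD = gmodD[OF hmodsD(1)[OF M(1)]]
  note D' = hmodsD[OF N(1)] and GD' = gmodD[OF hmodsD(1)[OF N(1)]]
  let ?MN = "hsum (d, X, Y) (e, X', Y')"
  have "iso_class H (d, \<rho>) = cls (d, X, Y)" "iso_class H (e, \<sigma>) = cls (e, X', Y')"
    unfolding cls_def using iso_class_cong[of d "snd (rep_of (d, X, Y))" \<rho>] rep_of_fd_modules[OF M(1)] M(2)
      iso_class_cong[of e "snd (rep_of (e, X', Y'))" \<sigma>] rep_of_fd_modules[OF N(1)] N(2) by simp_all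
  moreover have "snd (module_sum (d, \<rho>) (e, \<sigma>)) x = snd (rep_of ?MN) x" if x: "x \<in> carrier H" for x
  proof -
    have k: "b \<in> Poly_Mapping.keys x \<Longrightarrow> snd b \<in> carrier G" for b
      using x by (auto simp: hopf_carrier H_basis_def)
    have c: "Y ^\<^sub>m i * X h \<in> carrier_mat d d" "Y' ^\<^sub>m i * X' h \<in> carrier_mat e e" if "h \<in> carrier G" for i h
      using that D(3,4) D'(3,4) GD(4,5) GD'(4,5) by (auto intro!: carrier_matI)
    have "snd (rep_of ?MN) x = evm (d + e) (\<lambda>b. four_block_mat (case b of (i, h) \<Rightarrow> Y ^\<^sub>m i * X h) (0\<^sub>m d e) (0\<^sub>m e d)
        (case b of (i, h) \<Rightarrow> Y' ^\<^sub>m i * X' h)) x"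
      unfolding hsum.simps rep_of.simps snd_conv
    proof (intro evm_cong)
      fix b assume "b \<in> Poly_Mapping.keys x"
      then obtain i h where b: "b = (i, h)" "h \<in> carrier G" using k by (cases b) auto
      have "Y ^\<^sub>m i \<in> carrier_mat d d" "Y' ^\<^sub>m i \<in> carrier_mat e e" using D D' by auto
      then show "(case b of (i, h) \<Rightarrow> four_block_mat Y (0\<^sub>m d e) (0\<^sub>m e d) Y' ^\<^sub>m i *
          four_block_mat (X h) (0\<^sub>m d e) (0\<^sub>m e d) (X' h)) =
        four_block_mat (case b of (i, h) \<Rightarrow> Y ^\<^sub>m i * X h) (0\<^sub>m d e) (0\<^sub>m e d) (case b of (i, h) \<Rightarrow> Y' ^\<^sub>m i * X' h)"
        using D(2) D'(2) GD(1)[OF b(2)] GD'(1)[OF b(2)]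
        by (simp add: b(1) pow_four_block_mat[of _ d _ e] mult_four_block_mat[of _ d d _ e _ e _ _ d _ e])
    qed
    also have "\<dots> = four_block_mat (\<rho> x) (0\<^sub>m d e) (0\<^sub>m e d) (\<sigma> x)"
      using k c by (subst evm_four_block) (auto simp: M(2)[OF x] N(2)[OF x])
    finally show ?thesis by simp
  qed
  then have "iso_class H (module_sum A B) = cls ?MN"
    using iso_class_cong[of "d + e" "snd (rep_of ?MN)" "snd (module_sum (d, \<rho>) (e, \<sigma>))"]
      rep_of_fd_modules[OF hsum_hmods[OF M(1) N(1)]] by (simp add: eq cls_def)
  ultimately show ?thesis using that[OF M(1) N(1)] eq by simp
qed

end


section \<open>Distributivity and the ring of formal sums of classes\<close>

lemma mat_add_assoc:
  fixes A B C :: "'k::field mat"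
  shows "dim_row A = dim_row B \<Longrightarrow> dim_col A = dim_col B \<Longrightarrow> dim_row C = dim_row B \<Longrightarrow> dim_col C = dim_col B \<Longrightarrow>
    A + B + C = A + (B + C)"
  by (intro eq_matI) auto

lemma four_block_in:
  fixes A B :: "'k::field mat"
  assumes "A \<in> carrier_mat a a" "B \<in> carrier_mat b b"
  shows "four_block_mat A (0\<^sub>m a b) (0\<^sub>m b a) B * in1 a b = in1 a b * A"
    "four_block_mat A (0\<^sub>m a b) (0\<^sub>m b a) B * in2 a b = in2 a b * B"
  using carrier_matD[OF assms(1)] carrier_matD[OF assms(2)]
  by (simp_all add: four_block_biprod[OF assms] mat_left_distrib mat_assoc)

context green_datum
begin

fun hhom :: "('a, 'k) hmod \<Rightarrow> ('a, 'k) hmod \<Rightarrow> 'k mat \<Rightarrow> bool"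
  where "hhom (d, X, Y) (e, X', Y') J \<longleftrightarrow> J \<in> carrier_mat e d \<and>
    (\<forall>h\<in>carrier G. X' h * J = J * X h) \<and> Y' * J = J * Y"

text \<open>\<open>K1\<close> and \<open>K2\<close> are merely linear: joint surjectivity of
  \<open>J1\<close> and \<open>J2\<close> together with the count of dimensions already makes the
  combined homomorphism bijective.\<close>

lemma hiso_hsum:
  assumes M: "M \<in> hmods" "M1 \<in> hmods" "M2 \<in> hmods" and J: "hhom M1 M J1" "hhom M2 M J2"
    and K: "K1 \<in> carrier_mat (fst M1) (fst M)" "K2 \<in> carrier_mat (fst M2) (fst M)"
    and s: "J1 * K1 + J2 * K2 = 1\<^sub>m (fst M)" and d: "fst M = fst M1 + fst M2"
  shows "hiso M (hsum M1 M2)"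
proof -
  obtain d X Y d1 X1 Y1 d2 X2 Y2 where eq: "M = (d, X, Y)" "M1 = (d1, X1, Y1)" "M2 = (d2, X2, Y2)"
    by (metis surj_pair)
  note D = hmodsD[OF M(1)[unfolded eq]] hmodsD[OF M(2)[unfolded eq]] hmodsD[OF M(3)[unfolded eq]]
  have J': "J1 \<in> carrier_mat d d1" "J2 \<in> carrier_mat d d2" "Y * J1 = J1 * Y1" "Y * J2 = J2 * Y2"
    "\<And>h. h \<in> carrier G \<Longrightarrow> X h * J1 = J1 * X1 h" "\<And>h. h \<in> carrier G \<Longrightarrow> X h * J2 = J2 * X2 h"
    using J by (auto simp: eq)
  have dd: "d = d1 + d2" using d by (simp add: eq)
  obtain P P' where P: "P \<in> carrier_mat d d" "P' \<in> carrier_mat d d" "P * P' = 1\<^sub>m d" "P' * P = 1\<^sub>m d"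
    "\<And>T T1 T2. T \<in> carrier_mat d d \<Longrightarrow> T1 \<in> carrier_mat d1 d1 \<Longrightarrow> T2 \<in> carrier_mat d2 d2 \<Longrightarrow>
      T * J1 = J1 * T1 \<Longrightarrow> T * J2 = J2 * T2 \<Longrightarrow>
      P * T = four_block_mat T1 (0\<^sub>m d1 d2) (0\<^sub>m d2 d1) T2 * P"
    using direct_sum_iso[OF J'(1,2), of K1 K2] K s dd by (auto simp: eq)
  have 1: "P * X h = four_block_mat (X1 h) (0\<^sub>m d1 d2) (0\<^sub>m d2 d1) (X2 h) * P" if h: "h \<in> carrier G" for h
    by (rule P(5)[OF gmodD(1)[OF D(1) h] gmodD(1)[OF D(7) h] gmodD(1)[OF D(13) h] J'(5)[OF h] J'(6)[OF h]])
  have 2: "P * Y = four_block_mat Y1 (0\<^sub>m d1 d2) (0\<^sub>m d2 d1) Y2 * P"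
    by (rule P(5)[OF D(2) D(8) D(14) J'(3,4)])
  show ?thesis unfolding eq hsum.simps hiso.simps
    by (rule conjI[OF dd], rule bexI[OF _ P(1)], rule bexI[OF _ P(2)]) (use P(3,4) 1 2 in auto)
qed

lemma hsum_tens_left:
  assumes M: "M \<in> hmods" and N: "N \<in> hmods" and L: "L \<in> hmods"
  shows "hiso (htens L (hsum M N)) (hsum (htens L M) (htens L N))"
proof -
  obtain d X Y e X' Y' f X'' Y'' where eq: "M = (d, X, Y)" "N = (e, X', Y')" "L = (f, X'', Y'')" by (metis surj_pair)
  note D = hmodsD[OF M[unfolded eq]] hmodsD[OF N[unfolded eq]] hmodsD[OF L[unfolded eq]]
  note GD = gmodD(1)[OF D(1)] gmodD(1)[OF D(7)] gmodD(1)[OF D(13)]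
  note [simp] = D(3,4) D(9,10) D(15,16) gmodD(4,5)[OF D(1)] gmodD(4,5)[OF D(7)] gmodD(4,5)[OF D(13)] g_closed
    four_block_in[OF D(2) D(8)] four_block_in[OF GD(1) GD(2)]
  show ?thesis
  proof (rule hiso_hsum)
    show "hhom (htens L M) (htens L (hsum M N)) (kronecker (1\<^sub>m f) (in1 d e))"
      by (auto simp: eq kron_mult mat_left_distrib mat_right_distrib intro!: carrier_matI)
    show "hhom (htens L N) (htens L (hsum M N)) (kronecker (1\<^sub>m f) (in2 d e))"
      by (auto simp: eq kron_mult mat_left_distrib mat_right_distrib intro!: carrier_matI)
    show "kronecker (1\<^sub>m f) (in1 d e) * kronecker (1\<^sub>m f) (pr1 d e) +
        kronecker (1\<^sub>m f) (in2 d e) * kronecker (1\<^sub>m f) (pr2 d e) = 1\<^sub>m (fst (htens L (hsum M N)))"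
      by (simp add: eq kron_mult biprod_sum flip: kron_add_right)
    show "kronecker (1\<^sub>m f) (pr1 d e) \<in> carrier_mat (fst (htens L M)) (fst (htens L (hsum M N)))"
      "kronecker (1\<^sub>m f) (pr2 d e) \<in> carrier_mat (fst (htens L N)) (fst (htens L (hsum M N)))"
      by (auto simp: eq intro!: carrier_matI)
    show "fst (htens L (hsum M N)) = fst (htens L M) + fst (htens L N)"
      by (simp add: eq distrib_left)
  qed (intro htens_hmods hsum_hmods M N L)+
qed

lemma hsum_tens_right:
  assumes M: "M \<in> hmods" and N: "N \<in> hmods" and L: "L \<in> hmods"
  shows "hiso (htens (hsum M N) L) (hsum (htens M L) (htens N L))"
proof -
  obtain d X Y e X' Y' f X'' Y'' where eq: "M = (d, X, Y)" "N = (e, X', Y')" "L = (f, X'', Y'')" by (metis surj_pair)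
  note D = hmodsD[OF M[unfolded eq]] hmodsD[OF N[unfolded eq]] hmodsD[OF L[unfolded eq]]
  note GD = gmodD(1)[OF D(1)] gmodD(1)[OF D(7)] gmodD(1)[OF D(13)]
  note [simp] = D(3,4) D(9,10) D(15,16) gmodD(4,5)[OF D(1)] gmodD(4,5)[OF D(7)] gmodD(4,5)[OF D(13)] g_closed
    four_block_in[OF D(2) D(8)] four_block_in[OF GD(1) GD(2)]
  show ?thesis
  proof (rule hiso_hsum)
    show "hhom (htens M L) (htens (hsum M N) L) (kronecker (in1 d e) (1\<^sub>m f))"
      by (auto simp: eq kron_mult mat_left_distrib mat_right_distrib intro!: carrier_matI)
    show "hhom (htens N L) (htens (hsum M N) L) (kronecker (in2 d e) (1\<^sub>m f))"
      by (auto simp: eq kron_mult mat_left_distrib mat_right_distrib intro!: carrier_matI)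
    show "kronecker (in1 d e) (1\<^sub>m f) * kronecker (pr1 d e) (1\<^sub>m f) +
        kronecker (in2 d e) (1\<^sub>m f) * kronecker (pr2 d e) (1\<^sub>m f) = 1\<^sub>m (fst (htens (hsum M N) L))"
      by (simp add: eq kron_mult biprod_sum flip: kron_add_left)
    show "kronecker (pr1 d e) (1\<^sub>m f) \<in> carrier_mat (fst (htens M L)) (fst (htens (hsum M N) L))"
      "kronecker (pr2 d e) (1\<^sub>m f) \<in> carrier_mat (fst (htens N L)) (fst (htens (hsum M N) L))"
      by (auto simp: eq intro!: carrier_matI)
    show "fst (htens (hsum M N) L) = fst (htens M L) + fst (htens N L)"
      by (simp add: eq distrib_right)
  qed (intro htens_hmods hsum_hmods M N L)+
qed

definition "FF = free_class_ring H (H_comult G \<chi> g n) H_counit"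
definition "II = sum_relations H (H_comult G \<chi> g n) H_counit"
abbreviation "RR \<equiv> green_ring_H G \<chi> g n"

lemma htens_assoc:
  assumes "M \<in> hmods" "N \<in> hmods" "L \<in> hmods"
  shows "htens (htens M N) L = htens M (htens N L)"
proof -
  obtain d X Y e X' Y' f X'' Y'' where eq: "M = (d, X, Y)" "N = (e, X', Y')" "L = (f, X'', Y'')" by (metis surj_pair)
  note D = hmodsD[OF assms(1)[unfolded eq]] hmodsD[OF assms(2)[unfolded eq]] hmodsD[OF assms(3)[unfolded eq]]
  note [simp] = D(3,4) D(9,10) D(15,16) gmodD(4,5)[OF D(1)] gmodD(4,5)[OF D(7)] gmodD(4,5)[OF D(13)] g_closed
  show ?thesis
    by (simp add: eq mult.assoc kron_assoc kron_add_left kron_add_right mat_add_assoc flip: kron_one)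
qed

lemma htens_one: "M \<in> hmods \<Longrightarrow> htens htriv M = M" "M \<in> hmods \<Longrightarrow> htens M htriv = M"
proof -
  assume M: "M \<in> hmods"
  obtain d X Y where eq: "M = (d, X, Y)" by (metis surj_pair)
  note D = hmodsD[OF M[unfolded eq]]
  have "dim_row (X g) = d" "dim_col (X g) = d" using gmodD(4,5)[OF D(1) g_closed] by auto
  then show "htens htriv M = M" "htens M htriv = M"
    using D(3,4) by (simp_all add: eq htriv_def)
qed

lemma FF_simps:
  "carrier FF = {x. Poly_Mapping.keys x \<subseteq> cls ` hmods}" "\<zero>\<^bsub>FF\<^esub> = 0" "x \<oplus>\<^bsub>FF\<^esub> y = x + y"
  "\<one>\<^bsub>FF\<^esub> = frag_of (cls htriv)"
  by (simp_all add: FF_def free_class_ring_def basis_algebra_def classes trivial_module_cls)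

lemma FF_mult_cls:
  "M \<in> hmods \<Longrightarrow> N \<in> hmods \<Longrightarrow> frag_of (cls M) \<otimes>\<^bsub>FF\<^esub> frag_of (cls N) = frag_of (cls (htens M N))"
  by (simp add: FF_def free_class_ring_def basis_algebra_def bilin_ext_def class_tensor_cls)

lemma FF_ring: "ring FF"
  unfolding FF_def free_class_ring_def classes trivial_module_cls
proof (rule basis_algebra_ring, goal_cases)
  case (2 a b)
  then obtain M N where eq: "a = cls M" "b = cls N" and M: "M \<in> hmods" "N \<in> hmods" by blast
  then show ?case using htens_hmods[OF M] by (simp add: class_tensor_cls)
next
  case (3 a b c)
  then obtain M N L where eq: "a = cls M" "b = cls N" "c = cls L" and M: "M \<in> hmods" "N \<in> hmods" "L \<in> hmods" by blast
  then show ?case by (simp add: class_tensor_cls htens_hmods htens_assoc)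
next
  case (4 a)
  then obtain M where "a = cls M" "M \<in> hmods" by blast
  then show ?case by (simp add: class_tensor_cls htriv_hmods htens_one)
next
  case (5 a)
  then obtain M where "a = cls M" "M \<in> hmods" by blast
  then show ?case by (simp add: class_tensor_cls htriv_hmods htens_one)
qed (simp add: htriv_hmods)

interpretation F: ring FF by (rule FF_ring)

lemma FF_minus: "x \<in> carrier FF \<Longrightarrow> \<ominus>\<^bsub>FF\<^esub> x = - x"
  by (rule F.minus_equality) (auto simp: FF_simps)

lemma FF_diff: "x \<in> carrier FF \<Longrightarrow> y \<in> carrier FF \<Longrightarrow> x \<ominus>\<^bsub>FF\<^esub> y = x - y"
proof -
  assume "y \<in> carrier FF"
  then have "x \<ominus>\<^bsub>FF\<^esub> y = x + - y" unfolding a_minus_def FF_simps(3) by (simp only: FF_minus)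
  then show ?thesis by simp
qed

lemma FF_diff_closed: "x \<in> carrier FF \<Longrightarrow> y \<in> carrier FF \<Longrightarrow> x - y \<in> carrier FF"
  using F.minus_closed[of x y] FF_diff[of x y] by simp

lemma cls_FF: "M \<in> hmods \<Longrightarrow> frag_of (cls M) \<in> carrier FF"
  by (auto simp: FF_simps)

definition "rel_gens = {frag_of (cls (hsum M N)) - frag_of (cls M) - frag_of (cls N) | M N. M \<in> hmods \<and> N \<in> hmods}"

lemma rel_gensI:
  "M \<in> hmods \<Longrightarrow> N \<in> hmods \<Longrightarrow> frag_of (cls (hsum M N)) - frag_of (cls M) - frag_of (cls N) \<in> rel_gens"
  unfolding rel_gens_def by blast

lemma rel_gensE:
  assumes "x \<in> rel_gens"
  obtains M N where "M \<in> hmods" "N \<in> hmods" "x = frag_of (cls (hsum M N)) - frag_of (cls M) - frag_of (cls N)"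
  using assms unfolding rel_gens_def by blast

lemma II_eq: "II = generate (add_monoid FF) rel_gens"
proof -
  have "{frag_of (iso_class H (module_sum M N)) - frag_of (iso_class H M) - frag_of (iso_class H N)
      | M N. M \<in> fd_modules H \<and> N \<in> fd_modules H} = rel_gens" (is "?A = _")
  proof (intro equalityI subsetI)
    fix x assume "x \<in> ?A"
    then obtain A B where AB: "A \<in> fd_modules H" "B \<in> fd_modules H"
      "x = frag_of (iso_class H (module_sum A B)) - frag_of (iso_class H A) - frag_of (iso_class H B)" by blast
    obtain M N where *: "M \<in> hmods" "N \<in> hmods" "iso_class H A = cls M" "iso_class H B = cls N"
      "iso_class H (module_sum A B) = cls (hsum M N)" using module_sum_cls[OF AB(1,2)] .
    show "x \<in> rel_gens" unfolding AB(3) *(3-5) by (rule rel_gensI[OF *(1,2)])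
  next
    fix x assume "x \<in> rel_gens"
    then obtain M N where MN: "M \<in> hmods" "N \<in> hmods" "x = frag_of (cls (hsum M N)) - frag_of (cls M) - frag_of (cls N)" by (rule rel_gensE)
    have *: "cls (hsum M N) = iso_class H (module_sum (rep_of M) (rep_of N))"
    proof -
      obtain d X Y e X' Y' where eq: "M = (d, X, Y)" "N = (e, X', Y')" by (metis surj_pair)
      note D = hmodsD[OF MN(1)[unfolded eq]] hmodsD[OF MN(2)[unfolded eq]]
      note GD = gmodD[OF D(1)] gmodD[OF D(7)]
      have "snd (module_sum (rep_of M) (rep_of N)) x = snd (rep_of (hsum M N)) x" if x: "x \<in> carrier H" for x
      proof -
        have k: "b \<in> Poly_Mapping.keys x \<Longrightarrow> snd b \<in> carrier G" for b
          using x by (auto simp: hopf_carrier H_basis_def)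
        have c: "Y ^\<^sub>m i * X h \<in> carrier_mat d d" "Y' ^\<^sub>m i * X' h \<in> carrier_mat e e" if "h \<in> carrier G" for i h
          using that D(3,4) D(9,10) GD(4,5) GD(12,13) by (auto intro!: carrier_matI)
        have "snd (module_sum (rep_of M) (rep_of N)) x = evm (d + e) (\<lambda>b. four_block_mat
            (case b of (i, h) \<Rightarrow> Y ^\<^sub>m i * X h) (0\<^sub>m d e) (0\<^sub>m e d) (case b of (i, h) \<Rightarrow> Y' ^\<^sub>m i * X' h)) x"
          using k c by (subst evm_four_block) (auto simp: eq)
        also have "\<dots> = snd (rep_of (hsum M N)) x"
          unfolding eq hsum.simps rep_of.simps snd_conv
        proof (intro evm_cong)
          fix b assume "b \<in> Poly_Mapping.keys x"
          then obtain i h where b: "b = (i, h)" "h \<in> carrier G" using k by (cases b) auto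
          have "Y ^\<^sub>m i \<in> carrier_mat d d" "Y' ^\<^sub>m i \<in> carrier_mat e e" using D by auto
          then show "four_block_mat (case b of (i, h) \<Rightarrow> Y ^\<^sub>m i * X h) (0\<^sub>m d e) (0\<^sub>m e d) (case b of (i, h) \<Rightarrow> Y' ^\<^sub>m i * X' h) =
              (case b of (i, h) \<Rightarrow> four_block_mat Y (0\<^sub>m d e) (0\<^sub>m e d) Y' ^\<^sub>m i *
            four_block_mat (X h) (0\<^sub>m d e) (0\<^sub>m e d) (X' h))"
            using D(2) D(8) GD(1)[OF b(2)] GD(9)[OF b(2)]
            by (simp add: b(1) pow_four_block_mat[of _ d _ e] mult_four_block_mat[of _ d d _ e _ e _ _ d _ e])
        qed
        finally show ?thesis .
      qed
      then show ?thesis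
        using iso_class_cong[of "d + e" "snd (rep_of (hsum M N))" "snd (module_sum (rep_of M) (rep_of N))"]
          rep_of_fd_modules[OF hsum_hmods[OF MN(1,2)]] by (simp add: eq cls_def)
    qed
    show "x \<in> ?A"
      unfolding MN(3) * cls_def[of M] cls_def[of N] using rep_of_fd_modules[OF MN(1)] rep_of_fd_modules[OF MN(2)] by blast
  qed
  then show ?thesis by (simp only: II_def sum_relations_def FF_def)
qed

end


section \<open>The ideal of direct sum relations and the quotient ring\<close>

context green_datum
begin

interpretation F: ring FF by (rule FF_ring)

lemma rel_gens_carrier: "rel_gens \<subseteq> carrier FF"
proof
  fix x assume "x \<in> rel_gens"
  then obtain M N where MN: "M \<in> hmods" "N \<in> hmods" "x = frag_of (cls (hsum M N)) - frag_of (cls M) - frag_of (cls N)" by (rule rel_gensE)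
  show "x \<in> carrier FF"
    unfolding MN(3) by (intro FF_diff_closed cls_FF hsum_hmods MN(1,2))
qed

lemma II_subgroup: "subgroup II (add_monoid FF)"
proof -
  have "rel_gens \<subseteq> carrier (add_monoid FF)"
    using rel_gens_carrier by (simp only: partial_object.select_convs)
  then show ?thesis unfolding II_eq by (rule group.generate_is_subgroup[OF F.a_group])
qed

lemma II_add: "x \<in> II \<Longrightarrow> y \<in> II \<Longrightarrow> x + y \<in> II" and II_zero: "0 \<in> II"
  and II_minus: "x \<in> II \<Longrightarrow> - x \<in> II" and II_carrier: "x \<in> II \<Longrightarrow> x \<in> carrier FF"
proof -
  interpret I: subgroup II "add_monoid FF" by (rule II_subgroup)
  show "x \<in> II \<Longrightarrow> y \<in> II \<Longrightarrow> x + y \<in> II" using I.m_closed[of x y] by (simp add: FF_simps)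
  show "0 \<in> II" using I.one_closed by (simp add: FF_simps)
  show c: "x \<in> II \<Longrightarrow> x \<in> carrier FF" for x using I.mem_carrier[of x] by simp
  show "x \<in> II \<Longrightarrow> - x \<in> II" using I.m_inv_closed[of x] c[of x] FF_minus[of x] by (simp add: a_inv_def)
qed

lemma II_diff: "x \<in> II \<Longrightarrow> y \<in> II \<Longrightarrow> x - y \<in> II"
  using II_add[OF _ II_minus] by simp

lemma rel_in_II:
  "M \<in> hmods \<Longrightarrow> N \<in> hmods \<Longrightarrow> frag_of (cls (hsum M N)) - frag_of (cls M) - frag_of (cls N) \<in> II"
  unfolding II_eq by (intro generate.incl rel_gensI)

text \<open>In the generated subgroup the negative of \<open>x\<close> is \<open>0 - x\<close> and a
  sum is \<open>x - (0 - y)\<close>, so a single closure rule for differences covers both.\<close>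

lemma II_induct [consumes 1, case_names zero gen diff]:
  assumes "x \<in> II" "P 0" "\<And>M N. M \<in> hmods \<Longrightarrow> N \<in> hmods \<Longrightarrow>
      P (frag_of (cls (hsum M N)) - frag_of (cls M) - frag_of (cls N))"
    and "\<And>x y. x \<in> carrier FF \<Longrightarrow> y \<in> carrier FF \<Longrightarrow> P x \<Longrightarrow> P y \<Longrightarrow> P (x - y)"
  shows "P x"
proof -
  have "x \<in> carrier FF \<and> P x" using assms(1) unfolding II_eq
  proof (induction rule: generate.induct)
    case one
    show ?case using assms(2) by (simp add: FF_simps)
  next
    case (incl h)
    then obtain M N where "M \<in> hmods" "N \<in> hmods" "h = frag_of (cls (hsum M N)) - frag_of (cls M) - frag_of (cls N)" by (rule rel_gensE)
    then have "P h" using assms(3) by simp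
    then show ?case using subsetD[OF rel_gens_carrier incl] by blast
  next
    case (inv h)
    then obtain M N where "M \<in> hmods" "N \<in> hmods" "h = frag_of (cls (hsum M N)) - frag_of (cls M) - frag_of (cls N)" by (rule rel_gensE)
    then have "P h" using assms(3) by simp
    then have h: "h \<in> carrier FF" "P h" using subsetD[OF rel_gens_carrier inv] by blast+
    have "inv\<^bsub>add_monoid FF\<^esub> h = 0 - h" using FF_minus[OF h(1)] by (simp add: a_inv_def)
    moreover have "P (0 - h)" using assms(4)[OF F.zero_closed[unfolded FF_simps(2)] h(1) assms(2) h(2)] .
    moreover have "0 - h \<in> carrier FF" using h by (simp add: FF_simps(1))
    ultimately show ?case by simp
  next
    case (eng h1 h2)
    then have "P (h1 - (0 - h2))"
      using assms(2,4) F.zero_closed by (metis FF_simps(2) F.minus_closed FF_diff)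
    with eng show ?case using F.a_closed[of h1 h2] by (simp add: FF_simps(3))
  qed
  then show ?thesis by simp
qed

lemma frag_FF_induct [consumes 1, case_names zero cls diff]:
  assumes "x \<in> carrier FF" "P 0" "\<And>M. M \<in> hmods \<Longrightarrow> P (frag_of (cls M))"
    "\<And>x y. x \<in> carrier FF \<Longrightarrow> y \<in> carrier FF \<Longrightarrow> P x \<Longrightarrow> P y \<Longrightarrow> P (x - y)"
  shows "P x"
proof -
  have "Poly_Mapping.keys x \<subseteq> cls ` hmods" using assms(1) by (simp add: FF_simps)
  then have "x \<in> carrier FF \<and> P x"
  proof (induction rule: frag_induction)
    case (diff a b)
    then show ?case using assms(4) F.minus_closed[of a b] by (simp add: FF_diff)
  qed (use assms(2,3) cls_FF F.zero_closed in \<open>auto simp: FF_simps(2)\<close>)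
  then show ?thesis by simp
qed

text \<open>On a generator and a class, absorption is the distributivity of the tensor product over
  direct sums; the nested inductions extend this additively in both arguments.\<close>

lemma II_ideal: "ideal II FF"
proof (rule idealI[OF FF_ring II_subgroup])
  have distr: "x \<otimes>\<^bsub>FF\<^esub> (y - z) = x \<otimes>\<^bsub>FF\<^esub> y - x \<otimes>\<^bsub>FF\<^esub> z"
      "(y - z) \<otimes>\<^bsub>FF\<^esub> x = y \<otimes>\<^bsub>FF\<^esub> x - z \<otimes>\<^bsub>FF\<^esub> x"
    if "x \<in> carrier FF" "y \<in> carrier FF" "z \<in> carrier FF" for x y z
  proof -
    have "x \<otimes>\<^bsub>FF\<^esub> (y \<ominus>\<^bsub>FF\<^esub> z) = x \<otimes>\<^bsub>FF\<^esub> y \<ominus>\<^bsub>FF\<^esub> x \<otimes>\<^bsub>FF\<^esub> z"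
      "(y \<ominus>\<^bsub>FF\<^esub> z) \<otimes>\<^bsub>FF\<^esub> x = y \<otimes>\<^bsub>FF\<^esub> x \<ominus>\<^bsub>FF\<^esub> z \<otimes>\<^bsub>FF\<^esub> x"
      using that by (simp_all add: a_minus_def F.r_distr F.l_distr F.r_minus F.l_minus)
    then show "x \<otimes>\<^bsub>FF\<^esub> (y - z) = x \<otimes>\<^bsub>FF\<^esub> y - x \<otimes>\<^bsub>FF\<^esub> z"
      "(y - z) \<otimes>\<^bsub>FF\<^esub> x = y \<otimes>\<^bsub>FF\<^esub> x - z \<otimes>\<^bsub>FF\<^esub> x"
      using that by (simp_all add: FF_diff)
  qed
  have z: "x \<otimes>\<^bsub>FF\<^esub> 0 = 0" "0 \<otimes>\<^bsub>FF\<^esub> x = 0" if "x \<in> carrier FF" for x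
    using F.r_null[OF that] F.l_null[OF that] by (simp_all add: FF_simps(2))
  note [simp] = distr cls_FF hsum_hmods FF_mult_cls htens_hmods
  have sub [simp]: "x - y \<in> carrier FF" if "x \<in> carrier FF" "y \<in> carrier FF" for x y
    using F.minus_closed[OF that] FF_diff[OF that] by simp
  fix i x assume i: "i \<in> II" and x: "x \<in> carrier FF"
  show "x \<otimes>\<^bsub>FF\<^esub> i \<in> II" using i
  proof (induction rule: II_induct)
    case (gen M N)
    show ?case using x
    proof (induction rule: frag_FF_induct)
      case (cls L)
      have "cls (htens L (hsum M N)) = cls (hsum (htens L M) (htens L N))"
        using hsum_tens_left[OF gen cls] gen cls by (simp add: cls_eq_iff)
      then show ?case using rel_in_II[of "htens L M" "htens L N"] gen cls by simp
    next
      case (diff a b)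
      show ?case
        unfolding distr(2)[OF subsetD[OF rel_gens_carrier rel_gensI[OF gen]] diff(1,2)] by (rule II_diff[OF diff(3,4)])
    qed (use gen in \<open>simp add: z II_zero\<close>)
  qed (use x z II_zero II_diff in auto)
  show "i \<otimes>\<^bsub>FF\<^esub> x \<in> II" using i
  proof (induction rule: II_induct)
    case (gen M N)
    show ?case using x
    proof (induction rule: frag_FF_induct)
      case (cls L)
      have "cls (htens (hsum M N) L) = cls (hsum (htens M L) (htens N L))"
        using hsum_tens_right[OF gen cls] gen cls by (simp add: cls_eq_iff)
      then show ?case using rel_in_II[of "htens M L" "htens N L"] gen cls by simp
    next
      case (diff a b)
      show ?case
        unfolding distr(1)[OF subsetD[OF rel_gens_carrier rel_gensI[OF gen]] diff(1,2)] by (rule II_diff[OF diff(3,4)])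
    qed (use gen in \<open>simp add: z II_zero\<close>)
  qed (use x z II_zero II_diff in auto)
qed

interpretation I: ideal II FF by (rule II_ideal)

lemma RR_eq: "RR = FF Quot II"
  by (simp only: green_ring_H_def green_ring_def FF_def II_def)

lemma RR_ring: "ring RR"
  unfolding RR_eq by (rule I.quotient_is_ring)

text \<open>The class \<open>[M]\<close> in the Green ring.\<close>

definition br :: "('a, 'k) hmod \<Rightarrow> ((nat \<times> 'a, 'k) rep set \<Rightarrow>\<^sub>0 int) set"
  where "br M = II +>\<^bsub>FF\<^esub> frag_of (cls M)"

lemma coset_eq_iff: "x \<in> carrier FF \<Longrightarrow> y \<in> carrier FF \<Longrightarrow> II +>\<^bsub>FF\<^esub> x = II +>\<^bsub>FF\<^esub> y \<longleftrightarrow> x - y \<in> II"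
  using F.quotient_eq_iff_same_a_r_cos[OF II_ideal, of x y] by (simp add: FF_diff)

lemma br_closed [simp]: "M \<in> hmods \<Longrightarrow> br M \<in> carrier RR"
  unfolding RR_eq br_def using ring_hom_closed[OF I.rcos_ring_hom cls_FF] by simp

lemma br_mult: "M \<in> hmods \<Longrightarrow> N \<in> hmods \<Longrightarrow> br M \<otimes>\<^bsub>RR\<^esub> br N = br (htens M N)"
  unfolding RR_eq br_def using ring_hom_mult[OF I.rcos_ring_hom cls_FF cls_FF] by (simp add: FF_mult_cls)

lemma br_one: "\<one>\<^bsub>RR\<^esub> = br htriv"
  unfolding RR_eq br_def using ring_hom_one[OF I.rcos_ring_hom] by (simp add: FF_simps)

lemma br_hiso: "M \<in> hmods \<Longrightarrow> N \<in> hmods \<Longrightarrow> hiso M N \<Longrightarrow> br M = br N"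
  by (simp add: br_def flip: cls_eq_iff)

lemma br_add:
  assumes "M \<in> hmods" "N \<in> hmods"
  shows "br (hsum M N) = br M \<oplus>\<^bsub>RR\<^esub> br N"
proof -
  have "br M \<oplus>\<^bsub>RR\<^esub> br N = II +>\<^bsub>FF\<^esub> (frag_of (cls M) + frag_of (cls N))"
    unfolding RR_eq br_def using ring_hom_add[OF I.rcos_ring_hom cls_FF cls_FF] assms by (simp add: FF_simps)
  also have "\<dots> = br (hsum M N)"
    unfolding br_def using rel_in_II[OF assms] F.a_closed[OF cls_FF cls_FF] assms hsum_hmods
    by (subst eq_commute, subst coset_eq_iff) (simp_all add: cls_FF diff_diff_eq FF_simps(3))
  finally show ?thesis ..
qed

lemma br_surj:
  assumes "e \<in> carrier RR"
  obtains M N where "M \<in> hmods" "N \<in> hmods" "e = br M \<ominus>\<^bsub>RR\<^esub> br N"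
proof -
  interpret R: ring RR by (rule RR_ring)
  obtain x where x: "x \<in> carrier FF" "e = II +>\<^bsub>FF\<^esub> x"
    using assms unfolding RR_eq FactRing_def A_RCOSETS_def' by auto
  have "\<exists>M\<in>hmods. \<exists>N\<in>hmods. II +>\<^bsub>FF\<^esub> x = br M \<ominus>\<^bsub>RR\<^esub> br N" using x(1)
  proof (induction rule: frag_FF_induct)
    case zero
    have "II +>\<^bsub>FF\<^esub> 0 = br htriv \<ominus>\<^bsub>RR\<^esub> br htriv"
      using ring_hom_zero[OF I.rcos_ring_hom FF_ring RR_ring[unfolded RR_eq]] htriv_hmods
      by (simp add: FF_simps RR_eq[symmetric] R.r_neg a_minus_def)
    then show ?case using htriv_hmods by blast
  next
    case (cls M)
    \<comment> \<open>A single class is padded to a difference by adding and subtracting the unit,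
      just as zero is written as \<open>[1] - [1]\<close>.\<close>
    have "hsum M htriv \<in> hmods" using cls htriv_hmods by (rule hsum_hmods)
    moreover have "br M = br (hsum M htriv) \<ominus>\<^bsub>RR\<^esub> br htriv"
      using cls htriv_hmods by (simp add: br_add R.r_neg a_minus_def R.a_assoc)
    ultimately show ?case using htriv_hmods unfolding br_def[of M] by blast
  next
    case (diff x y)
    then obtain M N M' N' where M: "M \<in> hmods" "N \<in> hmods" "II +>\<^bsub>FF\<^esub> x = br M \<ominus>\<^bsub>RR\<^esub> br N"
      "M' \<in> hmods" "N' \<in> hmods" "II +>\<^bsub>FF\<^esub> y = br M' \<ominus>\<^bsub>RR\<^esub> br N'" by blast
    have xy: "x - y \<in> carrier FF" using F.minus_closed[OF diff(1,2)] FF_diff[OF diff(1,2)] by simp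
    have "II +>\<^bsub>FF\<^esub> x = (II +>\<^bsub>FF\<^esub> (x - y)) \<oplus>\<^bsub>RR\<^esub> (II +>\<^bsub>FF\<^esub> y)"
      unfolding RR_eq using ring_hom_add[OF I.rcos_ring_hom xy diff(2)] by (simp add: FF_simps)
    moreover have "II +>\<^bsub>FF\<^esub> (x - y) \<in> carrier RR"
      unfolding RR_eq using ring_hom_closed[OF I.rcos_ring_hom xy] .
    ultimately have "II +>\<^bsub>FF\<^esub> (x - y) = (II +>\<^bsub>FF\<^esub> x) \<ominus>\<^bsub>RR\<^esub> (II +>\<^bsub>FF\<^esub> y)"
      using M by (simp add: a_minus_def R.a_assoc R.r_neg)
    also have "\<dots> = br (hsum M N') \<ominus>\<^bsub>RR\<^esub> br (hsum N M')"
      using M by (simp add: br_add a_minus_def R.minus_add R.a_ac)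
    finally show ?case using M hsum_hmods by blast
  qed
  then show ?thesis using that x(2) by blast
qed

text \<open>An additive function that is constant on isomorphism classes extends linearly to formal
  sums and vanishes on the relations. This lets traces and \<open>phi\<close>, which are defined on
  modules, be compared through equations in the Green ring.\<close>

lemma br_invariant:
  fixes f :: "('a, 'k) hmod \<Rightarrow> 'k"
  assumes add: "\<And>M N. M \<in> hmods \<Longrightarrow> N \<in> hmods \<Longrightarrow> f (hsum M N) = f M + f N"
    and iso: "\<And>M N. M \<in> hmods \<Longrightarrow> N \<in> hmods \<Longrightarrow> hiso M N \<Longrightarrow> f M = f N"
    and MN: "M \<in> hmods" "N \<in> hmods" "br M = br N"
  shows "f M = f N"
proof -
  define c where "c = (\<lambda>C. f (SOME M. M \<in> hmods \<and> cls M = C))"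
  have c: "c (cls M) = f M" if "M \<in> hmods" for M
  proof -
    have "(SOME M'. M' \<in> hmods \<and> cls M' = cls M) \<in> hmods \<and> cls (SOME M'. M' \<in> hmods \<and> cls M' = cls M) = cls M"
      using that by (intro someI[of "\<lambda>M'. M' \<in> hmods \<and> cls M' = cls M"]) auto
    then show ?thesis unfolding c_def using that iso cls_eq_iff by blast
  qed
  define F where "F = (\<lambda>x :: (nat \<times> 'a, 'k) rep set \<Rightarrow>\<^sub>0 int. \<Sum>C\<in>Poly_Mapping.keys x. of_int (Poly_Mapping.lookup x C) * c C)"
  have F_sup: "F x = (\<Sum>C\<in>S. of_int (Poly_Mapping.lookup x C) * c C)" if "finite S" "Poly_Mapping.keys x \<subseteq> S" for x S
    unfolding F_def using that by (intro sum.mono_neutral_left) (auto simp: in_keys_iff)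
  have F_diff: "F (x - y) = F x - F y" for x y
  proof -
    let ?S = "Poly_Mapping.keys x \<union> Poly_Mapping.keys y"
    have "Poly_Mapping.keys (x - y) \<subseteq> ?S" by (rule keys_diff)
    then show ?thesis
      by (subst (1 2 3) F_sup[of ?S]) (auto simp: lookup_minus sum_subtractf algebra_simps)
  qed
  have F_cls: "F (frag_of (cls M)) = f M" if "M \<in> hmods" for M
    using c[OF that] by (simp add: F_def)
  have F_II: "F x = 0" if "x \<in> II" for x
    using that
  proof (induction rule: II_induct)
    case (gen M N)
    then show ?case by (simp add: F_diff F_cls hsum_hmods add)
  qed (auto simp: F_diff, simp add: F_def)
  have "frag_of (cls M) - frag_of (cls N) \<in> II"
    using MN coset_eq_iff[OF cls_FF cls_FF, of M N] by (simp add: br_def)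
  then show ?thesis using F_II[of "frag_of (cls M) - frag_of (cls N)"] MN by (simp add: F_diff F_cls)
qed

end


subsection \<open>Representations of the group and their characters\<close>

text \<open>The complementary idempotent \<open>1 - A * B\<close> splits as well, and the traces of
  the two add up to \<open>s\<close>; in characteristic 0 this is an equation between ranks.\<close>

lemma idempotent_trace_le:
  fixes A B :: "'k::field_char_0 mat"
  assumes "A \<in> carrier_mat s r" "B \<in> carrier_mat r s" "B * A = 1\<^sub>m r"
  obtains r' A' B' where "s = r + r'" "A' \<in> carrier_mat s r'" "B' \<in> carrier_mat r' s" "B' * A' = 1\<^sub>m r'"
    "A * B + A' * B' = 1\<^sub>m s" "B * A' = 0\<^sub>m r r'" "B' * A = 0\<^sub>m r' r"
proof -
  have [simp]: "dim_row A = s" "dim_col A = r" "dim_row B = r" "dim_col B = s" using assms by auto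
  let ?F = "1\<^sub>m s - A * B"
  have ABA: "A * (B * (A * B)) = A * B" using mat_pull[OF assms(3), of B] by simp
  have "?F * ?F = ?F" by (simp add: mat_left_diff_distrib mat_right_diff_distrib mat_assoc ABA)
  moreover have F: "?F \<in> carrier_mat s s" by (intro carrier_matI) auto
  ultimately obtain r' A' B' where *: "A' \<in> carrier_mat s r'" "B' \<in> carrier_mat r' s" "?F = A' * B'" "B' * A' = 1\<^sub>m r'"
    using idempotent_factorisation[OF F] by metis
  have [simp]: "dim_row A' = s" "dim_col A' = r'" "dim_row B' = r'" "dim_col B' = s" using * by auto
  have sum: "A * B + A' * B' = 1\<^sub>m s" unfolding *(3)[symmetric] by (intro eq_matI) auto
  have "of_nat s = mtr (A * B + A' * B')" by (simp add: sum)
  also have "\<dots> = mtr (A * B) + mtr (A' * B')" by (rule mtr_add) (auto intro!: carrier_matI)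
  also have "\<dots> = mtr (B * A) + mtr (B' * A')" using mtr_comm[of A B] mtr_comm[of A' B'] by simp
  also have "\<dots> = of_nat (r + r')" using assms(3) *(4) by simp
  finally have s: "s = r + r'" by (simp only: of_nat_eq_iff)
  have "?F * A = 0\<^sub>m s r" using assms(3) by (simp add: mat_left_diff_distrib mat_assoc)
  then have "A' * (B' * A) = 0\<^sub>m s r" unfolding *(3) by (simp add: mat_assoc)
  then have "B' * A = 0\<^sub>m r' r"
    using mat_pull[OF *(4), of "B' * A"] by simp
  moreover have "B * ?F = 0\<^sub>m r s" using mat_pull[OF assms(3), of B] by (simp add: mat_right_diff_distrib)
  then have "B * A' * B' = 0\<^sub>m r s" unfolding *(3) by (simp add: mat_assoc)
  then have "B * A' * B' * A' = 0\<^sub>m r r'" by simp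
  then have "B * A' = 0\<^sub>m r r'" by (simp add: mat_assoc *(4))
  ultimately show ?thesis using that s * sum by blast
qed

context green_datum
begin

definition ghom :: "nat \<Rightarrow> ('a \<Rightarrow> 'k mat) \<Rightarrow> nat \<Rightarrow> ('a \<Rightarrow> 'k mat) \<Rightarrow> 'k mat \<Rightarrow> bool"
  where "ghom d X e X' T \<longleftrightarrow> T \<in> carrier_mat e d \<and> (\<forall>h\<in>carrier G. X' h * T = T * X h)"

lemma ghomD:
  assumes "ghom d X e X' T"
  shows "T \<in> carrier_mat e d" "dim_row T = e" "dim_col T = d" "h \<in> carrier G \<Longrightarrow> X' h * T = T * X h"
  using assms by (auto simp: ghom_def)

text \<open>The Reynolds operator, which projects linear maps onto intertwiners.\<close>

definition avg :: "nat \<Rightarrow> ('a \<Rightarrow> 'k mat) \<Rightarrow> nat \<Rightarrow> ('a \<Rightarrow> 'k mat) \<Rightarrow> 'k mat \<Rightarrow> 'k mat"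
  where "avg d X e X' T =
    inverse (of_nat (card (carrier G))) \<cdot>\<^sub>m gsum e d (\<lambda>h. X' (inv h) * T * X h) (carrier G)"

lemma right_mult_image: "k \<in> carrier G \<Longrightarrow> (\<lambda>h. h \<otimes> k) ` carrier G = carrier G"
proof (intro equalityI subsetI)
  fix x assume "k \<in> carrier G" "x \<in> carrier G"
  then have "x = (x \<otimes> inv k) \<otimes> k" "x \<otimes> inv k \<in> carrier G" by (simp_all add: m_assoc)
  then show "x \<in> (\<lambda>h. h \<otimes> k) ` carrier G" by blast
qed auto

lemma card_G: "of_nat (card (carrier G)) \<noteq> (0::'k)"
  using finite_G one_closed by auto

context
  fixes d e :: nat and X X' :: "'a \<Rightarrow> 'k mat"
  assumes X: "gmod G d X" and X': "gmod G e X'"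
begin

lemma avg_term_carrier:
  "T \<in> carrier_mat e d \<Longrightarrow> h \<in> carrier G \<Longrightarrow> X' (inv h) * T * X h \<in> carrier_mat e d"
  using gmodD(1)[OF X, of h] gmodD(1)[OF X', of "inv h"] by (metis inv_closed mult_carrier_mat)

lemma avg_ghom:
  assumes T: "T \<in> carrier_mat e d"
  shows "ghom d X e X' (avg d X e X' T)"
  unfolding ghom_def
proof (intro conjI ballI)
  show "avg d X e X' T \<in> carrier_mat e d" by (simp add: avg_def)
  fix k assume k: "k \<in> carrier G"
  note [simp] = gmodD(4,5)[OF X] gmodD(4,5)[OF X'] carrier_matD[OF T]
  have c: "\<And>h. h \<in> carrier G \<Longrightarrow> X' (inv h) * T * X h \<in> carrier_mat e d" using avg_term_carrier[OF T] .
  have "X' k * gsum e d (\<lambda>h. X' (inv h) * T * X h) (carrier G) =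
      gsum e d (\<lambda>h. X' k * (X' (inv h) * T * X h)) (carrier G)"
    using k by (subst gsum_mult_left[OF c]) auto
  also have "\<dots> = gsum e d (\<lambda>h. X' k * (X' (inv h) * T * X h)) ((\<lambda>h. h \<otimes> k) ` carrier G)"
  proof -
    show ?thesis by (simp add: right_mult_image[OF k])
  qed
  also have "\<dots> = gsum e d (\<lambda>h. X' k * (X' (inv (h \<otimes> k)) * T * X (h \<otimes> k))) (carrier G)"
    using k by (intro gsum_reindex) (auto simp: inj_on_def)
  also have "\<dots> = gsum e d (\<lambda>h. X' (inv h) * T * X h * X k) (carrier G)"
  proof (intro gsum_cong)
    fix h assume h: "h \<in> carrier G"
    have "X' k * (X' (inv (h \<otimes> k)) * T * X (h \<otimes> k)) = (X' k * X' (inv (h \<otimes> k))) * T * (X h * X k)"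
      using h k by (simp add: mat_assoc gmodD(3)[OF X])
    also have "X' k * X' (inv (h \<otimes> k)) = X' (inv h)"
      using h k gmodD(3)[OF X', of k "inv (h \<otimes> k)"] by (simp add: inv_mult_group flip: m_assoc)
    finally show "X' k * (X' (inv (h \<otimes> k)) * T * X (h \<otimes> k)) = X' (inv h) * T * X h * X k"
      using h k by (simp add: mat_assoc)
  qed
  also have "\<dots> = gsum e d (\<lambda>h. X' (inv h) * T * X h) (carrier G) * X k"
    using k by (subst gsum_mult_right[OF c]) auto
  finally show "X' k * avg d X e X' T = avg d X e X' T * X k"
    using k by (simp add: avg_def)
qed

lemma avg_fixed:
  assumes "ghom d X e X' T"
  shows "avg d X e X' T = T"
proof -
  note T = ghomD[OF assms]
  note [simp] = gmodD(4,5)[OF X] gmodD(4,5)[OF X'] T(2,3)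
  have "X' (inv h) * T * X h = T" if h: "h \<in> carrier G" for h
  proof -
    have "X' (inv h) * T * X h = T * (X (inv h) * X h)" using h T(4)[of "inv h"] by (simp add: mat_assoc)
    then show ?thesis using h gmodD(6)[OF X] by simp
  qed
  then have "gsum e d (\<lambda>h. X' (inv h) * T * X h) (carrier G) = of_nat (card (carrier G)) \<cdot>\<^sub>m T"
    using gsum_cong[of "carrier G" "\<lambda>h. X' (inv h) * T * X h" "\<lambda>_. T"] gsum_const[OF finite_G T(1)] by simp
  then show ?thesis using card_G by (simp add: avg_def)
qed

end

text \<open>Averaging a linear section of an equivariant map gives a section again, because every
  summand \<open>X (inv h) * S * X' h\<close> is one.\<close>

lemma maschke_right:
  assumes X: "gmod G d X" and X': "gmod G e X'" and "ghom d X e X' B" "S \<in> carrier_mat d e" "B * S = 1\<^sub>m e"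
  obtains S' where "ghom e X' d X S'" "B * S' = 1\<^sub>m e"
proof
  note B = ghomD[OF assms(3)]
  note [simp] = gmodD(4,5)[OF X] gmodD(4,5)[OF X'] B(2,3) carrier_matD[OF assms(4)]
  have c: "X (inv h) * S * X' h \<in> carrier_mat d e" if "h \<in> carrier G" for h
    using that by (intro carrier_matI) auto
  have "B * gsum d e (\<lambda>h. X (inv h) * S * X' h) (carrier G) =
      gsum e e (\<lambda>h. B * (X (inv h) * S * X' h)) (carrier G)"
    by (subst gsum_mult_left[OF c]) auto
  also have "\<dots> = gsum e e (\<lambda>h. 1\<^sub>m e) (carrier G)"
  proof (intro gsum_cong)
    fix h assume h: "h \<in> carrier G"
    have "B * (X (inv h) * S * X' h) = (B * X (inv h)) * S * X' h" using h by (simp add: mat_assoc)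
    also have "\<dots> = X' (inv h) * (B * S) * X' h" using h B(4)[of "inv h", symmetric] by (simp add: mat_assoc)
    also have "\<dots> = 1\<^sub>m e" using h assms(5) gmodD(6)[OF X'] by simp
    finally show "B * (X (inv h) * S * X' h) = 1\<^sub>m e" .
  qed
  also have "\<dots> = of_nat (card (carrier G)) \<cdot>\<^sub>m 1\<^sub>m e" by (rule gsum_const[OF finite_G]) simp
  finally show "B * avg e X' d X S = 1\<^sub>m e" using card_G by (simp add: avg_def)
qed (rule avg_ghom[OF X' X assms(4)])

lemma maschke_left:
  assumes X: "gmod G d X" and X': "gmod G e X'" and "ghom d X e X' A" "L \<in> carrier_mat d e" "L * A = 1\<^sub>m d"
  obtains L' where "ghom e X' d X L'" "L' * A = 1\<^sub>m d"
proof
  note A = ghomD[OF assms(3)]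
  note [simp] = gmodD(4,5)[OF X] gmodD(4,5)[OF X'] A(2,3) carrier_matD[OF assms(4)]
  have c: "X (inv h) * L * X' h \<in> carrier_mat d e" if "h \<in> carrier G" for h
    using that by (intro carrier_matI) auto
  have "gsum d e (\<lambda>h. X (inv h) * L * X' h) (carrier G) * A =
      gsum d d (\<lambda>h. X (inv h) * L * X' h * A) (carrier G)"
    by (subst gsum_mult_right[OF c]) auto
  also have "\<dots> = gsum d d (\<lambda>h. 1\<^sub>m d) (carrier G)"
  proof (intro gsum_cong)
    fix h assume h: "h \<in> carrier G"
    have "X (inv h) * L * X' h * A = X (inv h) * (L * A) * X h" using h A(4)[of h] by (simp add: mat_assoc)
    also have "\<dots> = 1\<^sub>m d" using h assms(5) gmodD(6)[OF X] by simp
    finally show "X (inv h) * L * X' h * A = 1\<^sub>m d" .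
  qed
  also have "\<dots> = of_nat (card (carrier G)) \<cdot>\<^sub>m 1\<^sub>m d" by (rule gsum_const[OF finite_G]) simp
  finally show "avg e X' d X L * A = 1\<^sub>m d" using card_G by (simp add: avg_def)
qed (rule avg_ghom[OF X' X assms(4)])

context
  fixes d e :: nat and X X' :: "'a \<Rightarrow> 'k mat"
  assumes X: "gmod G d X" and X': "gmod G e X'"
begin

text \<open>As an operator on matrices, written row by row as vectors, averaging is \<open>K\<close>
  divided by the order of \<open>G\<close>. It is idempotent and its trace is the normalised pairing
  of the characters. Trace zero kills it, and an intertwiner is its own average.\<close>

lemma char_pairing_zero:
  assumes 0: "(\<Sum>h\<in>carrier G. mtr (X' (inv h)) * mtr (X h)) = 0" and T: "ghom d X e X' T"
  shows "T = 0\<^sub>m e d"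
proof -
  note TD = ghomD[OF T]
  note [simp] = gmodD(4,5)[OF X] gmodD(4,5)[OF X'] TD(2,3)
  let ?c = "of_nat (card (carrier G)) :: 'k"
  let ?k = "\<lambda>h. kronecker (X' (inv h)) (transpose_mat (X h))"
  define K where "K = gsum (e * d) (e * d) ?k (carrier G)"
  have k: "?k h \<in> carrier_mat (e * d) (e * d)" if "h \<in> carrier G" for h
    using that by (intro carrier_matI) auto
  have "K * K = gsum (e * d) (e * d) (\<lambda>l. ?k l * K) (carrier G)"
    unfolding K_def using k by (subst gsum_mult_right) auto
  also have "\<dots> = gsum (e * d) (e * d) (\<lambda>l. K) (carrier G)"
  proof (intro gsum_cong)
    fix l assume l: "l \<in> carrier G"
    have "?k l * K = gsum (e * d) (e * d) (\<lambda>h. ?k l * ?k h) (carrier G)"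
      unfolding K_def using k l by (subst gsum_mult_left) auto
    also have "\<dots> = gsum (e * d) (e * d) (\<lambda>h. ?k (h \<otimes> l)) (carrier G)"
    proof (intro gsum_cong)
      fix h assume h: "h \<in> carrier G"
      have "transpose_mat (X l) * transpose_mat (X h) = transpose_mat (X (h \<otimes> l))"
        using h l gmodD(1)[OF X] by (simp add: gmodD(3)[OF X] transpose_mult[of _ d d _ d])
      then show "?k l * ?k h = ?k (h \<otimes> l)"
        using h l gmodD(3)[OF X', of "inv l" "inv h"] by (simp add: kron_mult inv_mult_group)
    qed
    also have "\<dots> = gsum (e * d) (e * d) ?k ((\<lambda>h. h \<otimes> l) ` carrier G)"
      using l by (intro gsum_reindex[symmetric]) (auto simp: inj_on_def)
    also have "(\<lambda>h. h \<otimes> l) ` carrier G = carrier G"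
      by (rule right_mult_image[OF l])
    finally show "?k l * K = K" by (simp add: K_def)
  qed
  also have "\<dots> = ?c \<cdot>\<^sub>m K" by (rule gsum_const[OF finite_G]) (simp add: K_def)
  finally have KK: "K * K = ?c \<cdot>\<^sub>m K" .
  have Kc: "K \<in> carrier_mat (e * d) (e * d)" by (simp add: K_def)
  have "mtr K = (\<Sum>h\<in>carrier G. mtr (X' (inv h)) * mtr (X h))"
  proof -
    have "mtr (transpose_mat (X h)) = mtr (X h)" if "h \<in> carrier G" for h
      using that by (simp add: mtr_def)
    then show ?thesis unfolding K_def using k by (subst mtr_gsum) (auto simp: mtr_kron)
  qed
  then have "mtr (inverse ?c \<cdot>\<^sub>m K) = 0" using 0 Kc by simp
  moreover have "(inverse ?c \<cdot>\<^sub>m K) * (inverse ?c \<cdot>\<^sub>m K) = inverse ?c \<cdot>\<^sub>m K"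
    using Kc KK card_G by simp
  ultimately have "inverse ?c \<cdot>\<^sub>m K = 0\<^sub>m (e * d) (e * d)"
    using Kc by (intro idempotent_trace) auto
  then have K0: "K $$ (i, j) = 0" if "i < e * d" "j < e * d" for i j
  proof -
    have "(inverse ?c \<cdot>\<^sub>m K) $$ (i, j) = 0" unfolding \<open>inverse ?c \<cdot>\<^sub>m K = _\<close> using that by simp
    then show ?thesis using that Kc card_G by simp
  qed
  have "avg d X e X' T = 0\<^sub>m e d"
  proof (intro eq_matI, goal_cases)
    case (1 i j)
    then have ij: "i < e" "j < d" by auto
    have pair: "a * d + b < e * d" "(a * d + b) div d = a" "(a * d + b) mod d = b" if "a < e" "b < d" for a b
    proof -
      have "a * d + b < Suc a * d" using that by simp
      also have "\<dots> \<le> e * d" using that by (intro mult_le_mono1) auto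
      finally show "a * d + b < e * d" .
      show "(a * d + b) div d = a" "(a * d + b) mod d = b" using that by auto
    qed
    have z: "(\<Sum>h\<in>carrier G. X' (inv h) $$ (i, k) * X h $$ (l, j)) = 0" if "k < e" "l < d" for k l
      using K0[of "i * d + j" "k * d + l"] pair[OF ij] pair[OF that] ij that
      by (simp add: K_def index_kron)
    have "(\<Sum>h\<in>carrier G. (X' (inv h) * T * X h) $$ (i, j)) =
        (\<Sum>h\<in>carrier G. \<Sum>l<d. \<Sum>k<e. T $$ (k, l) * (X' (inv h) $$ (i, k) * X h $$ (l, j)))"
      using ij by (intro sum.cong) (simp_all add: sum_distrib_left sum_distrib_right mult_ac)
    also have "\<dots> = (\<Sum>l<d. \<Sum>k<e. T $$ (k, l) * (\<Sum>h\<in>carrier G. X' (inv h) $$ (i, k) * X h $$ (l, j)))"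
      by (subst sum.swap, intro sum.cong refl, subst sum.swap) (simp add: sum_distrib_left)
    also have "\<dots> = 0" using z by simp
    finally show ?case using ij by (simp add: avg_def)
  qed (auto simp: avg_def)
  then show ?thesis using avg_fixed[OF X X' T] by simp
qed

text \<open>Up to the order of \<open>G\<close> the pairing is the sum over \<open>(a, b)\<close> of
  the entry at \<open>(a, b)\<close> of the averaged matrix unit \<open>E a b\<close>, so some
  average is a nonzero intertwiner.\<close>

lemma char_pairing_nonzero:
  assumes "(\<Sum>h\<in>carrier G. mtr (X' (inv h)) * mtr (X h)) \<noteq> 0"
  obtains T where "ghom d X e X' T" "T \<noteq> 0\<^sub>m e d"
proof -
  note [simp] = gmodD(4,5)[OF X] gmodD(4,5)[OF X']
  define E where "E = (\<lambda>a b. mat e d (\<lambda>(i, j). if i = a \<and> j = b then 1 else 0 :: 'k))"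
  have Ec: "E a b \<in> carrier_mat e d" for a b by (simp add: E_def)
  have ent: "(X' (inv h) * E a b * X h) $$ (a, b) = X' (inv h) $$ (a, a) * X h $$ (b, b)"
    if "h \<in> carrier G" "a < e" "b < d" for h a b
  proof -
    have "(X' (inv h) * E a b) $$ (a, l) = (if l = b then X' (inv h) $$ (a, a) else 0)" if "l < d" for l
    proof -
      show ?thesis
        using \<open>h \<in> carrier G\<close> \<open>a < e\<close> that Ec[of a b]
        by (cases "l = b") (simp_all add: E_def if_distrib[of "\<lambda>x. _ * x"] cong: if_cong)
    qed
    then show ?thesis
      using that Ec[of a b] by (simp add: index_mult_sum[of a "X' (inv h) * E a b"] if_distrib[of "\<lambda>x. x * _"] del: index_mult_sum cong: if_cong)
  qed
  have "\<exists>a<e. \<exists>b<d. avg d X e X' (E a b) \<noteq> 0\<^sub>m e d"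
  proof (rule ccontr)
    assume H: "\<not> (\<exists>a<e. \<exists>b<d. avg d X e X' (E a b) \<noteq> 0\<^sub>m e d)"
    have z: "(\<Sum>h\<in>carrier G. X' (inv h) $$ (a, a) * X h $$ (b, b)) = 0" if "a < e" "b < d" for a b
    proof -
      have "avg d X e X' (E a b) $$ (a, b) = 0" using H that by auto
      then show ?thesis using that card_G ent by (simp add: avg_def del: index_mult_sum)
    qed
    have "(\<Sum>h\<in>carrier G. mtr (X' (inv h)) * mtr (X h)) =
        (\<Sum>h\<in>carrier G. \<Sum>a<e. \<Sum>b<d. X' (inv h) $$ (a, a) * X h $$ (b, b))"
      by (intro sum.cong) (simp_all add: mtr_def sum_product)
    also have "\<dots> = (\<Sum>a<e. \<Sum>b<d. \<Sum>h\<in>carrier G. X' (inv h) $$ (a, a) * X h $$ (b, b))"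
      by (subst sum.swap, intro sum.cong refl, subst sum.swap) simp
    also have "\<dots> = 0" using z by simp
    finally show False using assms by simp
  qed
  then show ?thesis using that avg_ghom[OF X X' Ec] by blast
qed

end

text \<open>A rank factorisation transports the action to the image. The one-sided inverses
  \<open>L\<close> and \<open>S\<close> are only linear; where equivariant ones are needed, they are
  averaged.\<close>

lemma image_gmod:
  assumes X: "gmod G d X" and X': "gmod G e X'" and T: "ghom d X e X' T" and ne: "T \<noteq> 0\<^sub>m e d"
  obtains r U A B L S where "gmod G r U" "ghom r U e X' A" "ghom d X r U B" "L \<in> carrier_mat r e" "S \<in> carrier_mat d r"
    "T = A * B" "L * A = 1\<^sub>m r" "B * S = 1\<^sub>m r" "r > 0"
proof -
  note TD = ghomD[OF T]
  obtain r A B L S where *: "A \<in> carrier_mat e r" "B \<in> carrier_mat r d" "L \<in> carrier_mat r e"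
    "S \<in> carrier_mat d r" "T = A * B" "L * A = 1\<^sub>m r" "B * S = 1\<^sub>m r"
    using rank_factorisation[OF TD(1)] .
  note [simp] = gmodD(4,5)[OF X] gmodD(4,5)[OF X'] carrier_matD[OF *(1)] carrier_matD[OF *(2)] carrier_matD[OF *(3)] carrier_matD[OF *(4)]
  define U where "U = (\<lambda>h. B * X h * S)"
  have dU [simp]: "dim_row (U h) = r" "dim_col (U h) = r" for h by (simp_all add: U_def)
  have AB: "X' h * (A * B) = A * (B * X h)" if "h \<in> carrier G" for h
    using TD(4)[OF that] that by (simp add: *(5) mat_assoc)
  have A: "X' h * A = A * U h" if h: "h \<in> carrier G" for h
  proof -
    have "X' h * A = X' h * (A * B) * S" using h by (simp add: mat_assoc *(7))
    then show ?thesis unfolding AB[OF h] using h by (simp add: U_def mat_assoc)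
  qed
  have B: "U h * B = B * X h" if h: "h \<in> carrier G" for h
  proof -
    have "B * X h = L * (A * (B * X h))" using h by (simp add: mat_pull[OF *(6)])
    also have "\<dots> = L * (X' h * A * B)" using h by (simp add: mat_assoc flip: AB)
    also have "\<dots> = U h * B" unfolding A[OF h] using h by (simp add: mat_assoc mat_pull[OF *(6)])
    finally show ?thesis ..
  qed
  have "gmod G r U" unfolding gmod_def
  proof (intro conjI ballI)
    show "U \<one> = 1\<^sub>m r" using gmodD(2)[OF X] *(7) by (simp add: U_def)
    fix h k assume h: "h \<in> carrier G" and k: "k \<in> carrier G"
    have "U (h \<otimes> k) = (B * X h) * (X k * S)" using h k by (simp add: U_def gmodD(3)[OF X] mat_assoc)
    also have "\<dots> = U h * U k" unfolding B[OF h, symmetric] using h k by (simp add: U_def mat_assoc)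
    finally show "U (h \<otimes> k) = U h * U k" .
  qed (auto intro!: carrier_matI)
  moreover have "ghom r U e X' A" using A *(1) by (simp add: ghom_def)
  moreover have "ghom d X r U B" using B *(2) by (simp add: ghom_def)
  moreover have "r > 0"
  proof (rule Nat.gr0I)
    assume "r = 0"
    then have "T = 0\<^sub>m e d" using *(1,2) unfolding *(5) by (intro eq_matI) auto
    with ne show False by simp
  qed
  ultimately show ?thesis using that *(3-7) by blast
qed

text \<open>\<open>A * L\<close> is equivariant, hence so is the complementary idempotent, whose
  image is an invariant complement. The trace identity permits cancelling \<open>U\<close> from
  characters.\<close>

lemma gmod_split:
  assumes X: "gmod G d X" and U: "gmod G r U" and A: "ghom r U d X A" and L: "ghom d X r U L" and LA: "L * A = 1\<^sub>m r"
  obtains r' X' A' B' where "d = r + r'" "gmod G r' X'" "ghom r' X' d X A'" "ghom d X r' X' B'" "B' * A' = 1\<^sub>m r'"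
    "A * L + A' * B' = 1\<^sub>m d" "L * A' = 0\<^sub>m r r'" "B' * A = 0\<^sub>m r' r"
    "\<And>h. h \<in> carrier G \<Longrightarrow> mtr (X h) = mtr (U h) + mtr (X' h)"
proof -
  note AD = ghomD[OF A] and LD = ghomD[OF L]
  obtain r' A' B' where *: "d = r + r'" "A' \<in> carrier_mat d r'" "B' \<in> carrier_mat r' d" "B' * A' = 1\<^sub>m r'"
    "A * L + A' * B' = 1\<^sub>m d" "L * A' = 0\<^sub>m r r'" "B' * A = 0\<^sub>m r' r"
    using idempotent_trace_le[OF AD(1) LD(1) LA] .
  note [simp] = gmodD(4,5)[OF X] gmodD(4,5)[OF U] AD(2,3) LD(2,3) carrier_matD[OF *(2)] carrier_matD[OF *(3)]
  define X' where "X' = (\<lambda>h. B' * X h * A')"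
  have "X h * (A' * B') = A' * B' * X h" if h: "h \<in> carrier G" for h
  proof -
    have "A' * B' = 1\<^sub>m d - A * L" unfolding *(5)[symmetric] by (intro eq_matI) auto
    moreover have "X h * (A * L) = A * L * X h"
      using h AD(4)[OF h] LD(4)[OF h] by (simp add: mat_assoc mat_pull[OF AD(4)[OF h]])
    ultimately show ?thesis using h by (simp add: mat_left_diff_distrib mat_right_diff_distrib)
  qed
  note res = idempotent_restrict[OF *(2,3) gmodD(1)[OF X] *(4) this]
  have A': "X h * A' = A' * X' h" and B': "B' * X h = X' h * B'" if "h \<in> carrier G" for h
    using res[OF that that] by (simp_all add: X'_def)
  have "gmod G r' X'" unfolding gmod_def
  proof (intro conjI ballI)
    show "X' \<one> = 1\<^sub>m r'" using gmodD(2)[OF X] *(4) by (simp add: X'_def)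
    fix h k assume h: "h \<in> carrier G" and k: "k \<in> carrier G"
    have "X' (h \<otimes> k) = (B' * X h) * (X k * A')" using h k by (simp add: X'_def gmodD(3)[OF X] mat_assoc)
    also have "\<dots> = X' h * X' k" unfolding B'[OF h] using h k by (simp add: X'_def mat_assoc)
    finally show "X' (h \<otimes> k) = X' h * X' k" .
  qed (auto simp: X'_def intro!: carrier_matI)
  moreover have "mtr (X h) = mtr (U h) + mtr (X' h)" if h: "h \<in> carrier G" for h
  proof -
    have "mtr (X h) = mtr (X h * A * L + X h * A' * B')"
      using h arg_cong[OF *(5), of "\<lambda>M. X h * M"] by (simp add: mat_right_distrib mat_assoc)
    also have "\<dots> = mtr (X h * A * L) + mtr (X h * A' * B')"
      using h by (intro mtr_add) (auto intro!: carrier_matI)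
    also have "mtr (X h * A * L) = mtr (L * (X h * A))" using h by (intro mtr_comm) auto
    also have "\<dots> = mtr (U h)" using h by (simp add: AD(4) mat_pull[OF LA])
    also have "mtr (X h * A' * B') = mtr (B' * (X h * A'))" using h by (intro mtr_comm) auto
    also have "\<dots> = mtr (X' h)" using h by (simp add: X'_def mat_assoc)
    finally show ?thesis .
  qed
  moreover have "ghom r' X' d X A'" "ghom d X r' X' B'" using A' B' * by (auto simp: ghom_def)
  ultimately show ?thesis using that * by blast
qed

lemma ghom_comp:
  assumes "ghom d X e Y S" "ghom e Y f Z T" "gmod G d X" "gmod G e Y" "gmod G f Z"
  shows "ghom d X f Z (T * S)"
  unfolding ghom_def
proof (intro conjI ballI)
  note S = ghomD[OF assms(1)] and T = ghomD[OF assms(2)]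
  note [simp] = S(2,3) T(2,3) gmodD(4,5)[OF assms(3)] gmodD(4,5)[OF assms(4)] gmodD(4,5)[OF assms(5)]
  show "T * S \<in> carrier_mat f d" using S(1) T(1) by auto
  fix h assume h: "h \<in> carrier G"
  have "Z h * (T * S) = T * (Y h * S)" using h T(4)[OF h] mat_pull[OF T(4)[OF h], of S] by (simp add: mat_assoc)
  then show "Z h * (T * S) = T * S * X h" using h by (simp add: S(4) mat_assoc)
qed

text \<open>Equal characters have equal pairings with every representation, so a minimal constituent
  \<open>U\<close> of \<open>X\<close> also maps nontrivially to \<open>X'\<close>. Splitting it off
  on both sides leaves equal characters in a smaller dimension.\<close>

lemma gmod_iso_of_char_eq:
  assumes "gmod G d X" "gmod G e X'" "\<And>h. h \<in> carrier G \<Longrightarrow> mtr (X h) = mtr (X' h)"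
  shows "d = e \<and> (\<exists>P Q. ghom d X d X' P \<and> ghom d X' d X Q \<and> P * Q = 1\<^sub>m d \<and> Q * P = 1\<^sub>m d)"
  using assms
proof (induction d arbitrary: e X X' rule: less_induct)
  case (less d e X X')
  note X = less.prems(1) and X' = less.prems(2)
  have de: "d = e" using less.prems(3)[OF one_closed] gmodD(2)[OF X] gmodD(2)[OF X'] by simp
  show ?case
  proof (cases "d = 0")
    case True
    have c: "A \<in> carrier_mat 0 0 \<Longrightarrow> A = 1\<^sub>m 0" for A :: "'k mat" by (intro eq_matI) auto
    have "X h = 1\<^sub>m 0" "X' h = 1\<^sub>m 0" if "h \<in> carrier G" for h
      using gmodD(1)[OF X that] gmodD(1)[OF X' that] True de by (auto intro!: c)
    then have "ghom d X d X' (1\<^sub>m 0)" "ghom d X' d X (1\<^sub>m 0)" using True by (auto simp: ghom_def)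
    then show ?thesis using de True by (auto intro!: exI[of _ "1\<^sub>m 0"])
  next
    case False
    \<comment> \<open>The least dimension of a representation with a nonzero map to \<open>X\<close>
      takes the place of irreducibility: such a map has an image of full dimension.\<close>
    define P where "P = (\<lambda>s. s > 0 \<and> (\<exists>S T. gmod G s S \<and> ghom s S d X T \<and> T \<noteq> 0\<^sub>m d s))"
    have "ghom d X d X (1\<^sub>m d)" using gmodD(4,5)[OF X] by (auto simp: ghom_def)
    moreover have "1\<^sub>m d \<noteq> (0\<^sub>m d d :: 'k mat)"
    proof
      assume "1\<^sub>m d = (0\<^sub>m d d :: 'k mat)"
      then have "mtr (1\<^sub>m d) = mtr (0\<^sub>m d d :: 'k mat)" by (rule arg_cong)
      then show False using False by simp
    qed
    ultimately have "P d" using X False by (auto simp: P_def)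
    then have Ps: "P (LEAST s. P s)" by (rule LeastI)
    define s where "s = (LEAST s. P s)"
    have min: "s \<le> r" if "P r" for r unfolding s_def using that by (rule Least_le)
    have s0: "s > 0" using Ps by (simp add: P_def s_def)
    obtain S0 T0 where ST: "gmod G s S0" "ghom s S0 d X T0" "T0 \<noteq> 0\<^sub>m d s" using Ps by (auto simp: P_def s_def)
    obtain r U A B L R where I: "gmod G r U" "ghom r U d X A" "ghom s S0 r U B" "L \<in> carrier_mat r d" "R \<in> carrier_mat s r"
      "T0 = A * B" "L * A = 1\<^sub>m r" "B * R = 1\<^sub>m r" "r > 0"
      using image_gmod[OF ST(1) X ST(2,3)] .
    have nz: "A' \<noteq> 0\<^sub>m a b" if "L' * A' = 1\<^sub>m b" "dim_col L' = a" "b > 0" for L' A' :: "'k mat" and a b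
    proof
      assume "A' = 0\<^sub>m a b"
      then have "1\<^sub>m b = (0\<^sub>m (dim_row L') b :: 'k mat)" using that by simp
      then have "mtr (1\<^sub>m b :: 'k mat) = mtr (0\<^sub>m (dim_row L') b :: 'k mat)" "dim_row (1\<^sub>m b :: 'k mat) = dim_row (0\<^sub>m (dim_row L') b :: 'k mat)"
        by (simp_all only:)
      then show False using that(3) by simp
    qed
    have "P r" using I(1,2,9) nz[OF I(7) _ I(9), of d] I(4) by (auto simp: P_def)
    then have sr: "s \<le> r" by (rule min)
    obtain r' where "s = r + r'" using idempotent_trace_le[OF I(5) ghomD(1)[OF I(3)] I(8)] by metis
    then have rs: "r = s" using sr by simp
    obtain L' where L': "ghom d X s U L'" "L' * A = 1\<^sub>m s"
      using maschke_left[OF I(1) X I(2,4,7)] rs by metis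
    note U = I(1)[unfolded rs] and A = I(2)[unfolded rs]
    have "(\<Sum>h\<in>carrier G. mtr (X (inv h)) * mtr (U h)) \<noteq> 0"
      using char_pairing_zero[OF U X _ A] nz[OF L'(2) _ s0, of d] ghomD[OF L'(1)] by auto
    then have "(\<Sum>h\<in>carrier G. mtr (X' (inv h)) * mtr (U h)) \<noteq> 0" using less.prems(3) by simp
    then obtain T where T: "ghom s U e X' T" "T \<noteq> 0\<^sub>m e s" using char_pairing_nonzero[OF U X'] by metis
    obtain r U' A' B' M R where J: "gmod G r U'" "ghom r U' e X' A'" "ghom s U r U' B'" "M \<in> carrier_mat r e" "R \<in> carrier_mat s r"
      "T = A' * B'" "M * A' = 1\<^sub>m r" "B' * R = 1\<^sub>m r" "r > 0"
      using image_gmod[OF U X' T] .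
    obtain R' where R': "ghom r U' s U R'" "B' * R' = 1\<^sub>m r"
      using maschke_right[OF U J(1) J(3,5,8)] by metis
    \<comment> \<open>The image of \<open>T\<close> also maps nontrivially to \<open>X\<close>,
      through the section \<open>R'\<close>, so minimality of \<open>s\<close> forces
      \<open>T\<close> to be injective.\<close>
    have "ghom r U' d X (A * R')" by (rule ghom_comp[OF R'(1) A J(1) U X])
    moreover have "A * R' \<noteq> 0\<^sub>m d r"
    proof (rule nz)
      show "(B' * L') * (A * R') = 1\<^sub>m r"
        using R'(2) ghomD[OF L'(1)] ghomD[OF A] ghomD[OF R'(1)] ghomD[OF J(3)]
        by (simp add: mat_assoc mat_pull[OF L'(2)])
    qed (use ghomD[OF L'(1)] J(9) in auto)
    ultimately have "P r" using J(1,9) by (auto simp: P_def)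
    then have sr: "s \<le> r" by (rule min)
    obtain r' where "s = r + r'" using idempotent_trace_le[OF J(5) ghomD(1)[OF J(3)] J(8)] by metis
    then have rs: "r = s" using sr by simp
    have "R' * B' = 1\<^sub>m s"
      using mat_mult_left_right_inverse[of B' s R'] ghomD(1)[OF J(3)] ghomD(1)[OF R'(1)] R'(2) rs by auto
    then have "(R' * M) * T = 1\<^sub>m s"
      using J(4,6) rs ghomD[OF R'(1)] ghomD[OF J(3)] ghomD[OF J(2)] by (simp add: mat_assoc mat_pull[OF J(7)])
    moreover have "R' * M \<in> carrier_mat s e" using ghomD(1)[OF R'(1)] J(4) by auto
    ultimately obtain M' where M': "ghom e X' s U M'" "M' * T = 1\<^sub>m s"
      using maschke_left[OF U X' T(1)] by metis
    obtain d1 X1 A1 B1 where s1: "d = s + d1" "gmod G d1 X1" "ghom d1 X1 d X A1" "ghom d X d1 X1 B1" "B1 * A1 = 1\<^sub>m d1"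
      "A * L' + A1 * B1 = 1\<^sub>m d" "L' * A1 = 0\<^sub>m s d1" "B1 * A = 0\<^sub>m d1 s"
      "\<And>h. h \<in> carrier G \<Longrightarrow> mtr (X h) = mtr (U h) + mtr (X1 h)"
      by (rule gmod_split[OF X U A L']) (rule that; assumption)
    obtain d2 X2 A2 B2 where s2: "e = s + d2" "gmod G d2 X2" "ghom d2 X2 e X' A2" "ghom e X' d2 X2 B2" "B2 * A2 = 1\<^sub>m d2"
      "T * M' + A2 * B2 = 1\<^sub>m e" "M' * A2 = 0\<^sub>m s d2" "B2 * T = 0\<^sub>m d2 s"
      "\<And>h. h \<in> carrier G \<Longrightarrow> mtr (X' h) = mtr (U h) + mtr (X2 h)"
      by (rule gmod_split[OF X' U T(1) M']) (rule that; assumption)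
    have d12: "d2 = d1" using s1(1) s2(1) de by simp
    have "mtr (X1 h) = mtr (X2 h)" if "h \<in> carrier G" for h
      using less.prems(3)[OF that] s1(9)[OF that] s2(9)[OF that] by simp
    moreover have "d1 < d" using s1(1) s0 by simp
    ultimately obtain P1 Q1 where PQ: "ghom d1 X1 d1 X2 P1" "ghom d1 X2 d1 X1 Q1" "P1 * Q1 = 1\<^sub>m d1" "Q1 * P1 = 1\<^sub>m d1"
      using less.IH[OF _ s1(2) s2(2)] by auto
    note s2' = s2[unfolded d12, folded de] and T' = T[folded de] and M'' = M'[folded de]
    note hs = ghomD[OF A] ghomD[OF L'(1)] ghomD[OF s1(3)] ghomD[OF s1(4)] ghomD[OF s2'(3)] ghomD[OF s2'(4)] ghomD[OF T'(1)] ghomD[OF M''(1)]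
      ghomD[OF PQ(1)] ghomD[OF PQ(2)]
    note [simp] = hs(2,3) hs(6,7) hs(10,11) hs(14,15) hs(18,19) hs(22,23) hs(26,27) hs(30,31) hs(34,35) hs(38,39)
    note pulls = mat_pull[OF L'(2)] mat_pull[OF M''(2)] mat_pull[OF s1(5)] mat_pull[OF s2'(5)] mat_pull[OF s1(7)] mat_pull[OF s1(8)]
       mat_pull[OF s2'(7)] mat_pull[OF s2'(8)] mat_pull[OF PQ(3)] mat_pull[OF PQ(4)]
    let ?P = "T * L' + A2 * (P1 * B1)" and ?Q = "A * M' + A1 * (Q1 * B2)"
    have hadd: "ghom d Z d Z' (V + W)" if "ghom d Z d Z' V" "ghom d Z d Z' W" "gmod G d Z" "gmod G d Z'" for Z Z' V W
      using that ghomD[OF that(1)] ghomD[OF that(2)] gmodD(4,5)[OF that(3)] gmodD(4,5)[OF that(4)]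
      by (auto simp: ghom_def mat_left_distrib mat_right_distrib)
    have "ghom d X d X' ?P"
      by (rule hadd[OF ghom_comp[OF L'(1) T'(1)] ghom_comp[OF ghom_comp[OF s1(4) PQ(1)] s2'(3)]])
        (use X X' U s1(2) s2'(2) de in auto)
    moreover have "ghom d X' d X ?Q"
      by (rule hadd[OF ghom_comp[OF M''(1) A] ghom_comp[OF ghom_comp[OF s2'(4) PQ(2)] s1(3)]])
        (use X X' U s1(2) s2'(2) de in auto)
    moreover have "?P * ?Q = 1\<^sub>m d"
      using s2'(6) by (simp add: mat_left_distrib mat_right_distrib mat_assoc pulls)
    moreover have "?Q * ?P = 1\<^sub>m d"
      using s1(6) by (simp add: mat_left_distrib mat_right_distrib mat_assoc pulls)
    ultimately show ?thesis using de by blast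
  qed
qed

end


subsection \<open>Induced modules and chains\<close>

declare pow_mat_dim [simp del]

text \<open>Basis columns and rows of an \<open>l\<close>-dimensional space, the shift to the next
  basis vector, and the diagonal of powers of \<open>a\<close>. An index at or beyond
  \<open>l\<close> yields the zero vector, so \<open>sh_ec\<close> also describes the truncation at
  \<open>l\<close>.\<close>

definition ec :: "nat \<Rightarrow> nat \<Rightarrow> 'k::field mat" where "ec l i = mat l 1 (\<lambda>(r, _). if r = i then 1 else 0)"
definition er :: "nat \<Rightarrow> nat \<Rightarrow> 'k::field mat" where "er l i = mat 1 l (\<lambda>(_, c). if c = i then 1 else 0)"
definition sh :: "nat \<Rightarrow> 'k::field mat" where "sh l = mat l l (\<lambda>(r, c). if r = Suc c then 1 else 0)"
definition dg :: "'k \<Rightarrow> nat \<Rightarrow> 'k::field mat" where "dg a l = mat l l (\<lambda>(r, c). if r = c then a ^ r else 0)"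

lemma ec_er_dims [simp]:
  "dim_row (ec l i) = l" "dim_col (ec l i) = 1" "dim_row (er l i) = 1" "dim_col (er l i) = l"
  "dim_row (sh l) = l" "dim_col (sh l) = l" "dim_row (dg a l) = l" "dim_col (dg a l) = l"
  by (simp_all add: ec_def er_def sh_def dg_def)

lemma ec_er_index [simp]:
  "r < l \<Longrightarrow> ec l i $$ (r, 0) = (if r = i then 1 else 0)"
  "c < l \<Longrightarrow> er l i $$ (0, c) = (if c = i then 1 else 0)"
  "r < l \<Longrightarrow> c < l \<Longrightarrow> sh l $$ (r, c) = (if r = Suc c then 1 else 0)"
  "r < l \<Longrightarrow> c < l \<Longrightarrow> dg a l $$ (r, c) = (if r = c then a ^ r else 0)"
  by (simp_all add: ec_def er_def sh_def dg_def)

lemma er_ec: "i < l \<Longrightarrow> er l i * ec l j = (if i = j then 1\<^sub>m 1 else 0\<^sub>m 1 1)"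
  by (intro eq_matI) (auto simp: if_distrib[of "\<lambda>x. x * _"] cong: if_cong)

lemma sh_ec: "sh l * ec l i = (ec l (Suc i) :: 'k::field mat)"
proof (intro eq_matI, goal_cases)
  case (1 r c)
  then have r: "r < l" "c = 0" by auto
  have "(sh l * ec l i :: 'k mat) $$ (r, 0) = (\<Sum>k<dim_row (ec l i :: 'k mat). sh l $$ (r, k) * ec l i $$ (k, 0))"
    using r by (intro index_mult_sum) auto
  also have "\<dots> = (\<Sum>k<l. if k = i then (if r = Suc i then 1 else 0) else 0)"
    using r by (intro sum.cong) auto
  finally have "(sh l * ec l i) $$ (r, 0) = (\<Sum>k<l. if k = i then (if r = Suc i then 1 else 0) else (0::'k))" .
  with r show ?case by (simp del: index_mult_sum)
qed auto

lemma er_sh: "Suc i < l \<Longrightarrow> er l (Suc i) * sh l = er l i" "er l 0 * sh l = 0\<^sub>m 1 l"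
proof -
  have *: "(er l j * sh l) $$ (0, c) = (if j = Suc c then 1 else 0)" if "c < l" "j < l" for j c
    using that by (simp add: if_distrib[of "\<lambda>x. x * _"] cong: if_cong)
  show "Suc i < l \<Longrightarrow> er l (Suc i) * sh l = er l i"
    by (intro eq_matI) (auto simp: * simp del: index_mult_sum)
  show "er l 0 * sh l = 0\<^sub>m 1 l"
    by (intro eq_matI) (auto simp: * simp del: index_mult_sum)
qed

lemma dg_ec: "dg a l * ec l i = a ^ i \<cdot>\<^sub>m ec l i"
proof (intro eq_matI, goal_cases)
  case (1 r c)
  then have r: "r < l" "c = 0" by auto
  have "(\<Sum>k<l. dg a l $$ (r, k) * ec l i $$ (k, 0)) = (\<Sum>k<l. if k = r then (if r = i then a ^ r else 0) else 0)"
    using r by (intro sum.cong) auto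
  with r show ?case by simp
qed auto

lemma er_dg: "er l i * dg a l = a ^ i \<cdot>\<^sub>m er l i"
proof (intro eq_matI, goal_cases)
  case (1 r c)
  then have r: "c < l" "r = 0" by auto
  have "(\<Sum>k<l. er l i $$ (0, k) * dg a l $$ (k, c)) = (\<Sum>k<l. if k = c then (if c = i then a ^ c else 0) else 0)"
    using r by (intro sum.cong) auto
  with r show ?case by simp
qed auto

lemma ec_er_sum: "gsum l l (\<lambda>i. ec l i * er l i) {..<l} = 1\<^sub>m l"
proof (intro eq_matI, goal_cases)
  case (1 r c)
  then have "(\<Sum>i<l. (ec l i * er l i) $$ (r, c)) = (\<Sum>i<l. if i = r then (if r = c then 1 else 0) else 0)"
    by (intro sum.cong) auto
  with 1 show ?case by simp
qed auto

lemma dg_mult: "dg a l * dg b l = dg (a * b) l"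
  by (intro eq_matI) (auto simp: power_mult_distrib if_distrib[of "\<lambda>x. x * _"] cong: if_cong)

lemma dg_one [simp]: "dg 1 l = 1\<^sub>m l"
  by (intro eq_matI) auto

lemma kron_ec_sum:
  "gsum (r * l) (r * l) (\<lambda>i. kronecker (1\<^sub>m r) (ec l i) * kronecker (1\<^sub>m r) (er l i)) {..<l} = (1\<^sub>m (r * l) :: 'k::field mat)"
proof (intro eq_matI, goal_cases)
  case (1 i j)
  then have "i mod l < l" "j mod l < l" "i div l < r" "j div l < r" by (auto intro: div_mod_bounds)
  then have "(\<Sum>s<l. (kronecker (1\<^sub>m r) (ec l s) * kronecker (1\<^sub>m r) (er l s)) $$ (i, j)) =
      (1\<^sub>m r :: 'k mat) $$ (i div l, j div l) * gsum l l (\<lambda>i. ec l i * er l i) {..<l} $$ (i mod l, j mod l)"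
    using 1 by (simp add: kron_mult index_kron sum_distrib_left)
  also have "\<dots> = (1\<^sub>m (r * l) :: 'k mat) $$ (i, j)"
    unfolding ec_er_sum using 1 by (simp add: index_kron flip: kron_one)
  finally show ?case using 1 by (simp del: index_mult_sum)
qed auto

lemma kron_ec_mult: "dim_row A = r \<Longrightarrow> kronecker (1\<^sub>m r) (ec l i) * A = kronecker A (ec l i)"
  using kron_mult[of "1\<^sub>m r" A "ec l i" "1\<^sub>m 1"] by simp

lemma kron_er_mult: "dim_col A = r \<Longrightarrow> A * kronecker (1\<^sub>m r) (er l i) = kronecker A (er l i)"
  using kron_mult[of A "1\<^sub>m r" "1\<^sub>m 1" "er l i"] by simp

text \<open>Tensoring with the basis columns and rows gives inclusions and projections of
  \<open>l\<close> layers; they form a biproduct, so maps out of the whole space can be compared on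
  each layer.\<close>

lemma kron_ec_ext:
  fixes B B' :: "'k::field mat"
  assumes "B \<in> carrier_mat a (r * l)" "B' \<in> carrier_mat a (r * l)"
    and eq: "\<And>i. i < l \<Longrightarrow> B * kronecker (1\<^sub>m r) (ec l i) = B' * kronecker (1\<^sub>m r) (ec l i)"
  shows "B = B'"
proof -
  let ?t = "\<lambda>i. kronecker (1\<^sub>m r) (ec l i) * kronecker (1\<^sub>m r) (er l i) :: 'k mat"
  have *: "C = gsum a (r * l) (\<lambda>i. C * kronecker (1\<^sub>m r) (ec l i) * kronecker (1\<^sub>m r) (er l i)) {..<l}"
    if C: "C \<in> carrier_mat a (r * l)" for C :: "'k mat"
  proof -
    have "C = C * gsum (r * l) (r * l) ?t {..<l}" using C by (simp add: kron_ec_sum)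
    also have "\<dots> = gsum a (r * l) (\<lambda>i. C * ?t i) {..<l}"
      using C by (subst gsum_mult_left) (auto intro!: carrier_matI)
    finally show ?thesis using C by (simp add: mat_assoc)
  qed
  show ?thesis
    by (subst *[OF assms(1)], subst *[OF assms(2)]) (intro gsum_cong, simp add: eq)
qed

lemma kron_er_ext:
  fixes B B' :: "'k::field mat"
  assumes "B \<in> carrier_mat (r * l) a" "B' \<in> carrier_mat (r * l) a"
    and eq: "\<And>i. i < l \<Longrightarrow> kronecker (1\<^sub>m r) (er l i) * B = kronecker (1\<^sub>m r) (er l i) * B'"
  shows "B = B'"
proof -
  let ?t = "\<lambda>i. kronecker (1\<^sub>m r) (ec l i) * kronecker (1\<^sub>m r) (er l i) :: 'k mat"
  have *: "C = gsum (r * l) a (\<lambda>i. kronecker (1\<^sub>m r) (ec l i) * (kronecker (1\<^sub>m r) (er l i) * C)) {..<l}"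
    if C: "C \<in> carrier_mat (r * l) a" for C :: "'k mat"
  proof -
    have "C = gsum (r * l) (r * l) ?t {..<l} * C" using C by (simp add: kron_ec_sum)
    also have "\<dots> = gsum (r * l) a (\<lambda>i. ?t i * C) {..<l}"
      using C by (subst gsum_mult_right) (auto intro!: carrier_matI)
    finally show ?thesis using C by (simp add: mat_assoc)
  qed
  show ?thesis
    by (subst *[OF assms(1)], subst *[OF assms(2)]) (intro gsum_cong, simp add: eq)
qed

text \<open>The inverse is the geometric series in \<open>W\<close>, which is finite.\<close>

lemma nilpotent_inverse:
  fixes W :: "'k::field mat"
  assumes W: "W \<in> carrier_mat d d" "W ^\<^sub>m l = 0\<^sub>m d d"
  obtains Q where "Q \<in> carrier_mat d d" "(1\<^sub>m d - W) * Q = 1\<^sub>m d" "Q * (1\<^sub>m d - W) = 1\<^sub>m d"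
proof -
  have [simp]: "dim_row W = d" "dim_col W = d" using W by auto
  have "(1\<^sub>m d - W) * gsum d d (\<lambda>i. W ^\<^sub>m i) {..<m} = 1\<^sub>m d - W ^\<^sub>m m" for m
  proof (induction m)
    case (Suc m)
    have "(1\<^sub>m d - W) * W ^\<^sub>m m = W ^\<^sub>m m - W ^\<^sub>m Suc m"
      by (simp add: mat_left_diff_distrib pow_mat_Suc2 del: pow_mat.simps)
    moreover have "1\<^sub>m d - W ^\<^sub>m m + (W ^\<^sub>m m - W ^\<^sub>m Suc m) = 1\<^sub>m d - W ^\<^sub>m Suc m"
      by (intro eq_matI) (auto simp del: pow_mat.simps)
    ultimately show ?case using Suc W(1)
      by (subst gsum_lessThan_Suc) (auto simp: mat_right_distrib simp del: pow_mat.simps)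
  qed (intro eq_matI, auto)
  from this[of l] W have 1: "(1\<^sub>m d - W) * gsum d d (\<lambda>i. W ^\<^sub>m i) {..<l} = 1\<^sub>m d"
    by (simp add: minus_mat_def) (intro eq_matI, auto)
  have c: "1\<^sub>m d - W \<in> carrier_mat d d" by (intro carrier_matI) auto
  show ?thesis using that[OF gsum_carrier 1 mat_mult_left_right_inverse[OF c gsum_carrier 1]] .
qed

text \<open>\<open>E\<close> is the average of the powers of \<open>B\<close>, hence the projection
  onto the fixed vectors of \<open>B\<close>. It serves to cut out eigenspaces of \<open>g\<close>
  and of \<open>g^n\<close>.\<close>

lemma order_idempotent:
  fixes B :: "'k::field_char_0 mat"
  assumes B: "B \<in> carrier_mat d d" "B ^\<^sub>m N = 1\<^sub>m d" "N > 0"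
  defines "E \<equiv> inverse (of_nat N) \<cdot>\<^sub>m gsum d d (\<lambda>j. B ^\<^sub>m j) {..<N}"
  shows "E \<in> carrier_mat d d" "B * E = E" "E * E = E"
    "\<And>T. T \<in> carrier_mat d d \<Longrightarrow> T * B = B * T \<Longrightarrow> T * E = E * T"
    "\<And>v c. v \<in> carrier_mat d c \<Longrightarrow> B * v = v \<Longrightarrow> E * v = v"
proof -
  have [simp]: "dim_row B = d" "dim_col B = d" using B by auto
  have p: "B ^\<^sub>m j \<in> carrier_mat d d" for j by (intro carrier_matI) auto
  let ?S = "gsum d d (\<lambda>j. B ^\<^sub>m j) {..<N}"
  obtain M where M: "N = Suc M" using B(3) by (cases N) auto
  show E: "E \<in> carrier_mat d d" by (simp add: E_def)
  have "B * ?S = gsum d d (\<lambda>j. B ^\<^sub>m Suc j) {..<N}"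
    using p by (subst gsum_mult_left) (auto simp: pow_mat_Suc2 simp del: pow_mat.simps)
  also have "\<dots> = gsum d d (\<lambda>j. B ^\<^sub>m Suc j) {..<M} + B ^\<^sub>m N"
    unfolding M by (rule gsum_lessThan_Suc[OF p])
  also have "\<dots> = B ^\<^sub>m 0 + gsum d d (\<lambda>j. B ^\<^sub>m Suc j) {..<M}"
    unfolding B(2) by (intro eq_matI) (auto simp del: pow_mat.simps(2))
  also have "\<dots> = ?S" unfolding M by (rule gsum_lessThan_Suc_shift[OF p, symmetric])
  finally show BE: "B * E = E" by (simp add: E_def)
  have BjE: "B ^\<^sub>m j * E = E" for j
    using E BE by (induction j) (auto simp: mat_assoc)
  have "?S * E = gsum d d (\<lambda>j. E) {..<N}"
    using E p BjE by (subst gsum_mult_right) auto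
  also have "\<dots> = of_nat N \<cdot>\<^sub>m E" using E by (subst gsum_const) auto
  finally show "E * E = E" using E B(3) by (subst (1) E_def) simp
  show "T * E = E * T" if T: "T \<in> carrier_mat d d" "T * B = B * T" for T
  proof -
    have "T * B ^\<^sub>m j = B ^\<^sub>m j * T" for j
      using pow_mat_intertwine[of B d B d T 1 j] B T by simp
    then have "T * ?S = ?S * T"
      using T p by (simp add: gsum_mult_left[where r = d and c = d] gsum_mult_right[where r = d and c = d])
    then show ?thesis using T by (simp add: E_def)
  qed
  show "E * v = v" if v: "v \<in> carrier_mat d c" "B * v = v" for v c
  proof -
    have "B ^\<^sub>m j * v = v" for j using v by (induction j) (auto simp: mat_assoc)
    then have "?S * v = of_nat N \<cdot>\<^sub>m v"
      using v p by (simp add: gsum_mult_right[where r = d and c = d] gsum_const)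
    then show ?thesis using v B(3) by (simp add: E_def)
  qed
qed

context green_datum
begin

text \<open>Both modules have the layers \<open>U, y U, y\<^sup>2 U, \<dots>\<close>: in \<open>chain l\<close> one has \<open>y\<^sup>l = 0\<close>, while
  \<open>Ind\<close> is \<open>H \<otimes> U\<close> over the group algebra, where \<open>y\<close> maps the last layer back to the first by \<open>g\<^sup>n - 1\<close>.\<close>

fun chain :: "nat \<Rightarrow> nat \<times> ('a \<Rightarrow> 'k mat) \<Rightarrow> ('a, 'k) hmod"
  where "chain l (d, X) = (d * l, (\<lambda>h. kronecker (X h) (dg (inverse (\<chi> h)) l)), kronecker (1\<^sub>m d) (sh l))"

definition yind :: "nat \<Rightarrow> ('a \<Rightarrow> 'k mat) \<Rightarrow> 'k mat"
  where "yind d X = kronecker (1\<^sub>m d) (sh n) + kronecker (X (g [^] n) - 1\<^sub>m d) (ec n 0 * er n (n - 1))"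

fun Ind :: "nat \<times> ('a \<Rightarrow> 'k mat) \<Rightarrow> ('a, 'k) hmod"
  where "Ind (d, X) = (d * n, (\<lambda>h. kronecker (X h) (dg (inverse (\<chi> h)) n)), yind d X)"

text \<open>Moving \<open>h\<close> past \<open>y^i\<close> costs the factor
  \<open>\<chi>(h)^(-i)\<close>; this is why the layers are twisted by the inverse of
  \<open>\<chi> h\<close>.\<close>

lemma sh_dg: "h \<in> carrier G \<Longrightarrow> sh l * dg (inverse (\<chi> h)) l = \<chi> h \<cdot>\<^sub>m (dg (inverse (\<chi> h)) l * sh l)"
proof (intro eq_matI, goal_cases)
  case (1 r c)
  then have rc: "r < l" "c < l" by auto
  have "(\<Sum>k<l. sh l $$ (r, k) * dg (inverse (\<chi> h)) l $$ (k, c)) =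
      (\<Sum>k<l. if k = c then (if r = Suc c then inverse (\<chi> h) ^ c else 0) else 0)"
    using rc by (intro sum.cong) auto
  moreover have "(\<Sum>k<l. dg (inverse (\<chi> h)) l $$ (r, k) * sh l $$ (k, c)) =
      (\<Sum>k<l. if k = r then (if r = Suc c then inverse (\<chi> h) ^ r else 0) else 0)"
    using rc by (intro sum.cong) auto
  ultimately show ?case using rc \<chi>_nz[OF 1(1)] by simp
qed auto

lemma gmod_twist:
  assumes "gmod G d X"
  shows "gmod G (d * l) (\<lambda>h. kronecker (X h) (dg (inverse (\<chi> h)) l))"
  unfolding gmod_def
proof (intro conjI ballI)
  note [simp] = gmodD(4,5)[OF assms]
  show "kronecker (X h) (dg (inverse (\<chi> h)) l) \<in> carrier_mat (d * l) (d * l)" if "h \<in> carrier G" for h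
    using that by (intro carrier_matI) auto
  show "kronecker (X (h \<otimes> k)) (dg (inverse (\<chi> (h \<otimes> k))) l) =
      kronecker (X h) (dg (inverse (\<chi> h)) l) * kronecker (X k) (dg (inverse (\<chi> k)) l)"
    if "h \<in> carrier G" "k \<in> carrier G" for h k
    using that by (simp add: kron_mult dg_mult gmodD(3)[OF assms] \<chi>_mult)
qed (simp add: gmodD(2)[OF assms] \<chi>_one)

lemma dg_gn [simp]: "dg (inverse (\<chi> (g [^] n))) l = 1\<^sub>m l"
proof -
  have "\<chi> (g [^] n) = 1" using order_q[of n] by (simp add: \<chi>_g_pow)
  then show ?thesis by simp
qed

lemma sh_pow_ec: "sh l ^\<^sub>m j * ec l i = ec l (i + j)"
  by (induction j arbitrary: i) (simp_all add: mat_assoc sh_ec)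

lemma ec_zero: "l \<le> i \<Longrightarrow> ec l i = 0\<^sub>m l 1"
  by (intro eq_matI) auto

lemma chain_hmods:
  assumes X: "gmod G d X" "X (g [^] n) = 1\<^sub>m d" and l: "l \<le> n"
  shows "chain l (d, X) \<in> hmods"
proof -
  note [simp] = gmodD(4,5)[OF X(1)]
  have "kronecker (1\<^sub>m d) (sh l) ^\<^sub>m n = 0\<^sub>m (d * l) (d * l)"
  proof (rule kron_ec_ext[of _ "d * l" d l])
    fix i
    show "kronecker (1\<^sub>m d) (sh l) ^\<^sub>m n * kronecker (1\<^sub>m d) (ec l i) = 0\<^sub>m (d * l) (d * l) * kronecker (1\<^sub>m d) (ec l i)"
      using l by (simp add: kron_pow kron_mult sh_pow_ec ec_zero)
  qed (auto intro!: carrier_matI)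
  moreover have "(1\<^sub>m (d * l) - 1\<^sub>m (d * l) :: 'k mat) = 0\<^sub>m (d * l) (d * l)" by simp
  ultimately show ?thesis
    unfolding chain.simps hmods_def mem_Collect_eq prod.case
    using gmod_twist[OF X(1)] X(2) by (auto simp: kron_mult sh_dg intro!: carrier_matI)
qed

context
  fixes r :: nat and U :: "'a \<Rightarrow> 'k mat"
  assumes U: "gmod G r U"
begin

lemma gn_dims: "dim_row (U (g [^] n)) = r" "dim_col (U (g [^] n)) = r"
  using gmodD(4,5)[OF U, of "g [^] n"] g_closed by auto

lemma yind_dims [simp]: "dim_row (yind r U) = r * n" "dim_col (yind r U) = r * n"
  using gn_dims by (simp_all add: yind_def)

lemma yind_ec:
  assumes A: "dim_row A = r"
  shows "Suc i < n \<Longrightarrow> yind r U * kronecker A (ec n i) = kronecker A (ec n (Suc i))"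
    "Suc i = n \<Longrightarrow> yind r U * kronecker A (ec n i) = kronecker ((U (g [^] n) - 1\<^sub>m r) * A) (ec n 0)"
proof -
  note [simp] = gn_dims
  have e: "er n (n - 1) * ec n i = (if n - 1 = i then 1\<^sub>m 1 else 0\<^sub>m 1 1 :: 'k mat)"
    using n_ge_2 by (intro er_ec) auto
  show "Suc i < n \<Longrightarrow> yind r U * kronecker A (ec n i) = kronecker A (ec n (Suc i))"
    using A e by (cases "n - 1 = i") (auto simp: yind_def mat_left_distrib kron_mult sh_ec mat_assoc)
  show "Suc i = n \<Longrightarrow> yind r U * kronecker A (ec n i) = kronecker ((U (g [^] n) - 1\<^sub>m r) * A) (ec n 0)"
    using A e by (auto simp: yind_def mat_left_distrib kron_mult sh_ec mat_assoc ec_zero)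
qed

lemma yind_pow_ec: "dim_row A = r \<Longrightarrow> j < n \<Longrightarrow> yind r U ^\<^sub>m j * kronecker A (ec n 0) = kronecker A (ec n j)"
proof (induction j)
  case (Suc j)
  have "yind r U ^\<^sub>m Suc j * kronecker A (ec n 0) = yind r U * (yind r U ^\<^sub>m j * kronecker A (ec n 0))"
    using Suc.prems by (simp add: mat_assoc pow_mat_Suc2 del: pow_mat.simps)
  then show ?case using Suc by (simp add: yind_ec del: pow_mat.simps)
qed simp

text \<open>The first layer generates and powers of \<open>yind\<close> commute with each other, so
  it is enough that going around once applies \<open>g^n - 1\<close> to the first layer.\<close>

lemma yind_pow: "yind r U ^\<^sub>m n = kronecker (U (g [^] n) - 1\<^sub>m r) (1\<^sub>m n)"
proof (rule kron_ec_ext[of _ "r * n" r n])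
  note [simp] = gn_dims
  show "yind r U ^\<^sub>m n \<in> carrier_mat (r * n) (r * n)"
    by (intro carrier_matI) (simp_all only: pow_mat_dims yind_dims)
  show "kronecker (U (g [^] n) - 1\<^sub>m r) (1\<^sub>m n) \<in> carrier_mat (r * n) (r * n)" by (intro carrier_matI) auto
  fix i assume i: "i < n"
  let ?e = "\<lambda>A i. kronecker A (ec n i)"
  obtain m where m: "n = Suc m" using n_ge_2 by (cases n) auto
  have *: "yind r U ^\<^sub>m n * ?e (1\<^sub>m r) 0 = ?e (U (g [^] n) - 1\<^sub>m r) 0"
  proof -
    have "yind r U ^\<^sub>m n * ?e (1\<^sub>m r) 0 = yind r U * (yind r U ^\<^sub>m m * ?e (1\<^sub>m r) 0)"
      using pow_mat_Suc2[of "yind r U" m] by (simp add: mat_assoc flip: m)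
    also have "\<dots> = yind r U * ?e (1\<^sub>m r) m" using m by (subst yind_pow_ec) auto
    also have "\<dots> = ?e (U (g [^] n) - 1\<^sub>m r) 0" using m by (subst yind_ec(2)) auto
    finally show ?thesis .
  qed
  have "yind r U ^\<^sub>m n * ?e (1\<^sub>m r) i = yind r U ^\<^sub>m n * (yind r U ^\<^sub>m i * ?e (1\<^sub>m r) 0)" using i by (simp add: yind_pow_ec)
  also have "\<dots> = yind r U ^\<^sub>m i * (yind r U ^\<^sub>m n * ?e (1\<^sub>m r) 0)"
    using pow_mat_add[of "yind r U" n i] pow_mat_add[of "yind r U" i n]
      mat_assoc[of "yind r U ^\<^sub>m n" "yind r U ^\<^sub>m i" "?e (1\<^sub>m r) 0"]
      mat_assoc[of "yind r U ^\<^sub>m i" "yind r U ^\<^sub>m n" "?e (1\<^sub>m r) 0"] by (simp add: add.commute)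
  also have "\<dots> = ?e (U (g [^] n) - 1\<^sub>m r) i" unfolding * by (rule yind_pow_ec[OF _ i]) simp
  also have "\<dots> = kronecker (U (g [^] n) - 1\<^sub>m r) (1\<^sub>m n) * ?e (1\<^sub>m r) i" by (simp add: kron_mult)
  finally show "yind r U ^\<^sub>m n * kronecker (1\<^sub>m r) (ec n i) = kronecker (U (g [^] n) - 1\<^sub>m r) (1\<^sub>m n) * kronecker (1\<^sub>m r) (ec n i)" .
qed

lemma Ind_hmods: "Ind (r, U) \<in> hmods"
proof -
  note [simp] = gmodD(4,5)[OF U]
  have gn: "g [^] n \<in> carrier G" using g_closed by simp
  note [simp] = gn_dims
  have "yind r U * kronecker (U h) (dg (inverse (\<chi> h)) n) = \<chi> h \<cdot>\<^sub>m (kronecker (U h) (dg (inverse (\<chi> h)) n) * yind r U)"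
    if h: "h \<in> carrier G" for h
  proof -
    have c: "(U (g [^] n) - 1\<^sub>m r) * U h = U h * (U (g [^] n) - 1\<^sub>m r)"
      using h gn gmodD(3)[OF U h gn] gmodD(3)[OF U gn h] g_pow_central[OF h]
      by (simp add: mat_left_diff_distrib mat_right_diff_distrib)
    obtain m where m: "n = Suc m" using n_ge_2 by (cases n) auto
    \<comment> \<open>The wrap-around leads from layer \<open>n - 1\<close> back to layer 0, so the
      twist \<open>\<chi>(h)^(1 - n)\<close> has to be \<open>\<chi>(h)\<close>; this is where
      \<open>\<chi>^n = 1\<close> enters.\<close>
    have "inverse (\<chi> h) ^ m = \<chi> h * inverse (\<chi> h) ^ n" using \<chi>_nz[OF h] by (simp add: m)
    also have "\<dots> = \<chi> h" using \<chi>_pow[OF h] by (simp add: power_inverse)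
    finally have "inverse (\<chi> h) ^ (n - 1) = \<chi> h" by (simp add: m)
    then have "(ec n 0 * er n (n - 1)) * dg (inverse (\<chi> h)) n = \<chi> h \<cdot>\<^sub>m (dg (inverse (\<chi> h)) n * (ec n 0 * er n (n - 1)))"
      by (simp add: mat_assoc er_dg mat_pull[OF dg_ec])
    then show ?thesis
      using h c by (simp add: yind_def mat_left_distrib mat_right_distrib kron_mult sh_dg smult_add_mat)
  qed
  moreover have "yind r U ^\<^sub>m n = kronecker (U (g [^] n)) (1\<^sub>m n) - 1\<^sub>m (r * n)"
    unfolding yind_pow by (simp add: kron_diff_left)
  ultimately show ?thesis
    unfolding Ind.simps hmods_def mem_Collect_eq prod.case
    using gmod_twist[OF U] by (auto intro!: carrier_matI)
qed

end

text \<open>The wrap-around carries the factor \<open>g^n - 1\<close>, which is zero here; chains of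
  full length \<open>n\<close> thus count as induced modules.\<close>

lemma Ind_eq_chain: "gmod G d X \<Longrightarrow> X (g [^] n) = 1\<^sub>m d \<Longrightarrow> Ind (d, X) = chain n (d, X)"
  by (simp add: yind_def)

end


section \<open>Frobenius reciprocity and the tensor identity\<close>

context green_datum
begin

text \<open>Frobenius reciprocity: \<open>frob Y f r l\<close> sends the vector \<open>u\<close> of the \<open>i\<close>-th layer to \<open>Y\<^sup>i (f u)\<close>.\<close>

definition frob :: "'k mat \<Rightarrow> 'k mat \<Rightarrow> nat \<Rightarrow> nat \<Rightarrow> 'k mat"
  where "frob Y f r l = gsum (dim_row Y) (r * l) (\<lambda>i. Y ^\<^sub>m i * f * kronecker (1\<^sub>m r) (er l i)) {..<l}"

lemma frob_ec:
  assumes "Y \<in> carrier_mat d d" "f \<in> carrier_mat d r" "dim_row A = r" "i < l"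
  shows "frob Y f r l * kronecker A (ec l i) = Y ^\<^sub>m i * f * A"
proof -
  have [simp]: "dim_row Y = d" "dim_col Y = d" "dim_row f = d" "dim_col f = r" "dim_row A = r" using assms by auto
  have "frob Y f r l * kronecker A (ec l i) =
      gsum d (dim_col A) (\<lambda>j. Y ^\<^sub>m j * f * kronecker (1\<^sub>m r) (er l j) * kronecker A (ec l i)) {..<l}"
    unfolding frob_def by (subst gsum_mult_right) (auto intro!: carrier_matI)
  also have "\<dots> = gsum d (dim_col A) (\<lambda>j. if j = i then Y ^\<^sub>m i * f * A else 0\<^sub>m d (dim_col A)) {..<l}"
    by (intro gsum_cong) (auto simp: mat_assoc kron_mult er_ec)
  also have "\<dots> = Y ^\<^sub>m i * f * A"
    using assms(4) by (intro eq_matI) (auto simp: if_distrib[of "\<lambda>M. M $$ _"] simp del: index_mult_sum cong: if_cong)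
  finally show ?thesis .
qed

lemma frob_carrier: "Y \<in> carrier_mat d d \<Longrightarrow> frob Y f r l \<in> carrier_mat d (r * l)"
  by (simp add: frob_def)

lemma frob_group:
  assumes M: "(d, X, Y) \<in> hmods" and U: "gmod G r U" and f: "ghom r U d X f" and h: "h \<in> carrier G"
  shows "X h * frob Y f r l = frob Y f r l * kronecker (U h) (dg (inverse (\<chi> h)) l)"
proof (rule kron_ec_ext[of _ d r l])
  note D = hmodsD[OF M] and F = ghomD[OF f]
  note [simp] = D(3,4) gmodD(4,5)[OF D(1)] gmodD(4,5)[OF U] F(2,3) h carrier_matD[OF frob_carrier[OF D(2)]]
  show "X h * frob Y f r l \<in> carrier_mat d (r * l)"
    "frob Y f r l * kronecker (U h) (dg (inverse (\<chi> h)) l) \<in> carrier_mat d (r * l)"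
    by (intro carrier_matI; simp)+
  fix i assume i: "i < l"
  have "X h * frob Y f r l * kronecker (1\<^sub>m r) (ec l i) = X h * (frob Y f r l * kronecker (1\<^sub>m r) (ec l i))"
    by (simp add: mat_assoc)
  also have "\<dots> = X h * Y ^\<^sub>m i * f"
    using i F(1) D(2) by (simp add: frob_ec[of Y d] mat_assoc)
  also have "\<dots> = inverse (\<chi> h) ^ i \<cdot>\<^sub>m (Y ^\<^sub>m i * f * U h)"
    unfolding hmods_commute[OF M h] by (simp add: mat_assoc F(4))
  also have "\<dots> = frob Y f r l * (kronecker (U h) (dg (inverse (\<chi> h)) l) * kronecker (1\<^sub>m r) (ec l i))"
    using i F(1) D(2) by (simp add: kron_mult dg_ec frob_ec[of Y d])
  also have "\<dots> = frob Y f r l * kronecker (U h) (dg (inverse (\<chi> h)) l) * kronecker (1\<^sub>m r) (ec l i)"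
    by (simp add: mat_assoc)
  finally show "X h * frob Y f r l * kronecker (1\<^sub>m r) (ec l i) =
    frob Y f r l * kronecker (U h) (dg (inverse (\<chi> h)) l) * kronecker (1\<^sub>m r) (ec l i)" .
qed

lemma frob_chain:
  assumes M: "(d, X, Y) \<in> hmods" and U: "gmod G r U" and f: "ghom r U d X f" and z: "Y ^\<^sub>m l * f = 0\<^sub>m d r"
  shows "hhom (chain l (r, U)) (d, X, Y) (frob Y f r l)"
proof -
  note D = hmodsD[OF M] and F = ghomD[OF f]
  note [simp] = D(3,4) F(2,3) carrier_matD[OF frob_carrier[OF D(2)]]
  have "Y * frob Y f r l = frob Y f r l * kronecker (1\<^sub>m r) (sh l)"
  proof (rule kron_ec_ext[of _ d r l])
    show "Y * frob Y f r l \<in> carrier_mat d (r * l)" "frob Y f r l * kronecker (1\<^sub>m r) (sh l) \<in> carrier_mat d (r * l)"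
      by (intro carrier_matI; simp)+
    fix i assume i: "i < l"
    have "Y * frob Y f r l * kronecker (1\<^sub>m r) (ec l i) = Y ^\<^sub>m Suc i * f"
      using i F(1) D(2) by (simp add: mat_assoc frob_ec[of Y d] pow_mat_Suc2 del: pow_mat.simps)
    also have "\<dots> = frob Y f r l * kronecker (1\<^sub>m r) (ec l (Suc i))"
    proof (cases "Suc i = l")
      case True
      then show ?thesis using z by (simp add: ec_zero del: pow_mat.simps)
    next
      case False
      then show ?thesis using i F(1) D(2) by (subst frob_ec[of Y d]) (auto simp del: pow_mat.simps)
    qed
    finally show "Y * frob Y f r l * kronecker (1\<^sub>m r) (ec l i) =
        frob Y f r l * kronecker (1\<^sub>m r) (sh l) * kronecker (1\<^sub>m r) (ec l i)"
      by (simp add: mat_assoc kron_mult sh_ec)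
  qed
  then show ?thesis using frob_group[OF M U f] frob_carrier[OF D(2)] by simp
qed

lemma frob_Ind:
  assumes M: "(d, X, Y) \<in> hmods" and U: "gmod G r U" and f: "ghom r U d X f"
  shows "hhom (Ind (r, U)) (d, X, Y) (frob Y f r n)"
proof -
  note D = hmodsD[OF M] and F = ghomD[OF f]
  note [simp] = D(3,4) F(2,3) carrier_matD[OF frob_carrier[OF D(2)]] yind_dims[OF U]
  have gn: "g [^] n \<in> carrier G" using g_closed by simp
  have [simp]: "dim_row (U (g [^] n)) = r" "dim_col (U (g [^] n)) = r" "dim_row (X (g [^] n)) = d" "dim_col (X (g [^] n)) = d"
    using gmodD(4,5)[OF U gn] gmodD(4,5)[OF D(1) gn] by auto
  have "Y * frob Y f r n = frob Y f r n * yind r U"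
  proof (rule kron_ec_ext[of _ d r n])
    show "Y * frob Y f r n \<in> carrier_mat d (r * n)" "frob Y f r n * yind r U \<in> carrier_mat d (r * n)"
      by (intro carrier_matI; simp)+
    fix i assume i: "i < n"
    have "Y * frob Y f r n * kronecker (1\<^sub>m r) (ec n i) = Y ^\<^sub>m Suc i * f"
      using i F(1) D(2) by (simp add: mat_assoc frob_ec[of Y d] pow_mat_Suc2 del: pow_mat.simps)
    also have "\<dots> = frob Y f r n * (yind r U * kronecker (1\<^sub>m r) (ec n i))"
    proof (cases "Suc i = n")
      case True
      have "Y ^\<^sub>m Suc i * f = (X (g [^] n) - 1\<^sub>m d) * f" using D(6) True by simp
      also have "\<dots> = f * (U (g [^] n) - 1\<^sub>m r)"
        using F(4)[OF gn] by (simp add: mat_left_diff_distrib mat_right_diff_distrib)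
      also have "\<dots> = frob Y f r n * kronecker (U (g [^] n) - 1\<^sub>m r) (ec n 0)"
        using F(1) D(2) n_ge_2 by (subst frob_ec[of Y d]) auto
      finally show ?thesis using True by (simp add: yind_ec(2)[OF U])
    next
      case False
      then show ?thesis using i F(1) D(2) by (simp add: yind_ec(1)[OF U] frob_ec[of Y d] del: pow_mat.simps)
    qed
    finally show "Y * frob Y f r n * kronecker (1\<^sub>m r) (ec n i) = frob Y f r n * yind r U * kronecker (1\<^sub>m r) (ec n i)"
      by (simp add: mat_assoc)
  qed
  then show ?thesis using frob_group[OF M U f] frob_carrier[OF D(2)] by simp
qed

text \<open>\<open>frob\<close> maps between spaces of equal dimension. Every \<open>F i\<close>
  factors through it, and the \<open>F i\<close> cover the target by the partition of unity with the
  \<open>Q i\<close>, so it has a right inverse and is bijective.\<close>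

lemma Ind_iso:
  assumes M: "(d, X, Y) \<in> hmods" and U: "gmod G r U" and f: "ghom r U d X f" and d: "d = r * n"
    and F: "\<And>i. i < n \<Longrightarrow> \<exists>K. K \<in> carrier_mat (r * n) c \<and> frob Y f r n * K = F i"
    and Q: "\<And>i. i < n \<Longrightarrow> Q i \<in> carrier_mat c d" "gsum d d (\<lambda>i. F i * Q i) {..<n} = 1\<^sub>m d"
  shows "hiso (Ind (r, U)) (d, X, Y)"
proof -
  note D = hmodsD[OF M]
  let ?J = "frob Y f r n"
  have J: "?J \<in> carrier_mat d d" using frob_carrier[OF D(2)] d by simp
  obtain K where K: "\<And>i. i < n \<Longrightarrow> K i \<in> carrier_mat (r * n) c" "\<And>i. i < n \<Longrightarrow> ?J * K i = F i"
    using F by metis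
  define R where "R = gsum d d (\<lambda>i. K i * Q i) {..<n}"
  have KQ: "K i * Q i \<in> carrier_mat d d" if "i < n" for i using K(1)[OF that] Q(1)[OF that] d by auto
  have "?J * R = gsum d d (\<lambda>i. ?J * (K i * Q i)) {..<n}"
    unfolding R_def using J KQ by (subst gsum_mult_left[where r = d]) auto
  also have "\<dots> = gsum d d (\<lambda>i. F i * Q i) {..<n}"
  proof (intro gsum_cong)
    fix i assume "i \<in> {..<n}"
    then have "i < n" by simp
    then show "?J * (K i * Q i) = F i * Q i"
      using K(2)[of i, symmetric] carrier_matD[OF K(1)[of i]] carrier_matD[OF Q(1)[of i]] carrier_matD[OF J] d by (simp add: mat_assoc)
  qed
  finally have JR: "?J * R = 1\<^sub>m d" using Q(2) by simp
  have R: "R \<in> carrier_mat d d" by (simp add: R_def)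
  have "hhom (Ind (r, U)) (d, X, Y) ?J" by (rule frob_Ind[OF M U f])
  then show ?thesis unfolding Ind.simps hiso.simps hhom.simps
    by (intro conjI bexI[OF _ J[unfolded d]] bexI[OF _ R[unfolded d]] d[symmetric])
      (use JR mat_mult_left_right_inverse[OF J R JR] d in auto)
qed

lemma hiso_sym:
  assumes "M \<in> hmods" "N \<in> hmods" "hiso M N"
  shows "hiso N M"
  using assms cls_eq_iff[of M N] cls_eq_iff[of N M] by simp

lemma gmod_tensor:
  assumes "gmod G d X" "gmod G e X'"
  shows "gmod G (d * e) (\<lambda>h. kronecker (X h) (X' h))"
  unfolding gmod_def using gmodD(1-3)[OF assms(1)] gmodD(1-3)[OF assms(2)] gmodD(4,5)[OF assms(1)] gmodD(4,5)[OF assms(2)]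
  by (auto simp: kron_mult)

lemma mat_add_diff_cancel_left [simp]:
  fixes A B :: "'k mat"
  shows "dim_row A = dim_row B \<Longrightarrow> dim_col A = dim_col B \<Longrightarrow> A + B - B = A" "dim_row A = dim_row B \<Longrightarrow> dim_col A = dim_col B \<Longrightarrow> B + A - B = A"
  by (auto intro!: eq_matI)

text \<open>The image of \<open>frob\<close> is stable under \<open>Y\<close>, and
  \<open>Y * F i\<close> is \<open>F (Suc i)\<close> up to a term that factors through
  \<open>F i\<close>. By induction all \<open>F i\<close> lie in the image, although they are not
  the powers of \<open>Y\<close> applied to \<open>F 0\<close>.\<close>

lemma Ind_iso_twisted:
  assumes M: "(d, X, Y) \<in> hmods" and U: "gmod G r U" and d: "d = r * n"
    and f: "ghom r U d X (F 0)" and Fc: "\<And>i. F i \<in> carrier_mat d r" and C: "C \<in> carrier_mat r r"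
    and step: "\<And>i. Suc i < n \<Longrightarrow> Y * F i = F (Suc i) + a i \<cdot>\<^sub>m (F i * C)"
    and Q: "\<And>i. i < n \<Longrightarrow> Q i \<in> carrier_mat r d" "gsum d d (\<lambda>i. F i * Q i) {..<n} = 1\<^sub>m d"
  shows "hiso (Ind (r, U)) (d, X, Y)"
proof (rule Ind_iso[OF M U f d _ Q])
  note D = hmodsD[OF M]
  note [simp] = D(3,4) carrier_matD[OF frob_carrier[OF D(2)]] yind_dims[OF U] carrier_matD[OF Fc] carrier_matD[OF C]
  let ?J = "frob Y (F 0) r n"
  have JY: "Y * ?J = ?J * yind r U" using frob_Ind[OF M U f] by simp
  fix i assume "i < n"
  then show "\<exists>K. K \<in> carrier_mat (r * n) r \<and> ?J * K = F i"
  proof (induction i)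
    case 0
    have "?J * kronecker (1\<^sub>m r) (ec n 0) = F 0"
      using 0 Fc D(2) by (subst frob_ec[of Y d]) auto
    then show ?case by (intro exI[of _ "kronecker (1\<^sub>m r) (ec n 0)"]) (auto intro!: carrier_matI)
  next
    case (Suc i)
    then obtain K where K: "K \<in> carrier_mat (r * n) r" "?J * K = F i" by auto
    note [simp] = carrier_matD[OF K(1)]
    have "?J * (yind r U * K - a i \<cdot>\<^sub>m (K * C)) = ?J * yind r U * K - a i \<cdot>\<^sub>m (?J * K * C)"
      by (simp add: mat_right_diff_distrib mat_assoc)
    also have "\<dots> = Y * F i - a i \<cdot>\<^sub>m (F i * C)"
      unfolding JY[symmetric] by (simp add: mat_assoc K(2))
    also have "\<dots> = F (Suc i)" using Suc.prems by (simp add: step)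
    finally show ?case by (intro exI[of _ "yind r U * K - a i \<cdot>\<^sub>m (K * C)"]) (auto intro!: carrier_matI)
  qed
qed

text \<open>The twist by \<open>g^i\<close> in the second factor of \<open>?F i\<close> absorbs the
  \<open>g\<close> in \<open>y \<otimes> g\<close>. The summand \<open>1 \<otimes> y\<close> then
  only adds a term in the same layer, with the scalar \<open>q^i\<close> from moving
  \<open>y\<close> past \<open>g^i\<close>.\<close>

lemma Ind_tens_right:
  assumes W: "gmod G w W" and N: "(e, X', Y') \<in> hmods"
  shows "hiso (Ind (w * e, \<lambda>h. kronecker (W h) (X' h))) (htens (Ind (w, W)) (e, X', Y'))"
proof -
  note D = hmodsD[OF N]
  note [simp] = D(3,4) gmodD(4,5)[OF D(1)] gmodD(4,5)[OF W] g_closed yind_dims[OF W]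
  let ?q = "\<chi> g"
  let ?F = "\<lambda>i. kronecker (kronecker (1\<^sub>m w) (ec n i)) (X' g ^\<^sub>m i)"
  let ?Q = "\<lambda>i. kronecker (kronecker (1\<^sub>m w) (er n i)) (X' (inv g) ^\<^sub>m i)"
  have M: "htens (Ind (w, W)) (e, X', Y') \<in> hmods" using htens_hmods[OF Ind_hmods[OF W] N] .
  show ?thesis unfolding Ind.simps[of w] htens.simps
  proof (rule Ind_iso_twisted[OF M[unfolded Ind.simps htens.simps] gmod_tensor[OF W D(1)], of ?F "kronecker (1\<^sub>m w) Y'" "\<lambda>i. ?q ^ i" ?Q])
    show "ghom (w * e) (\<lambda>h. kronecker (W h) (X' h)) (w * n * e)
       (\<lambda>h. kronecker (kronecker (W h) (dg (inverse (\<chi> h)) n)) (X' h)) (?F 0)"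
      unfolding ghom_def by (auto simp: kron_mult dg_ec kron_ec_mult intro!: carrier_matI)
    have Yp: "Y' * X' g ^\<^sub>m i = ?q ^ i \<cdot>\<^sub>m (X' g ^\<^sub>m i * Y')" for i
      by (rule pow_mat_intertwine[of _ e _ e]) (use D(2) D(5)[OF g_closed] gmodD(1)[OF D(1) g_closed] in auto)
    show "(kronecker (yind w W) (X' g) + kronecker (1\<^sub>m (w * n)) Y') * ?F i =
        ?F (Suc i) + ?q ^ i \<cdot>\<^sub>m (?F i * kronecker (1\<^sub>m w) Y')" if "Suc i < n" for i
      using that yind_ec(1)[OF W, of "1\<^sub>m w" i]
      by (simp add: mat_left_distrib kron_mult Yp kron_ec_mult pow_mat_Suc2 del: pow_mat.simps)
    have inv: "X' g ^\<^sub>m i * X' (inv g) ^\<^sub>m i = 1\<^sub>m e" for i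
    proof (induction i)
      case (Suc i)
      have "X' g ^\<^sub>m Suc i * X' (inv g) ^\<^sub>m Suc i = X' g ^\<^sub>m i * (X' g * X' (inv g)) * X' (inv g) ^\<^sub>m i"
        by (simp add: pow_mat_Suc2[of "X' (inv g)"] mat_assoc del: pow_mat.simps(2)) (simp add: mat_assoc)
      then show ?case using Suc gmodD(7)[OF D(1) g_closed] by simp
    qed (use D(1) in simp)
    have "gsum (w * n * e) (w * n * e) (\<lambda>i. ?F i * ?Q i) {..<n} =
        kronecker (gsum (w * n) (w * n) (\<lambda>i. kronecker (1\<^sub>m w) (ec n i) * kronecker (1\<^sub>m w) (er n i)) {..<n}) (1\<^sub>m e)"
      by (intro eq_matI) (auto simp: kron_mult inv index_kron div_mod_bounds sum_distrib_right simp del: index_mult_sum)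
    then show "gsum (w * n * e) (w * n * e) (\<lambda>i. ?F i * ?Q i) {..<n} = 1\<^sub>m (w * n * e)"
      by (simp add: kron_ec_sum)
  qed (auto intro!: carrier_matI)
qed

text \<open>Here \<open>1 \<otimes> y\<close> moves the layers without a twist and
  \<open>y \<otimes> g\<close> supplies the extra term; \<open>g\<close> scales layer
  \<open>i\<close> by \<open>\<chi>(g)^(-i)\<close>, which explains the coefficient.\<close>

lemma Ind_tens_left:
  assumes W: "gmod G w W" and N: "(e, X', Y') \<in> hmods"
  shows "hiso (Ind (e * w, \<lambda>h. kronecker (X' h) (W h))) (htens (e, X', Y') (Ind (w, W)))"
proof -
  note D = hmodsD[OF N]
  note [simp] = D(3,4) gmodD(4,5)[OF D(1)] gmodD(4,5)[OF W] g_closed yind_dims[OF W]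
  let ?a = "inverse (\<chi> g)"
  let ?F = "\<lambda>i. kronecker (1\<^sub>m e) (kronecker (1\<^sub>m w) (ec n i))"
  let ?Q = "\<lambda>i. kronecker (1\<^sub>m e) (kronecker (1\<^sub>m w) (er n i))"
  have M: "htens (e, X', Y') (Ind (w, W)) \<in> hmods" using htens_hmods[OF N Ind_hmods[OF W]] .
  show ?thesis unfolding Ind.simps[of w] htens.simps
  proof (rule Ind_iso_twisted[OF M[unfolded Ind.simps htens.simps] gmod_tensor[OF D(1) W], of ?F "kronecker Y' (W g)" "\<lambda>i. ?a ^ i" ?Q])
    show "ghom (e * w) (\<lambda>h. kronecker (X' h) (W h)) (e * (w * n))
       (\<lambda>h. kronecker (X' h) (kronecker (W h) (dg (inverse (\<chi> h)) n))) (?F 0)"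
      unfolding ghom_def by (auto simp: kron_mult dg_ec kron_ec_mult intro!: carrier_matI)
    show "(kronecker Y' (kronecker (W g) (dg (inverse (\<chi> g)) n)) + kronecker (1\<^sub>m e) (yind w W)) * ?F i =
        ?F (Suc i) + ?a ^ i \<cdot>\<^sub>m (?F i * kronecker Y' (W g))" if "Suc i < n" for i
      using that yind_ec(1)[OF W, of "1\<^sub>m w" i]
      by (simp add: mat_left_distrib kron_mult kron_ec_mult dg_ec)
        (rule comm_add_mat[of _ "e * (w * n)" "e * w"]; intro carrier_matI; simp)
    have "gsum (e * (w * n)) (e * (w * n)) (\<lambda>i. ?F i * ?Q i) {..<n} =
        kronecker (1\<^sub>m e) (gsum (w * n) (w * n) (\<lambda>i. kronecker (1\<^sub>m w) (ec n i) * kronecker (1\<^sub>m w) (er n i)) {..<n})"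
    proof (intro eq_matI, goal_cases)
      case (1 i j)
      then have "i mod (w * n) < w * n" "j mod (w * n) < w * n" by (auto intro: div_mod_bounds)
      with 1 show ?case
        by (auto simp: kron_mult index_kron div_mod_bounds sum_distrib_left simp del: index_mult_sum)
    qed auto
    then show "gsum (e * (w * n)) (e * (w * n)) (\<lambda>i. ?F i * ?Q i) {..<n} = 1\<^sub>m (e * (w * n))"
      by (simp add: kron_ec_sum)
  qed (auto intro!: carrier_matI)
qed

end


subsection \<open>Decomposition of modules\<close>

context green_datum
begin

lemma hmods_restrict:
  assumes M: "(d, X, Y) \<in> hmods" and A: "A \<in> carrier_mat d r" and B: "B \<in> carrier_mat r d" and BA: "B * A = 1\<^sub>m r"
    and XA: "\<And>h. h \<in> carrier G \<Longrightarrow> X h * A = A * (B * X h * A)" and YA: "Y * A = A * (B * Y * A)"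
  shows "(r, \<lambda>h. B * X h * A, B * Y * A) \<in> hmods" "hhom (r, \<lambda>h. B * X h * A, B * Y * A) (d, X, Y) A"
proof -
  note D = hmodsD[OF M] and GD = gmodD[OF hmodsD(1)[OF M]]
  note [simp] = D(3,4) GD(4,5) carrier_matD[OF A] carrier_matD[OF B]
  let ?X = "\<lambda>h. B * X h * A" and ?Y = "B * Y * A"
  have cancel: "B * (A * Z) = Z" if "dim_row Z = r" for Z using mat_pull[OF BA, of Z] that by simp
  have "gmod G r ?X" unfolding gmod_def
  proof (intro conjI ballI)
    fix h k assume h: "h \<in> carrier G" and k: "k \<in> carrier G"
    have "?X (h \<otimes> k) = B * (X h * (X k * A))" using h k by (simp add: GD(3) mat_assoc)
    also have "\<dots> = B * (X h * (A * ?X k))" using XA[OF k] by simp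
    finally show "?X (h \<otimes> k) = ?X h * ?X k" using h k by (simp add: mat_assoc)
  qed (auto simp: GD(2) BA intro!: carrier_matI)
  moreover have "?Y * ?X h = \<chi> h \<cdot>\<^sub>m (?X h * ?Y)" if h: "h \<in> carrier G" for h
  proof -
    have "?Y * ?X h = B * Y * (A * ?X h)" using h by (simp add: mat_assoc)
    also have "\<dots> = B * (Y * X h * A)" unfolding XA[OF h, symmetric] using h by (simp add: mat_assoc)
    also have "\<dots> = \<chi> h \<cdot>\<^sub>m (B * (X h * (Y * A)))" unfolding D(5)[OF h] using h by (simp add: mat_assoc)
    also have "B * (X h * (Y * A)) = B * (X h * (A * ?Y))" using YA by simp
    also have "\<dots> = ?X h * ?Y" using h by (simp add: mat_assoc)
    finally show ?thesis .
  qed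
  moreover have "?Y ^\<^sub>m n = ?X (g [^] n) - 1\<^sub>m r"
  proof -
    have gn: "g [^] n \<in> carrier G" using g_closed by simp
    have "A * ?Y = 1 \<cdot>\<^sub>m (Y * A)" by (simp only: one_smult_mat YA[symmetric])
    then have "A * ?Y ^\<^sub>m n = 1 ^ n \<cdot>\<^sub>m (Y ^\<^sub>m n * A)"
      by (intro pow_mat_intertwine D(2) A carrier_matI) simp_all
    then have "Y ^\<^sub>m n * A = A * ?Y ^\<^sub>m n" by simp
    then have "?Y ^\<^sub>m n = B * (Y ^\<^sub>m n * A)" by (simp add: cancel)
    also have "\<dots> = ?X (g [^] n) - 1\<^sub>m r"
      unfolding D(6) using GD(4,5)[OF gn] by (simp add: mat_left_diff_distrib mat_right_diff_distrib mat_assoc BA del: GD(8))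
    finally show ?thesis .
  qed
  ultimately show "(r, ?X, ?Y) \<in> hmods" unfolding hmods_def by (auto intro!: carrier_matI)
  show "hhom (r, ?X, ?Y) (d, X, Y) A" unfolding hhom.simps by (intro conjI ballI XA YA A)
qed

text \<open>The idempotent \<open>J * K\<close> commutes with the action, hence so does its
  complement, whose image is the second summand.\<close>

lemma hmods_split:
  assumes M: "(d, X, Y) \<in> hmods" and M1: "(r, X1, Y1) \<in> hmods" and J: "hhom (r, X1, Y1) (d, X, Y) J"
    and K: "hhom (d, X, Y) (r, X1, Y1) K" and KJ: "K * J = 1\<^sub>m r"
  obtains M2 where "M2 \<in> hmods" "d = r + fst M2" "hiso (d, X, Y) (hsum (r, X1, Y1) M2)"
proof -
  note D = hmodsD[OF M] and GD = gmodD[OF hmodsD(1)[OF M]] and D1 = hmodsD[OF M1] and GD1 = gmodD[OF hmodsD(1)[OF M1]]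
  have J': "J \<in> carrier_mat d r" "Y * J = J * Y1" "\<And>h. h \<in> carrier G \<Longrightarrow> X h * J = J * X1 h"
    and K': "K \<in> carrier_mat r d" "Y1 * K = K * Y" "\<And>h. h \<in> carrier G \<Longrightarrow> X1 h * K = K * X h" using J K by auto
  obtain r' A B where *: "d = r + r'" "A \<in> carrier_mat d r'" "B \<in> carrier_mat r' d" "B * A = 1\<^sub>m r'"
    "J * K + A * B = 1\<^sub>m d" "K * A = 0\<^sub>m r r'" "B * J = 0\<^sub>m r' r"
    using idempotent_trace_le[OF J'(1) K'(1) KJ] .
  note [simp] = D(3,4) GD(4,5) D1(3,4) GD1(4,5) carrier_matD[OF J'(1)] carrier_matD[OF K'(1)] carrier_matD[OF *(2)] carrier_matD[OF *(3)]
  have AB: "A * B = 1\<^sub>m d - J * K" unfolding *(5)[symmetric] by (intro eq_matI) auto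
  have comm: "T * (A * B) = A * B * T" if "T \<in> carrier_mat d d" "T1 \<in> carrier_mat r r" "T * J = J * T1" "T1 * K = K * T" for T T1
    using that carrier_matD[OF that(1)] carrier_matD[OF that(2)] mat_pull[OF that(3), of K]
    unfolding AB by (simp add: mat_left_diff_distrib mat_right_diff_distrib mat_assoc)
  have XA: "X h * A = A * (B * X h * A)" if h: "h \<in> carrier G" for h
    by (rule idempotent_restrict(1)[OF *(2,3) GD(1)[OF h] *(4) comm[OF GD(1)[OF h] GD1(1)[OF h] J'(3)[OF h] K'(3)[OF h]]])
  have YA: "Y * A = A * (B * Y * A)"
    by (rule idempotent_restrict(1)[OF *(2,3) D(2) *(4) comm[OF D(2) D1(2) J'(2) K'(2)]])
  note R = hmods_restrict[OF M *(2-4) XA YA]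
  let ?M2 = "(r', \<lambda>h. B * X h * A, B * Y * A)"
  have "hiso (d, X, Y) (hsum (r, X1, Y1) ?M2)"
    by (rule hiso_hsum[OF M M1 R(1) J R(2), of K B]) (use K'(1) *(1,3,5) in simp_all)
  then show ?thesis using that[OF R(1)] *(1) by simp
qed

text \<open>The inverse of the endomorphism \<open>R * J\<close> commutes with the action as
  \<open>R * J\<close> does, so it corrects \<open>R\<close> to an equivariant retraction of
  \<open>J\<close>.\<close>

lemma hhom_comp_inverse:
  assumes M: "(d, X, Y) \<in> hmods" and M1: "(r, X1, Y1) \<in> hmods" and J: "hhom (r, X1, Y1) (d, X, Y) J"
    and R: "hhom (d, X, Y) (r, X1, Y1) R" and Q: "Q \<in> carrier_mat r r" "(R * J) * Q = 1\<^sub>m r" "Q * (R * J) = 1\<^sub>m r"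
  shows "hhom (d, X, Y) (r, X1, Y1) (Q * R)" "(Q * R) * J = 1\<^sub>m r"
proof -
  note D = hmodsD[OF M] and GD = gmodD[OF hmodsD(1)[OF M]] and D1 = hmodsD[OF M1] and GD1 = gmodD[OF hmodsD(1)[OF M1]]
  have J': "J \<in> carrier_mat d r" "Y * J = J * Y1" "\<And>h. h \<in> carrier G \<Longrightarrow> X h * J = J * X1 h"
    and R': "R \<in> carrier_mat r d" "Y1 * R = R * Y" "\<And>h. h \<in> carrier G \<Longrightarrow> X1 h * R = R * X h" using J R by auto
  note [simp] = D(3,4) GD(4,5) D1(3,4) GD1(4,5) carrier_matD[OF J'(1)] carrier_matD[OF R'(1)] carrier_matD[OF Q(1)]
  have comm: "T1 * (Q * R) = Q * R * T" if c: "T \<in> carrier_mat d d" "T1 \<in> carrier_mat r r" and e: "T * J = J * T1" "T1 * R = R * T" for T T1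
  proof -
    note [simp] = carrier_matD[OF c(1)] carrier_matD[OF c(2)]
    have V: "T1 * (R * J) = (R * J) * T1" using mat_pull[OF e(2), of J] by (simp add: mat_assoc e(1))
    have "T1 * Q = Q * ((R * J) * T1) * Q" using mat_pull[OF Q(3), of "T1 * Q"] by (simp add: mat_assoc)
    also have "\<dots> = Q * T1 * ((R * J) * Q)" unfolding V[symmetric] by (simp add: mat_assoc)
    also have "\<dots> = Q * T1" unfolding Q(2) by simp
    finally have "T1 * Q = Q * T1" .
    then show ?thesis using mat_pull[of T1 Q "Q * T1" R] by (simp add: mat_assoc e(2))
  qed
  show "hhom (d, X, Y) (r, X1, Y1) (Q * R)"
    using comm[OF D(2) D1(2) J'(2) R'(2)] comm[OF GD(1) GD1(1) J'(3) R'(3)] by (auto intro!: carrier_matI)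
  show "(Q * R) * J = 1\<^sub>m r" using Q(3) by (simp add: mat_assoc)
qed

lemma carrier_order: "g [^] n \<in> carrier G" "(g [^] n) [^] card (carrier G) = \<one>" "card (carrier G) > 0"
proof -
  show 1: "g [^] n \<in> carrier G" using g_closed by simp
  show "(g [^] n) [^] card (carrier G) = \<one>" using pow_order_eq_1[OF 1] by (simp add: Coset.order_def)
  show "card (carrier G) > 0" using finite_G one_closed by (auto simp: card_gt_0_iff)
qed

text \<open>\<open>g^n\<close> is central in \<open>G\<close> and commutes with \<open>y\<close>
  because \<open>\<chi>(g^n) = 1\<close>. Its eigenspaces are therefore submodules, and the
  decomposition starts from them.\<close>

lemma central_Z:
  assumes M: "(d, X, Y) \<in> hmods"
  shows "h \<in> carrier G \<Longrightarrow> X h * X (g [^] n) = X (g [^] n) * X h" "Y * X (g [^] n) = X (g [^] n) * Y"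
    "X (g [^] n) ^\<^sub>m card (carrier G) = 1\<^sub>m d"
proof -
  note D = hmodsD[OF M] and GD = gmodD[OF hmodsD(1)[OF M]]
  note gn = carrier_order(1)
  show "h \<in> carrier G \<Longrightarrow> X h * X (g [^] n) = X (g [^] n) * X h"
    using GD(3)[of h "g [^] n"] GD(3)[of "g [^] n" h] gn g_pow_central[of h n] by metis
  have "\<chi> (g [^] n) = 1" using order_q[of n] by (simp add: \<chi>_g_pow)
  then show "Y * X (g [^] n) = X (g [^] n) * Y" using D(5)[OF gn] by simp
  have "X ((g [^] n) [^] i) = X (g [^] n) ^\<^sub>m i" for i :: nat
  proof (induction i)
    case (Suc i)
    then show ?case using GD(3)[of "(g [^] n) [^] i" "g [^] n"] gn by (simp del: pow_mat.simps(1) add: nat_pow_Suc)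
  qed (use GD(2) GD(4)[OF gn] in simp)
  then show "X (g [^] n) ^\<^sub>m card (carrier G) = 1\<^sub>m d" using carrier_order(2) GD(2) by metis
qed

lemma alg_closed_eigenvector:
  fixes Z :: "'k mat"
  assumes Z: "Z \<in> carrier_mat d d" and d: "d > 0"
  obtains \<mu> v where "v \<in> carrier_mat d 1" "v \<noteq> 0\<^sub>m d 1" "Z * v = \<mu> \<cdot>\<^sub>m v"
proof -
  have "degree (char_poly Z) > 0" using degree_monic_char_poly[OF Z] d by simp
  then obtain \<mu> where "poly (char_poly Z) \<mu> = 0" using alg_closed_imp_poly_has_root by blast
  then obtain w where w: "w \<in> carrier_vec d" "w \<noteq> 0\<^sub>v d" "Z *\<^sub>v w = \<mu> \<cdot>\<^sub>v w"
    using eigenvalue_root_char_poly[OF Z] Z by (auto simp: eigenvalue_def eigenvector_def)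
  let ?v = "mat d 1 (\<lambda>(i, _). w $ i)"
  have "Z * ?v = \<mu> \<cdot>\<^sub>m ?v"
  proof (intro eq_matI, goal_cases)
    case (1 i j)
    then have i: "i < d" "j = 0" using Z by auto
    have "(\<Sum>k<d. Z $$ (i, k) * w $ k) = (Z *\<^sub>v w) $ i"
      using i Z w(1) by (auto simp: mult_mat_vec_def scalar_prod_def lessThan_atLeast0 intro!: sum.cong)
    with i Z w show ?case by simp
  qed (use Z in auto)
  moreover have "?v \<noteq> 0\<^sub>m d 1"
  proof
    assume eq: "?v = 0\<^sub>m d 1"
    have "w $ i = 0" if "i < d" for i
      using that arg_cong[OF eq, of "\<lambda>M. M $$ (i, 0)"] by simp
    then show False using w by (auto intro!: eq_vecI)
  qed
  ultimately show ?thesis using that[of ?v \<mu>] by auto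
qed

text \<open>Here \<open>y^n\<close> is the nonzero scalar \<open>\<mu> - 1\<close>, so
  \<open>y\<close> is invertible. It permutes cyclically the eigenspaces of \<open>g\<close> for the
  \<open>n\<close>-th roots of \<open>\<mu>\<close>, and the module is induced from any one of
  them.\<close>

lemma invertible_block:
  assumes M: "(d, X, Y) \<in> hmods" and Z: "X (g [^] n) = \<mu> \<cdot>\<^sub>m 1\<^sub>m d" and \<mu>: "\<mu> \<noteq> 1"
  obtains r U where "gmod G r U" "hiso (Ind (r, U)) (d, X, Y)"
proof -
  note D = hmodsD[OF M] and GD = gmodD[OF hmodsD(1)[OF M]]
  note [simp] = D(3,4) GD(4,5) g_closed
  have n0: "n > 0" using n_ge_2 by simp
  obtain u where lam: "u ^ n = \<mu>" using nth_root_exists[OF n0] by blast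
  show ?thesis
  proof (cases "d = 0")
    case True
    have 0: "A = B" if "A \<in> carrier_mat 0 0" "B \<in> carrier_mat 0 0" for A B :: "'k mat" using that by (intro eq_matI) auto
    have "hiso (Ind (d, X)) (d, X, Y)" using True D(2) GD(1) yind_dims[OF D(1)]
      by (auto intro!: bexI[of _ "1\<^sub>m 0"] 0 carrier_matI)
    then show ?thesis using that D(1) by blast
  next
    case False
    have mu0: "\<mu> \<noteq> 0"
    proof
      assume "\<mu> = 0"
      then have "X (g [^] n) = 0\<^sub>m d d" using Z by simp
      moreover have "X (inv (g [^] n)) * X (g [^] n) = 1\<^sub>m d" by (rule GD(6)) simp
      ultimately have "1\<^sub>m d = (0\<^sub>m d d :: 'k mat)" using GD(4,5)[of "inv (g [^] n)"] by simp
      then have "mtr (1\<^sub>m d :: 'k mat) = mtr (0\<^sub>m d d :: 'k mat)" by (rule arg_cong)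
      then show False using False by simp
    qed
    then have lam0: "u \<noteq> 0" using lam n0 by auto
    let ?B = "inverse u \<cdot>\<^sub>m X g"
    have gnp: "X g ^\<^sub>m n = \<mu> \<cdot>\<^sub>m 1\<^sub>m d" using Z GD(8)[of n] by simp
    have Bn: "?B ^\<^sub>m n = 1\<^sub>m d" using lam mu0 by (simp add: pow_mat_smult gnp power_inverse)
    have Bc: "?B \<in> carrier_mat d d" by (intro carrier_matI) auto
    define E where "E = inverse (of_nat n) \<cdot>\<^sub>m gsum d d (\<lambda>j. ?B ^\<^sub>m j) {..<n}"
    note O = order_idempotent[OF Bc Bn n0, folded E_def]
    obtain r A B where AB: "A \<in> carrier_mat d r" "B \<in> carrier_mat r d" "E = A * B" "B * A = 1\<^sub>m r"
      using idempotent_factorisation[OF O(1,3)] .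
    note [simp] = carrier_matD[OF AB(1)] carrier_matD[OF AB(2)]
    have comm: "X h * E = E * X h" if "h \<in> carrier G" for h
    proof (rule O(4)[OF GD(1)[OF that]])
      have "X h * X g = X g * X h" using that GD(3)[of h g] GD(3)[of g h] g_central[OF that] by simp
      then show "X h * ?B = ?B * X h" using that by simp
    qed
    define U where "U = (\<lambda>h. B * X h * A)"
    have XA: "X h * A = A * U h" if "h \<in> carrier G" for h
      using idempotent_restrict(1)[OF AB(1,2) GD(1)[OF that] AB(4)] comm[OF that] by (simp add: AB(3) U_def)
    have U: "gmod G r U" unfolding gmod_def
    proof (intro conjI ballI)
      fix h k assume h: "h \<in> carrier G" and k: "k \<in> carrier G"
      have "U (h \<otimes> k) = B * (X h * (X k * A))" using h k by (simp add: U_def GD(3) mat_assoc)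
      also have "\<dots> = U h * U k" unfolding XA[OF k] using h k by (simp add: U_def mat_assoc)
      finally show "U (h \<otimes> k) = U h * U k" .
    qed (auto simp: U_def GD(2) AB(4) intro!: carrier_matI)
    have f: "ghom r U d X A" using XA AB(1) by (simp add: ghom_def)
    \<comment> \<open>The inverse of \<open>Y^i\<close> is \<open>c\<close> times
      \<open>Y^(n - i)\<close>, so \<open>?F i * ?Q i\<close> below is the conjugate of
      \<open>E\<close> by \<open>Y^i\<close>: the projection onto the \<open>i\<close>-th eigenspace
      in the cycle.\<close>
    define c where "c = inverse (\<mu> - 1)"
    have Yn: "Y ^\<^sub>m n = (\<mu> - 1) \<cdot>\<^sub>m 1\<^sub>m d" unfolding D(6) Z by (intro eq_matI) auto
    have Yni: "Y ^\<^sub>m i * Y ^\<^sub>m (n - i) = (\<mu> - 1) \<cdot>\<^sub>m 1\<^sub>m d" "Y ^\<^sub>m (n - i) * Y ^\<^sub>m i = (\<mu> - 1) \<cdot>\<^sub>m 1\<^sub>m d" if "i < n" for i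
      using that pow_mat_add[of Y i "n - i"] pow_mat_add[of Y "n - i" i] Yn by simp_all
    have YB: "Y ^\<^sub>m i * ?B ^\<^sub>m j = (\<chi> g ^ i) ^ j \<cdot>\<^sub>m (?B ^\<^sub>m j * Y ^\<^sub>m i)" for i j
    proof (rule pow_mat_intertwine[OF Bc Bc])
      have "X g * Y ^\<^sub>m i = inverse (\<chi> g) ^ i \<cdot>\<^sub>m (Y ^\<^sub>m i * X g)" using hmods_commute[OF M g_closed] .
      then have "\<chi> g ^ i \<cdot>\<^sub>m (X g * Y ^\<^sub>m i) = Y ^\<^sub>m i * X g"
        using \<chi>_nz[OF g_closed] by (simp add: power_mult_distrib[symmetric])
      note eq = this
      have "Y ^\<^sub>m i * ?B = inverse u \<cdot>\<^sub>m (Y ^\<^sub>m i * X g)" by simp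
      also have "\<dots> = \<chi> g ^ i \<cdot>\<^sub>m (?B * Y ^\<^sub>m i)" unfolding eq[symmetric] by (simp add: mult.commute)
      finally show "Y ^\<^sub>m i * ?B = \<chi> g ^ i \<cdot>\<^sub>m (?B * Y ^\<^sub>m i)" .
    qed (auto intro!: carrier_matI)
    let ?Q = "\<lambda>i. c \<cdot>\<^sub>m (B * Y ^\<^sub>m (n - i))"
    let ?F = "\<lambda>i. Y ^\<^sub>m i * A"
    have "gsum d d (\<lambda>i. ?F i * ?Q i) {..<n} = 1\<^sub>m d"
    proof (intro eq_matI, goal_cases)
      case (1 a b)
      then have ab: "a < d" "b < d" by auto
      have t: "?F i * ?Q i = inverse (of_nat n) \<cdot>\<^sub>m gsum d d (\<lambda>j. (\<chi> g ^ i) ^ j \<cdot>\<^sub>m ?B ^\<^sub>m j) {..<n}" if i: "i < n" for i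
      proof -
        have "?F i * ?Q i = c \<cdot>\<^sub>m (Y ^\<^sub>m i * E * Y ^\<^sub>m (n - i))" by (simp add: AB(3) mat_assoc)
        also have "Y ^\<^sub>m i * E * Y ^\<^sub>m (n - i) =
            inverse (of_nat n) \<cdot>\<^sub>m gsum d d (\<lambda>j. Y ^\<^sub>m i * ?B ^\<^sub>m j * Y ^\<^sub>m (n - i)) {..<n}"
        proof -
          have p: "?B ^\<^sub>m j \<in> carrier_mat d d" "Y ^\<^sub>m i * ?B ^\<^sub>m j \<in> carrier_mat d d" for j
            by (intro carrier_matI; simp)+
          have 1: "Y ^\<^sub>m i * gsum d d (\<lambda>j. ?B ^\<^sub>m j) {..<n} = gsum d d (\<lambda>j. Y ^\<^sub>m i * ?B ^\<^sub>m j) {..<n}"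
            by (subst gsum_mult_left[OF p(1)]) simp_all
          have 2: "gsum d d (\<lambda>j. Y ^\<^sub>m i * ?B ^\<^sub>m j) {..<n} * Y ^\<^sub>m (n - i) =
              gsum d d (\<lambda>j. Y ^\<^sub>m i * ?B ^\<^sub>m j * Y ^\<^sub>m (n - i)) {..<n}"
            by (subst gsum_mult_right[OF p(2)]) simp_all
          have "Y ^\<^sub>m i * E * Y ^\<^sub>m (n - i) =
              inverse (of_nat n) \<cdot>\<^sub>m ((Y ^\<^sub>m i * gsum d d (\<lambda>j. ?B ^\<^sub>m j) {..<n}) * Y ^\<^sub>m (n - i))"
            unfolding E_def by simp
          then show ?thesis unfolding 1 2 .
        qed
        also have "gsum d d (\<lambda>j. Y ^\<^sub>m i * ?B ^\<^sub>m j * Y ^\<^sub>m (n - i)) {..<n} =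
            gsum d d (\<lambda>j. (\<mu> - 1) \<cdot>\<^sub>m ((\<chi> g ^ i) ^ j \<cdot>\<^sub>m ?B ^\<^sub>m j)) {..<n}"
          unfolding YB using i by (intro gsum_cong) (simp add: mat_assoc Yni mult.commute)
        also have "\<dots> = (\<mu> - 1) \<cdot>\<^sub>m gsum d d (\<lambda>j. (\<chi> g ^ i) ^ j \<cdot>\<^sub>m ?B ^\<^sub>m j) {..<n}"
          by (rule gsum_smult[symmetric]) (auto intro!: carrier_matI)
        finally have "?F i * ?Q i = c \<cdot>\<^sub>m (inverse (of_nat n) \<cdot>\<^sub>m ((\<mu> - 1) \<cdot>\<^sub>m gsum d d (\<lambda>j. (\<chi> g ^ i) ^ j \<cdot>\<^sub>m ?B ^\<^sub>m j) {..<n}))" .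
        moreover have "c * (inverse (of_nat n) * (\<mu> - 1)) = inverse (of_nat n)" using \<mu> by (simp add: c_def)
        ultimately show ?thesis by (simp only: smult_smult_mat)
      qed
      \<comment> \<open>Orthogonality for the primitive \<open>n\<close>-th root of unity
        \<open>\<chi> g\<close>: only \<open>j = 0\<close> survives, so the conjugates of
        \<open>E\<close> add up to 1.\<close>
      have geo: "(\<Sum>i<n. (\<chi> g ^ i) ^ j) = (if j = 0 then of_nat n else 0)" if "j < n" for j
      proof (cases "j = 0")
        case False
        have "\<chi> g ^ j \<noteq> 1" using order_q[of j] False that by (auto dest: dvd_imp_le)
        moreover have "(\<chi> g ^ j) ^ n = 1" using order_q[of "j * n"] by (simp add: power_mult)
        moreover have "(\<Sum>i<n. (\<chi> g ^ i) ^ j) = (\<Sum>i<n. (\<chi> g ^ j) ^ i)"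
          by (simp add: mult.commute flip: power_mult)
        ultimately show ?thesis using False by (simp add: geometric_sum)
      qed simp
      have "(\<Sum>i<n. (?F i * ?Q i) $$ (a, b)) =
          (\<Sum>i<n. \<Sum>j<n. inverse (of_nat n) * ((\<chi> g ^ i) ^ j * (?B ^\<^sub>m j) $$ (a, b)))"
        using ab t by (intro sum.cong) (simp_all add: sum_distrib_left del: index_mult_sum)
      also have "\<dots> = (\<Sum>j<n. inverse (of_nat n) * ((\<Sum>i<n. (\<chi> g ^ i) ^ j) * (?B ^\<^sub>m j) $$ (a, b)))"
        by (subst sum.swap) (simp add: sum_distrib_left sum_distrib_right)
      also have "\<dots> = (\<Sum>j<n. if j = 0 then (1\<^sub>m d) $$ (a, b) else 0)"
        using geo n0 by (intro sum.cong) auto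
      also have "\<dots> = (1\<^sub>m d) $$ (a, b)" using n0 by simp
      finally show ?case using ab by (simp del: index_mult_sum)
    qed auto
    note sum = this
    \<comment> \<open>Each of the \<open>n\<close> conjugates has trace \<open>r\<close>; this gives
      the dimension \<open>r * n\<close> that \<open>Ind_iso\<close> asks for.\<close>
    have "of_nat d = mtr (gsum d d (\<lambda>i. ?F i * ?Q i) {..<n})" unfolding sum by simp
    also have "\<dots> = (\<Sum>i<n. mtr (?F i * ?Q i))" by (rule mtr_gsum) (auto intro!: carrier_matI)
    also have "\<dots> = (\<Sum>i<n. of_nat r)"
    proof (intro sum.cong refl)
      fix i assume "i \<in> {..<n}"
      then have i: "i < n" by simp
      have "mtr (?F i * ?Q i) = mtr (?Q i * ?F i)" by (rule mtr_comm) auto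
      also have "?Q i * ?F i = 1\<^sub>m r"
        using i \<mu> AB(4) mat_pull[OF Yni(2)[OF i], of A] by (simp add: mat_assoc c_def)
      finally show "mtr (?F i * ?Q i) = of_nat r" by simp
    qed
    finally have "of_nat d = (of_nat (r * n) :: 'k)" by (simp add: mult.commute)
    then have d: "d = r * n" by (simp only: of_nat_eq_iff)
    have "hiso (Ind (r, U)) (d, X, Y)"
    proof (rule Ind_iso[OF M U f d, of r ?F ?Q])
      fix i assume i: "i < n"
      show "\<exists>K. K \<in> carrier_mat (r * n) r \<and> frob Y A r n * K = ?F i"
        using i frob_ec[OF D(2) AB(1), of "1\<^sub>m r" i n]
        by (intro exI[of _ "kronecker (1\<^sub>m r) (ec n i)"]) (auto intro!: carrier_matI)
    qed (use sum in \<open>auto intro!: carrier_matI\<close>)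
    then show ?thesis using that U by blast
  qed
qed

text \<open>A Jordan chain of greatest length splits off. All chains of length \<open>l\<close> are
  taken together: \<open>U\<close> is the image of \<open>y^(l - 1)\<close> with the action it has
  as a quotient of the module, and Maschke's theorem lifts it back.\<close>

lemma nilpotent_block:
  assumes M: "(d, X, Y) \<in> hmods" and Z: "X (g [^] n) = 1\<^sub>m d" and d: "d > 0"
  obtains l r U M2 where "0 < l" "l \<le> n" "0 < r" "gmod G r U" "U (g [^] n) = 1\<^sub>m r" "M2 \<in> hmods"
    "d = r * l + fst M2" "hiso (d, X, Y) (hsum (chain l (r, U)) M2)"
proof -
  note D = hmodsD[OF M] and GD = gmodD[OF hmodsD(1)[OF M]]
  note [simp] = D(3,4) GD(4,5) g_closed
  have Yn: "Y ^\<^sub>m n = 0\<^sub>m d d" using D(6) Z by simp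
  define l where "l = (LEAST l. Y ^\<^sub>m l = 0\<^sub>m d d)"
  have Yl: "Y ^\<^sub>m l = 0\<^sub>m d d" unfolding l_def by (rule LeastI[of "\<lambda>l. Y ^\<^sub>m l = 0\<^sub>m d d", OF Yn])
  have ln: "l \<le> n" unfolding l_def by (rule Least_le) (rule Yn)
  have one: "1\<^sub>m d \<noteq> (0\<^sub>m d d :: 'k mat)"
  proof
    assume "1\<^sub>m d = (0\<^sub>m d d :: 'k mat)"
    then have "mtr (1\<^sub>m d :: 'k mat) = mtr (0\<^sub>m d d :: 'k mat)" by (rule arg_cong)
    then show False using d by simp
  qed
  then have l0: "l > 0" using Yl by (intro Nat.gr0I) auto
  have Yl1: "Y ^\<^sub>m (l - 1) \<noteq> 0\<^sub>m d d" using not_less_Least[of "l - 1" "\<lambda>l. Y ^\<^sub>m l = 0\<^sub>m d d"] l0 by (simp add: l_def)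
  \<comment> \<open>\<open>Y^(l - 1)\<close> becomes \<open>G\<close>-linear once the action on its
    target is twisted by \<open>\<chi>^(l - 1)\<close>.\<close>
  define Xt where "Xt = (\<lambda>h. \<chi> h ^ (l - 1) \<cdot>\<^sub>m X h)"
  have Xt: "gmod G d Xt"
    unfolding gmod_def using GD(1-3) by (auto simp: Xt_def \<chi>_one \<chi>_mult power_mult_distrib mult.commute)
  have T: "ghom d X d Xt (Y ^\<^sub>m (l - 1))"
    unfolding ghom_def
  proof (intro conjI ballI)
    fix h assume h: "h \<in> carrier G"
    show "Xt h * Y ^\<^sub>m (l - 1) = Y ^\<^sub>m (l - 1) * X h"
      using h hmods_commute[OF M h, of "l - 1"] \<chi>_nz[OF h] by (simp add: Xt_def power_mult_distrib[symmetric])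
  qed (auto intro!: carrier_matI)
  obtain r U A B L S where I: "gmod G r U" "ghom r U d Xt A" "ghom d X r U B" "L \<in> carrier_mat r d" "S \<in> carrier_mat d r"
    "Y ^\<^sub>m (l - 1) = A * B" "L * A = 1\<^sub>m r" "B * S = 1\<^sub>m r" "r > 0"
    using image_gmod[OF D(1) Xt T Yl1] .
  note U = I(1)
  obtain f where f: "ghom r U d X f" "B * f = 1\<^sub>m r" using maschke_right[OF D(1) U I(3,5,8)] .
  obtain L' where L': "ghom d Xt r U L'" "L' * A = 1\<^sub>m r" using maschke_left[OF U Xt I(2,4,7)] .
  note F = ghomD[OF f(1)] and LD = ghomD[OF L'(1)] and BD = ghomD[OF I(3)] and AD = ghomD[OF I(2)]
  note [simp] = F(2,3) LD(2,3) BD(2,3) AD(2,3) gmodD(4,5)[OF U]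
  have Ugn: "U (g [^] n) = 1\<^sub>m r"
  proof -
    have gn: "g [^] n \<in> carrier G" by simp
    have "U (g [^] n) = U (g [^] n) * (B * f)" using gmodD(5)[OF U gn] by (simp add: f(2))
    also have "\<dots> = B * X (g [^] n) * f" using BD(4)[OF gn] gmodD(4,5)[OF U gn] GD(4,5)[OF gn] by (simp flip: mat_assoc)
    also have "\<dots> = 1\<^sub>m r" unfolding Z using f(2) by simp
    finally show ?thesis .
  qed
  let ?C = "chain l (r, U)"
  have C: "?C \<in> hmods" using chain_hmods[OF U Ugn ln] .
  let ?J = "frob Y f r l"
  have J: "hhom ?C (d, X, Y) ?J" using frob_chain[OF M U f(1)] Yl by simp
  have Jc: "?J \<in> carrier_mat d (r * l)" using frob_carrier[OF D(2)] .
  let ?e = "\<lambda>i. kronecker (1\<^sub>m r) (er l i) :: 'k mat" and ?c = "\<lambda>i. kronecker (1\<^sub>m r) (ec l i) :: 'k mat"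
  \<comment> \<open>The candidate retraction: \<open>L'\<close> recognises the last layer, so
    applying \<open>Y^(l - 1 - i)\<close> before it reads off the coordinate in layer
    \<open>i\<close>, up to contributions from earlier layers.\<close>
  define R where "R = gsum (r * l) d (\<lambda>i. ?c i * (L' * Y ^\<^sub>m (l - 1 - i))) {..<l}"
  have Rc: "R \<in> carrier_mat (r * l) d" by (simp add: R_def)
  have eR: "?e i * R = L' * Y ^\<^sub>m (l - 1 - i)" if i: "i < l" for i
  proof -
    have "?e i * R = gsum r d (\<lambda>j. ?e i * (?c j * (L' * Y ^\<^sub>m (l - 1 - j)))) {..<l}"
      unfolding R_def by (subst gsum_mult_left) (auto intro!: carrier_matI)
    also have "\<dots> = gsum r d (\<lambda>j. if j = i then L' * Y ^\<^sub>m (l - 1 - i) else 0\<^sub>m r d) {..<l}"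
    proof (intro gsum_cong)
      fix j
      have "?e i * ?c j = (if j = i then 1\<^sub>m r else 0\<^sub>m r r)" using i by (auto simp: kron_mult er_ec)
      then show "?e i * (?c j * (L' * Y ^\<^sub>m (l - 1 - j))) = (if j = i then L' * Y ^\<^sub>m (l - 1 - i) else 0\<^sub>m r d)"
        by (subst mat_pull) auto
    qed
    also have "\<dots> = L' * Y ^\<^sub>m (l - 1 - i)"
      using i by (intro eq_matI) (auto simp: if_distrib[of "\<lambda>M. M $$ _"] simp del: index_mult_sum cong: if_cong)
    finally show ?thesis .
  qed
  have RY: "kronecker (1\<^sub>m r) (sh l) * R = R * Y"
  proof (rule kron_er_ext[of _ r l d])
    show "kronecker (1\<^sub>m r) (sh l) * R \<in> carrier_mat (r * l) d" "R * Y \<in> carrier_mat (r * l) d"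
      using Rc by (auto intro!: carrier_matI)
    fix i assume i: "i < l"
    have rhs: "?e i * (R * Y) = L' * Y ^\<^sub>m (l - i)"
    proof -
      have "l - i = Suc (l - 1 - i)" using i by simp
      then have "Y ^\<^sub>m (l - i) = Y ^\<^sub>m (l - 1 - i) * Y" by simp
      then show ?thesis using mat_pull[OF eR[OF i], of Y] carrier_matD[OF Rc] by (simp add: mat_assoc)
    qed
    show "?e i * (kronecker (1\<^sub>m r) (sh l) * R) = ?e i * (R * Y)"
    proof (cases i)
      case 0
      then show ?thesis using rhs Yl carrier_matD[OF Rc] by (simp add: kron_mult er_sh flip: mat_assoc)
    next
      case (Suc j)
      have "?e i * (kronecker (1\<^sub>m r) (sh l) * R) = ?e j * R"
        using Suc i carrier_matD[OF Rc] by (simp add: kron_mult er_sh flip: mat_assoc)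
      also have "\<dots> = L' * Y ^\<^sub>m (l - i)" using eR[of j] Suc i by simp
      finally show ?thesis using rhs by simp
    qed
  qed
  have RX: "kronecker (U h) (dg (inverse (\<chi> h)) l) * R = R * X h" if h: "h \<in> carrier G" for h
  proof (rule kron_er_ext[of _ r l d])
    note [simp] = h carrier_matD[OF Rc]
    show "kronecker (U h) (dg (inverse (\<chi> h)) l) * R \<in> carrier_mat (r * l) d" "R * X h \<in> carrier_mat (r * l) d"
      by (auto intro!: carrier_matI)
    fix i assume i: "i < l"
    have LX: "\<chi> h ^ (l - 1) \<cdot>\<^sub>m (L' * X h) = U h * L'" using LD(4)[OF h] by (simp add: Xt_def)
    have "X h * Y ^\<^sub>m (l - 1 - i) = inverse (\<chi> h) ^ (l - 1 - i) \<cdot>\<^sub>m (Y ^\<^sub>m (l - 1 - i) * X h)" by (rule hmods_commute[OF M h])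
    then have YX: "Y ^\<^sub>m (l - 1 - i) * X h = \<chi> h ^ (l - 1 - i) \<cdot>\<^sub>m (X h * Y ^\<^sub>m (l - 1 - i))"
      using \<chi>_nz[OF h] by (simp add: power_mult_distrib[symmetric])
    have pw: "\<chi> h ^ (l - 1 - i) = inverse (\<chi> h) ^ i * \<chi> h ^ (l - 1)"
    proof -
      have "\<chi> h ^ (l - 1) = \<chi> h ^ i * \<chi> h ^ (l - 1 - i)" using i by (simp flip: power_add)
      then show ?thesis using \<chi>_nz[OF h] by (simp add: power_inverse)
    qed
    have "?e i * (R * X h) = L' * (Y ^\<^sub>m (l - 1 - i) * X h)" using mat_pull[OF eR[OF i], of "X h"] by (simp add: mat_assoc)
    also have "\<dots> = inverse (\<chi> h) ^ i \<cdot>\<^sub>m (\<chi> h ^ (l - 1) \<cdot>\<^sub>m (L' * X h) * Y ^\<^sub>m (l - 1 - i))"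
      unfolding YX pw by (simp add: mat_assoc)
    also have "\<dots> = inverse (\<chi> h) ^ i \<cdot>\<^sub>m (U h * (?e i * R))" unfolding LX eR[OF i] by (simp add: mat_assoc)
    also have "\<dots> = (?e i * kronecker (U h) (dg (inverse (\<chi> h)) l)) * R"
      by (simp add: kron_mult er_dg kron_er_mult flip: mat_assoc)
    finally show "?e i * (kronecker (U h) (dg (inverse (\<chi> h)) l) * R) = ?e i * (R * X h)" by (simp add: mat_assoc)
  qed
  have R: "hhom (d, X, Y) ?C R" using RX RY Rc by simp
  \<comment> \<open>Because \<open>Y^l = 0\<close>, the matrix \<open>R * ?J\<close> has identity
    blocks on the diagonal and zero blocks above it; \<open>W\<close> is strictly block triangular
    and hence nilpotent.\<close>
  define W where "W = 1\<^sub>m (r * l) - R * ?J"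
  have Wc: "W \<in> carrier_mat (r * l) (r * l)" using Rc Jc by (auto simp: W_def intro!: carrier_matI)
  note [simp] = carrier_matD[OF Rc] carrier_matD[OF Jc] carrier_matD[OF Wc]
  have eWc: "?e i * W * ?c j = 0\<^sub>m r r" if ij: "i < l" "j < l" "i \<le> j" for i j
  proof -
    have "?e i * (R * ?J) * ?c j = (?e i * R) * (?J * ?c j)" by (simp add: mat_assoc)
    also have "\<dots> = L' * (Y ^\<^sub>m (l - 1 - i + j)) * f"
      using eR[OF ij(1)] frob_ec[OF D(2) F(1) _ ij(2), of "1\<^sub>m r"] by (simp add: mat_assoc pow_mat_add)
    also have "\<dots> = (if i = j then 1\<^sub>m r else 0\<^sub>m r r)"
    proof (cases "i = j")
      case True
      then have "l - 1 - i + j = l - 1" using ij by simp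
      then show ?thesis using True f(2) mat_pull[OF L'(2), of "B * f"] by (simp only: I(6)) (simp add: mat_assoc)
    next
      case False
      then have "l - 1 - i + j = (j - i - 1) + l" using ij by simp
      then have "Y ^\<^sub>m (l - 1 - i + j) = 0\<^sub>m d d" by (simp only: pow_mat_add D(3,4) Yl) simp
      then show ?thesis using False by simp
    qed
    finally have RJ: "?e i * (R * ?J) * ?c j = (if i = j then 1\<^sub>m r else 0\<^sub>m r r)" .
    have "?e i * W * ?c j = ?e i * ?c j - ?e i * (R * ?J) * ?c j"
      unfolding W_def by (simp add: mat_left_diff_distrib mat_right_diff_distrib mat_assoc)
    also have "\<dots> = 0\<^sub>m r r" unfolding RJ using ij by (auto simp: kron_mult er_ec)
    finally show ?thesis .
  qed
  have eWmc: "?e i * W ^\<^sub>m m * ?c j = 0\<^sub>m r r" if "i < l" "j < l" "i < j + m" for i j m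
    using that
  proof (induction m arbitrary: i)
    case 0
    then show ?case by (simp add: kron_mult er_ec)
  next
    case (Suc m)
    have "?e i * W ^\<^sub>m Suc m * ?c j = ?e i * W * (gsum (r * l) (r * l) (\<lambda>k. ?c k * ?e k) {..<l} * (W ^\<^sub>m m * ?c j))"
      by (simp add: kron_ec_sum pow_mat_Suc2 mat_assoc del: pow_mat.simps)
    also have "\<dots> = gsum r r (\<lambda>k. ?e i * W * (?c k * ?e k * (W ^\<^sub>m m * ?c j))) {..<l}"
      by (subst gsum_mult_right, auto intro!: carrier_matI) (subst gsum_mult_left, auto intro!: carrier_matI)
    also have "\<dots> = gsum r r (\<lambda>k. 0\<^sub>m r r) {..<l}"
    proof (intro gsum_cong)
      fix k assume "k \<in> {..<l}"
      then have k: "k < l" by simp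
      have eq: "?e i * W * (?c k * ?e k * (W ^\<^sub>m m * ?c j)) = (?e i * W * ?c k) * (?e k * W ^\<^sub>m m * ?c j)"
        by (simp add: mat_assoc)
      show "?e i * W * (?c k * ?e k * (W ^\<^sub>m m * ?c j)) = 0\<^sub>m r r"
      proof (cases "i \<le> k")
        case True
        show ?thesis unfolding eq eWc[OF Suc.prems(1) k True] by simp
      next
        case False
        then have kj: "k < j + m" using Suc.prems by simp
        show ?thesis unfolding eq Suc.IH[OF k Suc.prems(2) kj] by simp
      qed
    qed
    also have "\<dots> = 0\<^sub>m r r" by (intro eq_matI) auto
    finally show ?case .
  qed
  have "W ^\<^sub>m l = 0\<^sub>m (r * l) (r * l)"
  proof (rule kron_ec_ext[of _ "r * l" r l])
    fix j assume j: "j < l"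
    show "W ^\<^sub>m l * ?c j = 0\<^sub>m (r * l) (r * l) * ?c j"
    proof (rule kron_er_ext[of _ r l r])
      fix i assume i: "i < l"
      show "?e i * (W ^\<^sub>m l * ?c j) = ?e i * (0\<^sub>m (r * l) (r * l) * ?c j)"
        using eWmc[OF i j, of l] i by (simp add: mat_assoc)
    qed (auto intro!: carrier_matI)
  qed (auto intro!: carrier_matI)
  then obtain Q where Q: "Q \<in> carrier_mat (r * l) (r * l)" "(1\<^sub>m (r * l) - W) * Q = 1\<^sub>m (r * l)" "Q * (1\<^sub>m (r * l) - W) = 1\<^sub>m (r * l)"
    using nilpotent_inverse[OF Wc] by metis
  have W1: "1\<^sub>m (r * l) - W = R * ?J" unfolding W_def by (intro eq_matI) auto
  note H = hhom_comp_inverse[OF M C[unfolded chain.simps] J[unfolded chain.simps] R[unfolded chain.simps] Q[unfolded W1]]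
  obtain M2 where "M2 \<in> hmods" "d = r * l + fst M2" "hiso (d, X, Y) (hsum ?C M2)"
    unfolding chain.simps using hmods_split[OF M C[unfolded chain.simps] J[unfolded chain.simps] H] .
  then show ?thesis using that[OF l0 ln I(9) U Ugn] by blast
qed

text \<open>Eigenspaces of the central element \<open>g^n\<close> split off until a single
  eigenvalue is left. An eigenvalue other than 1 means that the module is induced; for the
  eigenvalue 1 a chain splits off, and chains of length \<open>n\<close> fall under
  \<open>Ind\<close>.\<close>

lemma hmods_induct [consumes 1, case_names iso sum chain Ind]:
  assumes "M \<in> hmods"
    and iso: "\<And>M N. M \<in> hmods \<Longrightarrow> N \<in> hmods \<Longrightarrow> hiso M N \<Longrightarrow> P N \<Longrightarrow> P M"
    and sum: "\<And>M N. M \<in> hmods \<Longrightarrow> N \<in> hmods \<Longrightarrow> P M \<Longrightarrow> P N \<Longrightarrow> P (hsum M N)"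
    and chain: "\<And>l r U. 0 < l \<Longrightarrow> l < n \<Longrightarrow> gmod G r U \<Longrightarrow> U (g [^] n) = 1\<^sub>m r \<Longrightarrow> P (chain l (r, U))"
    and Ind: "\<And>r U. gmod G r U \<Longrightarrow> P (Ind (r, U))"
  shows "P M"
  using assms(1)
proof (induction "fst M" arbitrary: M rule: less_induct)
  case less
  obtain d X Y where eq: "M = (d, X, Y)" by (metis surj_pair)
  note M = less.prems[unfolded eq]
  note D = hmodsD[OF M] and GD = gmodD[OF hmodsD(1)[OF M]]
  note [simp] = D(3,4) GD(4,5) g_closed
  let ?N = "card (carrier G)"
  define Z where "Z = X (g [^] n)"
  have Zc: "Z \<in> carrier_mat d d" unfolding Z_def by (rule GD(1)[OF carrier_order(1)])
  note cZ = central_Z[OF M, folded Z_def]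
  show ?case
  proof (cases "d = 0")
    case True
    \<comment> \<open>In dimension 0 every scalar describes the action; taking 0, which differs from
      1, brings the zero module under \<open>invertible_block\<close>.\<close>
    have "X (g [^] n) = 0 \<cdot>\<^sub>m 1\<^sub>m d" using Zc True unfolding Z_def by (intro eq_matI) auto
    then obtain r U where "gmod G r U" "hiso (Ind (r, U)) (d, X, Y)" by (rule invertible_block[OF M]) auto
    then show ?thesis unfolding eq using iso[OF M Ind_hmods] hiso_sym[OF Ind_hmods M] Ind by blast
  next
    case False
    then obtain \<mu> v where v: "v \<in> carrier_mat d 1" "v \<noteq> 0\<^sub>m d 1" "Z * v = \<mu> \<cdot>\<^sub>m v"
      using alg_closed_eigenvector[OF Zc] by blast
    have "Z ^\<^sub>m i * v = \<mu> ^ i \<cdot>\<^sub>m v" for i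
      using carrier_matD[OF Zc] carrier_matD[OF v(1)] by (induction i) (simp_all add: mat_assoc v(3) mult.commute)
    from this[of ?N] have vN: "v = \<mu> ^ ?N \<cdot>\<^sub>m v" using cZ(3) v(1) by simp
    have "\<mu> ^ ?N = 1"
    proof (rule ccontr)
      assume "\<mu> ^ ?N \<noteq> 1"
      have "v $$ (i, 0) = 0" if "i < d" for i
      proof -
        have "v $$ (i, 0) = \<mu> ^ ?N * v $$ (i, 0)" using arg_cong[OF vN, of "\<lambda>M. M $$ (i, 0)"] v(1) that by simp
        then show ?thesis using \<open>\<mu> ^ ?N \<noteq> 1\<close> by simp
      qed
      then show False using v(1,2) by (auto intro!: eq_matI)
    qed
    then have mu0: "\<mu> \<noteq> 0" and muN: "\<mu> ^ ?N = 1" using carrier_order(3) by (auto simp: power_0_left)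
    \<comment> \<open>Division by the eigenvalue turns its eigenspace into the fixed space of
      \<open>?B\<close>. The eigenvalue is a root of unity, so \<open>?B\<close> has finite order
      and \<open>order_idempotent\<close> yields the projection.\<close>
    let ?B = "inverse \<mu> \<cdot>\<^sub>m Z"
    have Bc: "?B \<in> carrier_mat d d" using Zc by simp
    have BN: "?B ^\<^sub>m ?N = 1\<^sub>m d" using carrier_matD[OF Zc] muN by (simp add: pow_mat_smult cZ(3) power_inverse)
    define E where "E = inverse (of_nat ?N) \<cdot>\<^sub>m gsum d d (\<lambda>j. ?B ^\<^sub>m j) {..<?N}"
    note O = order_idempotent[OF Bc BN carrier_order(3), folded E_def]
    have Ev: "E * v = v" using O(5)[OF v(1)] v Zc mu0 by simp
    obtain r A B where AB: "A \<in> carrier_mat d r" "B \<in> carrier_mat r d" "E = A * B" "B * A = 1\<^sub>m r"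
      using idempotent_factorisation[OF O(1,3)] .
    note [simp] = carrier_matD[OF AB(1)] carrier_matD[OF AB(2)] carrier_matD[OF Zc]
    have cE: "X h * (A * B) = (A * B) * X h" if h: "h \<in> carrier G" for h
      using O(4)[OF GD(1)[OF h]] cZ(1)[OF h] h by (simp add: AB(3))
    have cEY: "Y * (A * B) = (A * B) * Y" using O(4)[OF D(2)] cZ(2) by (simp add: AB(3))
    note rX = idempotent_restrict[OF AB(1,2) GD(1) AB(4) cE] and rY = idempotent_restrict[OF AB(1,2) D(2) AB(4) cEY]
    note R = hmods_restrict[OF M AB(1,2,4) rX(1) rY(1)]
    let ?M1 = "(r, \<lambda>h. B * X h * A, B * Y * A)"
    have K: "hhom (d, X, Y) ?M1 B" using rX(2) rY(2) AB(2) by simp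
    obtain M2 where M2: "M2 \<in> hmods" "d = r + fst M2" "hiso (d, X, Y) (hsum ?M1 M2)"
      using hmods_split[OF M R(1,2) K AB(4)] by metis
    have r0: "r > 0"
    proof (rule Nat.gr0I)
      assume "r = 0"
      then have "E = 0\<^sub>m d d" unfolding AB(3) using AB(1,2) by (intro eq_matI) auto
      then show False using Ev v by simp
    qed
    show ?thesis
    proof (cases "r < d")
      case True
      have "P ?M1" using less.hyps[of ?M1] R(1) True by (simp add: eq)
      moreover have "P M2" using less.hyps[of M2] M2 r0 by (simp add: eq)
      ultimately show ?thesis unfolding eq using iso[OF M hsum_hmods M2(3)] sum R(1) M2(1) by blast
    next
      case False
      then have "r = d" using M2(2) by simp
      then have "E = 1\<^sub>m d" unfolding AB(3) using mat_mult_left_right_inverse[of B d A] AB by simp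
      then have "?B = 1\<^sub>m d" using O(2) Bc by simp
      then have "\<mu> \<cdot>\<^sub>m ?B = \<mu> \<cdot>\<^sub>m 1\<^sub>m d" by simp
      then have Zmu: "X (g [^] n) = \<mu> \<cdot>\<^sub>m 1\<^sub>m d" using mu0 by (simp add: Z_def)
      show ?thesis
      proof (cases "\<mu> = 1")
        case False
        then obtain r U where "gmod G r U" "hiso (Ind (r, U)) (d, X, Y)" using invertible_block[OF M Zmu] by metis
        then show ?thesis unfolding eq using iso[OF M Ind_hmods] hiso_sym[OF Ind_hmods M] Ind by blast
      next
        case True
        then have "X (g [^] n) = 1\<^sub>m d" using Zmu by simp
        then obtain l r U M2 where N: "0 < l" "l \<le> n" "0 < r" "gmod G r U" "U (g [^] n) = 1\<^sub>m r" "M2 \<in> hmods"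
          "d = r * l + fst M2" "hiso (d, X, Y) (hsum (chain l (r, U)) M2)"
          using nilpotent_block[OF M] \<open>d \<noteq> 0\<close> by (metis neq0_conv)
        have "P (chain l (r, U))"
        proof (cases "l = n")
          case True
          then show ?thesis using Ind[OF N(4)] Ind_eq_chain[OF N(4,5)] by simp
        qed (use chain N in simp)
        moreover have "P M2" using less.hyps[of M2] N by (simp add: eq)
        ultimately show ?thesis unfolding eq
          using iso[OF M hsum_hmods[OF chain_hmods[OF N(4,5,2)] N(6)] N(8)] sum[OF chain_hmods[OF N(4,5,2)] N(6)] by blast
      qed
    qed
  qed
qed

end


subsection \<open>Additive invariants\<close>

text \<open>For every generalised inverse \<open>Q\<close> the product \<open>T * Q\<close> projects
  onto the image of \<open>T\<close>, and the trace of an operator on an invariant subspace does not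
  depend on the projection; \<open>a\<close> accounts for the commutation rule.\<close>

lemma gen_inverse_trace_unique:
  fixes T X Q1 Q2 :: "'k::field mat"
  assumes c: "T \<in> carrier_mat d d" "X \<in> carrier_mat d d" "Q1 \<in> carrier_mat d d" "Q2 \<in> carrier_mat d d"
    and Q: "T * Q1 * T = T" "T * Q2 * T = T" and X: "T * X = a \<cdot>\<^sub>m (X * T)"
  shows "mtr (T * X * Q1) = mtr (T * X * Q2)"
proof -
  note [simp] = carrier_matD[OF c(1)] carrier_matD[OF c(2)] carrier_matD[OF c(3)] carrier_matD[OF c(4)]
  have "mtr (T * X * Q1) = mtr (a \<cdot>\<^sub>m (X * ((T * Q2 * T) * Q1)))" unfolding X Q(2) by (simp add: mat_assoc)
  also have "\<dots> = mtr ((a \<cdot>\<^sub>m (X * T)) * (Q2 * T * Q1))" by (simp add: mat_assoc)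
  also have "\<dots> = mtr (T * (X * Q2 * T * Q1))" unfolding X[symmetric] by (simp add: mat_assoc)
  also have "\<dots> = mtr (X * Q2 * T * Q1 * T)" by (rule mtr_comm) auto
  also have "\<dots> = mtr (X * Q2 * (T * Q1 * T))" by (simp add: mat_assoc)
  also have "\<dots> = mtr (T * (X * Q2))" unfolding Q(1) by (intro mtr_comm) auto
  finally show ?thesis by (simp add: mat_assoc)
qed

lemma mtr_four_block:
  assumes "A \<in> carrier_mat a a" "B \<in> carrier_mat b b"
  shows "mtr (four_block_mat A (0\<^sub>m a b) (0\<^sub>m b a) B) = mtr A + mtr B"
proof -
  have *: "(\<Sum>i<a + b. f i) = (\<Sum>i<a. f i) + (\<Sum>i<b. f (a + i))" for f :: "nat \<Rightarrow> 'a"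
    by (induction b) (auto simp: algebra_simps)
  show ?thesis using assms unfolding mtr_def by (simp add: *)
qed

lemma mtr_kron_blocks:
  fixes M :: "'k::field mat"
  assumes M: "M \<in> carrier_mat (r * l) (r * l)"
    and C: "\<And>j. j < l \<Longrightarrow> C j \<in> carrier_mat r r" "\<And>j. j < l \<Longrightarrow> M * kronecker (1\<^sub>m r) (ec l j) = kronecker (C j) (ec l j)"
  shows "mtr M = (\<Sum>j<l. mtr (C j))"
proof -
  let ?c = "\<lambda>j. kronecker (1\<^sub>m r) (ec l j) :: 'k mat" and ?e = "\<lambda>j. kronecker (1\<^sub>m r) (er l j) :: 'k mat"
  have [simp]: "dim_row M = r * l" "dim_col M = r * l" using M by auto
  have "mtr M = mtr (M * gsum (r * l) (r * l) (\<lambda>j. ?c j * ?e j) {..<l})" by (simp add: kron_ec_sum)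
  also have "M * gsum (r * l) (r * l) (\<lambda>j. ?c j * ?e j) {..<l} = gsum (r * l) (r * l) (\<lambda>j. M * (?c j * ?e j)) {..<l}"
    by (subst gsum_mult_left) (auto intro!: carrier_matI)
  also have "mtr \<dots> = (\<Sum>j<l. mtr (M * (?c j * ?e j)))"
    by (rule mtr_gsum) (auto intro!: carrier_matI)
  also have "\<dots> = (\<Sum>j<l. mtr (C j))"
  proof (intro sum.cong refl)
    fix j assume "j \<in> {..<l}"
    then have j: "j < l" by simp
    note [simp] = carrier_matD[OF C(1)[OF j]]
    have "mtr (M * (?c j * ?e j)) = mtr (kronecker (C j) (ec l j) * ?e j)" using C(2)[OF j] by (simp flip: mat_assoc)
    also have "\<dots> = mtr (?e j * kronecker (C j) (ec l j))" by (rule mtr_comm) auto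
    also have "\<dots> = mtr (C j)" using j by (simp add: kron_mult er_ec)
    finally show "mtr (M * (?c j * ?e j)) = mtr (C j)" .
  qed
  finally show ?thesis .
qed

text \<open>The division-free form of \<open>(u^m - 1) / (u - 1)\<close>, meaningful also at
  \<open>u = 1\<close>.\<close>

definition geo :: "'k::field \<Rightarrow> nat \<Rightarrow> 'k" where "geo u m = (\<Sum>i<m. u ^ i)"

lemma geo_simps [simp]: "geo u 0 = 0" "geo u (Suc m) = 1 + u * geo u m"
  by (simp_all add: geo_def sum.lessThan_Suc_shift sum_distrib_left del: sum.lessThan_Suc)

text \<open>A recursion with characteristic roots 1 and \<open>u\<close>. At \<open>m = 0\<close>,
  with truncated subtraction, its left side is 1 instead; this jump is how \<open>nu\<close> detects
  the length of a chain.\<close>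

lemma geo_diff: "1 \<le> m \<Longrightarrow> geo u (Suc m) - (1 + u) * geo u m + u * geo u (m - 1) = 0"
  by (cases m) (auto simp: algebra_simps)

lemma geo_shift:
  assumes "i \<le> m"
  shows "(\<Sum>j<i. u ^ (j + m - i)) = geo u m - geo u (m - i)"
proof -
  have *: "(\<Sum>j<i. u ^ (j + k)) = geo u (i + k) - geo u k" for k
    by (induction i) (simp_all add: geo_def)
  have "j + m - i = j + (m - i)" for j using assms by simp
  then show ?thesis using *[of "m - i"] assms by simp
qed

lemma geo_trunc: "(\<Sum>j<m. if i \<le> j then u ^ (j - i) else 0) = geo u (m - i)"
proof (induction m)
  case (Suc m)
  show ?case
  proof (cases "i \<le> m")
    case True
    then have "Suc m - i = Suc (m - i)" by simp
    then show ?thesis using Suc True by (simp add: geo_def)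
  qed (use Suc in \<open>simp add: geo_def\<close>)
qed simp

text \<open>The division-free form of \<open>(a\<^sup>l - b\<^sup>l) / (a - b)\<close>; for \<open>a = b\<close> it is \<open>l a\<^sup>l\<^sup>-\<^sup>1\<close>.\<close>

definition bl :: "'k::field \<Rightarrow> 'k \<Rightarrow> nat \<Rightarrow> 'k" where "bl a b l = (\<Sum>i<l. a ^ i * b ^ (l - 1 - i))"

lemma bl_mult: "(a - b) * bl a b l = a ^ l - b ^ l"
  unfolding bl_def by (simp add: power_diff_sumr2 mult.commute)

text \<open>The recursion mirrors the Clebsch-Gordan rule: \<open>a + b\<close> is the value at
  length 2 and \<open>a * b\<close> that of the twist of the shorter summand.\<close>

lemma bl_rec: "l \<ge> 1 \<Longrightarrow> (a + b) * bl a b l = bl a b (Suc l) + a * b * bl a b (l - 1)"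
proof -
  have s1: "bl a b (Suc m) = b * bl a b m + a ^ m" for m
  proof -
    have "(\<Sum>i<m. a ^ i * b ^ (m - i)) = (\<Sum>i<m. b * (a ^ i * b ^ (m - 1 - i)))"
    proof (intro sum.cong refl)
      fix i assume "i \<in> {..<m}"
      then have "m - i = Suc (m - 1 - i)" by auto
      then show "a ^ i * b ^ (m - i) = b * (a ^ i * b ^ (m - 1 - i))" by simp
    qed
    then show ?thesis by (simp add: bl_def sum_distrib_left)
  qed
  assume "l \<ge> 1"
  then obtain m where m: "l = Suc m" by (cases l) auto
  show ?thesis by (simp add: m s1 algebra_simps)
qed

context green_datum
begin

definition ginv :: "'k mat \<Rightarrow> nat \<Rightarrow> 'k mat"
  where "ginv T d = (SOME Q. Q \<in> carrier_mat d d \<and> T * Q * T = T)"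

text \<open>Since \<open>T * ginv T d\<close> is a projection onto the image of \<open>T\<close>, up to the factor \<open>\<chi>(x)\<^sup>i\<close> this is the
  trace of \<open>x\<close> on the submodule \<open>y\<^sup>i M\<close>.\<close>

fun Rtr :: "nat \<Rightarrow> 'a \<Rightarrow> ('a, 'k) hmod \<Rightarrow> 'k"
  where "Rtr i x (d, X, Y) = mtr (Y ^\<^sub>m i * X x * ginv (Y ^\<^sub>m i) d)"

lemma ginv: "T \<in> carrier_mat d d \<Longrightarrow> ginv T d \<in> carrier_mat d d \<and> T * ginv T d * T = T"
  unfolding ginv_def by (rule someI_ex) (metis gen_inverse_exists)

lemma Rtr_eq:
  assumes M: "(d, X, Y) \<in> hmods" and x: "x \<in> carrier G" and Q: "Q \<in> carrier_mat d d" "Y ^\<^sub>m i * Q * Y ^\<^sub>m i = Y ^\<^sub>m i"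
  shows "Rtr i x (d, X, Y) = mtr (Y ^\<^sub>m i * X x * Q)"
proof -
  note D = hmodsD[OF M] and GD = gmodD[OF hmodsD(1)[OF M]]
  have T: "Y ^\<^sub>m i \<in> carrier_mat d d" using D(3,4) by (intro carrier_matI) auto
  have "Y ^\<^sub>m i * X x = \<chi> x ^ i \<cdot>\<^sub>m (X x * Y ^\<^sub>m i)"
    using hmods_commute[OF M x, of i] \<chi>_nz[OF x] by (simp add: power_mult_distrib[symmetric])
  then show ?thesis
    using gen_inverse_trace_unique[OF T GD(1)[OF x] _ Q(1) _ Q(2)] ginv[OF T] by simp
qed

lemma Rtr_hsum:
  assumes "M \<in> hmods" "N \<in> hmods" "x \<in> carrier G"
  shows "Rtr i x (hsum M N) = Rtr i x M + Rtr i x N"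
proof -
  obtain d X Y e X' Y' where eq: "M = (d, X, Y)" "N = (e, X', Y')" by (metis surj_pair)
  note D = hmodsD[OF assms(1)[unfolded eq]] and D' = hmodsD[OF assms(2)[unfolded eq]]
  have c: "Y ^\<^sub>m i \<in> carrier_mat d d" "Y' ^\<^sub>m i \<in> carrier_mat e e" using D(3,4) D'(3,4) by (auto intro!: carrier_matI)
  note q = ginv[OF c(1)] ginv[OF c(2)]
  let ?b = "\<lambda>A B. four_block_mat A (0\<^sub>m d e) (0\<^sub>m e d) B :: 'k mat"
  have m: "?b A B * ?b A' B' = ?b (A * A') (B * B')"
    if "A \<in> carrier_mat d d" "A' \<in> carrier_mat d d" "B \<in> carrier_mat e e" "B' \<in> carrier_mat e e" for A A' B B'
    using that by (subst mult_four_block_mat[of _ d d _ e _ e _ _ d _ e]) auto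
  have p: "?b Y Y' ^\<^sub>m i = ?b (Y ^\<^sub>m i) (Y' ^\<^sub>m i)" using D D' by (subst pow_four_block_mat[of _ d _ e]) auto
  have X: "X x \<in> carrier_mat d d" "X' x \<in> carrier_mat e e" using gmodD(1)[OF D(1)] gmodD(1)[OF D'(1)] assms(3) by auto
  note mc = mult_carrier_mat[OF mult_carrier_mat] mult_carrier_mat
  have "Rtr i x (hsum M N) = mtr (?b Y Y' ^\<^sub>m i * ?b (X x) (X' x) * ?b (ginv (Y ^\<^sub>m i) d) (ginv (Y' ^\<^sub>m i) e))"
    unfolding eq hsum.simps
  proof (rule Rtr_eq[OF hsum_hmods[OF assms(1,2), unfolded eq hsum.simps] assms(3)])
    show "?b Y Y' ^\<^sub>m i * ?b (ginv (Y ^\<^sub>m i) d) (ginv (Y' ^\<^sub>m i) e) * ?b Y Y' ^\<^sub>m i = ?b Y Y' ^\<^sub>m i"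
      unfolding p using c q mult_carrier_mat[OF c(1), of "ginv (Y ^\<^sub>m i) d" d] mult_carrier_mat[OF c(2), of "ginv (Y' ^\<^sub>m i) e" e] by (simp add: m)
  qed (use q in auto)
  also have "\<dots> = Rtr i x M + Rtr i x N"
    unfolding p using c q X mult_carrier_mat[OF c(1) X(1)] mult_carrier_mat[OF c(2) X(2)]
    by (simp add: m eq mtr_four_block[OF mult_carrier_mat[OF mult_carrier_mat[OF c(1) X(1)]] mult_carrier_mat[OF mult_carrier_mat[OF c(2) X(2)]]])
  finally show ?thesis .
qed

lemma Rtr_hiso:
  assumes M: "M \<in> hmods" and N: "N \<in> hmods" and i: "hiso M N" and x: "x \<in> carrier G"
  shows "Rtr i x M = Rtr i x N"
proof -
  obtain d X Y where eq: "M = (d, X, Y)" by (metis surj_pair)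
  obtain X' Y' where eq': "N = (d, X', Y')" using i eq by (cases N) auto
  obtain P R where P: "P \<in> carrier_mat d d" "R \<in> carrier_mat d d" "P * R = 1\<^sub>m d" "R * P = 1\<^sub>m d"
    "\<And>h. h \<in> carrier G \<Longrightarrow> P * X h = X' h * P" "P * Y = Y' * P" using i by (auto simp: eq eq')
  note D = hmodsD[OF M[unfolded eq]] hmodsD[OF N[unfolded eq']]
  have c: "Y ^\<^sub>m i \<in> carrier_mat d d" "Y' ^\<^sub>m i \<in> carrier_mat d d" using D(3,4) D(9,10) by (auto intro!: carrier_matI)
  define Q where "Q = ginv (Y ^\<^sub>m i) d"
  have Q: "Q \<in> carrier_mat d d" "Y ^\<^sub>m i * Q * Y ^\<^sub>m i = Y ^\<^sub>m i" using ginv[OF c(1)] by (auto simp: Q_def)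
  note [simp] = carrier_matD[OF P(1)] carrier_matD[OF P(2)] carrier_matD[OF Q(1)] carrier_matD[OF c(1)] carrier_matD[OF c(2)]
    gmodD(4,5)[OF D(1)] gmodD(4,5)[OF D(7)] x
  have PY: "P * Y ^\<^sub>m i = Y' ^\<^sub>m i * P" using pow_mat_intertwine[OF D(2) D(8) P(1), of 1 i] P(6) by simp
  have Y'P: "Y' ^\<^sub>m i = P * Y ^\<^sub>m i * R" unfolding PY by (simp add: mat_assoc P(3))
  have X': "X' x = P * X x * R" unfolding P(5)[OF x] by (simp add: mat_assoc P(3))
  have c1: "R * (P * Z) = Z" if "dim_row Z = d" for Z using mat_pull[OF P(4), of Z] that by simp
  have "Y' ^\<^sub>m i * (P * Q * R) * Y' ^\<^sub>m i = P * (Y ^\<^sub>m i * Q * Y ^\<^sub>m i) * R" unfolding Y'P by (simp add: mat_assoc c1)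
  then have "Rtr i x N = mtr (Y' ^\<^sub>m i * X' x * (P * Q * R))"
    unfolding eq' by (intro Rtr_eq[OF N[unfolded eq'] x]) (auto simp: Q(2) Y'P[symmetric] intro!: carrier_matI)
  also have "\<dots> = mtr (P * (Y ^\<^sub>m i * X x * Q * R))" unfolding Y'P X' by (simp add: mat_assoc c1)
  also have "\<dots> = mtr ((Y ^\<^sub>m i * X x * Q * R) * P)" by (rule mtr_comm) auto
  also have "\<dots> = Rtr i x M" by (simp add: eq mat_assoc P(4) Q_def[symmetric])
  finally show ?thesis ..
qed

fun vmod :: "nat \<times> ('a \<Rightarrow> 'k mat) \<Rightarrow> ('a, 'k) hmod" where "vmod (d, X) = (d, X, 0\<^sub>m d d)"

lemma vmod_hmods: "gmod G d X \<Longrightarrow> X (g [^] n) = 1\<^sub>m d \<Longrightarrow> vmod (d, X) \<in> hmods"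
  using n_ge_2 gmodD(4,5)[of d X] by (auto simp: hmods_def pow_mat_zero)

text \<open>On the tensor product \<open>y\<close> acts as \<open>y \<otimes> g\<close>; the
  invertible factor \<open>V g\<close> commutes with \<open>V x\<close> and cancels against its
  inverse.\<close>

lemma Rtr_vmod:
  assumes N: "N \<in> hmods" and V: "gmod G e V" "V (g [^] n) = 1\<^sub>m e" and x: "x \<in> carrier G"
  shows "Rtr i x (htens N (vmod (e, V))) = Rtr i x N * mtr (V x)"
proof -
  obtain d X Y where eq: "N = (d, X, Y)" by (metis surj_pair)
  note D = hmodsD[OF N[unfolded eq]] and GD = gmodD[OF hmodsD(1)[OF N[unfolded eq]]]
  have c: "Y ^\<^sub>m i \<in> carrier_mat d d" using D(3,4) by (auto intro!: carrier_matI)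
  define Q where "Q = ginv (Y ^\<^sub>m i) d"
  have Q: "Q \<in> carrier_mat d d" "Y ^\<^sub>m i * Q * Y ^\<^sub>m i = Y ^\<^sub>m i" using ginv[OF c] by (auto simp: Q_def)
  note [simp] = D(3,4) GD(4,5) gmodD(4,5)[OF V(1)] carrier_matD[OF Q(1)] x g_closed
  have vi: "V g ^\<^sub>m i * V (inv g) ^\<^sub>m i = 1\<^sub>m e" for i
  proof (induction i)
    case (Suc i)
    have "V g ^\<^sub>m Suc i * V (inv g) ^\<^sub>m Suc i = V g ^\<^sub>m i * (V g * V (inv g)) * V (inv g) ^\<^sub>m i"
      by (simp add: pow_mat_Suc2[of "V (inv g)"] mat_assoc del: pow_mat.simps(2)) (simp add: mat_assoc)
    then show ?case using Suc gmodD(7)[OF V(1) g_closed] by simp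
  qed simp
  have ht: "htens N (vmod (e, V)) = (d * e, \<lambda>h. kronecker (X h) (V h), kronecker Y (V g))" by (simp add: eq)
  have H: "htens N (vmod (e, V)) \<in> hmods" using htens_hmods[OF N vmod_hmods[OF V]] .
  have "Rtr i x (htens N (vmod (e, V))) = mtr (kronecker Y (V g) ^\<^sub>m i * kronecker (X x) (V x) * kronecker Q (V (inv g) ^\<^sub>m i))"
    unfolding ht by (rule Rtr_eq[OF H[unfolded ht] x]) (auto simp: kron_pow kron_mult Q(2) vi intro!: carrier_matI)
  also have "\<dots> = mtr (Y ^\<^sub>m i * X x * Q) * mtr (V g ^\<^sub>m i * V x * V (inv g) ^\<^sub>m i)"
    by (simp add: kron_pow kron_mult mtr_kron)
  also have "mtr (V g ^\<^sub>m i * V x * V (inv g) ^\<^sub>m i) = mtr (V x)"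
  proof -
    have "V x * V g = 1 \<cdot>\<^sub>m (V g * V x)"
      using gmodD(3)[OF V(1), of g x] gmodD(3)[OF V(1), of x g] g_central[OF x] by simp
    then have "V x * V g ^\<^sub>m i = 1 ^ i \<cdot>\<^sub>m (V g ^\<^sub>m i * V x)"
      by (intro pow_mat_intertwine[of _ e _ e]) (auto intro!: carrier_matI)
    then have "V g ^\<^sub>m i * V x * V (inv g) ^\<^sub>m i = V x * (V g ^\<^sub>m i * V (inv g) ^\<^sub>m i)" by (simp flip: mat_assoc)
    then show ?thesis by (simp add: vi)
  qed
  finally show ?thesis by (simp add: eq Q_def)
qed

lemma Rtr_chain:
  assumes V: "gmod G d V" "V (g [^] n) = 1\<^sub>m d" and l: "l \<le> n" and x: "x \<in> carrier G"
  shows "Rtr i x (chain l (d, V)) = mtr (V x) * geo (inverse (\<chi> x)) (l - i)"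
proof -
  note [simp] = gmodD(4,5)[OF V(1)] x
  let ?u = "inverse (\<chi> x)"
  let ?c = "\<lambda>A j. kronecker A (ec l j) :: 'k mat" and ?e = "\<lambda>j. kronecker (1\<^sub>m d) (er l j) :: 'k mat"
  let ?T = "kronecker (1\<^sub>m d) (sh l)"
  \<comment> \<open>A generalised inverse of the \<open>i\<close>-th power of the shift: layers move
    back by \<open>i\<close>, and the first \<open>i\<close> layers go to 0.\<close>
  define Q where "Q = gsum (d * l) (d * l) (\<lambda>j. (if i \<le> j then ?c (1\<^sub>m d) (j - i) else 0\<^sub>m (d * l) d) * ?e j) {..<l}"
  have Qc: "Q \<in> carrier_mat (d * l) (d * l)" by (simp add: Q_def)
  note [simp] = carrier_matD[OF Qc]
  have Te: "?T ^\<^sub>m i * ?c A j = ?c A (j + i)" if "dim_row A = d" for A j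
    using that by (simp add: kron_pow kron_mult sh_pow_ec)
  have Qe: "Q * ?c A j = (if i \<le> j then ?c A (j - i) else 0\<^sub>m (d * l) (dim_col A))" if A: "dim_row A = d" and j: "j < l" for A j
  proof -
    have "Q * ?c A j = gsum (d * l) (dim_col A) (\<lambda>k. (if i \<le> k then ?c (1\<^sub>m d) (k - i) else 0\<^sub>m (d * l) d) * ?e k * ?c A j) {..<l}"
      unfolding Q_def using A by (subst gsum_mult_right) (auto intro!: carrier_matI)
    also have "\<dots> = gsum (d * l) (dim_col A) (\<lambda>k. if k = j then (if i \<le> j then ?c A (j - i) else 0\<^sub>m (d * l) (dim_col A)) else 0\<^sub>m (d * l) (dim_col A)) {..<l}"
      using A by (intro gsum_cong) (auto simp: mat_assoc kron_mult er_ec kron_ec_mult)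
    also have "\<dots> = (if i \<le> j then ?c A (j - i) else 0\<^sub>m (d * l) (dim_col A))"
      using A j by (intro eq_matI) (auto simp: if_distrib[of "\<lambda>M. M $$ _"] simp del: index_mult_sum cong: if_cong)
    finally show ?thesis .
  qed
  have "?T ^\<^sub>m i * Q * ?T ^\<^sub>m i = ?T ^\<^sub>m i"
  proof (rule kron_ec_ext[of _ "d * l" d l])
    fix j assume j: "j < l"
    show "?T ^\<^sub>m i * Q * ?T ^\<^sub>m i * ?c (1\<^sub>m d) j = ?T ^\<^sub>m i * ?c (1\<^sub>m d) j"
    proof (cases "j + i < l")
      case True
      then show ?thesis by (simp add: mat_assoc Te Qe)
    next
      case False
      then have "ec l (j + i) = (0\<^sub>m l 1 :: 'k mat)" by (intro ec_zero) auto
      then show ?thesis by (simp add: mat_assoc Te)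
    qed
  qed (auto intro!: carrier_matI)
  then have "Rtr i x (chain l (d, V)) = mtr (?T ^\<^sub>m i * kronecker (V x) (dg ?u l) * Q)"
    unfolding chain.simps by (intro Rtr_eq[OF chain_hmods[OF V l, unfolded chain.simps] x Qc])
  also have "\<dots> = (\<Sum>j<l. mtr ((if i \<le> j then ?u ^ (j - i) else 0) \<cdot>\<^sub>m V x))"
  proof (rule mtr_kron_blocks)
    fix j assume j: "j < l"
    show "?T ^\<^sub>m i * kronecker (V x) (dg ?u l) * Q * ?c (1\<^sub>m d) j = ?c ((if i \<le> j then ?u ^ (j - i) else 0) \<cdot>\<^sub>m V x) j"
      using j by (auto simp: mat_assoc Qe Te kron_mult dg_ec)
  qed (auto intro!: carrier_matI)
  also have "\<dots> = mtr (V x) * (\<Sum>j<l. if i \<le> j then ?u ^ (j - i) else 0)"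
    by (simp add: sum_distrib_left mult.commute cong: sum.cong)
  finally show ?thesis unfolding geo_trunc .
qed

text \<open>On the first \<open>i\<close> layers the image of \<open>y^i\<close> consists of the
  image of \<open>g^n - 1\<close>, which contributes the constant \<open>k\<close>. As a function of
  \<open>n - i\<close> the result combines \<open>geo\<close> and a constant, both of which the
  second difference in \<open>nu\<close> annihilates.\<close>

lemma Rtr_Ind:
  assumes W: "gmod G d W" and x: "x \<in> carrier G"
  obtains k where "\<And>i. i \<le> n \<Longrightarrow> Rtr i x (Ind (d, W)) =
    mtr (W x) * geo (inverse (\<chi> x)) (n - i) + k * (geo (inverse (\<chi> x)) n - geo (inverse (\<chi> x)) (n - i))"
proof -
  note [simp] = gmodD(4,5)[OF W] x yind_dims[OF W]
  define K where "K = W (g [^] n) - 1\<^sub>m d"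
  have Kc: "K \<in> carrier_mat d d" using gmodD(1)[OF W carrier_order(1)] by (simp add: K_def minus_carrier_mat)
  define K' where "K' = ginv K d"
  have K': "K' \<in> carrier_mat d d" "K * K' * K = K" using ginv[OF Kc] by (auto simp: K'_def)
  note [simp] = carrier_matD[OF Kc] carrier_matD[OF K'(1)]
  let ?u = "inverse (\<chi> x)"
  let ?c = "\<lambda>A j. kronecker A (ec n j) :: 'k mat" and ?e = "\<lambda>j. kronecker (1\<^sub>m d) (er n j) :: 'k mat"
  let ?T = "yind d W"
  have un: "?u ^ n = 1" using \<chi>_pow[OF x] by (simp add: power_inverse)
  have T1: "?T ^\<^sub>m i * ?c A j = (if j + i < n then ?c A (j + i) else ?c (K * A) (j + i - n))" if "dim_row A = d" "j < n" "i \<le> n" for A i j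
    using that
  proof (induction i)
    case (Suc i)
    have "?T ^\<^sub>m Suc i * ?c A j = ?T * (?T ^\<^sub>m i * ?c A j)"
      using Suc.prems by (simp add: mat_assoc pow_mat_Suc2 del: pow_mat.simps)
    also have "\<dots> = ?T * (if j + i < n then ?c A (j + i) else ?c (K * A) (j + i - n))" using Suc by simp
    also have "\<dots> = (if j + Suc i < n then ?c A (j + Suc i) else ?c (K * A) (j + Suc i - n))"
    proof -
      consider "Suc (j + i) < n" | "Suc (j + i) = n" | "n \<le> j + i" by linarith
      then show ?thesis
      proof cases
        case 3
        then have "Suc (j + i - n) < n" "Suc (j + i - n) = j + Suc i - n" using Suc.prems by auto
        then show ?thesis using 3 Suc.prems by (simp add: yind_ec(1)[OF W])
      qed (use Suc.prems in \<open>simp_all add: yind_ec[OF W] K_def\<close>)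
    qed
    finally show ?case .
  qed simp
  \<comment> \<open>Layers move back by \<open>i\<close>; where this passes the first layer, a
    factor \<open>g^n - 1\<close> has to be undone, which its generalised inverse \<open>K'\<close>
    does.\<close>
  define Qt where "Qt = (\<lambda>i A j. if i \<le> j then ?c A (j - i) else ?c (K' * A) (j + n - i))"
  have Qtd: "dim_row (Qt i A j) = d * n" "dim_col (Qt i A j) = dim_col A" if "dim_row A = d" for i A j
    using that by (auto simp: Qt_def)
  define Q where "Q = (\<lambda>i. gsum (d * n) (d * n) (\<lambda>j. Qt i (1\<^sub>m d) j * ?e j) {..<n})"
  have Qc: "Q i \<in> carrier_mat (d * n) (d * n)" for i by (simp add: Q_def)
  note [simp] = carrier_matD[OF Qc]
  have Qe: "Q i * ?c A j = Qt i A j" if A: "dim_row A = d" and j: "j < n" for A i j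
  proof -
    have "Q i * ?c A j = gsum (d * n) (dim_col A) (\<lambda>k. Qt i (1\<^sub>m d) k * ?e k * ?c A j) {..<n}"
      unfolding Q_def using A by (subst gsum_mult_right) (auto intro!: carrier_matI simp: Qtd)
    also have "\<dots> = gsum (d * n) (dim_col A) (\<lambda>k. if k = j then Qt i A j else 0\<^sub>m (d * n) (dim_col A)) {..<n}"
    proof (intro gsum_cong)
      fix k assume "k \<in> {..<n}"
      then have "?e k * ?c A j = (if k = j then A else 0\<^sub>m d (dim_col A))" using A by (auto simp: kron_mult er_ec)
      moreover have "Qt i (1\<^sub>m d) j * A = Qt i A j"
        using A kron_mult[of K' A "ec n (j + n - i)" "1\<^sub>m 1"] by (auto simp: Qt_def kron_ec_mult)
      ultimately show "Qt i (1\<^sub>m d) k * ?e k * ?c A j = (if k = j then Qt i A j else 0\<^sub>m (d * n) (dim_col A))"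
        using A by (auto simp: mat_assoc Qtd)
    qed
    also have "\<dots> = Qt i A j"
      using A j Qtd[OF A] by (intro eq_matI) (auto simp: if_distrib[of "\<lambda>M. M $$ _"] simp del: index_mult_sum cong: if_cong)
    finally show ?thesis .
  qed
  have "Rtr i x (Ind (d, W)) = mtr (W x) * geo ?u (n - i) + mtr (K * (W x * K')) * (geo ?u n - geo ?u (n - i))"
    if i: "i \<le> n" for i
  proof -
    have "?T ^\<^sub>m i * Q i * ?T ^\<^sub>m i = ?T ^\<^sub>m i"
    proof (rule kron_ec_ext[of _ "d * n" d n])
      fix j assume j: "j < n"
      show "?T ^\<^sub>m i * Q i * ?T ^\<^sub>m i * ?c (1\<^sub>m d) j = ?T ^\<^sub>m i * ?c (1\<^sub>m d) j"
      proof (cases "j + i < n")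
        case True
        then show ?thesis using i j by (simp add: mat_assoc T1 Qe Qt_def)
      next
        case False
        then have l: "j + i - n < i" "j + i - n < n" "j + i - n + n - i = j" using i j by auto
        have "?T ^\<^sub>m i * Q i * ?T ^\<^sub>m i * ?c (1\<^sub>m d) j = ?T ^\<^sub>m i * (Q i * ?c K (j + i - n))"
          using False i j by (simp add: mat_assoc T1)
        also have "\<dots> = ?T ^\<^sub>m i * ?c (K' * K) j" using l by (simp add: Qe Qt_def)
        also have "\<dots> = ?c (K * K' * K) (j + i - n)" using False i j by (simp add: T1 mat_assoc)
        finally show ?thesis using False i j by (simp add: T1 K'(2))
      qed
    qed (auto intro!: carrier_matI)
    then have "Rtr i x (Ind (d, W)) = mtr (?T ^\<^sub>m i * kronecker (W x) (dg ?u n) * Q i)"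
      unfolding Ind.simps by (intro Rtr_eq[OF Ind_hmods[OF W, unfolded Ind.simps] x Qc])
    also have "\<dots> = (\<Sum>j<n. mtr (if i \<le> j then ?u ^ (j - i) \<cdot>\<^sub>m W x else ?u ^ (j + n - i) \<cdot>\<^sub>m (K * (W x * K'))))"
    proof (rule mtr_kron_blocks)
      fix j assume j: "j < n"
      show "?T ^\<^sub>m i * kronecker (W x) (dg ?u n) * Q i * ?c (1\<^sub>m d) j =
          ?c (if i \<le> j then ?u ^ (j - i) \<cdot>\<^sub>m W x else ?u ^ (j + n - i) \<cdot>\<^sub>m (K * (W x * K'))) j"
      proof (cases "i \<le> j")
        case True
        then show ?thesis using i j by (simp add: mat_assoc Qe Qt_def kron_mult dg_ec T1)
      next
        case False
        then have "j + n - i < n" "j + n - i + i = j + n" using i by auto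
        then show ?thesis using False i j by (simp add: mat_assoc Qe Qt_def kron_mult dg_ec T1)
      qed
    qed (auto intro!: carrier_matI)
    also have "\<dots> = (\<Sum>j<n. mtr (W x) * (if i \<le> j then ?u ^ (j - i) else 0) +
        mtr (K * (W x * K')) * (if j < i then ?u ^ (j + n - i) else 0))"
      by (intro sum.cong) auto
    also have "\<dots> = mtr (W x) * geo ?u (n - i) + mtr (K * (W x * K')) * (\<Sum>j<n. if j < i then ?u ^ (j + n - i) else 0)"
      by (simp add: sum.distrib flip: sum_distrib_left geo_trunc)
    also have "(\<Sum>j<n. if j < i then ?u ^ (j + n - i) else 0) = (\<Sum>j<i. ?u ^ (j + n - i))"
      using i by (intro sum.mono_neutral_cong_right) auto
    finally show ?thesis by (simp only: geo_shift[OF i])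
  qed
  then show ?thesis using that by blast
qed

end


section \<open>The Clebsch-Gordan rule for tensoring with the chain of length 2\<close>

lemma basis_cover:
  fixes J1 J2 :: "'k::field mat"
  assumes J: "J1 \<in> carrier_mat d d1" "J2 \<in> carrier_mat d d2"
    and c: "\<And>s. s < d \<Longrightarrow> \<exists>A\<in>carrier_mat d1 1. \<exists>B\<in>carrier_mat d2 1. J1 * A + J2 * B = ec d s"
  shows "\<exists>K1\<in>carrier_mat d1 d. \<exists>K2\<in>carrier_mat d2 d. J1 * K1 + J2 * K2 = 1\<^sub>m d"
proof -
  obtain A B where AB: "\<And>s. s < d \<Longrightarrow> A s \<in> carrier_mat d1 1 \<and> B s \<in> carrier_mat d2 1 \<and> J1 * A s + J2 * B s = ec d s"
    using c by metis
  have ABd: "dim_row (A s) = d1" "dim_col (A s) = 1" "dim_row (B s) = d2" "dim_col (B s) = 1" if "s < d" for s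
    using AB[OF that] by (auto dest: carrier_matD)
  let ?K = "\<lambda>e A. gsum e d (\<lambda>s. A s * er d s) {..<d} :: 'k mat"
  have "J1 * ?K d1 A + J2 * ?K d2 B = 1\<^sub>m d"
  proof -
    have 1: "J1 * ?K d1 A = gsum d d (\<lambda>s. J1 * (A s * er d s)) {..<d}"
      using J ABd by (subst gsum_mult_left) (auto intro!: carrier_matI)
    have 2: "J2 * ?K d2 B = gsum d d (\<lambda>s. J2 * (B s * er d s)) {..<d}"
      using J ABd by (subst gsum_mult_left) (auto intro!: carrier_matI)
    have "1\<^sub>m d = gsum d d (\<lambda>s. J1 * (A s * er d s) + J2 * (B s * er d s)) {..<d}"
      unfolding ec_er_sum[symmetric]
    proof (intro gsum_cong)
      fix s assume "s \<in> {..<d}"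
      then have *: "A s \<in> carrier_mat d1 1" "B s \<in> carrier_mat d2 1" "J1 * A s + J2 * B s = ec d s" using AB by auto
      show "ec d s * er d s = J1 * (A s * er d s) + J2 * (B s * er d s)"
        unfolding *(3)[symmetric] using carrier_matD[OF *(1)] carrier_matD[OF *(2)] carrier_matD[OF J(1)] carrier_matD[OF J(2)]
        by (simp add: mat_left_distrib mat_assoc)
    qed
    also have "\<dots> = J1 * ?K d1 A + J2 * ?K d2 B"
      unfolding 1 2
    proof (intro eq_matI, goal_cases)
      case (1 i j)
      have "(\<Sum>s<d. (J1 * (A s * er d s) + J2 * (B s * er d s)) $$ (i, j)) =
          (\<Sum>s<d. (J1 * (A s * er d s)) $$ (i, j) + (J2 * (B s * er d s)) $$ (i, j))"
        using J ABd 1 by (intro sum.cong refl index_add_mat) (auto dest: carrier_matD)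
      then show ?case using 1 by (simp add: sum.distrib del: index_mult_sum index_add_mat) (simp add: sum.distrib del: index_mult_sum)
    qed auto
    finally show ?thesis ..
  qed
  then show ?thesis by (intro bexI[of _ "?K d1 A"] bexI[of _ "?K d2 B"]) auto
qed

lemma kron_ec: "j < 2 \<Longrightarrow> kronecker (ec l k) (ec 2 j) = (ec (l * 2) (k * 2 + j) :: 'k::field mat)"
proof (intro eq_matI, goal_cases)
  case (1 r c)
  then have "r div 2 < l" "r mod 2 < 2" "c = 0" "r = k * 2 + j \<longleftrightarrow> r div 2 = k \<and> r mod 2 = j" by auto
  with 1 show ?case by (simp add: index_kron)
qed auto

context green_datum
begin

text \<open>\<open>mch l\<close> is the chain over the trivial representation; every chain is a
  \<open>vmod\<close> tensored with one of these. \<open>uu\<close> is the inverse of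
  \<open>\<chi>\<close>, the character by which \<open>G\<close> acts on \<open>y v\<close> for an
  invariant vector \<open>v\<close>.\<close>

abbreviation "mch l \<equiv> chain l (1, \<lambda>_. 1\<^sub>m 1)"
abbreviation "uu \<equiv> \<lambda>h. inverse (\<chi> h) \<cdot>\<^sub>m 1\<^sub>m 1"

lemma gmod_triv: "gmod G 1 (\<lambda>_. 1\<^sub>m 1)" "gmod G 1 uu" "uu (g [^] n) = 1\<^sub>m 1"
  using \<chi>_pow[OF g_closed] by (auto simp: gmod_def \<chi>_one \<chi>_mult \<chi>_g_pow)

lemma mch_hmods: "l \<le> n \<Longrightarrow> mch l \<in> hmods"
  by (rule chain_hmods[OF gmod_triv(1)]) auto

lemma chain_eq_tens: "chain l (d, V) = htens (vmod (d, V)) (mch l)"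
  by simp

lemma mch_1: "mch 1 = htriv"
proof -
  have "dg a (Suc 0) = 1\<^sub>m (Suc 0)" "sh (Suc 0) = 0\<^sub>m (Suc 0) (Suc 0)" for a :: 'k by (intro eq_matI; auto)+
  then show ?thesis by (simp add: htriv_def)
qed

text \<open>A quantum integer at the inverse of \<open>\<chi> g\<close>; it can vanish only if the
  order \<open>n\<close> of \<open>\<chi> g\<close> divides \<open>l\<close>.\<close>

lemma geo_nz:
  assumes "0 < l" "l < n" shows "geo (inverse (\<chi> g)) l \<noteq> 0"
proof
  let ?b = "inverse (\<chi> g)"
  assume "geo ?b l = 0"
  moreover have "(?b - 1) * geo ?b l = ?b ^ l - 1" unfolding geo_def by (induction l) (simp_all add: algebra_simps)
  ultimately have "\<chi> g ^ l = 1" by (simp add: power_inverse)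
  then show False using order_q[of l] assms by (auto dest: dvd_imp_le)
qed

text \<open>The summands are generated by \<open>v0 = e\<^sub>0 \<otimes> e\<^sub>0\<close> and by the combination \<open>v1\<close> of \<open>e\<^sub>0 \<otimes> e\<^sub>1\<close> and
  \<open>e\<^sub>1 \<otimes> e\<^sub>0\<close> that is killed by \<open>y\<^sup>l\<^sup>-\<^sup>1\<close>.\<close>

lemma clebsch_gordan:
  assumes l: "1 \<le> l" "l < n"
  shows "hiso (htens (mch l) (mch 2)) (hsum (mch (Suc l)) (htens (vmod (1, uu)) (mch (l - 1))))"
proof -
  let ?b = "inverse (\<chi> g)"
  let ?E = "\<lambda>k j. kronecker (ec l k) (ec 2 j) :: 'k mat"
  define X where "X = (\<lambda>h. kronecker (dg (inverse (\<chi> h)) l) (dg (inverse (\<chi> h)) 2))"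
  define Y where "Y = kronecker (sh l) (dg ?b 2) + kronecker (1\<^sub>m l) (sh 2)"
  have eq: "htens (mch l) (mch 2) = (l * 2, X, Y)" by (simp add: X_def Y_def)
  have M: "(l * 2, X, Y) \<in> hmods" unfolding eq[symmetric] using l n_ge_2 by (intro htens_hmods mch_hmods) auto
  note D = hmodsD[OF M]
  note [simp] = D(3,4) gmodD(4,5)[OF D(1)]
  have YE: "Y * ?E k j = ?b ^ j \<cdot>\<^sub>m ?E (Suc k) j + ?E k (Suc j)" for k j
    by (simp add: Y_def mat_left_distrib kron_mult sh_ec dg_ec)
  have E2: "?E k 2 = 0\<^sub>m (l * 2) 1" and El: "l \<le> k \<Longrightarrow> ?E k j = 0\<^sub>m (l * 2) 1" for k j
    by (simp_all add: ec_zero)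
  have Y1: "Y ^\<^sub>m k * ?E m 1 = ?b ^ k \<cdot>\<^sub>m ?E (m + k) 1" for k m
  proof (induction k)
    case (Suc k)
    have "Y ^\<^sub>m Suc k * ?E m 1 = Y * (Y ^\<^sub>m k * ?E m 1)" by (simp add: pow_mat_Suc2 mat_assoc del: pow_mat.simps)
    also have "\<dots> = ?b ^ Suc k \<cdot>\<^sub>m ?E (m + Suc k) 1"
      unfolding Suc using YE[of "m + k" 1] E2[of "m + k"] by (simp add: numeral_2_eq_2 mult.commute)
    finally show ?case .
  qed simp
  have Y0: "Y ^\<^sub>m k * ?E m 0 = ?E (m + k) 0 + geo ?b k \<cdot>\<^sub>m ?E (m + k - 1) 1" for k m
  proof (induction k)
    case (Suc k)
    have "Y ^\<^sub>m Suc k * ?E m 0 = Y * (Y ^\<^sub>m k * ?E m 0)" by (simp add: pow_mat_Suc2 mat_assoc del: pow_mat.simps)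
    also have "\<dots> = Y * ?E (m + k) 0 + geo ?b k \<cdot>\<^sub>m (Y * ?E (m + k - 1) 1)"
      unfolding Suc by (simp add: mat_right_distrib)
    also have "geo ?b k \<cdot>\<^sub>m (Y * ?E (m + k - 1) 1) = (geo ?b k * ?b) \<cdot>\<^sub>m ?E (m + k) 1"
    proof (cases k)
      case (Suc k')
      then show ?thesis using YE[of "m + k'" 1] E2[of "m + k'"] by (simp add: numeral_2_eq_2)
    qed (intro eq_matI; simp)
    also have "Y * ?E (m + k) 0 + \<dots> = ?E (m + Suc k) 0 + geo ?b (Suc k) \<cdot>\<^sub>m ?E (m + Suc k - 1) 1"
      using YE[of "m + k" 0] by (intro eq_matI) (auto simp: algebra_simps)
    finally show ?case .
  qed (intro eq_matI; simp)
  have XE: "X h * ?E k j = inverse (\<chi> h) ^ (k + j) \<cdot>\<^sub>m ?E k j" for h k j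
    by (simp add: X_def kron_mult dg_ec power_add mult.commute)
  define v0 where "v0 = ?E 0 0"
  define v1 where "v1 = geo ?b (l - 1) \<cdot>\<^sub>m ?E 0 1 + (- (?b ^ (l - 1))) \<cdot>\<^sub>m ?E 1 0"
  have vd [simp]: "dim_row v0 = l * 2" "dim_col v0 = 1" "dim_row v1 = l * 2" "dim_col v1 = 1"
    by (simp_all add: v0_def v1_def)
  have f0: "ghom 1 (\<lambda>_. 1\<^sub>m 1) (l * 2) X v0"
    unfolding ghom_def using XE[of _ 0 0] by (auto simp: v0_def intro!: carrier_matI)
  have f1: "ghom 1 uu (l * 2) X v1"
    unfolding ghom_def
  proof (intro conjI ballI)
    fix h assume h: "h \<in> carrier G"
    have "X h * v1 = geo ?b (l - 1) \<cdot>\<^sub>m (X h * ?E 0 1) + (- (?b ^ (l - 1))) \<cdot>\<^sub>m (X h * ?E 1 0)"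
      using h by (simp add: v1_def mat_right_distrib)
    also have "\<dots> = inverse (\<chi> h) \<cdot>\<^sub>m v1"
      unfolding XE by (intro eq_matI) (auto simp: v1_def algebra_simps)
    finally show "X h * v1 = v1 * uu h" by simp
  qed (auto intro!: carrier_matI)
  have p0: "Y ^\<^sub>m k * v0 = ?E k 0 + geo ?b k \<cdot>\<^sub>m ?E (k - 1) 1" for k
    using Y0[of k 0] by (simp add: v0_def)
  have p1: "Y ^\<^sub>m k * v1 = (geo ?b (l - 1) * ?b ^ k - ?b ^ (l - 1) * geo ?b k) \<cdot>\<^sub>m ?E k 1 + (- (?b ^ (l - 1))) \<cdot>\<^sub>m ?E (Suc k) 0" for k
  proof -
    have "Y ^\<^sub>m k * v1 = geo ?b (l - 1) \<cdot>\<^sub>m (Y ^\<^sub>m k * ?E 0 1) + (- (?b ^ (l - 1))) \<cdot>\<^sub>m (Y ^\<^sub>m k * ?E 1 0)"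
      by (simp add: v1_def mat_right_distrib)
    then show ?thesis unfolding Y1 Y0 by (simp, intro eq_matI) (auto simp: algebra_simps)
  qed
  have z0: "Y ^\<^sub>m Suc l * v0 = 0\<^sub>m (l * 2) 1" unfolding p0 by (simp add: El del: pow_mat.simps)
  have z1: "Y ^\<^sub>m (l - 1) * v1 = 0\<^sub>m (l * 2) 1" unfolding p1 using l by (intro eq_matI) (auto simp: El)
  let ?J0 = "frob Y v0 1 (Suc l)" and ?J1 = "frob Y v1 1 (l - 1)"
  have J0: "hhom (mch (Suc l)) (l * 2, X, Y) ?J0" by (rule frob_chain[OF M gmod_triv(1) f0 z0])
  have J1: "hhom (chain (l - 1) (1, uu)) (l * 2, X, Y) ?J1" by (rule frob_chain[OF M gmod_triv(2) f1 z1])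
  have c0: "?J0 \<in> carrier_mat (l * 2) (Suc l)" and c1: "?J1 \<in> carrier_mat (l * 2) (l - 1)"
    using frob_carrier[OF D(2), of _ 1] by auto
  have e0: "?J0 * ec (Suc l) k = Y ^\<^sub>m k * v0" if "k \<le> l" for k
    using frob_ec[OF D(2), of v0 1 "1\<^sub>m 1" k "Suc l"] that by (simp add: carrier_matI)
  \<comment> \<open>At \<open>k = l - 1\<close> both sides are zero:
    \<open>ec (l - 1) (l - 1)\<close> is the zero column and \<open>y^(l - 1)\<close> kills
    \<open>v1\<close>.\<close>
  have e1: "?J1 * ec (l - 1) k = Y ^\<^sub>m k * v1" if k: "k < l" for k
  proof (cases "k < l - 1")
    case True
    then show ?thesis using frob_ec[OF D(2), of v1 1 "1\<^sub>m 1" k "l - 1"] by (simp add: carrier_matI)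
  next
    case False
    then have "k = l - 1" using k by simp
    then show ?thesis using c1 z1 by (simp add: ec_zero)
  qed
  note [simp] = carrier_matD[OF c0, unfolded One_nat_def] carrier_matD[OF c1, unfolded One_nat_def]
  have g1: "geo ?b (Suc k) = geo ?b k + ?b ^ k" for k by (simp add: geo_def del: geo_simps)
  \<comment> \<open>Adding \<open>?b^(l - 1)\<close> times \<open>y^(k + 1) v0\<close> to
    \<open>y^k v1\<close> cancels \<open>e_(k+1) \<otimes> e_0\<close> and leaves
    \<open>geo ?b l * ?b^k\<close> times \<open>e_k \<otimes> e_1\<close>. The factor is nonzero
    because \<open>l < n\<close>, and dividing by it gives the coefficients in \<open>A\<close> and
    \<open>B\<close>.\<close>
  define A where "A = (\<lambda>k. inverse (geo ?b l * ?b ^ k) * ?b ^ (l - 1) \<cdot>\<^sub>m ec (Suc l) (Suc k) :: 'k mat)"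
  define B where "B = (\<lambda>k. inverse (geo ?b l * ?b ^ k) \<cdot>\<^sub>m ec (l - 1) k :: 'k mat)"
  have [simp]: "dim_row (A k) = Suc l" "dim_col (A k) = 1" "dim_row (B k) = l - 1" "dim_col (B k) = 1" for k
    by (simp_all add: A_def B_def)
  have r1: "?J0 * A k + ?J1 * B k = ?E k 1" if k: "k < l" for k
  proof -
    have nz: "geo ?b l * ?b ^ k \<noteq> 0" using geo_nz[of l] l \<chi>_nz[OF g_closed] by auto
    have "geo ?b l = geo ?b (l - 1) + ?b ^ (l - 1)" using g1[of "l - 1"] l by simp
    then have *: "?b ^ (l - 1) * geo ?b (Suc k) + (geo ?b (l - 1) * ?b ^ k - ?b ^ (l - 1) * geo ?b k) = geo ?b l * ?b ^ k"
      unfolding g1 by (simp add: algebra_simps)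
    have "?J0 * A k + ?J1 * B k = (inverse (geo ?b l * ?b ^ k) * ?b ^ (l - 1)) \<cdot>\<^sub>m (Y ^\<^sub>m Suc k * v0) + inverse (geo ?b l * ?b ^ k) \<cdot>\<^sub>m (Y ^\<^sub>m k * v1)"
      using k e0[of "Suc k"] e1[of k] by (simp add: A_def B_def del: pow_mat.simps)
    also have "\<dots> = (inverse (geo ?b l * ?b ^ k) * (?b ^ (l - 1) * geo ?b (Suc k) + (geo ?b (l - 1) * ?b ^ k - ?b ^ (l - 1) * geo ?b k))) \<cdot>\<^sub>m ?E k 1"
      unfolding p0 p1 by (intro eq_matI) (auto simp: algebra_simps simp del: geo_simps)
    also have "\<dots> = ?E k 1" unfolding * by (simp only: left_inverse[OF nz]) simp
    finally show ?thesis .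
  qed
  have r0: "\<exists>A'\<in>carrier_mat (Suc l) 1. \<exists>B'\<in>carrier_mat (l - 1) 1. ?J0 * A' + ?J1 * B' = ?E k 0" if k: "k < l" for k
  proof (intro bexI)
    \<comment> \<open>Subtracting the multiple of \<open>e_(k-1) \<otimes> e_1\<close> just obtained
      from \<open>y^k v0\<close> leaves \<open>e_k \<otimes> e_0\<close>. For \<open>k = 0\<close>
      the truncated index is harmless, since \<open>geo ?b 0 = 0\<close>.\<close>
    have E: "?E k 0 = Y ^\<^sub>m k * v0 + (- geo ?b k) \<cdot>\<^sub>m (?J0 * A (k - 1) + ?J1 * B (k - 1))"
      unfolding r1[of "k - 1", OF less_imp_diff_less[OF k]] p0 by (intro eq_matI) auto
    show "?J0 * (ec (Suc l) k + (- geo ?b k) \<cdot>\<^sub>m A (k - 1)) + ?J1 * ((- geo ?b k) \<cdot>\<^sub>m B (k - 1)) = ?E k 0"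
      unfolding E using k e0[of k, symmetric] by (simp add: mat_right_distrib smult_add_mat mat_add_assoc)
  qed (auto intro!: carrier_matI)
  have "\<exists>K1\<in>carrier_mat (Suc l) (l * 2). \<exists>K2\<in>carrier_mat (l - 1) (l * 2). ?J0 * K1 + ?J1 * K2 = 1\<^sub>m (l * 2)"
  proof (rule basis_cover[OF c0 c1])
    fix s assume s: "s < l * 2"
    have *: "ec (l * 2) s = ?E (s div 2) (s mod 2)" "s div 2 < l" using s by (simp_all add: kron_ec)
    consider "s mod 2 = 0" | "s mod 2 = 1" by linarith
    then show "\<exists>A\<in>carrier_mat (Suc l) 1. \<exists>B\<in>carrier_mat (l - 1) 1. ?J0 * A + ?J1 * B = ec (l * 2) s"
    proof cases
      case 1
      then show ?thesis unfolding *(1) 1 by (rule_tac r0[OF *(2)])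
    next
      case 2
      show ?thesis unfolding *(1) 2
        by (rule bexI[of _ "A (s div 2)"], rule bexI[of _ "B (s div 2)"], rule r1[OF *(2)]) (auto intro!: carrier_matI)
    qed
  qed
  then obtain K1 K2 where K: "K1 \<in> carrier_mat (Suc l) (l * 2)" "K2 \<in> carrier_mat (l - 1) (l * 2)" "?J0 * K1 + ?J1 * K2 = 1\<^sub>m (l * 2)"
    by blast
  show ?thesis unfolding eq chain_eq_tens[of "l - 1" 1 uu, symmetric]
    by (rule hiso_hsum[OF M mch_hmods chain_hmods[OF gmod_triv(2,3)] J0 J1]) (use K l in auto)
qed

end


section \<open>The invariants \<open>nu\<close> and \<open>phi\<close>, and multiplicativity of
  \<open>phi\<close>\<close>

context green_datum
begin

lemma hiso_refl: "M \<in> hmods \<Longrightarrow> hiso M M"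
proof -
  assume M: "M \<in> hmods"
  obtain d X Y where eq: "M = (d, X, Y)" by (metis surj_pair)
  note D = hmodsD[OF M[unfolded eq]]
  show ?thesis
    using D gmodD(4,5)[OF D(1)] by (auto simp: eq intro!: bexI[of _ "1\<^sub>m d"])
qed

text \<open>The second difference of \<open>Rtr\<close> isolates the chains of length exactly \<open>l\<close>: it is the trace of \<open>x\<close> on
  their first layers. The function \<open>phi\<close> is multiplicative because the numbers \<open>bl a b l\<close> with
  \<open>a b = \<chi>(x)\<^sup>-\<^sup>1\<close> obey the recursion of the Clebsch-Gordan rule, and \<open>a\<^sup>n = b\<^sup>n\<close> makes it vanish on
  the chains of length \<open>n\<close>, which are induced.\<close>

definition nu :: "'a \<Rightarrow> nat \<Rightarrow> ('a, 'k) hmod \<Rightarrow> 'k"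
  where "nu x l M = Rtr (l - 1) x M - (1 + inverse (\<chi> x)) * Rtr l x M + inverse (\<chi> x) * Rtr (Suc l) x M"

definition phi :: "'a \<Rightarrow> 'k \<Rightarrow> 'k \<Rightarrow> ('a, 'k) hmod \<Rightarrow> 'k"
  where "phi x a b M = (\<Sum>l=1..<n. nu x l M * bl a b l)"

lemma nu_hsum:
  "M \<in> hmods \<Longrightarrow> N \<in> hmods \<Longrightarrow> x \<in> carrier G \<Longrightarrow> nu x l (hsum M N) = nu x l M + nu x l N"
  by (simp add: nu_def Rtr_hsum algebra_simps)

lemma nu_hiso: "M \<in> hmods \<Longrightarrow> N \<in> hmods \<Longrightarrow> hiso M N \<Longrightarrow> x \<in> carrier G \<Longrightarrow> nu x l M = nu x l N"
  by (simp add: nu_def Rtr_hiso[of M N])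

lemma nu_vmod:
  assumes "N \<in> hmods" "gmod G e V" "V (g [^] n) = 1\<^sub>m e" "x \<in> carrier G"
  shows "nu x l (htens N (vmod (e, V))) = nu x l N * mtr (V x)"
  unfolding nu_def Rtr_vmod[OF assms] by (simp add: algebra_simps)

lemma nu_chain:
  assumes V: "gmod G d V" "V (g [^] n) = 1\<^sub>m d" and m: "m \<le> n" and x: "x \<in> carrier G" and l: "1 \<le> l"
  shows "nu x l (chain m (d, V)) = (if l = m then mtr (V x) else 0)"
proof -
  let ?u = "inverse (\<chi> x)"
  have *: "nu x l (chain m (d, V)) = mtr (V x) * (geo ?u (m - (l - 1)) - (1 + ?u) * geo ?u (m - l) + ?u * geo ?u (m - Suc l))"
    unfolding nu_def Rtr_chain[OF V m x] by (simp add: algebra_simps)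
  consider "l < m" | "l = m" | "m < l" by linarith
  then show ?thesis
  proof cases
    case 1
    then have "m - (l - 1) = Suc (m - l)" "m - Suc l = (m - l) - 1" "1 \<le> m - l" using l by auto
    then show ?thesis using 1 geo_diff[of "m - l" ?u] by (simp only: *) simp
  next
    case 2
    then have "m - (m - 1) = Suc 0" using l by simp
    then show ?thesis using 2 * by simp
  qed (simp only: *, simp)
qed

lemma nu_Ind:
  assumes W: "gmod G d W" and x: "x \<in> carrier G" and l: "1 \<le> l" "l < n"
  shows "nu x l (Ind (d, W)) = 0"
proof -
  let ?u = "inverse (\<chi> x)"
  obtain k where k: "\<And>i. i \<le> n \<Longrightarrow> Rtr i x (Ind (d, W)) = mtr (W x) * geo ?u (n - i) + k * (geo ?u n - geo ?u (n - i))"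
    using Rtr_Ind[OF W x] by blast
  have i: "l - 1 \<le> n" "l \<le> n" "Suc l \<le> n" using l by auto
  have "n - (l - 1) = Suc (n - l)" "n - Suc l = (n - l) - 1" "1 \<le> n - l" using l by auto
  then have g: "geo ?u (n - (l - 1)) = (1 + ?u) * geo ?u (n - l) - ?u * geo ?u (n - Suc l)"
    using geo_diff[of "n - l" ?u] by (simp only:) (simp add: algebra_simps)
  show ?thesis unfolding nu_def k[OF i(1)] k[OF i(2)] k[OF i(3)] g by (simp add: algebra_simps)
qed

lemma phi_hsum:
  "M \<in> hmods \<Longrightarrow> N \<in> hmods \<Longrightarrow> x \<in> carrier G \<Longrightarrow> phi x a b (hsum M N) = phi x a b M + phi x a b N"
  by (simp add: phi_def nu_hsum algebra_simps sum.distrib)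

lemma phi_hiso: "M \<in> hmods \<Longrightarrow> N \<in> hmods \<Longrightarrow> hiso M N \<Longrightarrow> x \<in> carrier G \<Longrightarrow> phi x a b M = phi x a b N"
  by (simp add: phi_def nu_hiso[of M N])

lemma phi_vmod:
  assumes "N \<in> hmods" "gmod G e V" "V (g [^] n) = 1\<^sub>m e" "x \<in> carrier G"
  shows "phi x a b (htens N (vmod (e, V))) = phi x a b N * mtr (V x)"
  unfolding phi_def nu_vmod[OF assms] by (simp add: sum_distrib_left ac_simps)

lemma phi_Ind: "gmod G d W \<Longrightarrow> x \<in> carrier G \<Longrightarrow> phi x a b (Ind (d, W)) = 0"
  unfolding phi_def by (intro sum.neutral ballI) (auto simp: nu_Ind simp del: Ind.simps)

lemma phi_zero:
  assumes "dim_row Y = 0"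
  shows "phi x a b (d, X, Y) = 0"
proof -
  have "dim_row (Y ^\<^sub>m i) = 0" for i using assms by (induction i) simp_all
  then have "Rtr i x (d, X, Y) = 0" for i by (simp add: mtr_def)
  then show ?thesis by (simp add: phi_def nu_def del: Rtr.simps)
qed

lemma bl_root:
  assumes "a \<noteq> b" "a ^ n = b ^ n"
  shows "bl a b n = 0"
  using bl_mult[of a b n] assms by simp

text \<open>For \<open>m = n\<close> no summand contributes, while \<open>bl a b n = 0\<close> by
  the conditions on \<open>a\<close> and \<open>b\<close>. The formula thus reaches the full length,
  where the Clebsch-Gordan recursion ends.\<close>

lemma phi_chain:
  assumes V: "gmod G d V" "V (g [^] n) = 1\<^sub>m d" and m: "m \<le> n" and x: "x \<in> carrier G"
    and ab: "a \<noteq> b" "a ^ n = b ^ n"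
  shows "phi x a b (chain m (d, V)) = mtr (V x) * bl a b m"
proof -
  have "phi x a b (chain m (d, V)) = (\<Sum>l=1..<n. if l = m then mtr (V x) * bl a b m else 0)"
    unfolding phi_def by (intro sum.cong refl) (simp add: nu_chain[OF V m x] del: chain.simps)
  also have "\<dots> = mtr (V x) * bl a b m"
    using m bl_root[OF ab] by (cases "m = 0"; cases "m = n") (auto simp: bl_def[of a b 0])
  finally show ?thesis .
qed

lemma vmod_tens: "htens (vmod (d, V)) (vmod (e, W)) = vmod (d * e, \<lambda>h. kronecker (V h) (W h))" 
  if "dim_row (W g) = e" "dim_col (W g) = e"
  using that by simp

text \<open>Induced modules stay induced under tensoring, so both sides are 0 there; on chains the
  Clebsch-Gordan rule turns the claim into \<open>bl_rec\<close>.\<close>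

lemma phi_tens_2:
  assumes N: "N \<in> hmods" and x: "x \<in> carrier G"
    and ab: "a \<noteq> b" "a ^ n = b ^ n" "a * b = inverse (\<chi> x)"
  shows "phi x a b (htens N (mch 2)) = (a + b) * phi x a b N"
  using N
proof (induction rule: hmods_induct)
  note m2 = mch_hmods[OF n_ge_2]
  case (iso M N)
  then have "hiso (htens M (mch 2)) (htens N (mch 2))" by (intro htens_hiso m2 hiso_refl)
  then show ?case using phi_hiso[OF htens_hmods[OF iso(1) m2] htens_hmods[OF iso(2) m2] _ x] phi_hiso[OF iso(1-3) x] iso(4) by simp
next
  note m2 = mch_hmods[OF n_ge_2]
  case (sum M N)
  note h = htens_hmods[OF sum(1) m2] htens_hmods[OF sum(2) m2]
  show ?case
    using phi_hiso[OF htens_hmods[OF hsum_hmods[OF sum(1,2)] m2] hsum_hmods[OF h] hsum_tens_right[OF sum(1,2) m2] x]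
      phi_hsum[OF h x] phi_hsum[OF sum(1,2) x] sum(3,4) by (simp add: algebra_simps)
next
  note m2 = mch_hmods[OF n_ge_2]
  case (Ind r U)
  obtain X Y where m: "mch 2 = (2, X, Y)" by simp
  have X: "gmod G 2 X" using m2 unfolding m by (rule hmodsD)
  show ?case
    using phi_hiso[OF Ind_hmods[OF gmod_tensor[OF Ind X]] htens_hmods[OF Ind_hmods[OF Ind] m2[unfolded m]] Ind_tens_right[OF Ind m2[unfolded m]] x]
      phi_Ind[OF gmod_tensor[OF Ind X] x, of a b] phi_Ind[OF Ind x, of a b] m by simp
next
  note m2 = mch_hmods[OF n_ge_2]
  case (chain l r U)
  note [simp] = gmodD(4,5)[OF chain(3)] g_closed
  have gn: "g [^] n \<in> carrier G" using g_closed by simp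
  have U': "gmod G (r * 1) (\<lambda>h. kronecker (U h) (uu h))" by (rule gmod_tensor[OF chain(3) gmod_triv(2)])
  have U'1: "kronecker (U (g [^] n)) (uu (g [^] n)) = 1\<^sub>m (r * 1)" unfolding chain(4) gmod_triv(3) kron_one ..
  have l: "l \<le> n" "l - 1 \<le> n" "Suc l \<le> n" using chain by auto
  note h = vmod_hmods[OF chain(3,4)] mch_hmods[OF l(1)] mch_hmods[OF l(2)] mch_hmods[OF l(3)] vmod_hmods[OF gmod_triv(2,3)]
  let ?U' = "\<lambda>h. kronecker (U h) (uu h)"
  have t: "htens (vmod (r, U)) (vmod (1, uu)) = vmod (r * 1, ?U')" by (rule vmod_tens) auto
  have "htens (chain l (r, U)) (mch 2) = htens (vmod (r, U)) (htens (mch l) (mch 2))"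
    unfolding chain_eq_tens[of l r U] by (rule htens_assoc[OF h(1,2) m2])
  also have "phi x a b \<dots> = phi x a b (htens (vmod (r, U)) (hsum (mch (Suc l)) (htens (vmod (1, uu)) (mch (l - 1)))))"
    using chain(1,2) by (intro phi_hiso x htens_hiso h htens_hmods m2 hsum_hmods hiso_refl clebsch_gordan) auto
  also have "\<dots> = phi x a b (hsum (htens (vmod (r, U)) (mch (Suc l))) (htens (vmod (r, U)) (htens (vmod (1, uu)) (mch (l - 1)))))"
    by (intro phi_hiso x hsum_tens_left h htens_hmods hsum_hmods)
  also have "htens (vmod (r, U)) (htens (vmod (1, uu)) (mch (l - 1))) = htens (htens (vmod (r, U)) (vmod (1, uu))) (mch (l - 1))"
    by (rule htens_assoc[symmetric, OF h(1,5,3)])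
  also have "\<dots> = chain (l - 1) (r * 1, ?U')" unfolding t chain_eq_tens[of "l - 1" "r * 1" ?U'] ..
  also have "htens (vmod (r, U)) (mch (Suc l)) = chain (Suc l) (r, U)" unfolding chain_eq_tens[of "Suc l" r U] ..
  also have "phi x a b (hsum (chain (Suc l) (r, U)) (chain (l - 1) (r * 1, ?U'))) = mtr (U x) * bl a b (Suc l) + mtr (kronecker (U x) (uu x)) * bl a b (l - 1)"
    by (subst phi_hsum[OF chain_hmods[OF chain(3,4) l(3)] chain_hmods[OF U' U'1 l(2)] x])
      (simp only: phi_chain[OF chain(3,4) l(3) x ab(1,2)] phi_chain[OF U' U'1 l(2) x ab(1,2)])
  also have "mtr (kronecker (U x) (uu x)) = a * b * mtr (U x)"
    using x by (simp add: mtr_kron ab(3) mtr_simps)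
  also have "mtr (U x) * bl a b (Suc l) + a * b * mtr (U x) * bl a b (l - 1) = mtr (U x) * ((a + b) * bl a b l)"
    using bl_rec[of l a b] chain(1) by (simp add: algebra_simps)
  finally show ?case by (simp only: phi_chain[OF chain(3,4) l(1) x ab(1,2)]) (simp add: ac_simps)
qed

text \<open>The Clebsch-Gordan rule expresses length \<open>m + 1\<close> through shorter modules,
  so multiplicativity spreads from length 2 by the recursion that \<open>bl\<close>
  satisfies.\<close>

lemma phi_tens_mch:
  assumes x: "x \<in> carrier G" and ab: "a \<noteq> b" "a ^ n = b ^ n" "a * b = inverse (\<chi> x)"
  shows "N \<in> hmods \<Longrightarrow> l \<le> n \<Longrightarrow> phi x a b (htens N (mch l)) = phi x a b N * bl a b l"
proof (induction l arbitrary: N rule: less_induct)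
  case (less l)
  note m2 = mch_hmods[OF n_ge_2]
  obtain d X Y where eq: "N = (d, X, Y)" by (metis surj_pair)
  note D = hmodsD[OF less.prems(1)[unfolded eq]]
  consider "l = 0" | "l = 1" | m where "l = Suc m" "m \<ge> 1" by (cases l; force)
  then show ?case
  proof cases
    case 1
    then show ?thesis using phi_zero by (simp add: eq bl_def)
  next
    case 2
    then show ?thesis unfolding 2 mch_1 htens_one(2)[OF less.prems(1)] by (simp add: bl_def)
  next
    case 3
    note m = 3
    have l: "m \<le> n" "m - 1 \<le> n" "Suc m \<le> n" using m less.prems by auto
    note h = less.prems(1) mch_hmods[OF l(1)] mch_hmods[OF l(2)] mch_hmods[OF l(3)] vmod_hmods[OF gmod_triv(2,3)]
    have "phi x a b (htens N (htens (mch m) (mch 2))) =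
        phi x a b (htens N (hsum (mch (Suc m)) (htens (vmod (1, uu)) (mch (m - 1)))))"
      using m l by (intro phi_hiso x htens_hiso h htens_hmods m2 hsum_hmods hiso_refl clebsch_gordan) auto
    also have "\<dots> = phi x a b (hsum (htens N (mch (Suc m))) (htens N (htens (vmod (1, uu)) (mch (m - 1)))))"
      by (intro phi_hiso x hsum_tens_left h htens_hmods hsum_hmods)
    also have "\<dots> = phi x a b (htens N (mch (Suc m))) + phi x a b (htens N (htens (vmod (1, uu)) (mch (m - 1))))"
      by (intro phi_hsum h htens_hmods x)
    also have "htens N (htens (vmod (1, uu)) (mch (m - 1))) = htens (htens N (vmod (1, uu))) (mch (m - 1))"
      by (rule htens_assoc[symmetric, OF h(1,5,3)])
    also have "phi x a b \<dots> = phi x a b N * mtr (uu x) * bl a b (m - 1)"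
      using less.IH[OF _ htens_hmods[OF h(1,5)] l(2)] m phi_vmod[OF h(1) gmod_triv(2,3) x] by simp
    also have "htens N (htens (mch m) (mch 2)) = htens (htens N (mch m)) (mch 2)"
      by (rule htens_assoc[symmetric, OF h(1,2) m2])
    also have "phi x a b \<dots> = (a + b) * phi x a b (htens N (mch m))"
      by (rule phi_tens_2[OF htens_hmods[OF h(1,2)] x ab])
    also have "phi x a b (htens N (mch m)) = phi x a b N * bl a b m"
      using less.IH[OF _ h(1) l(1)] m by simp
    finally have "phi x a b (htens N (mch (Suc m))) = phi x a b N * ((a + b) * bl a b m - a * b * bl a b (m - 1))"
      by (simp add: ab(3) mtr_simps algebra_simps)
    then show ?thesis using bl_rec[OF m(2), of a b] m(1) by (simp only:) simp
  qed
qed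

text \<open>A chain is a \<open>vmod\<close> tensored with \<open>mch l\<close>, two factors that
  are already settled; tensoring with an induced module gives an induced module, on which
  \<open>phi\<close> is 0.\<close>

lemma phi_mult:
  assumes N: "N \<in> hmods" and M: "M \<in> hmods" and x: "x \<in> carrier G"
    and ab: "a \<noteq> b" "a ^ n = b ^ n" "a * b = inverse (\<chi> x)"
  shows "phi x a b (htens N M) = phi x a b N * phi x a b M"
  using M
proof (induction rule: hmods_induct)
  case (iso M M')
  then have "hiso (htens N M) (htens N M')" by (intro htens_hiso hiso_refl N)
  then show ?case using phi_hiso[OF htens_hmods[OF N iso(1)] htens_hmods[OF N iso(2)] _ x] phi_hiso[OF iso(1-3) x] iso(4) by simp
next
  case (sum M M')
  note h = htens_hmods[OF N sum(1)] htens_hmods[OF N sum(2)]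
  show ?case
    using phi_hiso[OF htens_hmods[OF N hsum_hmods[OF sum(1,2)]] hsum_hmods[OF h] hsum_tens_left[OF sum(1,2) N] x]
      phi_hsum[OF h x] phi_hsum[OF sum(1,2) x] sum(3,4) by (simp add: algebra_simps)
next
  case (chain l r U)
  have l: "l \<le> n" using chain by simp
  note h = N vmod_hmods[OF chain(3,4)] mch_hmods[OF l]
  have "htens N (chain l (r, U)) = htens (htens N (vmod (r, U))) (mch l)"
    unfolding chain_eq_tens[of l r U] by (rule htens_assoc[symmetric, OF h])
  then show ?case
    using phi_tens_mch[OF x ab htens_hmods[OF h(1,2)] l] phi_vmod[OF N chain(3,4) x] phi_chain[OF chain(3,4) l x ab(1,2)] by simp
next
  case (Ind r U)
  obtain e X Y where eq: "N = (e, X, Y)" by (metis surj_pair)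
  have X: "gmod G e X" using N unfolding eq by (rule hmodsD)
  show ?case
    using phi_hiso[OF Ind_hmods[OF gmod_tensor[OF X Ind]] htens_hmods[OF N Ind_hmods[OF Ind], unfolded eq] Ind_tens_left[OF Ind N[unfolded eq]] x]
      phi_Ind[OF gmod_tensor[OF X Ind] x, of a b] phi_Ind[OF Ind x, of a b] eq by simp
qed

end


subsection \<open>Sums of roots of unity\<close>

definition unity :: "nat \<Rightarrow> 'k::field set" where "unity N = {z. z ^ N = 1}"

text \<open>\<open>X^N - 1\<close> splits into linear factors, and a multiple root would also be a
  root of the derivative, hence 0, which is not a root of unity.\<close>

lemma card_unity:
  assumes "N > 0"
  shows "finite (unity N :: 'k::{alg_closed_field, field_char_0} set)" "card (unity N :: 'k set) = N"
proof -
  define p where "p = (Polynomial.monom 1 N - 1 :: 'k poly)"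
  have deg: "degree p = N" unfolding p_def using assms
    by (subst diff_conv_add_uminus, subst degree_add_eq_left) (auto simp: degree_monom_eq)
  have lc: "lead_coeff p = 1" unfolding deg using assms by (simp add: p_def)
  have root: "poly p x = 0 \<longleftrightarrow> x \<in> unity N" for x by (simp add: p_def unity_def poly_monom)
  have "p \<noteq> 0" using lc by auto
  then obtain A where A: "size A = N" "p = (\<Prod>x\<in>#A. [:- x, 1:])"
    using alg_closed_imp_factorization[of p] deg lc by auto
  have set: "set_mset A = unity N"
  proof -
    have "poly p x = 0 \<longleftrightarrow> x \<in># A" for x
      by (auto simp: A(2) poly_prod_mset prod_mset_zero_iff image_iff)
    then show ?thesis using root by blast
  qed
  have cnt: "count A x = 1" if "x \<in># A" for x
  proof (rule ccontr)
    assume "count A x \<noteq> 1"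
    define B where "B = A - {#x#}"
    have B: "A = add_mset x B" using that by (simp add: B_def)
    then have "x \<in># B" using \<open>count A x \<noteq> 1\<close> by (simp add: count_eq_zero_iff)
    then have C: "B = add_mset x (B - {#x#})" by simp
    have "p = [:- x, 1:] * ([:- x, 1:] * (\<Prod>x\<in>#B - {#x#}. [:- x, 1:]))"
      unfolding A(2) B by (subst C) (simp only: image_mset_add_mset prod_mset.add_mset)
    then have "poly (pderiv p) x = 0" by (simp only: pderiv_mult poly_add poly_mult) simp
    moreover have "pderiv p = Polynomial.monom (of_nat N) (N - 1)" by (simp add: p_def pderiv_diff pderiv_monom)
    ultimately have "x = 0" using assms by (simp add: poly_monom)
    then show False using that set assms by (simp add: unity_def power_0_left)
  qed
  show "finite (unity N :: 'k set)" unfolding set[symmetric] by simp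
  show "card (unity N :: 'k set) = N"
    using A(1) cnt unfolding set[symmetric] by (simp add: size_multiset_overloaded_eq)
qed

text \<open>Multiplication by a root \<open>w\<close> with \<open>w^j\<close> different from 1
  permutes the range of summation and scales the sum; such a \<open>w\<close> exists because there
  are only \<open>j\<close> roots of order \<open>j\<close>.\<close>

lemma unity_power_sum:
  assumes "0 < j" "j < N"
  shows "(\<Sum>z\<in>unity N. z ^ j) = (0 :: 'k::{alg_closed_field, field_char_0})"
proof -
  have "\<exists>w\<in>unity N. w ^ j \<noteq> (1::'k)"
  proof (rule ccontr)
    assume "\<not> ?thesis"
    then have "unity N \<subseteq> (unity j :: 'k set)" by (auto simp: unity_def)
    then have "card (unity N :: 'k set) \<le> card (unity j :: 'k set)"
      using card_unity(1)[OF assms(1)] by (intro card_mono)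
    then show False using assms by (simp add: card_unity)
  qed
  then obtain w :: 'k where w: "w ^ N = 1" "w ^ j \<noteq> 1" by (auto simp: unity_def)
  have w0: "w \<noteq> 0" using w assms by (auto simp: power_0_left)
  have "(\<Sum>z\<in>unity N. z ^ j) = (\<Sum>z\<in>unity N. (w * z) ^ j)"
    by (rule sum.reindex_bij_witness[of _ "\<lambda>z. w * z" "\<lambda>z. inverse w * z"])
      (use w(1) w0 in \<open>auto simp: unity_def power_mult_distrib power_inverse\<close>)
  then have "(1 - w ^ j) * (\<Sum>z\<in>unity N. z ^ j) = 0"
    by (simp add: power_mult_distrib left_diff_distrib flip: sum_distrib_left)
  then show ?thesis using w by simp
qed

lemma sum_cyclic:
  fixes h :: "nat \<Rightarrow> 'k::field"
  assumes "h N = h 0"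
  shows "(\<Sum>i<N. h (Suc i)) = (\<Sum>i<N. h i)"
proof -
  have "sum h {..<N} + h N = h 0 + (\<Sum>i<N. h (Suc i))"
    by (rule trans[OF sum.lessThan_Suc[symmetric] sum.lessThan_Suc_shift])
  then show ?thesis using assms by simp
qed

text \<open>The coefficient \<open>r z\<close> is the rank of the projection \<open>N\<^sup>-\<^sup>1 (\<Sum>i<N. z\<^sup>-\<^sup>i A\<^sup>i)\<close> onto the eigenspace of \<open>z\<close>.\<close>

lemma root_trace:
  fixes A :: "'k::{alg_closed_field, field_char_0} mat"
  assumes A: "A \<in> carrier_mat d d" "A ^\<^sub>m N = 1\<^sub>m d" and N: "N > 0"
  obtains r :: "'k \<Rightarrow> nat" where "\<And>j. mtr (A ^\<^sub>m j) = (\<Sum>z\<in>unity N. of_nat (r z) * z ^ j)"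
proof -
  note [simp] = carrier_matD[OF A(1)]
  have Ac: "A ^\<^sub>m i \<in> carrier_mat d d" for i by (intro carrier_matI) auto
  define P where "P = (\<lambda>z. inverse (of_nat N) \<cdot>\<^sub>m gsum d d (\<lambda>i. inverse z ^ i \<cdot>\<^sub>m A ^\<^sub>m i) {..<N})"
  have Pd [simp]: "dim_row (P z) = d" "dim_col (P z) = d" for z by (simp_all add: P_def)
  have AP: "A * P z = z \<cdot>\<^sub>m P z" if z: "z \<in> unity N" for z
  proof -
    have z0: "z \<noteq> 0" "z ^ N = 1" using z N by (auto simp: unity_def power_0_left)
    let ?f = "\<lambda>i. inverse z ^ i \<cdot>\<^sub>m A ^\<^sub>m i"
    have fc: "?f i \<in> carrier_mat d d" for i by (intro carrier_matI) auto
    have "A * gsum d d ?f {..<N} = gsum d d (\<lambda>i. z \<cdot>\<^sub>m ?f (Suc i)) {..<N}"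
    proof -
      have "A * ?f i = z \<cdot>\<^sub>m ?f (Suc i)" for i
        using z0 by (simp add: pow_mat_Suc2 mult.assoc[symmetric] del: pow_mat.simps)
      then show ?thesis using fc by (subst gsum_mult_left) auto
    qed
    also have "\<dots> = z \<cdot>\<^sub>m gsum d d (\<lambda>i. ?f (Suc i)) {..<N}" using fc by (subst gsum_smult) auto
    also have "gsum d d (\<lambda>i. ?f (Suc i)) {..<N} = gsum d d ?f {..<N}"
    proof (intro eq_matI, goal_cases)
      case (1 a b)
      have "?f N = ?f 0" using z0 A(2) by (simp add: power_inverse)
      then have "(\<Sum>i<N. ?f (Suc i) $$ (a, b)) = (\<Sum>i<N. ?f i $$ (a, b))"
        by (intro sum_cyclic) (simp only:)
      with 1 show ?case by (simp del: pow_mat.simps power_Suc)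
    qed auto
    finally show ?thesis by (simp add: P_def mult.commute)
  qed
  have AjP: "A ^\<^sub>m j * P z = z ^ j \<cdot>\<^sub>m P z" if z: "z \<in> unity N" for z j
  proof (induction j)
    case (Suc j)
    have "A ^\<^sub>m Suc j * P z = A * (A ^\<^sub>m j * P z)" by (simp add: pow_mat_Suc2 mat_assoc del: pow_mat.simps)
    then show ?case by (simp add: Suc AP[OF z] mult.commute)
  qed simp
  have PP: "P z * P z = P z" if z: "z \<in> unity N" for z
  proof -
    have z0: "z \<noteq> 0" "z ^ N = 1" using z N by (auto simp: unity_def power_0_left)
    have "gsum d d (\<lambda>i. inverse z ^ i \<cdot>\<^sub>m A ^\<^sub>m i) {..<N} * P z = gsum d d (\<lambda>i. P z) {..<N}"
      by (subst gsum_mult_right) (auto intro!: carrier_matI gsum_cong simp: AjP[OF z] power_inverse z0)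
    also have "\<dots> = of_nat N \<cdot>\<^sub>m P z" by (subst gsum_const) (auto intro!: carrier_matI)
    finally show ?thesis using N by (subst P_def) simp
  qed
  have P1: "gsum d d P (unity N) = 1\<^sub>m d"
  proof (intro eq_matI, goal_cases)
    case (1 a b)
    then have ab: "a < d" "b < d" by auto
    have "(\<Sum>z\<in>unity N. P z $$ (a, b)) = inverse (of_nat N) * (\<Sum>z\<in>unity N. \<Sum>i<N. inverse z ^ i * (A ^\<^sub>m i) $$ (a, b))"
      using ab by (simp add: P_def sum_distrib_left)
    also have "(\<Sum>z\<in>unity N. \<Sum>i<N. inverse z ^ i * (A ^\<^sub>m i) $$ (a, b)) = (\<Sum>i<N. (\<Sum>z\<in>unity N. inverse z ^ i) * (A ^\<^sub>m i) $$ (a, b))"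
      by (subst sum.swap) (simp add: sum_distrib_right)
    also have "\<dots> = (\<Sum>i<N. if i = 0 then of_nat N * 1\<^sub>m d $$ (a, b) else 0)"
    proof (intro sum.cong refl)
      fix i assume i: "i \<in> {..<N}"
      have "(\<Sum>z\<in>unity N. inverse z ^ i) = (\<Sum>z\<in>unity N. (z::'k) ^ i)"
        by (rule sum.reindex_bij_witness[of _ inverse inverse]) (auto simp: unity_def power_inverse)
      then show "(\<Sum>z\<in>unity N. inverse z ^ i) * (A ^\<^sub>m i) $$ (a, b) = (if i = 0 then of_nat N * 1\<^sub>m d $$ (a, b) else 0)"
        using i N unity_power_sum[of i N, where 'k = 'k] by (auto simp: card_unity)
    qed
    finally show ?case using ab N by simp
  qed auto
  have "\<exists>r. mtr (P z) = of_nat r" if z: "z \<in> unity N" for z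
  proof -
    have "P z \<in> carrier_mat d d" by (intro carrier_matI) auto
    from idempotent_factorisation[OF this PP[OF z]]
    obtain r B C where r: "B \<in> carrier_mat d r" "C \<in> carrier_mat r d" "P z = B * C" "C * B = 1\<^sub>m r" by metis
    then have "mtr (P z) = mtr (C * B)" by (simp add: mtr_comm[of B C])
    then show ?thesis using r(4) by auto
  qed
  then obtain r where r: "\<And>z. z \<in> unity N \<Longrightarrow> mtr (P z) = of_nat (r z)" by metis
  have "mtr (A ^\<^sub>m j) = (\<Sum>z\<in>unity N. of_nat (r z) * z ^ j)" for j
  proof -
    have "A ^\<^sub>m j = A ^\<^sub>m j * gsum d d P (unity N)" by (simp add: P1)
    also have "\<dots> = gsum d d (\<lambda>z. A ^\<^sub>m j * P z) (unity N)"
      by (subst gsum_mult_left) (auto intro!: carrier_matI)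
    also have "mtr \<dots> = (\<Sum>z\<in>unity N. mtr (A ^\<^sub>m j * P z))" by (rule mtr_gsum) (auto intro!: carrier_matI)
    also have "\<dots> = (\<Sum>z\<in>unity N. of_nat (r z) * z ^ j)" by (intro sum.cong) (auto simp: AjP r mult.commute)
    finally show ?thesis .
  qed
  then show ?thesis using that by blast
qed

text \<open>\<open>rsum N F\<close> says that \<open>F m\<close> is the \<open>m\<close>-th power sum of a formal difference of multisets of
  \<open>N\<close>-th roots of unity.\<close>

inductive rsum :: "nat \<Rightarrow> (nat \<Rightarrow> 'k::field) \<Rightarrow> bool" for N where
  root: "z ^ N = 1 \<Longrightarrow> rsum N (\<lambda>m. z ^ m)"
| diff: "rsum N F \<Longrightarrow> rsum N E \<Longrightarrow> rsum N (\<lambda>m. F m - E m)"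

lemma rsum_zero: "rsum N (\<lambda>m. 0)"
  using rsum.diff[OF rsum.root rsum.root, of 1 N 1] by simp

lemma rsum_one: "rsum N (\<lambda>m. 1)"
  using rsum.root[of 1 N] by simp

lemma rsum_minus: "rsum N F \<Longrightarrow> rsum N (\<lambda>m. - F m)"
  using rsum.diff[OF rsum_zero] by force

lemma rsum_add: "rsum N F \<Longrightarrow> rsum N E \<Longrightarrow> rsum N (\<lambda>m. F m + E m)"
  using rsum.diff[OF _ rsum_minus, of N F E] by simp

lemma rsum_sum: "(\<And>i. i \<in> I \<Longrightarrow> rsum N (F i)) \<Longrightarrow> rsum N (\<lambda>m. \<Sum>i\<in>I. F i m)"
  by (induction I rule: infinite_finite_induct) (auto intro: rsum_zero rsum_add)

lemma rsum_mult:
  assumes "rsum N F" "rsum N E"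
  shows "rsum N (\<lambda>m. F m * E m)"
proof -
  have *: "rsum N (\<lambda>m. z ^ m * E m)" if z: "z ^ N = 1" for z
    using assms(2)
  proof induction
    case (root w)
    then have "(z * w) ^ N = 1" using z by (simp add: power_mult_distrib)
    from rsum.root[OF this] show ?case by (simp add: power_mult_distrib)
  next
    case (diff F E)
    from rsum.diff[OF diff.IH] show ?case by (simp add: right_diff_distrib)
  qed
  show ?thesis using assms(1)
  proof induction
    case (diff F E)
    from rsum.diff[OF diff.IH] show ?case by (simp add: left_diff_distrib)
  qed (rule *)
qed

lemma rsum_power: "rsum N F \<Longrightarrow> rsum N (\<lambda>m. F m ^ k)"
  by (induction k) (auto intro: rsum_one rsum_mult)

lemma rsum_of_nat: "rsum N (\<lambda>m. of_nat k)"
  by (induction k) (auto intro: rsum_zero rsum_one rsum_add)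

text \<open>Powers of \<open>N\<close>-th roots of unity are again such roots; therefore the values
  at all exponents lie in the one ring \<open>rint N\<close>.\<close>

lemma rsum_at: "rsum N F \<Longrightarrow> rsum N (\<lambda>j. F (m * j))"
proof (induction rule: rsum.induct)
  case (root z)
  then have "(z ^ m) ^ N = 1" by (metis power_commutes power_mult power_one mult.commute)
  from rsum.root[OF this] show ?case by (simp add: power_mult)
qed (rule rsum.diff)

text \<open>The ring of integer combinations of \<open>N\<close>-th roots of unity.\<close>

definition rint :: "nat \<Rightarrow> 'k::field set" where "rint N = {F 1 |F. rsum N F}"

lemma rsum_rint: "rsum N F \<Longrightarrow> F m \<in> rint N"
  unfolding rint_def using rsum_at[of N F m] by (intro CollectI exI[of _ "\<lambda>j. F (m * j)"]) simp

lemma rint_closed: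
  assumes "a \<in> rint N"
  shows "b \<in> rint N \<Longrightarrow> a - b \<in> rint N" "b \<in> rint N \<Longrightarrow> a + b \<in> rint N"
    "b \<in> rint N \<Longrightarrow> a * b \<in> rint N" "a ^ k \<in> rint N" "- a \<in> rint N"
proof -
  obtain F where F: "rsum N F" "a = F 1" using assms by (auto simp: rint_def)
  show "a ^ k \<in> rint N" "- a \<in> rint N"
    using rsum_rint[OF rsum_power[OF F(1), of k], of 1] rsum_rint[OF rsum_minus[OF F(1)], of 1] F(2) by auto
  assume "b \<in> rint N"
  then obtain E where E: "rsum N E" "b = E 1" by (auto simp: rint_def)
  show "a - b \<in> rint N" "a + b \<in> rint N" "a * b \<in> rint N"
    using rsum_rint[OF rsum.diff[OF F(1) E(1)], of 1] rsum_rint[OF rsum_add[OF F(1) E(1)], of 1]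
      rsum_rint[OF rsum_mult[OF F(1) E(1)], of 1] F(2) E(2) by auto
qed

lemma rint_const: "0 \<in> rint N" "of_nat k \<in> rint N"
  using rsum_rint[OF rsum_zero] rsum_rint[OF rsum_of_nat] by auto

lemma rint_sum: "(\<And>i. i \<in> I \<Longrightarrow> f i \<in> rint N) \<Longrightarrow> (\<Sum>i\<in>I. f i) \<in> rint N"
  by (induction I rule: infinite_finite_induct) (auto intro: rint_closed rint_const)

lemma rint_span:
  assumes "r \<in> rint N" "N > 0"
  shows "\<exists>c. r = (\<Sum>z\<in>unity N. of_int (c z) * (z :: 'k::{alg_closed_field, field_char_0}))"
proof -
  obtain F where F: "rsum N F" "r = F 1" using assms(1) by (auto simp: rint_def)
  from F(1) have "\<exists>c. F 1 = (\<Sum>z\<in>unity N. of_int (c z) * z)"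
  proof induction
    case (root w)
    then have "(\<Sum>z\<in>unity N. of_int (if z = w then 1 else 0) * z) = w"
      using card_unity(1)[OF assms(2), where 'k = 'k] by (simp add: unity_def if_distrib[of "\<lambda>x. x * _"] if_distrib[of of_int] cong: if_cong)
    then show ?case by (intro exI[of _ "\<lambda>z. if z = w then 1 else 0"]) simp
  next
    case (diff F E)
    then obtain c e where "F 1 = (\<Sum>z\<in>unity N. of_int (c z) * z)" "E 1 = (\<Sum>z\<in>unity N. of_int (e z) * z)" by blast
    then show ?case by (intro exI[of _ "\<lambda>z. c z - e z"]) (simp add: left_diff_distrib sum_subtractf)
  qed
  then show ?thesis using F(2) by simp
qed

text \<open>Multiplication by \<open>r\<close> has an integer matrix with respect to the spanning set \<open>unity N\<close>.\<close>

lemma rint_algebraic_int: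
  assumes r: "r \<in> rint N" and N: "N > 0"
  shows "algebraic_int (r :: 'k::{alg_closed_field, field_char_0})"
proof -
  obtain zs where zs: "set zs = (unity N :: 'k set)" "distinct zs"
    using finite_distinct_list[OF card_unity(1)[OF N]] by blast
  let ?L = "length zs"
  have "\<exists>c. r * z = (\<Sum>w\<in>unity N. of_int (c w) * w)" if "z \<in> unity N" for z
  proof -
    have "z \<in> rint N" using rsum_rint[OF rsum.root, of z N 1] that by (simp add: unity_def)
    then show ?thesis by (intro rint_span rint_closed r N)
  qed
  then obtain c where c: "\<And>z. z \<in> unity N \<Longrightarrow> r * z = (\<Sum>w\<in>unity N. of_int (c z w) * w)" by metis
  define A where "A = mat ?L ?L (\<lambda>(i, j). c (zs ! i) (zs ! j))"
  define v where "v = vec ?L (\<lambda>i. zs ! i)"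
  let ?A = "map_mat of_int A :: 'k mat"
  have Ac: "A \<in> carrier_mat ?L ?L" "?A \<in> carrier_mat ?L ?L" by (auto simp: A_def)
  have s: "(\<Sum>w\<in>unity N. f w) = (\<Sum>j<?L. f (zs ! j))" for f :: "'k \<Rightarrow> 'k"
    unfolding zs(1)[symmetric] using zs(2) by (simp add: sum.distinct_set_conv_list sum_list_sum_nth atLeast0LessThan)
  have "eigenvector ?A v r"
    unfolding eigenvector_def
  proof (intro conjI)
    show "v \<in> carrier_vec (dim_row ?A)" by (simp add: v_def A_def)
    have "(1::'k) \<in> set zs" using zs(1) by (simp add: unity_def)
    then obtain i where i: "i < ?L" "zs ! i = 1" by (auto simp: in_set_conv_nth)
    then have "v $ i \<noteq> 0" by (simp add: v_def)
    then show "v \<noteq> 0\<^sub>v (dim_row ?A)" using i(1) by (auto simp: A_def)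
    show "?A *\<^sub>v v = r \<cdot>\<^sub>v v"
    proof (intro eq_vecI)
      fix i assume "i < dim_vec (r \<cdot>\<^sub>v v)"
      then have i: "i < ?L" by (simp add: v_def)
      then have "zs ! i \<in> unity N" unfolding zs(1)[symmetric] by simp
      have "(?A *\<^sub>v v) $ i = (\<Sum>j<?L. of_int (c (zs ! i) (zs ! j)) * zs ! j)"
        using i by (simp add: A_def v_def scalar_prod_def atLeast0LessThan)
      also have "\<dots> = r * zs ! i" unfolding c[OF \<open>zs ! i \<in> unity N\<close>] s ..
      finally show "(?A *\<^sub>v v) $ i = (r \<cdot>\<^sub>v v) $ i" using i by (simp add: v_def)
    qed (simp add: A_def v_def)
  qed
  then have "eigenvalue ?A r" by (auto simp: eigenvalue_def)
  then have "poly (char_poly ?A) r = 0" using eigenvalue_root_char_poly[OF Ac(2)] by simp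
  then have "poly (map_poly of_int (char_poly A)) r = 0" by (simp only: of_int_hom.char_poly_hom[OF Ac(1)])
  moreover have "lead_coeff (char_poly A) = 1" using degree_monic_char_poly[OF Ac(1)] by simp
  ultimately show ?thesis unfolding algebraic_int_altdef_ipoly by (intro exI[of _ "char_poly A"] conjI)
qed

lemma prime_not_unit_rint:
  assumes "prime (p::nat)" "N > 0" "h \<in> rint N"
  shows "of_nat p * h \<noteq> (1 :: 'k::{alg_closed_field, field_char_0})"
proof
  assume *: "of_nat p * h = 1"
  have p: "p \<ge> 2" using assms(1) by (simp add: prime_ge_2_nat)
  then have h: "h = inverse (of_nat p)" using * by (metis inverse_unique)
  then have "h \<in> \<int>" using rational_algebraic_int_is_int[OF rint_algebraic_int[OF assms(3,2)]] by simp
  then obtain k where "h = of_int k" by (auto elim: Ints_cases)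
  then have "of_int (int p * k) = (1 :: 'k)" using * by simp
  then have "int p * k = 1" by (simp only: of_int_eq_1_iff)
  then show False using p by (auto simp: zmult_eq_1_iff)
qed

text \<open>The middle binomial coefficients are divisible by \<open>p\<close>, and the quotient of
  the middle terms stays in \<open>rint N\<close>.\<close>

lemma rint_frobenius:
  assumes p: "prime p" and ab: "a \<in> rint N" "b \<in> rint N"
  shows "\<exists>h\<in>rint N. (a + b) ^ p = a ^ p + b ^ p + of_nat p * (h :: 'k::field)"
proof -
  have p0: "p \<ge> 2" using p by (simp add: prime_ge_2_nat)
  have "(a + b) ^ p = (\<Sum>k\<le>p. of_nat (p choose k) * a ^ k * b ^ (p - k))" by (rule binomial_ring)
  also have "{..p} = insert 0 (insert p {1..<p})" using p0 by auto
  also have "(\<Sum>k\<in>insert 0 (insert p {1..<p}). of_nat (p choose k) * a ^ k * b ^ (p - k)) =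
      a ^ p + b ^ p + (\<Sum>k=1..<p. of_nat (p choose k) * a ^ k * b ^ (p - k))"
    using p0 by (simp add: add.assoc add.left_commute)
  also have "(\<Sum>k=1..<p. of_nat (p choose k) * a ^ k * b ^ (p - k)) =
      of_nat p * (\<Sum>k=1..<p. of_nat ((p choose k) div p) * a ^ k * b ^ (p - k))"
    unfolding sum_distrib_left
  proof (intro sum.cong refl)
    fix k assume "k \<in> {1..<p}"
    then have "p dvd p choose k" using p by (intro dvd_choose_prime) auto
    then have "of_nat (p choose k) = (of_nat p * of_nat ((p choose k) div p) :: 'k)" by (simp flip: of_nat_mult)
    then show "of_nat (p choose k) * a ^ k * b ^ (p - k) = of_nat p * (of_nat ((p choose k) div p) * a ^ k * b ^ (p - k))"
      by (simp add: mult.assoc)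
  qed
  finally show ?thesis using ab by (intro bexI[of _ "\<Sum>k=1..<p. of_nat ((p choose k) div p) * a ^ k * b ^ (p - k)"])
      (auto intro!: rint_sum rint_closed rint_const)
qed

text \<open>For a single root the \<open>p\<close>-th power is exactly the value at exponent
  \<open>m * p\<close>; additivity of the \<open>p\<close>-th power modulo \<open>p\<close> extends
  this to differences.\<close>

lemma rsum_frobenius:
  assumes p: "prime p" and F: "rsum N F"
  shows "\<exists>h\<in>rint N. F m ^ p = F (m * p) + of_nat p * (h :: 'k::field)"
  using F
proof induction
  case (root z)
  show ?case by (intro bexI[of _ 0]) (simp_all add: power_mult rint_const)
next
  case (diff F E)
  then obtain a b where ab: "a \<in> rint N" "b \<in> rint N" "F m ^ p = F (m * p) + of_nat p * a" "E m ^ p = E (m * p) + of_nat p * b" by blast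
  \<comment> \<open>Additivity is applied to \<open>F m = (F m - E m) + E m\<close>, which avoids
    powers of negatives and so treats \<open>p = 2\<close> like the other primes.\<close>
  obtain h where h: "h \<in> rint N" "F m ^ p = (F m - E m) ^ p + E m ^ p + of_nat p * h"
    using rint_frobenius[OF p rint_closed(1)[OF rsum_rint[OF diff(1)] rsum_rint[OF diff(2)]] rsum_rint[OF diff(2)], of m m m] by auto
  show ?case
    using ab h by (intro bexI[of _ "a - b - h"]) (auto intro: rint_closed simp: algebra_simps)
qed

text \<open>The difference of the two values lies in \<open>{-1, 0, 1}\<close> and is
  \<open>p\<close> times an element of \<open>rint N\<close>, which excludes 1 and -1.\<close>

lemma rsum_idempotent_eq:
  assumes p: "prime p" and N: "N > 0" and F: "rsum N F"
    and 01: "F m \<in> {0, 1}" "F (m * p) \<in> {0, 1 :: 'k::{alg_closed_field, field_char_0}}"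
  shows "F m = F (m * p)"
proof -
  obtain h where h: "h \<in> rint N" "F m ^ p = F (m * p) + of_nat p * h" using rsum_frobenius[OF p F] by blast
  have "F m ^ p = F m" using 01(1) prime_gt_0_nat[OF p] by (auto simp: power_0_left)
  then have "F m - F (m * p) = of_nat p * h" using h(2) by (simp add: algebra_simps)
  moreover have "of_nat p * h \<noteq> 1" "of_nat p * (- h) \<noteq> 1"
    using h(1) by (auto intro!: prime_not_unit_rint[OF p N] rint_closed simp del: mult_minus_right)
  ultimately have "F m - F (m * p) \<noteq> 1" "F m - F (m * p) \<noteq> - 1" by (auto simp: minus_equation_iff)
  then show ?thesis using 01 by auto
qed

text \<open>Prime factors of \<open>k\<close> are removed one at a time. All exponents on the way
  divide \<open>k\<close>, and only there are the values known to be 0 or 1.\<close>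

lemma rsum_idempotent_eq_coprime:
  assumes N: "N > 0" and F: "rsum N F" and k: "k > 0"
    and 01: "\<And>j. 0 < j \<Longrightarrow> j dvd k \<Longrightarrow> F j \<in> {0, 1 :: 'k::{alg_closed_field, field_char_0}}"
  shows "F k = F 1"
  using k 01
proof (induction k rule: less_induct)
  case (less k)
  show ?case
  proof (cases "k = 1")
    case False
    then obtain p where p: "prime p" "p dvd k" using prime_factor_nat by blast
    then obtain j where j: "k = j * p" by (auto elim: dvdE simp: mult.commute)
    have j0: "0 < j" "j < k" using less.prems(1) prime_gt_1_nat[OF p(1)] by (auto simp: j)
    have "F j = F (j * p)"
      using less.prems j0 by (intro rsum_idempotent_eq[OF p(1) N F]) (auto simp: j)
    moreover have "F j = F 1" using less.prems j0 by (intro less.IH) (auto simp: j)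
    ultimately show ?thesis by (simp add: j)
  qed simp
qed

text \<open>Values on the way need not be 0 or 1, so only a congruence modulo \<open>p\<close> is
  carried along. It survives \<open>p\<close>-th powers because \<open>u - v\<close> divides
  \<open>u^p - v^p\<close>, and \<open>F m\<close> is its own \<open>p\<close>-th power.\<close>

lemma rsum_idempotent_prime_power:
  assumes p: "prime p" and F: "rsum N F" and 01: "F m \<in> {0, 1 :: 'k::field}"
  shows "\<exists>h\<in>rint N. F m = F (m * p ^ f) + of_nat p * h"
proof (induction f)
  case 0
  show ?case by (intro bexI[of _ 0]) (simp_all add: rint_const)
next
  case (Suc f)
  then obtain h where h: "h \<in> rint N" "F m = F (m * p ^ f) + of_nat p * h" by blast
  obtain h' where h': "h' \<in> rint N" "F (m * p ^ f) ^ p = F (m * p ^ f * p) + of_nat p * h'" using rsum_frobenius[OF p F] by blast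
  let ?a = "F (m * p ^ f)" and ?s = "\<Sum>i<p. F (m * p ^ f) ^ (p - Suc i) * F m ^ i"
  have s: "?s \<in> rint N" by (intro rint_sum rint_closed rsum_rint F)
  have "F m = F m ^ p" using 01 prime_gt_0_nat[OF p] by (auto simp: power_0_left)
  also have "\<dots> = ?a ^ p + (F m - ?a) * ?s" using power_diff_sumr2[of "F m" p ?a] by (simp add: algebra_simps)
  also have "\<dots> = F (m * p ^ f * p) + of_nat p * (h' + h * ?s)" using h(2) h'(2) by (simp add: algebra_simps)
  finally show ?case using s h h' by (intro bexI[of _ "h' + h * ?s"]) (auto intro: rint_closed simp: ac_simps)
qed


subsection \<open>The decomposition modulo induced modules\<close>

text \<open>For \<open>a = t * z\<close>, \<open>b = t / z\<close> the product
  \<open>(a - b) * bl a b i\<close> is \<open>t^i * (z^i - z^(-i))\<close>. Clearing denominators by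
  \<open>z^n\<close> gives a polynomial of degree below \<open>2 * n\<close> that vanishes at all
  \<open>z\<close> with \<open>z^(2 * n) = 1\<close>, the values 1 and -1 being automatic. So it is
  zero, and its coefficient at \<open>n + l\<close> isolates \<open>m l\<close>.\<close>

lemma trig_vanish:
  fixes t :: "'k::{alg_closed_field, field_char_0}"
  assumes n: "n > 0" and t: "t \<noteq> 0" and l: "l \<in> {1..<n}"
    and v: "\<And>z. z ^ (2 * n) = 1 \<Longrightarrow> z\<^sup>2 \<noteq> 1 \<Longrightarrow> (\<Sum>i=1..<n. m i * bl (t * z) (t / z) i) = 0"
  shows "m l = 0"
proof -
  define P where "P = (\<Sum>i=1..<n. Polynomial.monom (m i * t ^ i) (n + i) - Polynomial.monom (m i * t ^ i) (n - i))"
  have root: "poly P z = 0" if z: "z ^ (2 * n) = 1" for z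
  proof -
    have z0: "z \<noteq> 0" using z n by (auto simp: power_0_left)
    have "poly P z = (\<Sum>i=1..<n. m i * t ^ i * (z ^ (n + i) - z ^ (n - i)))"
      by (simp add: P_def poly_sum poly_monom algebra_simps)
    also have "\<dots> = (\<Sum>i=1..<n. z ^ n * (t * z - t / z) * (m i * bl (t * z) (t / z) i))"
    proof (intro sum.cong refl)
      fix i assume i: "i \<in> {1..<n}"
      have "z ^ (n - i) = z ^ n / z ^ i" using i z0 by (simp add: power_diff)
      then have "t ^ i * (z ^ (n + i) - z ^ (n - i)) = z ^ n * ((t * z) ^ i - (t / z) ^ i)"
        by (simp add: power_add power_mult_distrib power_divide algebra_simps)
      then have "m i * (t ^ i * (z ^ (n + i) - z ^ (n - i))) = m i * (z ^ n * ((t * z - t / z) * bl (t * z) (t / z) i))"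
        by (simp only: bl_mult)
      then show "m i * t ^ i * (z ^ (n + i) - z ^ (n - i)) = z ^ n * (t * z - t / z) * (m i * bl (t * z) (t / z) i)"
        by (simp only: ac_simps)
    qed
    also have "\<dots> = z ^ n * (t * z - t / z) * (\<Sum>i=1..<n. m i * bl (t * z) (t / z) i)"
      by (simp only: sum_distrib_left)
    also have "\<dots> = 0"
    proof (cases "z\<^sup>2 = 1")
      case True
      then have "t * z - t / z = 0" using z0 by (simp add: field_simps power2_eq_square)
      then show ?thesis by simp
    next
      case False
      then show ?thesis using v[OF z] by simp
    qed
    finally show ?thesis .
  qed
  have deg: "degree P \<le> 2 * n - 1"
    unfolding P_def by (intro degree_sum_le degree_diff_le order.trans[OF degree_monom_le]) auto
  have "P = 0"
  proof (rule ccontr)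
    assume P: "P \<noteq> 0"
    have "2 * n = card (unity (2 * n) :: 'k set)" using n by (simp add: card_unity)
    also have "\<dots> \<le> card {z. poly P z = 0}"
      using root poly_roots_finite[OF P] by (intro card_mono) (auto simp: unity_def)
    also have "\<dots> \<le> 2 * n - 1" using card_poly_roots_bound[OF P] deg by simp
    finally show False using n by simp
  qed
  moreover have "Polynomial.coeff P (n + l) = (\<Sum>i=1..<n. if i = l then m l * t ^ l else 0)"
    unfolding P_def Polynomial.coeff_sum by (intro sum.cong) (use l in auto)
  ultimately have "m l * t ^ l = 0" using l by simp
  then show ?thesis using t by simp
qed

context green_datum
begin

text \<open>When \<open>y\<close> acts by 0, the relation for \<open>y^n\<close> says that
  \<open>g^n\<close> acts trivially.\<close>

lemma vmod_hmods_iff: "vmod V \<in> hmods \<longleftrightarrow> gmod G (fst V) (snd V) \<and> snd V (g [^] n) = 1\<^sub>m (fst V)"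
proof
  assume M: "vmod V \<in> hmods"
  obtain d X where V: "V = (d, X)" by (cases V)
  note D = hmodsD[OF M[unfolded V vmod.simps]]
  have X: "X (g [^] n) \<in> carrier_mat d d" using gmodD(1)[OF D(1) carrier_order(1)] .
  have "X (g [^] n) - 1\<^sub>m d = 0\<^sub>m d d" using D(6) n_ge_2 by (simp add: pow_mat_zero)
  then have "X (g [^] n) = 1\<^sub>m d"
    using X by (intro eq_matI) (auto simp: mat_eq_iff)
  then show "gmod G (fst V) (snd V) \<and> snd V (g [^] n) = 1\<^sub>m (fst V)" using D(1) V by simp
qed (cases V, use vmod_hmods in auto)

fun vsum :: "nat \<times> ('a \<Rightarrow> 'k mat) \<Rightarrow> nat \<times> ('a \<Rightarrow> 'k mat) \<Rightarrow> nat \<times> ('a \<Rightarrow> 'k mat)"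
  where "vsum (d, X) (e, X') = (d + e, \<lambda>h. four_block_mat (X h) (0\<^sub>m d e) (0\<^sub>m e d) (X' h))"

lemma vmod_vsum: "vmod (vsum V W) = hsum (vmod V) (vmod W)"
  by (cases V; cases W) (auto intro!: eq_matI simp: four_block_mat_def Let_def)

abbreviation "vzero \<equiv> (0 :: nat, \<lambda>_ :: 'a. 0\<^sub>m 0 0 :: 'k mat)"

lemma vmod_vzero: "vmod vzero \<in> hmods" "br (vmod vzero) = \<zero>\<^bsub>RR\<^esub>"
proof -
  interpret R: ring RR by (rule RR_ring)
  have o: "(1\<^sub>m 0 :: 'k mat) = 0\<^sub>m 0 0" by (intro eq_matI) auto
  show z: "vmod vzero \<in> hmods" unfolding vmod_hmods_iff gmod_def by (simp add: o)
  have "vsum vzero vzero = vzero" by (auto intro!: ext eq_matI)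
  \<comment> \<open>A class that equals its own double is zero.\<close>
  then have "br (vmod vzero) \<oplus>\<^bsub>RR\<^esub> br (vmod vzero) = br (vmod vzero)"
    using vmod_vsum[of vzero vzero] br_add[OF z z] by simp
  then show "br (vmod vzero) = \<zero>\<^bsub>RR\<^esub>" using br_closed[OF z] by (metis R.add.l_cancel_one)
qed

lemma vmod_br_eq:
  assumes V: "vmod V \<in> hmods" "vmod W \<in> hmods" and t: "\<And>x. x \<in> carrier G \<Longrightarrow> mtr (snd V x) = mtr (snd W x)"
  shows "br (vmod V) = br (vmod W)"
proof -
  obtain d X e X' where eq: "V = (d, X)" "W = (e, X')" by (metis surj_pair)
  have g: "gmod G d X" "gmod G e X'" using V[unfolded vmod_hmods_iff eq] by simp_all
  from gmod_iso_of_char_eq[OF g] t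
  have d: "d = e" and "\<exists>P Q. ghom d X e X' P \<and> ghom e X' d X Q \<and> P * Q = 1\<^sub>m e \<and> Q * P = 1\<^sub>m d"
    unfolding eq by auto
  then obtain P Q where P: "ghom d X e X' P" "ghom e X' d X Q" "P * Q = 1\<^sub>m e" "Q * P = 1\<^sub>m d" by blast
  note P1 = ghomD[OF P(1)] and P2 = ghomD[OF P(2)]
  have "hiso (vmod V) (vmod W)"
    unfolding eq d vmod.simps hiso.simps using P(3,4) P1 P2(1)
    by (intro conjI refl bexI[of _ P] bexI[of _ Q] ballI) (simp_all add: d)
  then show ?thesis by (rule br_hiso[OF V])
qed

definition bm :: "nat \<Rightarrow> ((nat \<times> 'a, 'k) rep set \<Rightarrow>\<^sub>0 int) set"
  where "bm l = br (mch l)"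

lemma bm_closed: "l \<le> n \<Longrightarrow> bm l \<in> carrier RR"
  unfolding bm_def by (intro br_closed mch_hmods)

text \<open>The class of a direct sum of chains shorter than \<open>n\<close> with first layers
  \<open>V l\<close>, written with products so that it depends only on the classes of the
  \<open>V l\<close>.\<close>

definition layers :: "(nat \<Rightarrow> nat \<times> ('a \<Rightarrow> 'k mat)) \<Rightarrow> ((nat \<times> 'a, 'k) rep set \<Rightarrow>\<^sub>0 int) set"
  where "layers V = finsum RR (\<lambda>l. br (vmod (V l)) \<otimes>\<^bsub>RR\<^esub> bm l) {1..<n}"

lemma layer_term: "vmod (V l) \<in> hmods \<Longrightarrow> l \<in> {1..<n} \<Longrightarrow> br (vmod (V l)) \<otimes>\<^bsub>RR\<^esub> bm l \<in> carrier RR"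
  using ring.ring_simprules(5)[OF RR_ring br_closed bm_closed] by simp

lemma layers_closed: "(\<And>l. vmod (V l) \<in> hmods) \<Longrightarrow> layers V \<in> carrier RR"
proof -
  interpret R: ring RR by (rule RR_ring)
  assume "\<And>l. vmod (V l) \<in> hmods"
  then show ?thesis unfolding layers_def by (intro R.finsum_closed funcsetI layer_term)
qed

lemma layers_vsum:
  assumes V: "\<And>l. vmod (V l) \<in> hmods" and W: "\<And>l. vmod (W l) \<in> hmods"
  shows "layers (\<lambda>l. vsum (V l) (W l)) = layers V \<oplus>\<^bsub>RR\<^esub> layers W"
proof -
  interpret R: ring RR by (rule RR_ring)
  have t: "br (vmod (vsum (V l) (W l))) \<otimes>\<^bsub>RR\<^esub> bm l =
      (br (vmod (V l)) \<otimes>\<^bsub>RR\<^esub> bm l) \<oplus>\<^bsub>RR\<^esub> (br (vmod (W l)) \<otimes>\<^bsub>RR\<^esub> bm l)" if "l \<in> {1..<n}" for l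
    unfolding vmod_vsum br_add[OF V W] using that by (intro R.l_distr br_closed V W bm_closed) auto
  have "layers (\<lambda>l. vsum (V l) (W l)) =
      finsum RR (\<lambda>l. (br (vmod (V l)) \<otimes>\<^bsub>RR\<^esub> bm l) \<oplus>\<^bsub>RR\<^esub> (br (vmod (W l)) \<otimes>\<^bsub>RR\<^esub> bm l)) {1..<n}"
    unfolding layers_def by (rule R.finsum_cong') (auto simp: t simp del: vmod.simps intro!: R.a_closed layer_term V W)
  also have "\<dots> = layers V \<oplus>\<^bsub>RR\<^esub> layers W"
    unfolding layers_def by (rule R.finsum_addf) (auto simp del: vmod.simps intro!: layer_term V W)
  finally show ?thesis .
qed

lemma layers_single:
  assumes V: "vmod V \<in> hmods" and l: "l \<in> {1..<n}"
  shows "layers (\<lambda>i. if i = l then V else vzero) = br (vmod V) \<otimes>\<^bsub>RR\<^esub> bm l"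
proof -
  interpret R: ring RR by (rule RR_ring)
  have m: "i \<in> {1..<n} \<Longrightarrow> bm i \<in> carrier RR" for i by (rule bm_closed) auto
  have "layers (\<lambda>i. if i = l then V else vzero) =
      finsum RR (\<lambda>i. if l = i then br (vmod V) \<otimes>\<^bsub>RR\<^esub> bm i else \<zero>\<^bsub>RR\<^esub>) {1..<n}"
    unfolding layers_def
    by (rule R.finsum_cong') (auto simp: vmod_vzero(2) simp del: vmod.simps chain.simps intro!: R.m_closed br_closed[OF V] m R.l_null)
  also have "\<dots> = br (vmod V) \<otimes>\<^bsub>RR\<^esub> bm l"
    using l by (intro R.finsum_singleton) (auto simp del: vmod.simps chain.simps intro!: R.m_closed br_closed[OF V] m)
  finally show ?thesis .
qed

lemma layers_zero: "layers (\<lambda>_. vzero) = \<zero>\<^bsub>RR\<^esub>"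
proof -
  interpret R: ring RR by (rule RR_ring)
  have m: "i \<in> {1..<n} \<Longrightarrow> bm i \<in> carrier RR" for i by (rule bm_closed) auto
  have "layers (\<lambda>_. vzero) = finsum RR (\<lambda>_. \<zero>\<^bsub>RR\<^esub>) {1..<n}"
    unfolding layers_def
    by (rule R.finsum_cong') (auto simp: vmod_vzero(2) simp del: vmod.simps chain.simps intro!: m R.l_null)
  then show ?thesis by simp
qed

text \<open>\<open>K\<close> is any additive set containing the induced classes; of the induced part
  only membership in \<open>K\<close> will matter. This part is invisible to \<open>nu\<close> and
  its dimension is a multiple of \<open>n\<close>, whence the congruence for the remaining
  dimension.\<close>

lemma layered_decomposition:
  assumes K: "\<zero>\<^bsub>RR\<^esub> \<in> K" "\<And>x y. x \<in> K \<Longrightarrow> y \<in> K \<Longrightarrow> x \<oplus>\<^bsub>RR\<^esub> y \<in> K"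
    "\<And>r U. gmod G r U \<Longrightarrow> br (Ind (r, U)) \<in> K" "K \<subseteq> carrier RR"
    and M: "M \<in> hmods"
  shows "\<exists>V. \<exists>k\<in>K. (\<forall>l. vmod (V l) \<in> hmods) \<and> br M = layers V \<oplus>\<^bsub>RR\<^esub> k \<and>
    (\<forall>x\<in>carrier G. \<forall>l\<in>{1..<n}. nu x l M = mtr (snd (V l) x)) \<and>
    fst M mod n = (\<Sum>l=1..<n. l * fst (V l)) mod n"
  using M
proof (induction rule: hmods_induct)
  case (iso M N)
  then have "fst M = fst N" by (cases M; cases N) auto
  with iso(4) show ?case using br_hiso[OF iso(1-3)] nu_hiso[OF iso(1-3)] by simp
next
  case (sum M N)
  interpret R: ring RR by (rule RR_ring)
  obtain V k where V: "\<And>l. vmod (V l) \<in> hmods" and k: "k \<in> K" "br M = layers V \<oplus>\<^bsub>RR\<^esub> k"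
    "\<And>x l. x \<in> carrier G \<Longrightarrow> l \<in> {1..<n} \<Longrightarrow> nu x l M = mtr (snd (V l) x)" "fst M mod n = (\<Sum>l=1..<n. l * fst (V l)) mod n"
    using sum(3) by blast
  obtain W k' where W: "\<And>l. vmod (W l) \<in> hmods" and k': "k' \<in> K" "br N = layers W \<oplus>\<^bsub>RR\<^esub> k'"
    "\<And>x l. x \<in> carrier G \<Longrightarrow> l \<in> {1..<n} \<Longrightarrow> nu x l N = mtr (snd (W l) x)" "fst N mod n = (\<Sum>l=1..<n. l * fst (W l)) mod n"
    using sum(4) by blast
  have kc: "k \<in> carrier RR" "k' \<in> carrier RR" using k(1) k'(1) K(4) by auto
  have f: "fst (hsum M N) = fst M + fst N" by (cases M; cases N) auto
  have fv: "fst (vsum (V l) (W l)) = fst (V l) + fst (W l)" for l by (cases "V l"; cases "W l") auto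
  have tv: "mtr (snd (vsum (V l) (W l)) x) = mtr (snd (V l) x) + mtr (snd (W l) x)" if "x \<in> carrier G" for l x
  proof -
    have "gmod G (fst (V l)) (snd (V l))" "gmod G (fst (W l)) (snd (W l))" using V[of l] W[of l] vmod_hmods_iff by auto
    from gmodD(1)[OF this(1) that] gmodD(1)[OF this(2) that] show ?thesis
      by (cases "V l"; cases "W l") (auto intro: mtr_four_block)
  qed
  show ?case
  proof (intro exI[of _ "\<lambda>l. vsum (V l) (W l)"] bexI[of _ "k \<oplus>\<^bsub>RR\<^esub> k'"] conjI allI ballI)
    show "vmod (vsum (V l) (W l)) \<in> hmods" for l unfolding vmod_vsum by (rule hsum_hmods[OF V W])
    show "br (hsum M N) = layers (\<lambda>l. vsum (V l) (W l)) \<oplus>\<^bsub>RR\<^esub> (k \<oplus>\<^bsub>RR\<^esub> k')"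
      unfolding br_add[OF sum(1,2)] k(2) k'(2) layers_vsum[OF V W]
      using layers_closed[OF V] layers_closed[OF W] kc by (simp add: R.a_ac)
    show "fst (hsum M N) mod n = (\<Sum>l=1..<n. l * fst (vsum (V l) (W l))) mod n"
      unfolding f fv using k(4) k'(4) by (simp only: distrib_left sum.distrib) (metis mod_add_eq)
  qed (auto intro: K(2) k(1) k'(1) simp: nu_hsum[OF sum(1,2)] k(3) k'(3) tv simp del: vsum.simps)
next
  case (chain l r U)
  interpret R: ring RR by (rule RR_ring)
  have l: "l \<in> {1..<n}" "l \<le> n" using chain by auto
  have V: "vmod (r, U) \<in> hmods" by (rule vmod_hmods[OF chain(3,4)])
  have b: "br (chain l (r, U)) = br (vmod (r, U)) \<otimes>\<^bsub>RR\<^esub> bm l"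
    unfolding chain_eq_tens[of l r U] bm_def by (rule br_mult[symmetric, OF V mch_hmods[OF l(2)]])
  let ?V = "\<lambda>i. if i = l then (r, U) else vzero"
  have Vh: "vmod (?V i) \<in> hmods" for i using V vmod_vzero(1) by (auto simp del: vmod.simps)
  show ?case
  proof (intro exI[of _ ?V] bexI[of _ "\<zero>\<^bsub>RR\<^esub>"] conjI allI ballI)
    show "br (chain l (r, U)) = layers ?V \<oplus>\<^bsub>RR\<^esub> \<zero>\<^bsub>RR\<^esub>"
      unfolding layers_single[OF V l(1)] b[symmetric] using br_closed[OF chain_hmods[OF chain(3,4) l(2)]] by simp
    fix x i assume x: "x \<in> carrier G" and i: "i \<in> {1..<n}"
    show "nu x i (chain l (r, U)) = mtr (snd (?V i) x)"
      using nu_chain[OF chain(3,4) l(2) x, of i] i by (auto simp del: chain.simps)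
  next
    have "(\<Sum>i=1..<n. i * fst (?V i)) = (\<Sum>i=1..<n. if i = l then l * r else 0)" by (intro sum.cong) auto
    then have "(\<Sum>i=1..<n. i * fst (?V i)) = l * r" using l by simp
    then show "fst (chain l (r, U)) mod n = (\<Sum>i=1..<n. i * fst (?V i)) mod n" by (simp only: chain.simps fst_conv mult.commute)
  qed (use Vh K(1) in auto)
next
  case (Ind r U)
  interpret R: ring RR by (rule RR_ring)
  have "br (Ind (r, U)) \<in> carrier RR" by (rule br_closed[OF Ind_hmods[OF Ind]])
  then show ?case
    using K(3)[OF Ind] vmod_vzero(1)
    by (intro exI[of _ "\<lambda>_. vzero"] bexI[of _ "br (Ind (r, U))"] conjI allI ballI)
      (auto simp: layers_zero nu_Ind[OF Ind] simp del: Ind.simps vmod.simps, auto)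
qed

lemma Ind_hiso:
  assumes P: "ghom d X e X' P" "ghom e X' d X Q" "P * Q = 1\<^sub>m e" "Q * P = 1\<^sub>m d" "d = e"
    and X: "gmod G d X" "gmod G e X'"
  shows "hiso (Ind (d, X)) (Ind (e, X'))"
proof -
  note P1 = ghomD[OF P(1)] and P2 = ghomD[OF P(2)]
  note [simp] = P1(2,3) P2(2,3) gmodD(4,5)[OF X(1)] gmodD(4,5)[OF X(2)] P(3,4) carrier_order(1)
  let ?P = "kronecker P (1\<^sub>m n)" and ?Q = "kronecker Q (1\<^sub>m n)"
  have "?P * yind d X = yind e X' * ?P"
    using P1(4)[OF carrier_order(1)] P(5)
    by (simp add: yind_def mat_left_distrib mat_right_distrib kron_mult mat_left_diff_distrib mat_right_diff_distrib)
  moreover have "?P * kronecker (X h) (dg (inverse (\<chi> h)) n) = kronecker (X' h) (dg (inverse (\<chi> h)) n) * ?P" if "h \<in> carrier G" for h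
    using that P1(4)[OF that] P(5) by (simp add: kron_mult)
  moreover have "?P * ?Q = 1\<^sub>m (d * n)" "?Q * ?P = 1\<^sub>m (d * n)" "?P \<in> carrier_mat (d * n) (d * n)" "?Q \<in> carrier_mat (d * n) (d * n)"
    using P(5) by (auto simp: kron_mult intro!: carrier_matI)
  ultimately show ?thesis
    unfolding Ind.simps hiso.simps using P(5) by (intro conjI bexI[of _ ?P] bexI[of _ ?Q] ballI) simp_all
qed

end


subsection \<open>Idempotents\<close>

context green_datum
begin

fun gtr :: "'a \<Rightarrow> ('a, 'k) hmod \<Rightarrow> 'k" where "gtr x (d, X, Y) = mtr (X x)"

lemma gtr_hsum:
  assumes "M \<in> hmods" "N \<in> hmods" "x \<in> carrier G"
  shows "gtr x (hsum M N) = gtr x M + gtr x N"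
proof -
  obtain d X Y e X' Y' where eq: "M = (d, X, Y)" "N = (e, X', Y')" by (metis surj_pair)
  note X = hmodsD(1)[OF assms(1)[unfolded eq]] hmodsD(1)[OF assms(2)[unfolded eq]]
  show ?thesis using gmodD(1)[OF X(1) assms(3)] gmodD(1)[OF X(2) assms(3)] by (simp add: eq mtr_four_block)
qed

lemma gtr_hiso:
  assumes "M \<in> hmods" "N \<in> hmods" "hiso M N" "x \<in> carrier G"
  shows "gtr x M = gtr x N"
proof -
  obtain d X Y where eq: "M = (d, X, Y)" by (metis surj_pair)
  obtain X' Y' where eq': "N = (d, X', Y')" using assms(3) eq by (cases N) auto
  obtain P R where P: "P \<in> carrier_mat d d" "R \<in> carrier_mat d d" "P * R = 1\<^sub>m d" "R * P = 1\<^sub>m d"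
    "\<And>h. h \<in> carrier G \<Longrightarrow> P * X h = X' h * P" using assms(3) by (auto simp: eq eq')
  note [simp] = carrier_matD[OF P(1)] carrier_matD[OF P(2)] gmodD(4,5)[OF hmodsD(1)[OF assms(1)[unfolded eq]] assms(4)]
    gmodD(4,5)[OF hmodsD(1)[OF assms(2)[unfolded eq']] assms(4)]
  have "mtr (X' x) = mtr (X' x * P * R)" by (simp add: mat_assoc P(3))
  also have "\<dots> = mtr (P * (X x * R))" unfolding P(5)[OF assms(4), symmetric] by (simp add: mat_assoc)
  also have "\<dots> = mtr (X x * R * P)" by (rule mtr_comm) auto
  also have "\<dots> = mtr (X x)" by (simp add: mat_assoc P(4))
  finally show ?thesis by (simp add: eq eq')
qed

lemma gtr_htens:
  assumes "M \<in> hmods" "N \<in> hmods" "x \<in> carrier G"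
  shows "gtr x (htens M N) = gtr x M * gtr x N"
proof -
  obtain d X Y e X' Y' where eq: "M = (d, X, Y)" "N = (e, X', Y')" by (metis surj_pair)
  note X = hmodsD(1)[OF assms(1)[unfolded eq]] hmodsD(1)[OF assms(2)[unfolded eq]]
  show ?thesis using gmodD(4,5)[OF X(1) assms(3)] gmodD(4,5)[OF X(2) assms(3)] by (simp add: eq mtr_kron)
qed

lemma gmod_pow:
  assumes "gmod G d X" "x \<in> carrier G"
  shows "X (x [^] (m::nat)) = X x ^\<^sub>m m"
  using assms gmodD(1)[OF assms] by (induction m) (auto simp: gmodD(2,3))

text \<open>The eigenvalues of \<open>x\<close> are \<open>N\<close>-th roots of unity, and the
  trace of \<open>x^m\<close> is their \<open>m\<close>-th power sum.\<close>

lemma gmod_rsum: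
  fixes X :: "'a \<Rightarrow> 'k mat"
  assumes X: "gmod G d X" "x \<in> carrier G" and N: "card (carrier G) dvd N" "N > 0"
  shows "rsum N (\<lambda>m. mtr (X (x [^] m)))"
proof -
  obtain k where k: "N = card (carrier G) * k" using N(1) by auto
  have "x [^] N = (x [^] card (carrier G)) [^] k" unfolding k by (rule nat_pow_pow[symmetric, OF X(2)])
  also have "\<dots> = \<one>" using pow_order_eq_1[OF X(2)] by (simp add: Coset.order_def)
  finally have "X x ^\<^sub>m N = 1\<^sub>m d" unfolding gmod_pow[OF X, symmetric] using gmodD(2)[OF X(1)] by simp
  from root_trace[OF gmodD(1)[OF X] this N(2)]
  obtain r :: "'k \<Rightarrow> nat" where r: "\<And>j. mtr (X x ^\<^sub>m j) = (\<Sum>z\<in>unity N. of_nat (r z) * z ^ j)" by blast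
  show ?thesis unfolding gmod_pow[OF X] r
    by (intro rsum_sum rsum_mult rsum_of_nat rsum.root) (auto simp: unity_def)
qed

text \<open>\<open>e^2 = e\<close> is rewritten without subtraction, so that both sides are classes
  of actual modules and \<open>br_invariant\<close> applies. For \<open>t = f M - f N\<close> the
  outcome reads \<open>t * (t - 1) = 0\<close>.\<close>

lemma idempotent_invariant:
  fixes f :: "('a, 'k) hmod \<Rightarrow> 'k"
  assumes add: "\<And>M N. M \<in> hmods \<Longrightarrow> N \<in> hmods \<Longrightarrow> f (hsum M N) = f M + f N"
    and iso: "\<And>M N. M \<in> hmods \<Longrightarrow> N \<in> hmods \<Longrightarrow> hiso M N \<Longrightarrow> f M = f N"
    and mult: "\<And>M N. M \<in> hmods \<Longrightarrow> N \<in> hmods \<Longrightarrow> f (htens M N) = f M * f N"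
    and M: "M \<in> hmods" and N: "N \<in> hmods" and e: "e = br M \<ominus>\<^bsub>RR\<^esub> br N" "e \<otimes>\<^bsub>RR\<^esub> e = e"
  shows "f M - f N \<in> {0, 1}"
proof -
  interpret R: ring RR by (rule RR_ring)
  note c = br_closed[OF M] br_closed[OF N]
  have ec: "e \<in> carrier RR" unfolding e(1) using c by simp
  have m: "br M = e \<oplus>\<^bsub>RR\<^esub> br N" unfolding e(1) using c by (simp add: R.minus_eq R.a_assoc R.l_neg)
  have "br M \<otimes>\<^bsub>RR\<^esub> br M = e \<oplus>\<^bsub>RR\<^esub> e \<otimes>\<^bsub>RR\<^esub> br N \<oplus>\<^bsub>RR\<^esub> (br N \<otimes>\<^bsub>RR\<^esub> br M)"
    unfolding m using ec c by (simp add: R.l_distr R.r_distr e(2) R.a_ac)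
  moreover have "br M \<otimes>\<^bsub>RR\<^esub> br N = e \<otimes>\<^bsub>RR\<^esub> br N \<oplus>\<^bsub>RR\<^esub> (br N \<otimes>\<^bsub>RR\<^esub> br N)"
    unfolding m using ec c by (simp add: R.l_distr)
  ultimately have "br M \<otimes>\<^bsub>RR\<^esub> br M \<oplus>\<^bsub>RR\<^esub> br N \<otimes>\<^bsub>RR\<^esub> br N \<oplus>\<^bsub>RR\<^esub> br N =
      br M \<otimes>\<^bsub>RR\<^esub> br N \<oplus>\<^bsub>RR\<^esub> br N \<otimes>\<^bsub>RR\<^esub> br M \<oplus>\<^bsub>RR\<^esub> (e \<oplus>\<^bsub>RR\<^esub> br N)"
    using ec c by (simp add: R.a_ac)
  then have eq: "br (hsum (hsum (htens M M) (htens N N)) N) = br (hsum (hsum (htens M N) (htens N M)) M)"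
    using M N unfolding m[symmetric] by (simp add: br_add br_mult htens_hmods hsum_hmods)
  have "f (hsum (hsum (htens M M) (htens N N)) N) = f (hsum (hsum (htens M N) (htens N M)) M)"
    by (rule br_invariant[OF add iso _ _ eq]) (auto intro!: htens_hmods hsum_hmods M N)
  then have "f M * f M + f N * f N + f N = f M * f N + f N * f M + f M"
    using M N by (simp add: add mult htens_hmods hsum_hmods)
  then have "(f M - f N) * (f M - f N - 1) = 0" by (simp add: algebra_simps)
  then show ?thesis by auto
qed

text \<open>At the exponent \<open>card (carrier G)\<close> the element \<open>x\<close> becomes the
  identity and the traces are the equal dimensions. The values at all exponents are 0 or 1, so the
  difference at exponent 1 is 0 as well.\<close>

lemma idempotent_gtr_eq:
  assumes M: "M \<in> hmods" and N: "N \<in> hmods" and e: "e = br M \<ominus>\<^bsub>RR\<^esub> br N" "e \<otimes>\<^bsub>RR\<^esub> e = e"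
    and d: "fst M = fst N" and x: "x \<in> carrier G"
  shows "gtr x M = gtr x N"
proof -
  obtain d X Y X' Y' where eq: "M = (d, X, Y)" "N = (d, X', Y')" using d by (metis prod.collapse)
  note X = hmodsD(1)[OF M[unfolded eq]] hmodsD(1)[OF N[unfolded eq]]
  let ?N = "card (carrier G)" and ?F = "\<lambda>m::nat. mtr (X (x [^] m)) - mtr (X' (x [^] m))"
  have N0: "?N > 0" by (rule carrier_order(3))
  have r: "rsum ?N ?F" by (intro rsum.diff gmod_rsum[OF X(1)] gmod_rsum[OF X(2)] x N0 dvd_refl)
  have F01: "?F j \<in> {0, 1}" for j :: nat
  proof -
    have "gtr (x [^] j) M - gtr (x [^] j) N \<in> {0, 1}"
      by (rule idempotent_invariant[OF gtr_hsum gtr_hiso gtr_htens M N e]) (use x in simp_all)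
    then show ?thesis by (simp add: eq)
  qed
  have "?F ?N = ?F 1" by (rule rsum_idempotent_eq_coprime[OF N0 r N0 F01])
  moreover have "x [^] ?N = \<one>" using pow_order_eq_1[OF x] by (simp add: Coset.order_def)
  ultimately show ?thesis using x gmodD(2)[OF X(1)] gmodD(2)[OF X(2)] by (simp add: eq)
qed

text \<open>Let \<open>k\<close> be the order of \<open>a / b\<close> and \<open>p\<close> a prime factor of \<open>k\<close>. Raising \<open>x, a, b\<close> to powers prime to \<open>p\<close>
  keeps \<open>a \<noteq> b\<close>, so the value in \<open>{0, 1}\<close> does not change; the remaining \<open>p\<close>-power turns it modulo \<open>p\<close>
  into a difference of dimensions, which is divisible by \<open>n\<close> and hence by \<open>p\<close>.\<close>

lemma idempotent_phi_eq:
  assumes M: "M \<in> hmods" and N: "N \<in> hmods" and e: "e = br M \<ominus>\<^bsub>RR\<^esub> br N" "e \<otimes>\<^bsub>RR\<^esub> e = e"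
    and d: "fst M = fst N"
    and V: "\<And>l. vmod (V l) \<in> hmods" "\<And>y l. y \<in> carrier G \<Longrightarrow> l \<in> {1..<n} \<Longrightarrow> nu y l M = mtr (snd (V l) y)"
      "fst M mod n = (\<Sum>l=1..<n. l * fst (V l)) mod n"
    and W: "\<And>l. vmod (W l) \<in> hmods" "\<And>y l. y \<in> carrier G \<Longrightarrow> l \<in> {1..<n} \<Longrightarrow> nu y l N = mtr (snd (W l) y)"
      "fst N mod n = (\<Sum>l=1..<n. l * fst (W l)) mod n"
    and x: "x \<in> carrier G" and ab: "a \<noteq> b" "a ^ n = b ^ n" "a * b = inverse (\<chi> x)"
  shows "phi x a b M = phi x a b N"
proof -
  define F where "F = (\<lambda>m. phi (x [^] m) (a ^ m) (b ^ m) M - phi (x [^] m) (a ^ m) (b ^ m) N)"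
  have Fm: "F m = (\<Sum>l=1..<n. (mtr (snd (V l) (x [^] m)) - mtr (snd (W l) (x [^] m))) * bl (a ^ m) (b ^ m) l)" for m
    using x by (simp add: F_def phi_def V(2) W(2) left_diff_distrib sum_subtractf)
  \<comment> \<open>A common exponent for \<open>x\<close>, \<open>a\<close> and \<open>b\<close>:
    one has \<open>a^(2 * n) = a^n * b^n = \<chi>(x)^(-n) = 1\<close>, and the same for
    \<open>b\<close>.\<close>
  define N0 where "N0 = card (carrier G) * (2 * n)"
  have N0: "N0 > 0" "card (carrier G) dvd N0" using carrier_order(3) n_ge_2 by (auto simp: N0_def)
  have a2: "a ^ (2 * n) = 1"
  proof -
    have "a ^ (2 * n) = a ^ n * b ^ n" using ab(2) by (simp add: mult_2 power_add)
    also have "\<dots> = inverse (\<chi> x ^ n)" by (simp add: ab(3) power_inverse flip: power_mult_distrib)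
    finally show ?thesis using \<chi>_pow[OF x] by simp
  qed
  then have b2: "b ^ (2 * n) = 1" using ab(2) by (metis mult.commute power_mult)
  have aN: "a ^ N0 = 1" "b ^ N0 = 1" unfolding N0_def mult.commute[of "card (carrier G)"] by (simp_all only: power_mult[of _ "2 * n"] a2 b2 power_one)
  have gV: "gmod G (fst (V l)) (snd (V l))" "gmod G (fst (W l)) (snd (W l))" for l
    using V(1)[of l] W(1)[of l] vmod_hmods_iff by blast+
  have r: "rsum N0 F"
    unfolding Fm[abs_def] bl_def
    by (intro rsum_sum rsum_mult rsum.diff rsum_power gmod_rsum[OF gV(1) x] gmod_rsum[OF gV(2) x] N0 rsum.root aN)
  \<comment> \<open>Multiplicativity of \<open>phi\<close> is available only for two different
    numbers, so at exponents with \<open>a^m = b^m\<close> the value is not controlled.\<close>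
  have F01: "F m \<in> {0, 1}" if "a ^ m \<noteq> b ^ m" for m
  proof -
    have y: "x [^] m \<in> carrier G" using x by simp
    have "\<chi> (x [^] m) = \<chi> x ^ m" using x by (induction m) (simp_all add: \<chi>_one \<chi>_mult)
    then have "a ^ m * b ^ m = inverse (\<chi> (x [^] m))" by (simp add: ab(3) power_inverse flip: power_mult_distrib)
    moreover have "(a ^ m) ^ n = (b ^ m) ^ n" using ab(2) by (metis mult.commute power_mult)
    ultimately show ?thesis unfolding F_def
      using that y by (intro idempotent_invariant[of "phi (x [^] m) (a ^ m) (b ^ m)", OF _ _ _ M N e] phi_hsum phi_hiso phi_mult)
  qed
  define k where "k = (LEAST k. 0 < k \<and> a ^ k = b ^ k)"
  have k: "0 < k" "a ^ k = b ^ k" unfolding k_def using LeastI[of "\<lambda>k. 0 < k \<and> a ^ k = b ^ k" n] ab(2) n_ge_2 by auto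
  have b0: "b \<noteq> 0" using aN(2) N0(1) by (auto simp: power_0_left)
  have kd: "k dvd j" if "a ^ j = b ^ j" for j
  proof -
    have "a ^ j = (a ^ k) ^ (j div k) * a ^ (j mod k)" "b ^ j = (b ^ k) ^ (j div k) * b ^ (j mod k)"
      by (simp_all flip: power_mult power_add)
    then have "a ^ (j mod k) = b ^ (j mod k)" using that k(2) b0 by simp
    then have "\<not> 0 < j mod k" using not_less_Least[of "j mod k" "\<lambda>k. 0 < k \<and> a ^ k = b ^ k"] mod_less_divisor[OF k(1), of j]
      unfolding k_def[symmetric] by auto
    then show ?thesis by (simp add: dvd_eq_mod_eq_0)
  qed
  have "k \<noteq> 1" using k ab(1) by auto
  then obtain p where p: "prime p" "p dvd k" using prime_factor_nat by blast
  have pn: "p dvd n" using p(2) kd[OF ab(2)] by (rule dvd_trans)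
  obtain s where s: "N0 = p ^ multiplicity p N0 * s" "\<not> p dvd s"
    by (rule multiplicity_decompose'[of N0 p]) (use N0(1) p(1) in auto)
  have s0: "s > 0" using s(2) by (cases s) auto
  have Fj: "F j \<in> {0, 1}" if "j dvd s" for j
    using F01 kd that s(2) p(2) by (meson dvd_trans)
  have "F s = F 1" by (rule rsum_idempotent_eq_coprime[OF N0(1) r s0 Fj])
  moreover have "F s = 0"
  proof -
    obtain h where h: "h \<in> rint N0" "F s = F N0 + of_nat p * h"
      using rsum_idempotent_prime_power[OF p(1) r Fj[OF dvd_refl], of "multiplicity p N0"] s(1) by (metis mult.commute)
    let ?A = "\<Sum>l=1..<n. l * fst (V l)" and ?B = "\<Sum>l=1..<n. l * fst (W l)"
    have "x [^] N0 = (x [^] card (carrier G)) [^] (2 * n)" unfolding N0_def by (rule nat_pow_pow[symmetric, OF x])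
    then have xN: "x [^] N0 = \<one>" using pow_order_eq_1[OF x] by (simp add: Coset.order_def)
    \<comment> \<open>At exponent \<open>N0\<close> all arguments are 1 and
      \<open>bl 1 1 l = l\<close>, so \<open>F N0\<close> is the difference of the dimensions of the
      non-induced parts, which modulo \<open>n\<close> are the dimensions of \<open>M\<close> and
      \<open>N\<close>.\<close>
    have "bl 1 1 l = (of_nat l :: 'k)" for l by (simp add: bl_def)
    then have "F N0 = of_nat ?A - of_nat ?B"
      unfolding Fm aN xN using gmodD(2)[OF gV(1)] gmodD(2)[OF gV(2)]
      by (simp add: left_diff_distrib right_diff_distrib sum_subtractf mult.commute)
    also have "\<dots> = of_nat p * (of_nat (?A div p) - of_nat (?B div p))"
    proof -
      have "?A mod n = ?B mod n" using V(3) W(3) d by (simp only:)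
      then have "?A mod p = ?B mod p" using pn by (simp only: mod_mod_cancel[OF pn, symmetric, of ?A] mod_mod_cancel[OF pn, symmetric, of ?B])
      moreover have "of_nat ?A = (of_nat p * of_nat (?A div p) + of_nat (?A mod p) :: 'k)"
        "of_nat ?B = (of_nat p * of_nat (?B div p) + of_nat (?B mod p) :: 'k)"
        by (simp_all only: mult_div_mod_eq flip: of_nat_mult of_nat_add)
      ultimately show ?thesis by (simp only: right_diff_distrib) simp
    qed
    finally have "F s = of_nat p * (of_nat (?A div p) - of_nat (?B div p) + h)" using h(2) by (simp only: distrib_left)
    moreover have "of_nat (?A div p) - of_nat (?B div p) + h \<in> rint N0" by (intro rint_closed rint_const h(1))
    ultimately have "F s \<noteq> 1" using prime_not_unit_rint[OF p(1) N0(1)] by metis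
    then show ?thesis using Fj[OF dvd_refl] by simp
  qed
  ultimately show ?thesis using x by (simp add: F_def)
qed

lemma idempotent_zero:
  assumes M: "M \<in> hmods" and N: "N \<in> hmods" and e: "e = br M \<ominus>\<^bsub>RR\<^esub> br N" "e \<otimes>\<^bsub>RR\<^esub> e = e"
    and d: "fst M = fst N"
  shows "e = \<zero>\<^bsub>RR\<^esub>"
proof -
  interpret R: ring RR by (rule RR_ring)
  note c = br_closed[OF M] br_closed[OF N]
  have ec: "e \<in> carrier RR" unfolding e(1) using c by simp
  txt \<open>The annihilator of \<open>e\<close> contains all induced modules because \<open>M\<close> and \<open>N\<close> agree over \<open>G\<close>; it is
    shown to contain \<open>e\<close> itself.\<close>
  define K where "K = {z \<in> carrier RR. z \<otimes>\<^bsub>RR\<^esub> e = \<zero>\<^bsub>RR\<^esub>}"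
  have K0: "\<zero>\<^bsub>RR\<^esub> \<in> K" "K \<subseteq> carrier RR" using ec by (auto simp: K_def)
  have Ka: "y \<oplus>\<^bsub>RR\<^esub> z \<in> K" "y \<ominus>\<^bsub>RR\<^esub> z \<in> K" if "y \<in> K" "z \<in> K" for y z
    using that ec by (auto simp: K_def R.l_distr R.minus_eq R.l_minus)
  have KI: "br (Ind (r, U)) \<in> K" if U: "gmod G r U" for r U
  proof -
    obtain d X Y X' Y' where eq: "M = (d, X, Y)" "N = (d, X', Y')" using d by (metis prod.collapse)
    note X = hmodsD(1)[OF M[unfolded eq]] hmodsD(1)[OF N[unfolded eq]]
    note T = gmod_tensor[OF U X(1)] gmod_tensor[OF U X(2)]
    have "mtr (kronecker (U h) (X h)) = mtr (kronecker (U h) (X' h))" if h: "h \<in> carrier G" for h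
      using idempotent_gtr_eq[OF M N e d h] gmodD(4,5)[OF U h] gmodD(4,5)[OF X(1) h] gmodD(4,5)[OF X(2) h]
      by (simp add: eq mtr_kron)
    from gmod_iso_of_char_eq[OF T this]
    obtain P Q where PQ: "ghom (r * d) (\<lambda>h. kronecker (U h) (X h)) (r * d) (\<lambda>h. kronecker (U h) (X' h)) P"
      "ghom (r * d) (\<lambda>h. kronecker (U h) (X' h)) (r * d) (\<lambda>h. kronecker (U h) (X h)) Q"
      "P * Q = 1\<^sub>m (r * d)" "Q * P = 1\<^sub>m (r * d)" by blast
    note I = Ind_hmods[OF U] Ind_hmods[OF T(1)] Ind_hmods[OF T(2)]
    have "br (htens (Ind (r, U)) M) = br (Ind (r * d, \<lambda>h. kronecker (U h) (X h)))"
      unfolding eq by (rule br_hiso[symmetric, OF I(2) htens_hmods[OF I(1) M[unfolded eq]] Ind_tens_right[OF U M[unfolded eq]]])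
    also have "\<dots> = br (Ind (r * d, \<lambda>h. kronecker (U h) (X' h)))"
      by (rule br_hiso[OF I(2,3) Ind_hiso[OF PQ refl T]])
    also have "\<dots> = br (htens (Ind (r, U)) N)"
      unfolding eq by (rule br_hiso[OF I(3) htens_hmods[OF I(1) N[unfolded eq]] Ind_tens_right[OF U N[unfolded eq]]])
    finally have "br (Ind (r, U)) \<otimes>\<^bsub>RR\<^esub> br M = br (Ind (r, U)) \<otimes>\<^bsub>RR\<^esub> br N"
      by (simp only: br_mult[OF I(1) M] br_mult[OF I(1) N])
    moreover have ic: "br (Ind (r, U)) \<in> carrier RR" by (rule br_closed[OF I(1)])
    ultimately show ?thesis
      using c ec unfolding K_def e(1) by (simp del: Ind.simps add: R.minus_eq R.r_distr R.r_minus R.r_neg)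
  qed
  obtain V k where V: "\<And>l. vmod (V l) \<in> hmods" and k: "k \<in> K" "br M = layers V \<oplus>\<^bsub>RR\<^esub> k"
    "\<And>x l. x \<in> carrier G \<Longrightarrow> l \<in> {1..<n} \<Longrightarrow> nu x l M = mtr (snd (V l) x)" "fst M mod n = (\<Sum>l=1..<n. l * fst (V l)) mod n"
    using layered_decomposition[OF K0(1) Ka(1) KI K0(2) M] by blast
  obtain W k' where W: "\<And>l. vmod (W l) \<in> hmods" and k': "k' \<in> K" "br N = layers W \<oplus>\<^bsub>RR\<^esub> k'"
    "\<And>x l. x \<in> carrier G \<Longrightarrow> l \<in> {1..<n} \<Longrightarrow> nu x l N = mtr (snd (W l) x)" "fst N mod n = (\<Sum>l=1..<n. l * fst (W l)) mod n"
    using layered_decomposition[OF K0(1) Ka(1) KI K0(2) N] by blast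
  have tr: "mtr (snd (V l) x) = mtr (snd (W l) x)" if x: "x \<in> carrier G" and l: "l \<in> {1..<n}" for x l
  proof -
    have u0: "inverse (\<chi> x) \<noteq> 0" using \<chi>_nz[OF x] by simp
    \<comment> \<open>With a square root \<open>t\<close> the pairs \<open>t * z\<close> and
      \<open>t / z\<close> have the required product \<open>t^2\<close>, and
      \<open>z^(2 * n) = 1\<close> makes their \<open>n\<close>-th powers equal.\<close>
    obtain t where t: "t\<^sup>2 = inverse (\<chi> x)" using nth_root_exists[of 2 "inverse (\<chi> x)"] by auto
    then have t0: "t \<noteq> 0" using u0 by auto
    have "mtr (snd (V l) x) - mtr (snd (W l) x) = 0"
    proof (rule trig_vanish[of n t l "\<lambda>i. mtr (snd (V i) x) - mtr (snd (W i) x)", OF _ t0 l])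
      fix z :: 'k assume z: "z ^ (2 * n) = 1" "z\<^sup>2 \<noteq> 1"
      have z0: "z \<noteq> 0" using z(1) n_ge_2 by (auto simp: power_0_left)
      have "t * z \<noteq> t / z" using t0 z0 z(2) by (simp add: field_simps power2_eq_square)
      moreover have "(t * z) ^ n = (t / z) ^ n"
      proof -
        have "z ^ n * z ^ n = 1" using z(1) by (simp add: mult_2 power_add)
        from inverse_unique[OF this] show ?thesis by (simp add: divide_inverse power_mult_distrib power_inverse)
      qed
      moreover have "(t * z) * (t / z) = inverse (\<chi> x)" using z0 t by (simp add: power2_eq_square)
      ultimately have "phi x (t * z) (t / z) M = phi x (t * z) (t / z) N"
        by (intro idempotent_phi_eq[OF M N e d V k(3,4) W k'(3,4) x])
      then show "(\<Sum>i=1..<n. (mtr (snd (V i) x) - mtr (snd (W i) x)) * bl (t * z) (t / z) i) = 0"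
        by (simp add: phi_def k(3)[OF x] k'(3)[OF x] left_diff_distrib sum_subtractf)
    qed (use n_ge_2 in simp)
    then show ?thesis by simp
  qed
  have VW: "layers V = layers W"
    unfolding layers_def
  proof (rule R.finsum_cong')
    fix l assume l: "l \<in> {1..<n}"
    show "br (vmod (V l)) \<otimes>\<^bsub>RR\<^esub> bm l = br (vmod (W l)) \<otimes>\<^bsub>RR\<^esub> bm l"
      using vmod_br_eq[OF V W tr[OF _ l]] by simp
  qed (auto simp del: vmod.simps intro!: layer_term W)
  have kc: "k \<in> carrier RR" "k' \<in> carrier RR" using k(1) k'(1) K0(2) by auto
  have "e \<oplus>\<^bsub>RR\<^esub> (layers W \<oplus>\<^bsub>RR\<^esub> k') = layers W \<oplus>\<^bsub>RR\<^esub> k"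
    using c unfolding k(2)[unfolded VW, symmetric] k'(2)[symmetric] unfolding e(1) by (simp add: R.minus_eq R.a_assoc R.l_neg)
  then have "e \<oplus>\<^bsub>RR\<^esub> k' = k"
    using ec kc layers_closed[OF W] R.add.right_cancel[of "layers W" "e \<oplus>\<^bsub>RR\<^esub> k'" k] by (simp add: R.a_ac)
  then have "e = k \<ominus>\<^bsub>RR\<^esub> k'" using ec kc by (auto simp: R.minus_eq R.a_assoc R.r_neg)
  then have "e \<in> K" using Ka(2)[OF k(1) k'(1)] by simp
  then show ?thesis using e(2) by (simp add: K_def)
qed

lemma idempotent_trivial:
  assumes e: "e \<in> carrier RR" "e \<otimes>\<^bsub>RR\<^esub> e = e"
  shows "e \<in> {\<zero>\<^bsub>RR\<^esub>, \<one>\<^bsub>RR\<^esub>}"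
proof -
  interpret R: ring RR by (rule RR_ring)
  obtain M N where MN: "M \<in> hmods" "N \<in> hmods" "e = br M \<ominus>\<^bsub>RR\<^esub> br N" using br_surj[OF e(1)] .
  note c = br_closed[OF MN(1)] br_closed[OF MN(2)]
  have dim: "gtr \<one> M = of_nat (fst M)" "gtr \<one> N = of_nat (fst N)"
    using MN(1,2) by (cases M; cases N; simp add: gmodD(2)[OF hmodsD(1)])+
  have "of_nat (fst M) - of_nat (fst N) \<in> {0, 1 :: 'k}"
    unfolding dim[symmetric] by (rule idempotent_invariant[OF gtr_hsum gtr_hiso gtr_htens MN e(2)]) simp_all
  then consider "fst M = fst N" | "of_nat (fst M) = (of_nat (fst N + 1) :: 'k)" by (auto simp: algebra_simps)
  then show ?thesis
  proof cases
    case 1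
    then show ?thesis using idempotent_zero[OF MN e(2)] by simp
  next
    case 2
    then have d: "fst M = fst N + 1" by (simp only: of_nat_eq_iff)
    \<comment> \<open>\<open>1 - e\<close> is the class of the trivial module plus \<open>N\<close>,
      minus that of \<open>M\<close>, and these two modules have the same dimension.\<close>
    let ?e = "\<one>\<^bsub>RR\<^esub> \<ominus>\<^bsub>RR\<^esub> e"
    have "?e \<otimes>\<^bsub>RR\<^esub> ?e = ?e"
      using e by (simp add: R.minus_eq R.l_distr R.r_distr R.l_minus R.r_minus R.a_assoc R.r_neg)
    moreover have "?e = br (hsum htriv N) \<ominus>\<^bsub>RR\<^esub> br M"
      unfolding MN(3) br_add[OF htriv_hmods MN(2)] br_one[symmetric] using c
      by (simp add: R.minus_eq R.minus_add R.a_ac)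
    moreover have "fst (hsum htriv N) = fst M" using d by (cases N) (simp add: htriv_def)
    ultimately have "?e = \<zero>\<^bsub>RR\<^esub>" using idempotent_zero[OF hsum_hmods[OF htriv_hmods MN(2)] MN(1)] by blast
    then have "e = \<one>\<^bsub>RR\<^esub>" using e(1) by (metis R.r_right_minus_eq R.one_closed)
    then show ?thesis by simp
  qed
qed

end

theorem theorem6p5:
  fixes G :: "('a, 'm) monoid_scheme"
    and \<chi> :: "'a \<Rightarrow> 'k :: {alg_closed_field, field_char_0}"
    and g :: 'a and n :: nat
  assumes "non_nilpotent_datum G \<chi> g n"
  shows "{e \<in> carrier (green_ring_H G \<chi> g n). e \<otimes>\<^bsub>green_ring_H G \<chi> g n\<^esub> e = e}
    = {\<zero>\<^bsub>green_ring_H G \<chi> g n\<^esub>, \<one>\<^bsub>green_ring_H G \<chi> g n\<^esub>}"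
proof -
  interpret green_datum G \<chi> g n using assms by (simp add: green_datum_def)
  interpret R: ring RR by (rule RR_ring)
  show ?thesis using idempotent_trivial by auto
qed

end
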